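(* A toric manifold is a toric hyperkähler variety if and only if it is a product of ALE spaces of type $A_n$, if and only if it is a toric quiver variety $Y(Q,\theta)$ where $Q$ is a disjoint union of cycles. Explicitly, for a smooth complex variety $Z$ the following are equivalent: (i) $Z$ is isomorphic to a smooth toric hyperkähler variety $Y(A,\theta)$ (with $A$ unimodular, $\theta$ generic) which is a toric variety, in the sense that there is a subtorus of the dense torus of $X(A^\pm,\theta)$ such that $Y(A,\theta)$ is an orbit closure of that subtorus; (ii) $Z$ is isomorphic to a product of ALE spaces $\mathbb{C}^2/\!/\Gamma_{n_i}$; (iii) $Z$ is isomorphic to a toric quiver variety $Y(Q,\theta)$ where $Q$ is a disjoint union of cycles $C_{n_i}$ and $\theta$ is generic.
   Context: Toric hyperkähler varieties: let $A=[a_1,\dots,a_n]$ be a $d\times n$ integer matrix with entries $a_{ji}$ and relatively prime $d\times d$ minors, and $B$ an $n\times(n-d)$ integer matrix whose columns form a basis of $\ker_{\mathbb{Z}}A$; it is assumed that no row of $B$ is zero. $A$ is unimodular if all non-zero $d\times d$ minors have the same absolute value; $\theta\in\mathbb{Z}^d$ is generic if it lies on no hyperplane spanned by a subset of $\{a_1,\dots,a_n\}$. Grade $\mathbb{C}[z_1,\dots,z_n,w_1,\dots,w_n]$ by $\deg z_i=a_i$, $\deg w_i=-a_i$; $X(A^\pm,\theta)=\mathrm{Proj}\bigoplus_{r\ge0}\mathbb{C}[z,w]_{r\theta}$, and $Y(A,\theta)\subset X(A^\pm,\theta)$ is defined by $\sum_ia_{ji}z_iw_i=0$, $j=1,\dots,d$.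 For generic $\theta$, $Y(A,\theta)$ is smooth iff $A$ is unimodular. ALE spaces: for $n\ge1$ let $\Gamma_n$ be the cyclic group of order $n$ acting on $\mathbb{C}^2$ by the matrices $\mathrm{diag}(\eta,\eta^{-1})$, $\eta^n=1$. The ALE space $\mathbb{C}^2/\!/\Gamma_n$ (called of type $A_n$) is the unique crepant resolution of $\mathbb{C}^2/\Gamma_n$; equivalently, the smooth toric surface whose fan in $\mathbb{Z}^2$ has maximal cones $\mathbb{R}_{\ge0}\{(1,i-1),(1,i)\}$, $i=1,\dots,n$. Quivers: for a connected directed graph $Q=(V,E)$ with $d+1$ vertices $v_0,\dots,v_d$ and $n$ edges, let $A:\mathbb{Z}^n\to\mathbb{Z}^d$ be the boundary map $e_{ij}\mapsto v_i-v_j$, where $\mathbb{Z}^d$ is the group of integer combinations of the vertices with coefficient sum zero. For a disconnected quiver, $A$ is the direct sum of the boundary maps of the components. $Y(Q,\theta):=Y(A,\theta)$. The cycle $C_n$ has vertices $0,\dots,n-1$ and edges $(0,1),(1,2),\dots,(n-2,n-1),(n-1,0)$. *)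

theory Defs
  imports
    "HOL-Analysis.Analysis"
    "HOL-Library.Poly_Mapping"
    "HOL-Computational_Algebra.Polynomial"
    "HOL-Algebra.Ideal"
    "Jordan_Normal_Form.Matrix_Kernel"
    "Jordan_Normal_Form.DL_Submatrix"
begin

section \<open>Complex varieties as spaces with functions\<close>

text \<open>
  A complex variety is given by its set of complex points with the Zariski topology and the sheaf
  of regular functions.  \<open>regular X U h\<close> says that \<open>h\<close>, restricted to the open set \<open>U\<close>, is a section
  of the structure sheaf over \<open>U\<close>; the values of \<open>h\<close> outside \<open>U\<close> are irrelevant.
\<close>

record 'a fspace =
  zariski :: "'a topology"
  regular :: "'a set \<Rightarrow> ('a \<Rightarrow> complex) \<Rightarrow> bool"

abbreviation points :: "'a fspace \<Rightarrow> 'a set" where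
  "points X \<equiv> topspace (zariski X)"

definition sheaf_of_functions :: "'a fspace \<Rightarrow> bool" where
  "sheaf_of_functions X \<longleftrightarrow>
     (\<forall>U h. regular X U h \<longrightarrow> openin (zariski X) U) \<and>
     (\<forall>U V h. regular X U h \<longrightarrow> openin (zariski X) V \<longrightarrow> V \<subseteq> U \<longrightarrow> regular X V h) \<and>
     (\<forall>U h. openin (zariski X) U \<longrightarrow>
        (\<forall>x\<in>U. \<exists>V f. openin (zariski X) V \<and> x \<in> V \<and> V \<subseteq> U \<and> regular X V f \<and> (\<forall>y\<in>V. h y = f y)) \<longrightarrow>
        regular X U h)"

definition isomorphic :: "'a fspace \<Rightarrow> 'b fspace \<Rightarrow> bool" where
  "isomorphic X Y \<longleftrightarrow> (\<exists>\<phi>. homeomorphic_map (zariski X) (zariski Y) \<phi> \<and>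
     (\<forall>U h. openin (zariski Y) U \<longrightarrow>
        (regular Y U h \<longleftrightarrow> regular X {x \<in> points X. \<phi> x \<in> U} (h \<circ> \<phi>))))"

text \<open>The induced (reduced) structure on a subset of the points.\<close>

definition induced_on :: "'a fspace \<Rightarrow> 'a set \<Rightarrow> 'a fspace" where
  "induced_on X S = \<lparr>
     zariski = subtopology (zariski X) S,
     regular = (\<lambda>U h. openin (subtopology (zariski X) S) U \<and>
       (\<forall>x\<in>U. \<exists>V f. openin (zariski X) V \<and> x \<in> V \<and> V \<inter> S \<subseteq> U \<and> regular X V f \<and>
          (\<forall>y\<in>V \<inter> S. h y = f y))) \<rparr>"

text \<open>
  The structure generated by a collection \<open>B\<close> of pairs \<open>(W, f)\<close>, where \<open>f\<close> is a function on \<open>W\<close>: the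
  non-vanishing loci of the \<open>f\<close> generate the topology, and a function is regular iff it is locally
  a fraction of two members of \<open>B\<close> with the same \<open>W\<close>.
\<close>

definition generated_space :: "('a set \<times> ('a \<Rightarrow> complex)) set \<Rightarrow> 'a fspace" where
  "generated_space B = (let T = topology_generated_by {{x\<in>W. f x \<noteq> 0} |W f. (W, f) \<in> B} in \<lparr>
     zariski = T,
     regular = (\<lambda>U h. openin T U \<and>
       (\<forall>x\<in>U. \<exists>V W f g. (W, f) \<in> B \<and> (W, g) \<in> B \<and> openin T V \<and> x \<in> V \<and> V \<subseteq> U \<inter> W \<and>
          (\<forall>y\<in>V. g y \<noteq> 0 \<and> h y = f y / g y))) \<rparr>)"

text \<open>
  The product of \<open>X 0, \<dots>, X (k - 1)\<close>; its basic functions are the finite sums of products of regular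
  functions of the single coordinates.
\<close>

definition product_fspace :: "nat \<Rightarrow> (nat \<Rightarrow> 'a fspace) \<Rightarrow> (nat \<Rightarrow> 'a) fspace" where
  "product_fspace k X = generated_space
     {(PiE {..<k} U, \<lambda>x. \<Sum>j<m. c j * (\<Prod>i<k. g j i (x i))) |U (m :: nat) c g.
        (\<forall>i<k. openin (zariski (X i)) (U i)) \<and> (\<forall>j<m. \<forall>i<k. regular (X i) (U i) (g j i))}"

type_synonym 'v mpoly = "('v \<Rightarrow>\<^sub>0 nat) \<Rightarrow>\<^sub>0 complex"

definition eval_mpoly :: "('v \<Rightarrow> complex) \<Rightarrow> 'v mpoly \<Rightarrow> complex" where
  "eval_mpoly x f = (\<Sum>m\<in>Poly_Mapping.keys f. Poly_Mapping.lookup f m *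
     (\<Prod>v\<in>Poly_Mapping.keys m. x v ^ Poly_Mapping.lookup m v))"

definition affine_space :: "nat \<Rightarrow> (nat \<Rightarrow> complex) fspace" where
  "affine_space N = generated_space {({x. \<forall>i\<ge>N. x i = 0}, \<lambda>x. eval_mpoly x f) |f. True}"

definition affine_variety :: "'a fspace \<Rightarrow> bool" where
  "affine_variety X \<longleftrightarrow>
     (\<exists>N S. closedin (zariski (affine_space N)) S \<and> isomorphic X (induced_on (affine_space N) S))"

definition separated :: "'a fspace \<Rightarrow> bool" where
  "separated X \<longleftrightarrow> closedin (zariski (product_fspace 2 (\<lambda>_. X)))
     {x \<in> PiE {..<2} (\<lambda>_. points X). x 0 = x 1}"

text \<open>Varieties are reduced, separated and of finite type, but not necessarily irreducible.\<close>

definition variety :: "'a fspace \<Rightarrow> bool" where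
  "variety X \<longleftrightarrow> sheaf_of_functions X \<and> separated X \<and>
     (\<exists>\<U>. finite \<U> \<and> \<Union>\<U> = points X \<and>
        (\<forall>U\<in>\<U>. openin (zariski X) U \<and> affine_variety (induced_on X U)))"

text \<open>
  Smoothness in the sense of the Jacobian criterion: locally, the variety is an open part of the
  zero set in an affine space of polynomials whose differentials are linearly independent at all
  points of that part.
\<close>

definition jacobian_independent :: "nat \<Rightarrow> nat \<Rightarrow> (nat \<Rightarrow> nat mpoly) \<Rightarrow> (nat \<Rightarrow> complex) \<Rightarrow> bool" where
  "jacobian_independent N c f x \<longleftrightarrow>
     (\<forall>l :: nat \<Rightarrow> complex.
        (\<forall>j<N. (\<Sum>i<c. l i * deriv (\<lambda>t. eval_mpoly (x(j := t)) (f i)) (x j)) = 0) \<longrightarrow> (\<forall>i<c. l i = 0))"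

definition smooth_variety :: "'a fspace \<Rightarrow> bool" where
  "smooth_variety X \<longleftrightarrow> variety X \<and>
     (\<forall>p\<in>points X. \<exists>U N c f W. openin (zariski X) U \<and> p \<in> U \<and>
        openin (zariski (affine_space N)) W \<and>
        (let S = {x\<in>W. \<forall>i<c. eval_mpoly x (f i) = 0} in
           isomorphic (induced_on X U) (induced_on (affine_space N) S) \<and>
           (\<forall>x\<in>S. jacobian_independent N c f x)))"

section \<open>Toric hyperkaehler varieties\<close>

definition maximal_minors :: "int mat \<Rightarrow> int set" where
  "maximal_minors A =
     {det (submatrix A UNIV J) |J. J \<subseteq> {..<dim_col A} \<and> card J = dim_row A}"

definition unimodular :: "int mat \<Rightarrow> bool" where
  "unimodular A \<longleftrightarrow>
     (\<forall>x\<in>maximal_minors A. \<forall>y\<in>maximal_minors A. x \<noteq> 0 \<longrightarrow> y \<noteq> 0 \<longrightarrow> \<bar>x\<bar> = \<bar>y\<bar>)"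

text \<open>The columns of \<open>B\<close> form a \<open>\<int>\<close>-basis of the kernel of \<open>A\<close>.\<close>

definition kernel_basis :: "int mat \<Rightarrow> int mat \<Rightarrow> bool" where
  "kernel_basis A B \<longleftrightarrow> B \<in> carrier_mat (dim_col A) (dim_col A - dim_row A) \<and>
     bij_betw (\<lambda>y. B *\<^sub>v y) (carrier_vec (dim_col B)) (mat_kernel A)"

definition admissible :: "int mat \<Rightarrow> bool" where
  "admissible A \<longleftrightarrow> Gcd (maximal_minors A) = 1 \<and>
     (\<exists>B. kernel_basis A B \<and> (\<forall>i<dim_col A. row B i \<noteq> 0\<^sub>v (dim_col B)))"

text \<open>
  \<open>\<theta>\<close> lies on no hyperplane of \<open>\<real>\<^sup>d\<close> (the kernel of a nonzero functional \<open>c\<close>) that is the span of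
  some of the columns of \<open>A\<close>.  For \<open>d = 0\<close> there are no hyperplanes.
\<close>

definition generic :: "int mat \<Rightarrow> int vec \<Rightarrow> bool" where
  "generic A \<theta> \<longleftrightarrow>
     (\<forall>J \<subseteq> {..<dim_col A}. \<forall>c \<in> carrier_vec (dim_row A). c \<noteq> 0\<^sub>v (dim_row A) \<longrightarrow>
        (let M = map_mat real_of_int (submatrix A UNIV J); H = {v \<in> carrier_vec (dim_row A). scalar_prod c v = 0} in
           {M *\<^sub>v x |x. x \<in> carrier_vec (dim_col M)} = H \<longrightarrow> map_vec real_of_int \<theta> \<notin> H))"

text \<open>
  Polynomials in \<open>z\<^sub>i, w\<^sub>i\<close> for \<open>i < n = dim_col A\<close>: the variable \<open>z\<^sub>i\<close> is indexed by \<open>Inl i\<close>, the variable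
  \<open>w\<^sub>i\<close> by \<open>Inr i\<close>.
\<close>

type_synonym zw_poly = "(nat + nat) mpoly"

definition var :: "'v \<Rightarrow> 'v mpoly" where
  "var v = Poly_Mapping.single (Poly_Mapping.single v 1) 1"

definition const :: "complex \<Rightarrow> 'v mpoly" where
  "const c = Poly_Mapping.single 0 c"

definition monomial_degree :: "int mat \<Rightarrow> ((nat + nat) \<Rightarrow>\<^sub>0 nat) \<Rightarrow> int vec" where
  "monomial_degree A m = vec (dim_row A) (\<lambda>j. \<Sum>i<dim_col A. A $$ (j, i) *
     (int (Poly_Mapping.lookup m (Inl i)) - int (Poly_Mapping.lookup m (Inr i))))"

definition graded_piece :: "int mat \<Rightarrow> int vec \<Rightarrow> zw_poly set" where
  "graded_piece A v = {f. \<forall>m\<in>Poly_Mapping.keys f.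
     Poly_Mapping.keys m \<subseteq> Inl ` {..<dim_col A} \<union> Inr ` {..<dim_col A} \<and> monomial_degree A m = v}"

text \<open>
  The graded ring \<open>\<Oplus>\<^sub>r \<complex>[z,w]\<^bsub>r\<theta>\<^esub>\<close>, realised inside \<open>\<complex>[z,w][T]\<close> with the power of \<open>T\<close> recording \<open>r\<close>.  (The
  extra variable keeps the summands apart also when \<open>\<theta> = 0\<close>, which is generic if \<open>d = 0\<close>.)
\<close>

definition section_ring :: "int mat \<Rightarrow> int vec \<Rightarrow> zw_poly poly ring" where
  "section_ring A \<theta> = \<lparr>
     carrier = {F. \<forall>r. Polynomial.coeff F r \<in> graded_piece A (int r \<cdot>\<^sub>v \<theta>)},
     mult = (*), one = 1, zero = 0, add = (+) \<rparr>"

text \<open>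
  The complex points of \<open>Proj\<close>: the homogeneous prime ideals not containing the irrelevant ideal whose
  residue field, formed by the classes of fractions \<open>f / g\<close> of elements of equal degree, is \<open>\<complex>\<close>.
\<close>

definition proj_points :: "int mat \<Rightarrow> int vec \<Rightarrow> zw_poly poly set set" where
  "proj_points A \<theta> = {p. primeideal p (section_ring A \<theta>) \<and>
     (\<forall>F\<in>p. \<forall>r. Polynomial.monom (Polynomial.coeff F r) r \<in> p) \<and>
     (\<exists>r>0. \<exists>f\<in>graded_piece A (int r \<cdot>\<^sub>v \<theta>). Polynomial.monom f r \<notin> p) \<and>
     (\<forall>r. \<forall>f\<in>graded_piece A (int r \<cdot>\<^sub>v \<theta>). \<forall>g\<in>graded_piece A (int r \<cdot>\<^sub>v \<theta>).
        Polynomial.monom g r \<notin> p \<longrightarrow> (\<exists>c. Polynomial.monom (f - const c * g) r \<in> p))}"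

text \<open>
  \<open>X(A\<^sup>\<plusminus>, \<theta>)\<close>.  The basic functions are the \<open>f / g\<close> with \<open>f, g\<close> homogeneous of the same degree, on the set
  where \<open>g\<close> is nonzero; the value of \<open>f / g\<close> at \<open>p\<close> is its residue class modulo \<open>p\<close>.
\<close>

definition lawrence_variety :: "int mat \<Rightarrow> int vec \<Rightarrow> zw_poly poly set fspace" where
  "lawrence_variety A \<theta> = generated_space
     {({p \<in> proj_points A \<theta>. Polynomial.monom g r \<notin> p}, h) |r f g h.
        f \<in> graded_piece A (int r \<cdot>\<^sub>v \<theta>) \<and> g \<in> graded_piece A (int r \<cdot>\<^sub>v \<theta>) \<and>
        (\<forall>p \<in> proj_points A \<theta>. Polynomial.monom g r \<notin> p \<longrightarrow>
           Polynomial.monom (f - const (h p) * g) r \<in> p)}"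

definition hk_points :: "int mat \<Rightarrow> int vec \<Rightarrow> zw_poly poly set set" where
  "hk_points A \<theta> = {p \<in> proj_points A \<theta>. \<forall>j<dim_row A.
     Polynomial.monom
       (\<Sum>i<dim_col A. const (of_int (A $$ (j, i))) * var (Inl i) * var (Inr i)) 0 \<in> p}"

definition toric_hyperkaehler :: "int mat \<Rightarrow> int vec \<Rightarrow> zw_poly poly set fspace" where
  "toric_hyperkaehler A \<theta> = induced_on (lawrence_variety A \<theta>) (hk_points A \<theta>)"

text \<open>
  The torus \<open>(\<complex>\<^sup>*)\<^sup>2\<^sup>n\<close> acts on \<open>X(A\<^sup>\<plusminus>, \<theta>)\<close> by rescaling the variables; the dense torus is its quotient by the
  kernel of this action, i.e. the group of the self-maps of \<open>X(A\<^sup>\<plusminus>, \<theta>)\<close> so obtained.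
\<close>

definition rescale :: "('v \<Rightarrow> complex) \<Rightarrow> 'v mpoly \<Rightarrow> 'v mpoly" where
  "rescale t f = (\<Sum>m\<in>Poly_Mapping.keys f. Poly_Mapping.single m (Poly_Mapping.lookup f m *
     (\<Prod>v\<in>Poly_Mapping.keys m. t v ^ Poly_Mapping.lookup m v)))"

definition torus_map ::
    "int mat \<Rightarrow> int vec \<Rightarrow> (nat + nat \<Rightarrow> complex) \<Rightarrow> zw_poly poly set \<Rightarrow> zw_poly poly set" where
  "torus_map A \<theta> t p = {F \<in> carrier (section_ring A \<theta>). map_poly (rescale t) F \<in> p}"

definition dense_torus :: "int mat \<Rightarrow> int vec \<Rightarrow> (zw_poly poly set \<Rightarrow> zw_poly poly set) set" where
  "dense_torus A \<theta> = {torus_map A \<theta> t |t. \<forall>v. t v \<noteq> 0}"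

text \<open>
  A subtorus is the image of a homomorphism from some \<open>(\<complex>\<^sup>*)\<^sup>k\<close>.  Every subtorus of the quotient of
  \<open>(\<complex>\<^sup>*)\<^sup>2\<^sup>n\<close> is the image of a subtorus of \<open>(\<complex>\<^sup>*)\<^sup>2\<^sup>n\<close>, and homomorphisms \<open>(\<complex>\<^sup>*)\<^sup>k \<rightarrow> (\<complex>\<^sup>*)\<^sup>2\<^sup>n\<close> are given by
  Laurent monomials, here with exponents \<open>u\<close>.
\<close>

definition subtorus ::
    "int mat \<Rightarrow> int vec \<Rightarrow> (zw_poly poly set \<Rightarrow> zw_poly poly set) set \<Rightarrow> bool" where
  "subtorus A \<theta> H \<longleftrightarrow> H \<subseteq> dense_torus A \<theta> \<and>
     (\<exists>k (u :: nat + nat \<Rightarrow> nat \<Rightarrow> int).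
        H = {torus_map A \<theta> (\<lambda>v. \<Prod>l<k. s l powi u v l) |s. \<forall>l<k. s l \<noteq> 0})"

definition is_toric :: "int mat \<Rightarrow> int vec \<Rightarrow> bool" where
  "is_toric A \<theta> \<longleftrightarrow> (\<exists>H. subtorus A \<theta> H \<and> (\<exists>p \<in> points (lawrence_variety A \<theta>).
     hk_points A \<theta> = zariski (lawrence_variety A \<theta>) closure_of {\<tau> p |\<tau>. \<tau> \<in> H}))"

section \<open>ALE spaces\<close>

text \<open>
  The toric surface of a fan in \<open>\<int>\<^sup>2\<close>, given by its maximal cones.  The chart of a cone \<open>\<sigma>\<close> is the set of
  monoid homomorphisms from \<open>\<sigma>\<^sup>\<or> \<inter> \<int>\<^sup>2\<close> to the multiplicative monoid \<open>\<complex>\<close> (extended by zero), which are the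
  complex points of the spectrum of the monoid algebra; the charts of \<open>\<sigma>\<close> and \<open>\<sigma>'\<close> are glued along the
  chart of \<open>\<sigma> \<inter> \<sigma>'\<close>.
\<close>

definition dual_monoid :: "(real \<times> real) set \<Rightarrow> (int \<times> int) set" where
  "dual_monoid \<sigma> = {(a, b). \<forall>(x, y)\<in>\<sigma>. of_int a * x + of_int b * y \<ge> 0}"

definition chart :: "(real \<times> real) set \<Rightarrow> (int \<times> int \<Rightarrow> complex) set" where
  "chart \<sigma> = {\<gamma>. \<gamma> 0 = 1 \<and> (\<forall>m\<in>dual_monoid \<sigma>. \<forall>m'\<in>dual_monoid \<sigma>. \<gamma> (m + m') = \<gamma> m * \<gamma> m') \<and>
     (\<forall>m. m \<notin> dual_monoid \<sigma> \<longrightarrow> \<gamma> m = 0)}"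

type_synonym surface_point = "((real \<times> real) set \<times> (int \<times> int \<Rightarrow> complex)) set"

definition glued_point ::
    "(real \<times> real) set set \<Rightarrow> (real \<times> real) set \<Rightarrow> (int \<times> int \<Rightarrow> complex) \<Rightarrow> surface_point" where
  "glued_point \<Sigma> \<sigma> \<gamma> = {(\<sigma>', \<gamma>'). \<sigma>' \<in> \<Sigma> \<and> \<gamma>' \<in> chart \<sigma>' \<and>
     (\<exists>\<delta> \<in> chart (\<sigma> \<inter> \<sigma>'). (\<forall>m\<in>dual_monoid \<sigma>. \<delta> m = \<gamma> m) \<and> (\<forall>m\<in>dual_monoid \<sigma>'. \<delta> m = \<gamma>' m))}"

definition toric_surface :: "(real \<times> real) set set \<Rightarrow> surface_point fspace" where
  "toric_surface \<Sigma> = generated_space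
     {(glued_point \<Sigma> \<sigma> ` chart \<sigma>, f) |\<sigma> f. \<sigma> \<in> \<Sigma> \<and>
        (\<exists>M c. finite M \<and> M \<subseteq> dual_monoid \<sigma> \<and>
           (\<forall>\<gamma>\<in>chart \<sigma>. f (glued_point \<Sigma> \<sigma> \<gamma>) = (\<Sum>m\<in>M. c m * \<gamma> m)))}"

definition ale_space :: "nat \<Rightarrow> surface_point fspace" where
  "ale_space n = toric_surface
     {{s *\<^sub>R (1, real i - 1) + t *\<^sub>R (1, real i) |s t. s \<ge> 0 \<and> t \<ge> 0} |i. i \<in> {1..n}}"

section \<open>Toric quiver varieties\<close>

text \<open>
  A connected quiver is encoded as \<open>(d, es)\<close>: its vertices are \<open>v\<^sub>0, \<dots>, v\<^sub>d\<close>, and \<open>es\<close> lists its edges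
  as pairs \<open>(source, target)\<close>, so that loops and multiple edges are possible.  A quiver is the list of
  its connected components.  The boundary map is written in the basis \<open>v\<^sub>1 - v\<^sub>0, \<dots>, v\<^sub>d - v\<^sub>0\<close> of the
  lattice of combinations of vertices with coefficient sum zero: the coordinates of an element are its
  coefficients at \<open>v\<^sub>1, \<dots>, v\<^sub>d\<close>.
\<close>

type_synonym connected_quiver = "nat \<times> (nat \<times> nat) list"

definition boundary_matrix :: "connected_quiver \<Rightarrow> int mat" where
  "boundary_matrix Q = (case Q of (d, es) \<Rightarrow> mat d (length es) (\<lambda>(j, e).
     of_bool (fst (es ! e) = Suc j) - of_bool (snd (es ! e) = Suc j)))"

definition quiver_matrix :: "connected_quiver list \<Rightarrow> int mat" where
  "quiver_matrix Qs = diag_block_mat (map boundary_matrix Qs)"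

definition toric_quiver_variety ::
    "connected_quiver list \<Rightarrow> int vec \<Rightarrow> zw_poly poly set fspace" where
  "toric_quiver_variety Qs \<theta> = toric_hyperkaehler (quiver_matrix Qs) \<theta>"

definition cycle_quiver :: "nat \<Rightarrow> connected_quiver" where
  "cycle_quiver n = (n - 1, map (\<lambda>i. (i, Suc i mod n)) [0..<n])"

end

theory Submission
  imports Defs
begin

text \<open>
  The functions \<open>z\<^sub>i w\<^sub>i\<close> take their values on \<open>Y(A, \<theta>)\<close> in the kernel of \<open>A\<close>, and these values span the kernel.  If
  \<open>Y(A, \<theta>)\<close> is the closure of an orbit of a subtorus, then the kernel is already spanned by the orbit of a single vector
  on which the subtorus acts through characters, so it is a direct sum of lines with disjoint supports; by unimodularity
  these lines are spanned by sign vectors.  Thus the columns of \<open>A\<close> fall into disjoint circuits, as they do for a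
  disjoint union of cycles.  For such \<open>A\<close>, write \<open>\<theta> = A u\<close>; genericity says that the values of \<open>u\<close> (up to the signs) are
  distinct on each circuit, and they order the circuit.  Both \<open>Y(A, \<theta>)\<close> and the product of the ALE spaces are then
  covered by copies of \<open>\<complex>\<^sup>2\<^sup>k\<close> indexed by the choices of one column in every circuit, that is, of one cone in every fan,
  and the gluing maps agree.
\<close>

section \<open>Spaces with functions\<close>

text \<open>A point of \<open>proj_points\<close> is an abstract homogeneous prime ideal with
  residue field \<complex>, and the orbit in the definition of a toric Y(A, \<theta>) may start at
  any such ideal. Hence values of sections are developed for arbitrary ideals (\<open>val\<close>),
  and only points of Y are identified with evaluation ideals, chart by chart. Y and the ALE product
  are compared without transition maps: \<open>coord_atlas_isomorphic\<close> asks only that two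
  atlases with one index set have the same coincidences between chart points, and on both sides
  these become the relation \<open>cox_equiv\<close>, equality up to a torus element of determinant
  one. The kernel vectors carry signs that the ALE charts do not have; \<open>eta\<close>
  distributes them so that determinant one survives. Smoothness of Y(A, \<theta>) is not computed
  locally but inherited from Z along the isomorphism. That B has no zero row enters through an
  integral kernel vector without zero entries: shifting by its multiples makes any kernel vector a
  vector of values of the \<open>z\<^sub>i w\<^sub>i\<close> at a semistable point.\<close>

lemma zariski_generated:
  "zariski (generated_space B) = topology_generated_by {{x\<in>W. f x \<noteq> 0} |W f. (W, f) \<in> B}"
  by (simp add: generated_space_def Let_def)

lemma points_generated:
  "points (generated_space B) = \<Union>{{x\<in>W. f x \<noteq> 0} |W f. (W, f) \<in> B}"
  by (simp add: zariski_generated)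

lemma openin_generated_basic:
  "(W, f) \<in> B \<Longrightarrow> openin (zariski (generated_space B)) {x\<in>W. f x \<noteq> 0}"
  unfolding zariski_generated by (rule topology_generated_by_Basis) auto

lemma regular_generated:
  "regular (generated_space B) U h \<longleftrightarrow> openin (zariski (generated_space B)) U \<and>
     (\<forall>x\<in>U. \<exists>V W f g. (W, f) \<in> B \<and> (W, g) \<in> B \<and> openin (zariski (generated_space B)) V \<and> x \<in> V \<and>
        V \<subseteq> U \<inter> W \<and> (\<forall>y\<in>V. g y \<noteq> 0 \<and> h y = f y / g y))"
  by (simp add: generated_space_def Let_def)

lemma regular_generated_openin:
  "regular (generated_space B) U h \<Longrightarrow> openin (zariski (generated_space B)) U"
  by (simp add: regular_generated)

lemma sheaf_generated: "sheaf_of_functions (generated_space B)"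
  unfolding sheaf_of_functions_def
proof (intro conjI allI impI)
  let ?X = "generated_space B"
  fix U h assume "regular ?X U h" then show "openin (zariski ?X) U" by (simp add: regular_generated)
next
  let ?X = "generated_space B"
  fix U V h assume r: "regular ?X U h" and V: "openin (zariski ?X) V" "V \<subseteq> U"
  show "regular ?X V h" unfolding regular_generated
  proof (intro conjI ballI)
    fix x assume "x \<in> V"
    then obtain V' W f g where *: "(W, f) \<in> B" "(W, g) \<in> B" "openin (zariski ?X) V'" "x \<in> V'"
      "V' \<subseteq> U \<inter> W" "\<forall>y\<in>V'. g y \<noteq> 0 \<and> h y = f y / g y"
      using r V(2) unfolding regular_generated by blast
    then show "\<exists>V' W f g. (W, f) \<in> B \<and> (W, g) \<in> B \<and> openin (zariski ?X) V' \<and> x \<in> V' \<and>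
        V' \<subseteq> V \<inter> W \<and> (\<forall>y\<in>V'. g y \<noteq> 0 \<and> h y = f y / g y)"
      using V \<open>x \<in> V\<close> by (intro exI[of _ "V' \<inter> V"] exI[of _ W] exI[of _ f] exI[of _ g]) auto
  qed (fact V)
next
  let ?X = "generated_space B"
  fix U h assume U: "openin (zariski ?X) U"
    and loc: "\<forall>x\<in>U. \<exists>V f. openin (zariski ?X) V \<and> x \<in> V \<and> V \<subseteq> U \<and> regular ?X V f \<and> (\<forall>y\<in>V. h y = f y)"
  show "regular ?X U h" unfolding regular_generated
  proof (intro conjI ballI)
    fix x assume "x \<in> U"
    then obtain V h' where V: "openin (zariski ?X) V" "x \<in> V" "V \<subseteq> U" "regular ?X V h'" "\<forall>y\<in>V. h y = h' y"
      using loc by blast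
    then obtain V' W f g where *: "(W, f) \<in> B" "(W, g) \<in> B" "openin (zariski ?X) V'" "x \<in> V'"
      "V' \<subseteq> V \<inter> W" "\<forall>y\<in>V'. g y \<noteq> 0 \<and> h' y = f y / g y"
      unfolding regular_generated by blast
    then show "\<exists>V W f g. (W, f) \<in> B \<and> (W, g) \<in> B \<and> openin (zariski ?X) V \<and> x \<in> V \<and>
        V \<subseteq> U \<inter> W \<and> (\<forall>y\<in>V. g y \<noteq> 0 \<and> h y = f y / g y)"
      using V by (intro exI[of _ V'] exI[of _ W] exI[of _ f] exI[of _ g]) auto
  qed (fact U)
qed

lemma sheaf_openin:
  assumes "sheaf_of_functions X" "regular X U h" shows "openin (zariski X) U"
proof -
  have "\<forall>U h. regular X U h \<longrightarrow> openin (zariski X) U"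
    using assms(1) unfolding sheaf_of_functions_def by (elim conjE)
  with assms(2) show ?thesis by blast
qed

lemma sheaf_restrict:
  assumes "sheaf_of_functions X" "regular X U h" "openin (zariski X) V" "V \<subseteq> U"
  shows "regular X V h"
proof -
  have "\<forall>U V h. regular X U h \<longrightarrow> openin (zariski X) V \<longrightarrow> V \<subseteq> U \<longrightarrow> regular X V h"
    using assms(1) unfolding sheaf_of_functions_def by (elim conjE)
  with assms show ?thesis by simp
qed

lemma sheaf_glue:
  assumes "sheaf_of_functions X" "openin (zariski X) U"
    "\<And>x. x \<in> U \<Longrightarrow> \<exists>V f. openin (zariski X) V \<and> x \<in> V \<and> V \<subseteq> U \<and> regular X V f \<and> (\<forall>y\<in>V. h y = f y)"
  shows "regular X U h"
proof -
  have "\<forall>U h. openin (zariski X) U \<longrightarrow>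
      (\<forall>x\<in>U. \<exists>V f. openin (zariski X) V \<and> x \<in> V \<and> V \<subseteq> U \<and> regular X V f \<and> (\<forall>y\<in>V. h y = f y)) \<longrightarrow> regular X U h"
    using assms(1) unfolding sheaf_of_functions_def by (elim conjE)
  from this[rule_format, OF assms(2)] assms(3) show ?thesis by simp
qed

lemma sheaf_cong:
  assumes "sheaf_of_functions X" "\<And>x. x \<in> U \<Longrightarrow> h x = h' x"
  shows "regular X U h \<longleftrightarrow> regular X U h'"
proof -
  have "regular X U h'" if "regular X U h" "\<And>x. x \<in> U \<Longrightarrow> h x = h' x" for h h'
    using that sheaf_openin[OF assms(1) that(1)]
    by (intro sheaf_glue[OF assms(1)]) (auto intro!: exI[of _ U] exI[of _ h])
  then show ?thesis using assms(2) by metis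
qed

lemma regular_induced:
  "regular (induced_on X S) U h \<longleftrightarrow> openin (subtopology (zariski X) S) U \<and>
     (\<forall>x\<in>U. \<exists>V f. openin (zariski X) V \<and> x \<in> V \<and> V \<inter> S \<subseteq> U \<and> regular X V f \<and> (\<forall>y\<in>V \<inter> S. h y = f y))"
  by (simp add: induced_on_def)

lemma zariski_induced: "zariski (induced_on X S) = subtopology (zariski X) S"
  by (simp add: induced_on_def)

lemma sheaf_induced:
  assumes X: "sheaf_of_functions X" shows "sheaf_of_functions (induced_on X S)"
  unfolding sheaf_of_functions_def
proof (intro conjI allI impI)
  let ?Y = "induced_on X S"
  fix U h assume "regular ?Y U h" then show "openin (zariski ?Y) U"
    by (simp add: regular_induced zariski_induced)
next
  let ?Y = "induced_on X S"
  fix U V h assume r: "regular ?Y U h" and V: "openin (zariski ?Y) V" "V \<subseteq> U"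
  obtain V0 where V0: "openin (zariski X) V0" "V = V0 \<inter> S"
    using V(1) by (auto simp: zariski_induced openin_subtopology)
  show "regular ?Y V h" unfolding regular_induced
  proof (intro conjI ballI)
    show "openin (subtopology (zariski X) S) V" using V(1) by (simp add: zariski_induced)
    fix x assume "x \<in> V"
    then obtain V' f where *: "openin (zariski X) V'" "x \<in> V'" "V' \<inter> S \<subseteq> U" "regular X V' f"
       "\<forall>y\<in>V' \<inter> S. h y = f y"
      using r V(2) unfolding regular_induced by blast
    have "regular X (V' \<inter> V0) f" by (rule sheaf_restrict[OF X *(4)]) (use * V0 in auto)
    then show "\<exists>V' f. openin (zariski X) V' \<and> x \<in> V' \<and> V' \<inter> S \<subseteq> V \<and> regular X V' f \<and> (\<forall>y\<in>V' \<inter> S. h y = f y)"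
      using * V0 \<open>x \<in> V\<close> by (intro exI[of _ "V' \<inter> V0"] exI[of _ f]) auto
  qed
next
  let ?Y = "induced_on X S"
  fix U h assume U: "openin (zariski ?Y) U"
    and loc: "\<forall>x\<in>U. \<exists>V f. openin (zariski ?Y) V \<and> x \<in> V \<and> V \<subseteq> U \<and> regular ?Y V f \<and> (\<forall>y\<in>V. h y = f y)"
  show "regular ?Y U h" unfolding regular_induced
  proof (intro conjI ballI)
    show "openin (subtopology (zariski X) S) U" using U by (simp add: zariski_induced)
    fix x assume "x \<in> U"
    then obtain V h' where V: "openin (zariski ?Y) V" "x \<in> V" "V \<subseteq> U" "regular ?Y V h'" "\<forall>y\<in>V. h y = h' y"
      using loc by blast
    then obtain V' f where *: "openin (zariski X) V'" "x \<in> V'" "V' \<inter> S \<subseteq> V" "regular X V' f"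
       "\<forall>y\<in>V' \<inter> S. h' y = f y"
      unfolding regular_induced by blast
    then show "\<exists>V' f. openin (zariski X) V' \<and> x \<in> V' \<and> V' \<inter> S \<subseteq> U \<and> regular X V' f \<and> (\<forall>y\<in>V' \<inter> S. h y = f y)"
      using V by (intro exI[of _ V'] exI[of _ f]) auto
  qed
qed

text \<open>The empty open set is the union of the empty family, so it has no case of its
  own.\<close>

lemma openin_generated_induct [consumes 1, case_names inter union basic]:
  assumes "openin (zariski (generated_space B)) U"
    and "\<And>U V. Q U \<Longrightarrow> Q V \<Longrightarrow> Q (U \<inter> V)"
    and "\<And>K. (\<And>U. U \<in> K \<Longrightarrow> Q U) \<Longrightarrow> Q (\<Union>K)"
    and "\<And>W f. (W, f) \<in> B \<Longrightarrow> Q {x\<in>W. f x \<noteq> 0}"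
  shows "Q U"
proof -
  have "generate_topology_on {{x\<in>W. f x \<noteq> 0} |W f. (W, f) \<in> B} U"
    using assms(1) unfolding zariski_generated by (simp add: openin_topology_generated_by_iff)
  then show ?thesis
  proof induction
    case Empty then show ?case using assms(3)[of "{}"] by simp
  next
    case Int then show ?case using assms(2) by blast
  next
    case (UN K) then show ?case using assms(3) by blast
  next
    case (Basis s) then show ?case using assms(4) by blast
  qed
qed

text \<open>Closure of \<open>B\<close> under shrinking of domains makes the two structures agree: a
  numerator and a denominator with a common domain on \<open>S\<close> may come from different
  ambient domains, and only after these are intersected do they form a fraction in the ambient
  space.\<close>

lemma induced_generated:
  assumes Int: "\<And>W f W' f'. (W, f) \<in> B \<Longrightarrow> (W', f') \<in> B \<Longrightarrow> (W \<inter> W', f) \<in> B"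
  shows "induced_on (generated_space B) S = generated_space {(W \<inter> S, f) |W f. (W, f) \<in> B}"
proof -
  define B' where "B' = {(W \<inter> S, f) |W f. (W, f) \<in> B}"
  have B'I: "(W \<inter> S, f) \<in> B'" if "(W, f) \<in> B" for W f
    using that unfolding B'_def by blast
  have B'E: "\<exists>W'. W = W' \<inter> S \<and> (W', f) \<in> B" if "(W, f) \<in> B'" for W f
    using that unfolding B'_def by blast
  define X Y where "X = generated_space B" and "Y = generated_space B'"
  have op1: "openin (zariski Y) (U \<inter> S)" if "openin (zariski X) U" for U
    using that unfolding X_def
  proof (induction rule: openin_generated_induct)
    case (inter U V)
    have "U \<inter> V \<inter> S = (U \<inter> S) \<inter> (V \<inter> S)" by blast
    then show ?case using inter by (simp add: openin_Int)
  next
    case (union K)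
    have "\<Union>K \<inter> S = \<Union>((\<lambda>U. U \<inter> S) ` K)" by blast
    then show ?case using union by (metis (no_types, lifting) imageE openin_Union)
  next
    case (basic W f)
    have "{x \<in> W. f x \<noteq> 0} \<inter> S = {x\<in>W \<inter> S. f x \<noteq> 0}" by blast
    then show ?case using basic by (metis B'I Y_def openin_generated_basic)
  qed
  have op2: "openin (subtopology (zariski X) S) U" if "openin (zariski Y) U" for U
    using that unfolding Y_def
  proof (induction rule: openin_generated_induct)
    case (basic W f)
    then obtain W' where W: "W = W' \<inter> S" "(W', f) \<in> B" using B'E by blast
    have "{x \<in> W. f x \<noteq> 0} = {x \<in> W'. f x \<noteq> 0} \<inter> S" using W by blast
    then show ?case using openin_generated_basic[OF W(2)] unfolding openin_subtopology X_def by blast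
  next
    case (inter U V) then show ?case by (rule openin_Int)
  next
    case (union K) then show ?case by (rule openin_Union)
  qed
  have Z: "subtopology (zariski X) S = zariski Y"
    unfolding topology_eq using op1 op2 unfolding openin_subtopology by blast
  have R: "regular (induced_on X S) U h = regular Y U h" for U h
  proof
    assume l: "regular (induced_on X S) U h"
    show "regular Y U h" unfolding X_def Y_def regular_generated unfolding X_def[symmetric] Y_def[symmetric]
    proof (intro conjI ballI)
      show "openin (zariski Y) U" using l by (simp add: regular_induced Z)
      fix x assume "x \<in> U"
      then obtain V h' where V: "openin (zariski X) V" "x \<in> V" "V \<inter> S \<subseteq> U" "regular X V h'"
         "\<forall>y\<in>V \<inter> S. h y = h' y" using l unfolding regular_induced by blast
      then obtain V' W f g where *: "(W, f) \<in> B" "(W, g) \<in> B" "openin (zariski X) V'" "x \<in> V'"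
        "V' \<subseteq> V \<inter> W" "\<forall>y\<in>V'. g y \<noteq> 0 \<and> h' y = f y / g y"
        unfolding X_def Y_def regular_generated unfolding X_def[symmetric] Y_def[symmetric] by blast
      have "x \<in> S" using l \<open>x \<in> U\<close> by (auto simp: regular_induced openin_subtopology)
      then have xV: "x \<in> V' \<inter> S" using *(4) by blast
      have sub: "V' \<inter> S \<subseteq> U \<inter> (W \<inter> S)" using V(3) *(5) by blast
      have eq: "\<forall>y\<in>V' \<inter> S. g y \<noteq> 0 \<and> h y = f y / g y" using V(5) *(5,6) by auto
      show "\<exists>V W f g. (W, f) \<in> B' \<and> (W, g) \<in> B' \<and> openin (zariski Y) V \<and> x \<in> V \<and>
        V \<subseteq> U \<inter> W \<and> (\<forall>y\<in>V. g y \<noteq> 0 \<and> h y = f y / g y)"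
        by (rule exI[of _ "V' \<inter> S"], rule exI[of _ "W \<inter> S"], rule exI[of _ f], rule exI[of _ g])
          (intro conjI B'I op1 xV sub eq *)
    qed
  next
    assume r: "regular Y U h"
    show "regular (induced_on X S) U h" unfolding regular_induced
    proof (intro conjI ballI)
      show "openin (subtopology (zariski X) S) U" using r by (metis regular_generated_openin Y_def Z)
      fix x assume "x \<in> U"
      then obtain V W0 f g where *: "(W0, f) \<in> B'" "(W0, g) \<in> B'" "openin (zariski Y) V" "x \<in> V"
        "V \<subseteq> U \<inter> W0" "\<forall>y\<in>V. g y \<noteq> 0 \<and> h y = f y / g y"
        using r unfolding X_def Y_def regular_generated unfolding X_def[symmetric] Y_def[symmetric] by blast
      obtain W1 W2 where W: "(W1, f) \<in> B" "W0 = W1 \<inter> S" "(W2, g) \<in> B" "W0 = W2 \<inter> S"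
        using *(1,2) B'E by metis
      define W where "W = W1 \<inter> W2"
      have fg: "(W, f) \<in> B" "(W, g) \<in> B"
        using Int[OF W(1,3)] Int[OF W(3,1)] by (simp_all add: W_def Int_commute)
      obtain V0 where V0: "openin (zariski X) V0" "V = V0 \<inter> S"
        using *(3)[folded Z] unfolding openin_subtopology by blast
      \<comment> \<open>Off \<open>S\<close> nothing is known about \<open>g\<close> on
        \<open>V0\<close>, so the ambient neighbourhood shrinks to the nonvanishing locus of
        \<open>g\<close>.\<close>
      define V1 where "V1 = V0 \<inter> {x\<in>W. g x \<noteq> 0}"
      have V1: "openin (zariski X) V1" using V0 openin_generated_basic[OF fg(2)] by (simp add: V1_def openin_Int X_def)
      have in1: "V1 \<inter> S \<subseteq> U" "\<forall>y\<in>V1 \<inter> S. h y = f y / g y"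
        using *(5,6) V0(2) unfolding V1_def by blast+
      have x: "x \<in> V1" using *(4-6) V0(2) W unfolding V1_def W_def by blast
      have in2: "regular X V1 (\<lambda>y. f y / g y)" unfolding X_def Y_def regular_generated unfolding X_def[symmetric] Y_def[symmetric]
        using V1 fg by (intro conjI ballI exI[of _ V1] exI[of _ W] exI[of _ f] exI[of _ g]) (auto simp: V1_def)
      show "\<exists>V f. openin (zariski X) V \<and> x \<in> V \<and> V \<inter> S \<subseteq> U \<and> regular X V f \<and> (\<forall>y\<in>V \<inter> S. h y = f y)"
        by (rule exI[of _ V1], rule exI[of _ "\<lambda>y. f y / g y"]) (intro conjI V1 x in1 in2)
    qed
  qed
  show ?thesis unfolding B'_def[symmetric] X_def[symmetric] Y_def[symmetric]
    by (rule fspace.equality) (auto simp: R Z zariski_induced fun_eq_iff)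
qed

section \<open>Isomorphisms\<close>

lemma isomorphicE:
  assumes "isomorphic X Y"
  obtains \<phi> where "bij_betw \<phi> (points X) (points Y)"
    "\<And>U. U \<subseteq> points Y \<Longrightarrow> openin (zariski X) {x \<in> points X. \<phi> x \<in> U} \<longleftrightarrow> openin (zariski Y) U"
    "\<And>U h. openin (zariski Y) U \<Longrightarrow> regular Y U h \<longleftrightarrow> regular X {x \<in> points X. \<phi> x \<in> U} (h \<circ> \<phi>)"
proof -
  obtain \<phi> where \<phi>: "homeomorphic_map (zariski X) (zariski Y) \<phi>"
    "\<forall>U h. openin (zariski Y) U \<longrightarrow> (regular Y U h \<longleftrightarrow> regular X {x \<in> points X. \<phi> x \<in> U} (h \<circ> \<phi>))"
    using assms unfolding isomorphic_def by blast
  have "bij_betw \<phi> (points X) (points Y)"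
    using \<phi>(1) by (auto simp: homeomorphic_eq_everything_map bij_betw_def)
  moreover have "openin (zariski X) {x \<in> points X. \<phi> x \<in> U} \<longleftrightarrow> openin (zariski Y) U"
    if "U \<subseteq> points Y" for U
    using \<phi>(1) that unfolding homeomorphic_map_def quotient_map_def by blast
  ultimately show ?thesis using \<phi>(2) that by blast
qed

lemma isomorphicI:
  assumes "bij_betw \<phi> (points X) (points Y)"
    "\<And>U. U \<subseteq> points Y \<Longrightarrow> openin (zariski X) {x \<in> points X. \<phi> x \<in> U} \<longleftrightarrow> openin (zariski Y) U"
    "\<And>U h. openin (zariski Y) U \<Longrightarrow> regular Y U h \<longleftrightarrow> regular X {x \<in> points X. \<phi> x \<in> U} (h \<circ> \<phi>)"
  shows "isomorphic X Y"
proof -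
  have "homeomorphic_map (zariski X) (zariski Y) \<phi>"
    unfolding homeomorphic_map_def quotient_map_def
    using assms(1,2) by (auto simp: bij_betw_def)
  then show ?thesis using assms(3) unfolding isomorphic_def by blast
qed

lemma isomorphic_trans:
  assumes "isomorphic X Y" "isomorphic Y Z" shows "isomorphic X Z"
proof -
  obtain \<phi> where \<phi>: "bij_betw \<phi> (points X) (points Y)"
    "\<And>U. U \<subseteq> points Y \<Longrightarrow> openin (zariski X) {x \<in> points X. \<phi> x \<in> U} \<longleftrightarrow> openin (zariski Y) U"
    "\<And>U h. openin (zariski Y) U \<Longrightarrow> regular Y U h \<longleftrightarrow> regular X {x \<in> points X. \<phi> x \<in> U} (h \<circ> \<phi>)"
    using isomorphicE[OF assms(1)] by blast
  obtain \<psi> where \<psi>: "bij_betw \<psi> (points Y) (points Z)"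
    "\<And>U. U \<subseteq> points Z \<Longrightarrow> openin (zariski Y) {x \<in> points Y. \<psi> x \<in> U} \<longleftrightarrow> openin (zariski Z) U"
    "\<And>U h. openin (zariski Z) U \<Longrightarrow> regular Z U h \<longleftrightarrow> regular Y {x \<in> points Y. \<psi> x \<in> U} (h \<circ> \<psi>)"
    using isomorphicE[OF assms(2)] by blast
  have eq: "{x \<in> points X. \<phi> x \<in> {x \<in> points Y. \<psi> x \<in> U}} = {x \<in> points X. (\<psi> \<circ> \<phi>) x \<in> U}" for U
    using \<phi>(1) by (auto simp: bij_betw_def)
  show ?thesis
  proof (rule isomorphicI[of "\<psi> \<circ> \<phi>"])
    show "bij_betw (\<psi> \<circ> \<phi>) (points X) (points Z)" using \<phi>(1) \<psi>(1) by (rule bij_betw_trans)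
    show "openin (zariski X) {x \<in> points X. (\<psi> \<circ> \<phi>) x \<in> U} = openin (zariski Z) U" if "U \<subseteq> points Z" for U
      using \<phi>(2)[of "{x \<in> points Y. \<psi> x \<in> U}"] \<psi>(2)[OF that] unfolding eq by blast
    show "regular Z U h = regular X {x \<in> points X. (\<psi> \<circ> \<phi>) x \<in> U} (h \<circ> (\<psi> \<circ> \<phi>))"
      if U: "openin (zariski Z) U" for U h
    proof -
      have "openin (zariski Y) {x \<in> points Y. \<psi> x \<in> U}" using \<psi>(2) U openin_subset by blast
      from \<phi>(3)[OF this, of "h \<circ> \<psi>"] \<psi>(3)[OF U, of h] show ?thesis unfolding eq comp_assoc by blast
    qed
  qed
qed

text \<open>The function transported forth and back agrees with \<open>h\<close> on \<open>U\<close>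
  only; that values outside \<open>U\<close> are irrelevant is a consequence of the sheaf property
  of \<open>X\<close>.\<close>

lemma isomorphic_sym:
  assumes "isomorphic X Y" "sheaf_of_functions X" shows "isomorphic Y X"
proof -
  obtain \<phi> where \<phi>: "bij_betw \<phi> (points X) (points Y)"
    "\<And>U. U \<subseteq> points Y \<Longrightarrow> openin (zariski X) {x \<in> points X. \<phi> x \<in> U} \<longleftrightarrow> openin (zariski Y) U"
    "\<And>U h. openin (zariski Y) U \<Longrightarrow> regular Y U h \<longleftrightarrow> regular X {x \<in> points X. \<phi> x \<in> U} (h \<circ> \<phi>)"
    using isomorphicE[OF assms(1)] by blast
  define \<psi> where "\<psi> = inv_into (points X) \<phi>"
  have \<psi>: "bij_betw \<psi> (points Y) (points X)" unfolding \<psi>_def using \<phi>(1) by (rule bij_betw_inv_into)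
  have l: "\<And>x. x \<in> points X \<Longrightarrow> \<psi> (\<phi> x) = x" and r: "\<And>y. y \<in> points Y \<Longrightarrow> \<phi> (\<psi> y) = y"
    unfolding \<psi>_def using \<phi>(1) by (auto simp: bij_betw_def f_inv_into_f)
  have eq: "{x \<in> points X. \<phi> x \<in> {y \<in> points Y. \<psi> y \<in> U}} = U" if "U \<subseteq> points X" for U
    using \<phi>(1) l that by (auto simp: bij_betw_def)
  show ?thesis
  proof (rule isomorphicI[of \<psi>])
    fix U assume U: "U \<subseteq> points X"
    show "openin (zariski Y) {x \<in> points Y. \<psi> x \<in> U} = openin (zariski X) U"
      using \<phi>(2)[of "{x \<in> points Y. \<psi> x \<in> U}"] eq[OF U] by auto
  next
    fix U h assume U: "openin (zariski X) U"
    then have U': "U \<subseteq> points X" by (rule openin_subset)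
    have "openin (zariski Y) {x \<in> points Y. \<psi> x \<in> U}"
      using \<phi>(2)[of "{x \<in> points Y. \<psi> x \<in> U}"] eq[OF U'] U by auto
    from \<phi>(3)[OF this, of "h \<circ> \<psi>"] have
      "regular Y {x \<in> points Y. \<psi> x \<in> U} (h \<circ> \<psi>) = regular X U (h \<circ> \<psi> \<circ> \<phi>)" unfolding eq[OF U'] .
    also have "\<dots> = regular X U h" by (rule sheaf_cong[OF assms(2)]) (use U' l in auto)
    finally show "regular X U h = regular Y {x \<in> points Y. \<psi> x \<in> U} (h \<circ> \<psi>)" by simp
  qed (fact \<psi>)
qed

text \<open>Lets affine covers and local smooth models be carried along an isomorphism: both are
  conditions on open pieces with their induced structure.\<close>

lemma isomorphic_induced_image:
  assumes \<phi>: "bij_betw \<phi> (points X) (points Y)"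
    "\<And>U. U \<subseteq> points Y \<Longrightarrow> openin (zariski X) {x \<in> points X. \<phi> x \<in> U} \<longleftrightarrow> openin (zariski Y) U"
    "\<And>U h. openin (zariski Y) U \<Longrightarrow> regular Y U h \<longleftrightarrow> regular X {x \<in> points X. \<phi> x \<in> U} (h \<circ> \<phi>)"
    and X: "sheaf_of_functions X" and Y: "sheaf_of_functions Y" and U: "openin (zariski X) U"
  shows "openin (zariski Y) (\<phi> ` U)" "isomorphic (induced_on X U) (induced_on Y (\<phi> ` U))"
proof -
  have UX: "U \<subseteq> points X" using U by (rule openin_subset)
  have pre: "{x \<in> points X. \<phi> x \<in> \<phi> ` V} = V" if "V \<subseteq> points X" for V
    using \<phi>(1) that by (auto simp: bij_betw_def inj_on_def)
  have img: "openin (zariski Y) (\<phi> ` V) \<longleftrightarrow> openin (zariski X) V" if "V \<subseteq> points X" for V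
    using \<phi>(2)[of "\<phi> ` V"] pre[OF that] \<phi>(1) that by (auto simp: bij_betw_def)
  show oU: "openin (zariski Y) (\<phi> ` U)" using img U UX by blast
  \<comment> \<open>Over an open \<open>S\<close> the induced structure is plain restriction: the
    sheaf property glues the ambient functions that the definition allows to vary from point to
    point.\<close>
  have reg: "regular (induced_on Z S) V h \<longleftrightarrow> V \<subseteq> S \<and> regular Z V h"
    if Z: "sheaf_of_functions Z" and S: "openin (zariski Z) S" for Z :: "'z fspace" and S V h
  proof
    assume l: "regular (induced_on Z S) V h"
    then have V: "V \<subseteq> S" "openin (zariski Z) V"
      using S by (auto simp: regular_induced openin_subtopology)
    have "regular Z V h"
    proof (rule sheaf_glue[OF Z V(2)])
      fix x assume x: "x \<in> V"
      then obtain W f where *: "openin (zariski Z) W" "x \<in> W" "W \<inter> S \<subseteq> V" "regular Z W f" "\<forall>y\<in>W \<inter> S. h y = f y"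
        using l unfolding regular_induced by blast
      have "regular Z (W \<inter> S) f" by (rule sheaf_restrict[OF Z *(4)]) (use * S in auto)
      then show "\<exists>W f. openin (zariski Z) W \<and> x \<in> W \<and> W \<subseteq> V \<and> regular Z W f \<and> (\<forall>y\<in>W. h y = f y)"
        using * S x V by (intro exI[of _ "W \<inter> S"] exI[of _ f]) auto
    qed
    with V show "V \<subseteq> S \<and> regular Z V h" by blast
  next
    assume r: "V \<subseteq> S \<and> regular Z V h"
    then have "openin (zariski Z) V" using sheaf_openin[OF Z] by blast
    with r S show "regular (induced_on Z S) V h" unfolding regular_induced
      by (auto simp: openin_open_subtopology)
  qed
  show "isomorphic (induced_on X U) (induced_on Y (\<phi> ` U))"
  proof (rule isomorphicI[of \<phi>])
    have top: "points (induced_on X U) = U" "points (induced_on Y (\<phi> ` U)) = \<phi> ` U"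
      using U oU by (simp_all add: zariski_induced topspace_subtopology Int_absorb1 openin_subset)
    show "bij_betw \<phi> (points (induced_on X U)) (points (induced_on Y (\<phi> ` U)))"
      unfolding top using \<phi>(1) UX by (auto simp: bij_betw_def intro: inj_on_subset)
    have pre': "\<phi> ` {x \<in> U. \<phi> x \<in> V} = V" "{x \<in> points X. \<phi> x \<in> V} = {x \<in> U. \<phi> x \<in> V}" if "V \<subseteq> \<phi> ` U" for V
      using that pre[OF UX] by auto
    show "openin (zariski (induced_on X U)) {x \<in> points (induced_on X U). \<phi> x \<in> V} =
       openin (zariski (induced_on Y (\<phi> ` U))) V" if V: "V \<subseteq> points (induced_on Y (\<phi> ` U))" for V
      using V U oU img[of "{x \<in> U. \<phi> x \<in> V}"] pre'[of V] UX unfolding top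
      by (simp add: zariski_induced openin_open_subtopology) blast
    show "regular (induced_on Y (\<phi> ` U)) V h = regular (induced_on X U) {x \<in> points (induced_on X U). \<phi> x \<in> V} (h \<circ> \<phi>)"
      if V: "openin (zariski (induced_on Y (\<phi> ` U))) V" for V h
    proof -
      have V': "V \<subseteq> \<phi> ` U" "openin (zariski Y) V" using V oU by (auto simp: zariski_induced openin_open_subtopology)
      show ?thesis unfolding reg[OF Y oU] reg[OF X U] top using \<phi>(3)[OF V'(2)] V' pre'(2) by auto
    qed
  qed
qed

text \<open>Continuity may be tested on the generating sets. \<open>T\<close> and \<open>S\<close>
  stay arbitrary because the lemma serves products, charts, inverses of charts and curves of complex
  parameters.\<close>

lemma openin_generated_preimage:
  assumes "\<And>W f. (W, f) \<in> B \<Longrightarrow> openin T {x\<in>S. \<phi> x \<in> W \<and> f (\<phi> x) \<noteq> 0}"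
    and "openin (zariski (generated_space B)) U"
  shows "openin T {x\<in>S. \<phi> x \<in> U}"
  using assms(2)
proof (induction rule: openin_generated_induct)
  case (inter U V)
  have "{x\<in>S. \<phi> x \<in> U \<inter> V} = {x\<in>S. \<phi> x \<in> U} \<inter> {x\<in>S. \<phi> x \<in> V}" by blast
  then show ?case using openin_Int[OF inter] by (simp only:)
next
  case (union K)
  have "{x\<in>S. \<phi> x \<in> \<Union>K} = \<Union>((\<lambda>U. {x\<in>S. \<phi> x \<in> U}) ` K)" by blast
  then show ?case using union by (auto intro!: openin_Union)
next
  case (basic W f) then show ?case using assms(1)[OF basic] by simp
qed

section \<open>Morphisms, and properties carried along isomorphisms\<close>

definition morphism :: "'a fspace \<Rightarrow> 'b fspace \<Rightarrow> ('a \<Rightarrow> 'b) \<Rightarrow> bool" where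
  "morphism X Y \<phi> \<longleftrightarrow> \<phi> \<in> points X \<rightarrow> points Y \<and>
     (\<forall>U. openin (zariski Y) U \<longrightarrow> openin (zariski X) {x \<in> points X. \<phi> x \<in> U}) \<and>
     (\<forall>U h. regular Y U h \<longrightarrow> regular X {x \<in> points X. \<phi> x \<in> U} (h \<circ> \<phi>))"

lemma morphism_points: "morphism X Y \<phi> \<Longrightarrow> x \<in> points X \<Longrightarrow> \<phi> x \<in> points Y"
  unfolding morphism_def by blast

lemma morphism_openin:
  "morphism X Y \<phi> \<Longrightarrow> openin (zariski Y) U \<Longrightarrow> openin (zariski X) {x \<in> points X. \<phi> x \<in> U}"
  unfolding morphism_def by blast

lemma morphism_regular:
  "morphism X Y \<phi> \<Longrightarrow> regular Y U h \<Longrightarrow> regular X {x \<in> points X. \<phi> x \<in> U} (\<lambda>x. h (\<phi> x))"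
  unfolding morphism_def comp_def by blast

lemma isomorphic_morphisms:
  assumes "isomorphic X Y" "sheaf_of_functions X" "sheaf_of_functions Y"
  obtains \<phi> \<psi> where "morphism X Y \<phi>" "morphism Y X \<psi>"
    "\<And>x. x \<in> points X \<Longrightarrow> \<psi> (\<phi> x) = x" "\<And>y. y \<in> points Y \<Longrightarrow> \<phi> (\<psi> y) = y"
proof -
  obtain \<phi> where \<phi>: "bij_betw \<phi> (points X) (points Y)"
    "\<And>U. U \<subseteq> points Y \<Longrightarrow> openin (zariski X) {x \<in> points X. \<phi> x \<in> U} \<longleftrightarrow> openin (zariski Y) U"
    "\<And>U h. openin (zariski Y) U \<Longrightarrow> regular Y U h \<longleftrightarrow> regular X {x \<in> points X. \<phi> x \<in> U} (h \<circ> \<phi>)"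
    using isomorphicE[OF assms(1)] by blast
  define \<psi> where "\<psi> = inv_into (points X) \<phi>"
  have l: "\<And>x. x \<in> points X \<Longrightarrow> \<psi> (\<phi> x) = x" and r: "\<And>y. y \<in> points Y \<Longrightarrow> \<phi> (\<psi> y) = y"
    and m: "\<And>x. x \<in> points X \<Longrightarrow> \<phi> x \<in> points Y" and m': "\<And>y. y \<in> points Y \<Longrightarrow> \<psi> y \<in> points X"
    unfolding \<psi>_def using \<phi>(1) by (auto simp: bij_betw_def f_inv_into_f inv_into_into)
  have eq: "{x \<in> points X. \<phi> x \<in> {y \<in> points Y. \<psi> y \<in> U}} = U" if "U \<subseteq> points X" for U
    using that l m by auto
  have oY: "openin (zariski Y) {y \<in> points Y. \<psi> y \<in> U}" if U: "openin (zariski X) U" for U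
    using \<phi>(2)[of "{y \<in> points Y. \<psi> y \<in> U}"] eq[OF openin_subset[OF U]] U by auto
  have "morphism X Y \<phi>"
    unfolding morphism_def
  proof (intro conjI allI impI)
    show "\<phi> \<in> points X \<rightarrow> points Y" using m by blast
    fix U assume "openin (zariski Y) U" then show "openin (zariski X) {x \<in> points X. \<phi> x \<in> U}"
      using \<phi>(2)[OF openin_subset] by simp
  next
    fix U h assume "regular Y U h" then show "regular X {x \<in> points X. \<phi> x \<in> U} (h \<circ> \<phi>)"
      using \<phi>(3) sheaf_openin[OF assms(3)] by blast
  qed
  moreover have "morphism Y X \<psi>"
    unfolding morphism_def
  proof (intro conjI allI impI)
    show "\<psi> \<in> points Y \<rightarrow> points X" using m' by blast
    fix U assume "openin (zariski X) U" then show "openin (zariski Y) {y \<in> points Y. \<psi> y \<in> U}" by (rule oY)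
  next
    fix U h assume r: "regular X U h"
    have U: "openin (zariski X) U" by (rule sheaf_openin[OF assms(2) r])
    have "regular X U (h \<circ> \<psi> \<circ> \<phi>) = regular X U h"
      by (rule sheaf_cong[OF assms(2)]) (use openin_subset[OF U] l in auto)
    with r have "regular X U (h \<circ> \<psi> \<circ> \<phi>)" by blast
    with \<phi>(3)[OF oY[OF U], of "h \<circ> \<psi>"] show "regular Y {y \<in> points Y. \<psi> y \<in> U} (h \<circ> \<psi>)"
      unfolding eq[OF openin_subset[OF U]] by blast
  qed
  ultimately show ?thesis using that l r by blast
qed

lemma sum_prod_in_product_basis:
  assumes "\<forall>i<k. openin (zariski (X i)) (U i)" "\<forall>j<m. \<forall>i<k. regular (X i) (U i) (g j i)"
  shows "(PiE {..<k} U, \<lambda>x. \<Sum>j<(m::nat). c j * (\<Prod>i<k. g j i (x i))) \<in>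
    {(PiE {..<k} U, \<lambda>x. \<Sum>j<m. c j * (\<Prod>i<k. g j i (x i))) |U (m :: nat) c g.
        (\<forall>i<k. openin (zariski (X i)) (U i)) \<and> (\<forall>j<m. \<forall>i<k. regular (X i) (U i) (g j i))}"
  using assms by blast

lemma points_product_subset: "points (product_fspace k X) \<subseteq> PiE {..<k} (\<lambda>i. points (X i))"
proof
  fix x assume "x \<in> points (product_fspace k X)"
  then obtain U where "x \<in> PiE {..<k} U" "\<forall>i<k. openin (zariski (X i)) (U i)"
    unfolding product_fspace_def points_generated by blast
  then show "x \<in> PiE {..<k} (\<lambda>i. points (X i))"
    by (auto simp: PiE_iff dest: openin_subset)
qed

text \<open>Composition with morphisms in the coordinates turns a sum of products of regular
  functions into another such sum, so basic open sets pull back to basic open sets.\<close>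

lemma product_morphism_openin:
  assumes \<phi>: "\<And>i. i < k \<Longrightarrow> morphism (X i) (Y i) (\<phi> i)"
    and V: "openin (zariski (product_fspace k Y)) V"
  shows "openin (zariski (product_fspace k X)) {x \<in> PiE {..<k} (\<lambda>i. points (X i)). (\<lambda>i\<in>{..<k}. \<phi> i (x i)) \<in> V}"
proof (rule openin_generated_preimage[OF _ V[unfolded product_fspace_def]])
  show "openin (zariski (product_fspace k X)) {x \<in> PiE {..<k} (\<lambda>i. points (X i)). (\<lambda>i\<in>{..<k}. \<phi> i (x i)) \<in> W \<and> f (\<lambda>i\<in>{..<k}. \<phi> i (x i)) \<noteq> 0}"
    if mem: "(W, f) \<in> {(PiE {..<k} U, \<lambda>x. \<Sum>j<m. c j * (\<Prod>i<k. g j i (x i))) |U (m :: nat) c g.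
        (\<forall>i<k. openin (zariski (Y i)) (U i)) \<and> (\<forall>j<m. \<forall>i<k. regular (Y i) (U i) (g j i))}" for W f
  proof -
    obtain U m c g where W: "W = PiE {..<k} U" "f = (\<lambda>x. \<Sum>j<(m::nat). c j * (\<Prod>i<k. g j i (x i)))"
      "\<forall>i<k. openin (zariski (Y i)) (U i)" "\<forall>j<m. \<forall>i<k. regular (Y i) (U i) (g j i)"
      using mem unfolding mem_Collect_eq prod.inject by iprover
    define U' where "U' i = {x \<in> points (X i). \<phi> i x \<in> U i}" for i
    have "(PiE {..<k} U', \<lambda>x. \<Sum>j<(m::nat). c j * (\<Prod>i<k. (g j i \<circ> \<phi> i) (x i))) \<in>
      {(PiE {..<k} U, \<lambda>x. \<Sum>j<m. c j * (\<Prod>i<k. g j i (x i))) |U (m :: nat) c g.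
          (\<forall>i<k. openin (zariski (X i)) (U i)) \<and> (\<forall>j<m. \<forall>i<k. regular (X i) (U i) (g j i))}"
      by (rule sum_prod_in_product_basis) (use W(3,4) morphism_openin[OF \<phi>] morphism_regular[OF \<phi>] in \<open>auto simp: U'_def\<close>)
    note openin_generated_basic[OF this]
    moreover have "{x \<in> PiE {..<k} (\<lambda>i. points (X i)). (\<lambda>i\<in>{..<k}. \<phi> i (x i)) \<in> W \<and> f (\<lambda>i\<in>{..<k}. \<phi> i (x i)) \<noteq> 0} =
      {x \<in> PiE {..<k} U'. (\<Sum>j<m. c j * (\<Prod>i<k. (g j i \<circ> \<phi> i) (x i))) \<noteq> 0}"
      unfolding W(1,2) U'_def by (auto simp: PiE_iff)
    ultimately show ?thesis unfolding product_fspace_def by simp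
  qed
qed

text \<open>The diagonal of \<open>Y\<close> is the preimage of the diagonal of \<open>X\<close>
  under the inverse map applied to both coordinates. The topspace of a product is given through its
  basic open sets, so membership in it is carried over by \<open>F\<close> and \<open>G\<close> as
  well.\<close>

lemma separated_transport:
  assumes iso: "isomorphic X Y" and X: "sheaf_of_functions X" and Y: "sheaf_of_functions Y"
    and sep: "separated X"
  shows "separated Y"
proof -
  obtain \<phi> \<psi> where \<phi>: "morphism X Y \<phi>" and \<psi>: "morphism Y X \<psi>"
    and l: "\<And>x. x \<in> points X \<Longrightarrow> \<psi> (\<phi> x) = x" and r: "\<And>y. y \<in> points Y \<Longrightarrow> \<phi> (\<psi> y) = y"
    using isomorphic_morphisms[OF iso X Y] by blast
  have m: "\<And>x. x \<in> points X \<Longrightarrow> \<phi> x \<in> points Y" and m': "\<And>y. y \<in> points Y \<Longrightarrow> \<psi> y \<in> points X"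
    using \<phi> \<psi> by (auto simp: morphism_def)
  define PX where "PX = product_fspace 2 (\<lambda>_. X)"
  define PY where "PY = product_fspace 2 (\<lambda>_. Y)"
  define F where "F x = (\<lambda>i\<in>{..<2::nat}. \<phi> (x i))" for x
  define G where "G y = (\<lambda>i\<in>{..<2::nat}. \<psi> (y i))" for y
  define DX where "DX = {x \<in> PiE {..<2::nat} (\<lambda>_. points X). x 0 = x 1}"
  define DY where "DY = {x \<in> PiE {..<2::nat} (\<lambda>_. points Y). x 0 = x 1}"
  have trF: "openin (zariski PX) {x \<in> PiE {..<2} (\<lambda>_. points X). F x \<in> V}" if "openin (zariski PY) V" for V
    unfolding PX_def F_def by (rule product_morphism_openin) (use \<phi> that PY_def in auto)
  have trG: "openin (zariski PY) {x \<in> PiE {..<2} (\<lambda>_. points Y). G x \<in> V}" if "openin (zariski PX) V" for V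
    unfolding PY_def G_def by (rule product_morphism_openin) (use \<psi> that PX_def in auto)
  have FP: "F x \<in> PiE {..<2} (\<lambda>_. points Y)" if "x \<in> PiE {..<2} (\<lambda>_. points X)" for x
    using that m unfolding F_def by (auto simp: PiE_iff)
  have GP: "G x \<in> PiE {..<2} (\<lambda>_. points X)" if "x \<in> PiE {..<2} (\<lambda>_. points Y)" for x
    using that m' unfolding G_def by (auto simp: PiE_iff)
  have GF: "F (G y) = y" if "y \<in> PiE {..<2} (\<lambda>_. points Y)" for y
    using that r unfolding F_def G_def by (auto simp: PiE_iff extensional_def fun_eq_iff)
  have PX_sub: "points PX \<subseteq> PiE {..<2} (\<lambda>_. points X)" unfolding PX_def by (rule points_product_subset)
  have PY_sub: "points PY \<subseteq> PiE {..<2} (\<lambda>_. points Y)" unfolding PY_def by (rule points_product_subset)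
  have sX: "DX \<subseteq> points PX" "openin (zariski PX) (points PX - DX)"
    using sep unfolding separated_def closedin_def DX_def PX_def by blast+
  have inj: "y \<in> DY \<longleftrightarrow> G y \<in> DX" if y: "y \<in> PiE {..<2} (\<lambda>_. points Y)" for y
  proof -
    have "y 0 \<in> points Y" "y 1 \<in> points Y" using y by (auto simp: PiE_iff)
    then have "\<psi> (y 0) = \<psi> (y 1) \<longleftrightarrow> y 0 = y 1" using r by metis
    then show ?thesis using y GP[OF y] unfolding DX_def DY_def by (simp add: G_def)
  qed
  have "points PY - DY = {y \<in> PiE {..<2} (\<lambda>_. points Y). G y \<in> points PX - DX}"
  proof
    show "points PY - DY \<subseteq> {y \<in> PiE {..<2} (\<lambda>_. points Y). G y \<in> points PX - DX}"
    proof
      fix y assume y: "y \<in> points PY - DY"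
      then have yP: "y \<in> PiE {..<2} (\<lambda>_. points Y)" using PY_sub by blast
      have "G y \<in> {x \<in> PiE {..<2} (\<lambda>_. points X). F x \<in> points PY}" using y GP[OF yP] GF[OF yP] by simp
      then have "G y \<in> points PX" using openin_subset[OF trF[OF openin_topspace]] by blast
      then show "y \<in> {y \<in> PiE {..<2} (\<lambda>_. points Y). G y \<in> points PX - DX}" using inj[OF yP] yP y by blast
    qed
    show "{y \<in> PiE {..<2} (\<lambda>_. points Y). G y \<in> points PX - DX} \<subseteq> points PY - DY"
      using openin_subset[OF trG[OF openin_topspace]] inj by blast
  qed
  then have "openin (zariski PY) (points PY - DY)" using trG[OF sX(2)] by simp
  moreover have "DY \<subseteq> points PY"
  proof
    fix y assume y: "y \<in> DY"
    then have yP: "y \<in> PiE {..<2} (\<lambda>_. points Y)" by (simp add: DY_def)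
    then have "G y \<in> points PX" using inj y sX(1) by blast
    then show "y \<in> points PY" using openin_subset[OF trG[OF openin_topspace]] yP by blast
  qed
  ultimately show ?thesis unfolding separated_def closedin_def PY_def DY_def by simp
qed

lemma variety_transport:
  assumes iso: "isomorphic X Y" and Y: "sheaf_of_functions Y" and var: "variety X"
  shows "variety Y"
proof -
  have X: "sheaf_of_functions X" using var by (simp add: variety_def)
  obtain \<phi> where \<phi>: "bij_betw \<phi> (points X) (points Y)"
    "\<And>U. U \<subseteq> points Y \<Longrightarrow> openin (zariski X) {x \<in> points X. \<phi> x \<in> U} \<longleftrightarrow> openin (zariski Y) U"
    "\<And>U h. openin (zariski Y) U \<Longrightarrow> regular Y U h \<longleftrightarrow> regular X {x \<in> points X. \<phi> x \<in> U} (h \<circ> \<phi>)"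
    using isomorphicE[OF iso] by blast
  note img = isomorphic_induced_image[OF \<phi> X Y]
  obtain \<U> where \<U>: "finite \<U>" "\<Union>\<U> = points X"
    "\<forall>U\<in>\<U>. openin (zariski X) U \<and> affine_variety (induced_on X U)"
    using var unfolding variety_def by blast
  have "affine_variety (induced_on Y (\<phi> ` U))" if "U \<in> \<U>" for U
  proof -
    obtain N S where S: "closedin (zariski (affine_space N)) S" "isomorphic (induced_on X U) (induced_on (affine_space N) S)"
      using \<U>(3) \<open>U \<in> \<U>\<close> unfolding affine_variety_def by blast
    have "isomorphic (induced_on Y (\<phi> ` U)) (induced_on X U)"
      using isomorphic_sym[OF img(2)] sheaf_induced[OF X] \<U>(3) that by blast
    then show ?thesis unfolding affine_variety_def using S isomorphic_trans by blast
  qed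
  then have "\<forall>V\<in>(`) \<phi> ` \<U>. openin (zariski Y) V \<and> affine_variety (induced_on Y V)"
    using img(1) \<U>(3) by blast
  moreover have "\<Union>((`) \<phi> ` \<U>) = points Y"
    using \<phi>(1) unfolding bij_betw_def \<U>(2)[symmetric] by blast
  ultimately show ?thesis
    unfolding variety_def using Y separated_transport[OF iso X Y] var \<U>(1)
    by (meson finite_imageI variety_def)
qed

text \<open>The Jacobian criterion is a condition on the model in affine space, and the model is
  kept; only its identification with an open piece changes.\<close>

lemma smooth_variety_transport:
  assumes iso: "isomorphic X Y" and Y: "sheaf_of_functions Y" and sm: "smooth_variety X"
  shows "smooth_variety Y"
proof -
  have var: "variety X" using sm by (simp add: smooth_variety_def)
  have X: "sheaf_of_functions X" using var by (simp add: variety_def)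
  obtain \<phi> where \<phi>: "bij_betw \<phi> (points X) (points Y)"
    "\<And>U. U \<subseteq> points Y \<Longrightarrow> openin (zariski X) {x \<in> points X. \<phi> x \<in> U} \<longleftrightarrow> openin (zariski Y) U"
    "\<And>U h. openin (zariski Y) U \<Longrightarrow> regular Y U h \<longleftrightarrow> regular X {x \<in> points X. \<phi> x \<in> U} (h \<circ> \<phi>)"
    using isomorphicE[OF iso] by blast
  note img = isomorphic_induced_image[OF \<phi> X Y]
  have "\<exists>U N c f W. openin (zariski Y) U \<and> q \<in> U \<and> openin (zariski (affine_space N)) W \<and>
        (let S = {x\<in>W. \<forall>i<c. eval_mpoly x (f i) = 0} in
           isomorphic (induced_on Y U) (induced_on (affine_space N) S) \<and>
           (\<forall>x\<in>S. jacobian_independent N c f x))" if q: "q \<in> points Y" for q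
  proof -
    obtain p where p: "p \<in> points X" "q = \<phi> p" using \<phi>(1) q by (auto simp: bij_betw_def)
    obtain U N c f W where *: "openin (zariski X) U" "p \<in> U" "openin (zariski (affine_space N)) W"
       "(let S = {x\<in>W. \<forall>i<c. eval_mpoly x (f i) = 0} in
           isomorphic (induced_on X U) (induced_on (affine_space N) S) \<and>
           (\<forall>x\<in>S. jacobian_independent N c f x))"
      using sm p(1) unfolding smooth_variety_def by meson
    have "isomorphic (induced_on Y (\<phi> ` U)) (induced_on X U)"
      using isomorphic_sym[OF img(2)] sheaf_induced[OF X] * by blast
    then have "(let S = {x\<in>W. \<forall>i<c. eval_mpoly x (f i) = 0} in
           isomorphic (induced_on Y (\<phi> ` U)) (induced_on (affine_space N) S) \<and>
           (\<forall>x\<in>S. jacobian_independent N c f x))"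
      using *(4) unfolding Let_def using isomorphic_trans by blast
    moreover have "openin (zariski Y) (\<phi> ` U)" using img(1) * by blast
    moreover have "q \<in> \<phi> ` U" using p * by blast
    ultimately show ?thesis using *(3) by blast
  qed
  then show ?thesis unfolding smooth_variety_def using variety_transport[OF iso Y var] by blast
qed

section \<open>Coordinate spaces and atlases\<close>

text \<open>One pair for every class of columns or ALE factor. Points are undefined beyond
  \<open>k\<close>, so that they are determined by \<open>k\<close> entries and charts can be
  injective.\<close>

definition coords :: "nat \<Rightarrow> (nat \<Rightarrow> complex \<times> complex) set" where
  "coords k = PiE {..<k} (\<lambda>_. UNIV)"

text \<open>Polynomial functions instead of formal polynomials: statements about charts are then
  proved by induction on how a function is generated.\<close>

inductive_set polys :: "nat \<Rightarrow> ((nat \<Rightarrow> complex \<times> complex) \<Rightarrow> complex) set" for k where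
  const: "(\<lambda>_. c) \<in> polys k"
| fst: "i < k \<Longrightarrow> (\<lambda>x. fst (x i)) \<in> polys k"
| snd: "i < k \<Longrightarrow> (\<lambda>x. snd (x i)) \<in> polys k"
| add: "f \<in> polys k \<Longrightarrow> g \<in> polys k \<Longrightarrow> (\<lambda>x. f x + g x) \<in> polys k"
| mult: "f \<in> polys k \<Longrightarrow> g \<in> polys k \<Longrightarrow> (\<lambda>x. f x * g x) \<in> polys k"

definition coord_space :: "nat \<Rightarrow> (nat \<Rightarrow> complex \<times> complex) fspace" where
  "coord_space k = generated_space {(coords k, f) |f. f \<in> polys k}"

lemma polys_sum: "(\<And>j. j \<in> J \<Longrightarrow> f j \<in> polys k) \<Longrightarrow> (\<lambda>x. \<Sum>j\<in>J. f j x) \<in> polys k"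
  by (induction J rule: infinite_finite_induct) (auto intro: polys.intros)

lemma polys_prod: "(\<And>j. j \<in> J \<Longrightarrow> f j \<in> polys k) \<Longrightarrow> (\<lambda>x. \<Prod>j\<in>J. f j x) \<in> polys k"
  by (induction J rule: infinite_finite_induct) (auto intro: polys.intros)

lemma polys_power: "f \<in> polys k \<Longrightarrow> (\<lambda>x. f x ^ n) \<in> polys k"
  by (induction n) (auto intro: polys.intros)

lemma points_coord_space [simp]: "points (coord_space k) = coords k"
proof
  show "points (coord_space k) \<subseteq> coords k" unfolding coord_space_def points_generated by blast
  show "coords k \<subseteq> points (coord_space k)" unfolding coord_space_def points_generated
  proof
    fix x assume "x \<in> coords k"
    then have "x \<in> {x \<in> coords k. (\<lambda>_. 1) x \<noteq> (0::complex)}" by simp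
    then show "x \<in> \<Union>{{x \<in> W. f x \<noteq> 0} |W f. (W, f) \<in> {(coords k, f) |f. f \<in> polys k}}"
      using polys.const[of 1 k] by (intro UnionI[of "{x \<in> coords k. (\<lambda>_. 1) x \<noteq> (0::complex)}"] CollectI exI conjI refl) auto
  qed
qed

lemma sheaf_coord_space: "sheaf_of_functions (coord_space k)"
  unfolding coord_space_def by (rule sheaf_generated)

lemma openin_polys_nonzero: "f \<in> polys k \<Longrightarrow> openin (zariski (coord_space k)) {x \<in> coords k. f x \<noteq> 0}"
  unfolding coord_space_def by (rule openin_generated_basic) simp

lemma regular_coord_space:
  "regular (coord_space k) U h \<longleftrightarrow> openin (zariski (coord_space k)) U \<and>
     (\<forall>x\<in>U. \<exists>V. \<exists>f\<in>polys k. \<exists>g\<in>polys k. openin (zariski (coord_space k)) V \<and> x \<in> V \<and>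
        V \<subseteq> U \<and> (\<forall>y\<in>V. g y \<noteq> 0 \<and> h y = f y / g y))"
    (is "?l \<longleftrightarrow> ?r")
proof
  assume l: ?l
  show ?r
  proof (intro conjI ballI)
    show "openin (zariski (coord_space k)) U" using l unfolding coord_space_def by (rule regular_generated_openin)
    fix x assume "x \<in> U"
    then obtain V W f g where "(W, f) \<in> {(coords k, f) |f. f \<in> polys k}" "(W, g) \<in> {(coords k, f) |f. f \<in> polys k}"
      "openin (zariski (coord_space k)) V" "x \<in> V" "V \<subseteq> U \<inter> W" "(\<forall>y\<in>V. g y \<noteq> 0 \<and> h y = f y / g y)"
      using l unfolding coord_space_def regular_generated by meson
    then show "\<exists>V. \<exists>f\<in>polys k. \<exists>g\<in>polys k. openin (zariski (coord_space k)) V \<and> x \<in> V \<and>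
        V \<subseteq> U \<and> (\<forall>y\<in>V. g y \<noteq> 0 \<and> h y = f y / g y)"
      by (intro exI[of _ V] bexI[of _ f] bexI[of _ g]) auto
  qed
next
  assume r: ?r
  show ?l unfolding coord_space_def regular_generated
    unfolding coord_space_def[symmetric]
  proof (intro conjI ballI)
    show "openin (zariski (coord_space k)) U" using r by blast
    fix x assume "x \<in> U"
    then obtain V f g where *: "f \<in> polys k" "g \<in> polys k" "openin (zariski (coord_space k)) V" "x \<in> V"
        "V \<subseteq> U" "(\<forall>y\<in>V. g y \<noteq> 0 \<and> h y = f y / g y)" using r by meson
    have "V \<subseteq> coords k" using openin_subset[OF *(3)] by simp
    then show "\<exists>V W f g. (W, f) \<in> {(coords k, f) |f. f \<in> polys k} \<and> (W, g) \<in> {(coords k, f) |f. f \<in> polys k} \<and>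
       openin (zariski (coord_space k)) V \<and> x \<in> V \<and> V \<subseteq> U \<inter> W \<and> (\<forall>y\<in>V. g y \<noteq> 0 \<and> h y = f y / g y)"
      using * by (intro exI[of _ V] exI[of _ "coords k"] exI[of _ f] exI[of _ g] conjI) auto
  qed
qed

lemma regular_coord_openin: "regular (coord_space k) U h \<Longrightarrow> openin (zariski (coord_space k)) U"
  by (simp add: regular_coord_space)

lemma regular_coord_polys:
  assumes "f \<in> polys k" "openin (zariski (coord_space k)) U" "\<And>x. x \<in> U \<Longrightarrow> h x = f x"
  shows "regular (coord_space k) U h"
  unfolding regular_coord_space using assms polys.const[of 1 k]
  by (intro conjI ballI exI[of _ U] bexI[of _ f] bexI[of _ "\<lambda>_. 1"]) auto

text \<open>Common scheme for sums, products and quotients: near a point both functions are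
  fractions of polynomials, so only an identity of fractions at every \<open>y\<close> has to be
  supplied.\<close>

lemma regular_coord_combine:
  assumes "regular (coord_space k) U h1" "regular (coord_space k) U h2"
    and comb: "\<And>f1 g1 f2 g2. f1 \<in> polys k \<Longrightarrow> g1 \<in> polys k \<Longrightarrow> f2 \<in> polys k \<Longrightarrow> g2 \<in> polys k \<Longrightarrow>
      \<exists>f\<in>polys k. \<exists>g\<in>polys k. \<forall>y\<in>U. g1 y \<noteq> 0 \<longrightarrow> g2 y \<noteq> 0 \<longrightarrow> h1 y = f1 y / g1 y \<longrightarrow> h2 y = f2 y / g2 y \<longrightarrow>
         g y \<noteq> 0 \<and> h y = f y / g y"
  shows "regular (coord_space k) U h"
  unfolding regular_coord_space
proof (intro conjI ballI)
  show "openin (zariski (coord_space k)) U" using assms(1) by (rule regular_coord_openin)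
  fix x assume "x \<in> U"
  obtain V1 f1 g1 where 1: "f1 \<in> polys k" "g1 \<in> polys k" "openin (zariski (coord_space k)) V1" "x \<in> V1"
      "V1 \<subseteq> U" "\<forall>y\<in>V1. g1 y \<noteq> 0 \<and> h1 y = f1 y / g1 y"
    using assms(1) \<open>x \<in> U\<close> unfolding regular_coord_space by meson
  obtain V2 f2 g2 where 2: "f2 \<in> polys k" "g2 \<in> polys k" "openin (zariski (coord_space k)) V2" "x \<in> V2"
      "V2 \<subseteq> U" "\<forall>y\<in>V2. g2 y \<noteq> 0 \<and> h2 y = f2 y / g2 y"
    using assms(2) \<open>x \<in> U\<close> unfolding regular_coord_space by meson
  obtain f g where fg: "f \<in> polys k" "g \<in> polys k" "\<forall>y\<in>U. g1 y \<noteq> 0 \<longrightarrow> g2 y \<noteq> 0 \<longrightarrow> h1 y = f1 y / g1 y \<longrightarrow> h2 y = f2 y / g2 y \<longrightarrow>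
         g y \<noteq> 0 \<and> h y = f y / g y" using comb[OF 1(1,2) 2(1,2)] by blast
  then have "\<forall>y\<in>V1 \<inter> V2. g y \<noteq> 0 \<and> h y = f y / g y" using 1(5,6) 2(6) by blast
  then show "\<exists>V. \<exists>f\<in>polys k. \<exists>g\<in>polys k. openin (zariski (coord_space k)) V \<and> x \<in> V \<and> V \<subseteq> U \<and> (\<forall>y\<in>V. g y \<noteq> 0 \<and> h y = f y / g y)"
    using 1(3-5) 2(3-4) fg(1,2) by (intro exI[of _ "V1 \<inter> V2"] bexI[of _ f] bexI[of _ g]) (auto intro: openin_Int)
qed

lemma regular_coord_add:
  assumes "regular (coord_space k) U h1" "regular (coord_space k) U h2"
  shows "regular (coord_space k) U (\<lambda>x. h1 x + h2 x)"
  using assms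
proof (rule regular_coord_combine)
  fix f1 g1 f2 g2 assume "f1 \<in> polys k" "g1 \<in> polys k" "f2 \<in> polys k" "g2 \<in> polys k"
  then show "\<exists>f\<in>polys k. \<exists>g\<in>polys k. \<forall>y\<in>U. g1 y \<noteq> 0 \<longrightarrow> g2 y \<noteq> 0 \<longrightarrow> h1 y = f1 y / g1 y \<longrightarrow> h2 y = f2 y / g2 y \<longrightarrow>
         g y \<noteq> 0 \<and> h1 y + h2 y = f y / g y"
    by (intro bexI[of _ "\<lambda>y. f1 y * g2 y + f2 y * g1 y"] bexI[of _ "\<lambda>y. g1 y * g2 y"])
      (auto simp: field_simps intro!: polys.intros)
qed

lemma regular_coord_mult:
  assumes "regular (coord_space k) U h1" "regular (coord_space k) U h2"
  shows "regular (coord_space k) U (\<lambda>x. h1 x * h2 x)"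
  using assms
proof (rule regular_coord_combine)
  fix f1 g1 f2 g2 assume "f1 \<in> polys k" "g1 \<in> polys k" "f2 \<in> polys k" "g2 \<in> polys k"
  then show "\<exists>f\<in>polys k. \<exists>g\<in>polys k. \<forall>y\<in>U. g1 y \<noteq> 0 \<longrightarrow> g2 y \<noteq> 0 \<longrightarrow> h1 y = f1 y / g1 y \<longrightarrow> h2 y = f2 y / g2 y \<longrightarrow>
         g y \<noteq> 0 \<and> h1 y * h2 y = f y / g y"
    by (intro bexI[of _ "\<lambda>y. f1 y * f2 y"] bexI[of _ "\<lambda>y. g1 y * g2 y"])
      (auto simp: field_simps intro!: polys.intros)
qed

lemma regular_coord_divide:
  assumes "regular (coord_space k) U h1" "regular (coord_space k) U h2" "\<And>x. x \<in> U \<Longrightarrow> h2 x \<noteq> 0"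
  shows "regular (coord_space k) U (\<lambda>x. h1 x / h2 x)"
  using assms(1,2)
proof (rule regular_coord_combine)
  fix f1 g1 f2 g2 assume "f1 \<in> polys k" "g1 \<in> polys k" "f2 \<in> polys k" "g2 \<in> polys k"
  then show "\<exists>f\<in>polys k. \<exists>g\<in>polys k. \<forall>y\<in>U. g1 y \<noteq> 0 \<longrightarrow> g2 y \<noteq> 0 \<longrightarrow> h1 y = f1 y / g1 y \<longrightarrow> h2 y = f2 y / g2 y \<longrightarrow>
         g y \<noteq> 0 \<and> h1 y / h2 y = f y / g y"
    using assms(3)
    by (intro bexI[of _ "\<lambda>y. f1 y * g2 y"] bexI[of _ "\<lambda>y. g1 y * f2 y"])
      (fastforce simp: field_simps intro!: polys.intros)+
qed

lemma regular_coord_sum: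
  assumes "openin (zariski (coord_space k)) U" "\<And>j. j \<in> J \<Longrightarrow> regular (coord_space k) U (h j)"
  shows "regular (coord_space k) U (\<lambda>x. \<Sum>j\<in>J. h j x)"
  using assms(2)
proof (induction J rule: infinite_finite_induct)
  case (insert j J) then show ?case using regular_coord_add[of k U "h j" "\<lambda>x. \<Sum>j\<in>J. h j x"] by auto
qed (auto intro!: regular_coord_polys[OF polys.const[of 0]] assms(1))

lemma regular_coord_prod:
  assumes "openin (zariski (coord_space k)) U" "\<And>j. j \<in> J \<Longrightarrow> regular (coord_space k) U (h j)"
  shows "regular (coord_space k) U (\<lambda>x. \<Prod>j\<in>J. h j x)"
  using assms(2)
proof (induction J rule: infinite_finite_induct)
  case (insert j J) then show ?case using regular_coord_mult[of k U "h j" "\<lambda>x. \<Prod>j\<in>J. h j x"] by auto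
qed (auto intro!: regular_coord_polys[OF polys.const[of 1]] assms(1))

text \<open>Locally \<open>h\<close> is \<open>f / g\<close>, so it vanishes exactly where the
  numerator does.\<close>

lemma regular_coord_nonzero:
  assumes "regular (coord_space k) U h"
  shows "openin (zariski (coord_space k)) {x \<in> U. h x \<noteq> 0}"
proof (subst openin_subopen, intro ballI)
  fix x assume x: "x \<in> {x \<in> U. h x \<noteq> 0}"
  then obtain V f g where *: "f \<in> polys k" "g \<in> polys k" "openin (zariski (coord_space k)) V" "x \<in> V"
      "V \<subseteq> U" "\<forall>y\<in>V. g y \<noteq> 0 \<and> h y = f y / g y"
    using assms unfolding regular_coord_space by (simp only: mem_Collect_eq) meson
  have V: "V \<subseteq> coords k" using openin_subset[OF *(3)] by simp
  have "openin (zariski (coord_space k)) (V \<inter> {x \<in> coords k. f x \<noteq> 0})"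
    using *(3) openin_polys_nonzero[OF *(1)] by (rule openin_Int)
  moreover have "x \<in> V \<inter> {x \<in> coords k. f x \<noteq> 0}" using x * V by force
  moreover have "V \<inter> {x \<in> coords k. f x \<noteq> 0} \<subseteq> {x \<in> U. h x \<noteq> 0}" using * by auto
  ultimately show "\<exists>T. openin (zariski (coord_space k)) T \<and> x \<in> T \<and> T \<subseteq> {x \<in> U. h x \<noteq> 0}" by blast
qed

text \<open>Regular functions of the target are locally fractions of basic functions with
  nonvanishing denominator, and such fractions of regular functions are regular; so pullbacks are
  checked on basic functions only.\<close>

lemma morphism_coord_generated:
  assumes "\<And>W f. (W, f) \<in> B \<Longrightarrow> openin (zariski (coord_space k)) {x \<in> coords k. \<phi> x \<in> W}"
    and "\<And>W f. (W, f) \<in> B \<Longrightarrow> regular (coord_space k) {x \<in> coords k. \<phi> x \<in> W} (\<lambda>x. f (\<phi> x))"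
    and "\<And>x. x \<in> coords k \<Longrightarrow> \<phi> x \<in> points (generated_space B)"
  shows "morphism (coord_space k) (generated_space B) \<phi>"
proof -
  have o: "openin (zariski (coord_space k)) {x \<in> coords k. \<phi> x \<in> U}"
    if "openin (zariski (generated_space B)) U" for U
  proof (rule openin_generated_preimage[OF _ that])
    fix W f assume "(W, f) \<in> B"
    from regular_coord_nonzero[OF assms(2)[OF this]]
    have "openin (zariski (coord_space k)) {x \<in> {x \<in> coords k. \<phi> x \<in> W}. f (\<phi> x) \<noteq> 0}" .
    also have "{x \<in> {x \<in> coords k. \<phi> x \<in> W}. f (\<phi> x) \<noteq> 0} = {x \<in> coords k. \<phi> x \<in> W \<and> f (\<phi> x) \<noteq> 0}" by blast
    finally show "openin (zariski (coord_space k)) {x \<in> coords k. \<phi> x \<in> W \<and> f (\<phi> x) \<noteq> 0}" .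
  qed
  have r: "regular (coord_space k) {x \<in> coords k. \<phi> x \<in> U} (\<lambda>x. h (\<phi> x))"
    if h: "regular (generated_space B) U h" for U h
  proof (rule sheaf_glue[OF sheaf_coord_space o])
    show "openin (zariski (generated_space B)) U" using h by (rule regular_generated_openin)
    fix x assume x: "x \<in> {x \<in> coords k. \<phi> x \<in> U}"
    then obtain V W f g where *: "(W, f) \<in> B" "(W, g) \<in> B" "openin (zariski (generated_space B)) V"
      "\<phi> x \<in> V" "V \<subseteq> U \<inter> W" "\<forall>y\<in>V. g y \<noteq> 0 \<and> h y = f y / g y"
      using h unfolding regular_generated mem_Collect_eq by meson
    let ?V = "{x \<in> coords k. \<phi> x \<in> V}"
    have VW: "?V \<subseteq> {x \<in> coords k. \<phi> x \<in> W}" using *(5) by blast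
    have "regular (coord_space k) ?V (\<lambda>x. f (\<phi> x) / g (\<phi> x))"
    proof (rule regular_coord_divide)
      show "regular (coord_space k) ?V (\<lambda>x. f (\<phi> x))"
        by (rule sheaf_restrict[OF sheaf_coord_space assms(2)[OF *(1)] o[OF *(3)] VW])
      show "regular (coord_space k) ?V (\<lambda>x. g (\<phi> x))"
        by (rule sheaf_restrict[OF sheaf_coord_space assms(2)[OF *(2)] o[OF *(3)] VW])
    qed (use * in blast)
    then show "\<exists>V f. openin (zariski (coord_space k)) V \<and> x \<in> V \<and> V \<subseteq> {x \<in> coords k. \<phi> x \<in> U} \<and>
        regular (coord_space k) V f \<and> (\<forall>y\<in>V. h (\<phi> y) = f y)"
      using o[OF *(3)] * x by (intro exI[of _ ?V] exI[of _ "\<lambda>x. f (\<phi> x) / g (\<phi> x)"] conjI) auto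
  qed
  show ?thesis unfolding morphism_def comp_def points_coord_space using assms(3) o r by blast
qed

text \<open>An open immersion of the affine space of dimension 2k; openness and descent of regular
  functions stand in for an inverse morphism on the image.\<close>

definition coord_chart :: "nat \<Rightarrow> 'a fspace \<Rightarrow> ((nat \<Rightarrow> complex \<times> complex) \<Rightarrow> 'a) \<Rightarrow> bool" where
  "coord_chart k X \<phi> \<longleftrightarrow> morphism (coord_space k) X \<phi> \<and> inj_on \<phi> (coords k) \<and>
     (\<forall>V. openin (zariski (coord_space k)) V \<longrightarrow> openin (zariski X) (\<phi> ` V)) \<and>
     (\<forall>V h. openin (zariski (coord_space k)) V \<longrightarrow> regular (coord_space k) V (\<lambda>x. h (\<phi> x)) \<longrightarrow> regular X (\<phi> ` V) h)"

text \<open>If every polynomial becomes a basic function whose domain is the whole image, then the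
  inverse of the chart is continuous and fractions of polynomials turn into fractions of basic
  functions.\<close>

lemma coord_chart_generated:
  assumes mor: "morphism (coord_space k) (generated_space B) \<phi>" and inj: "inj_on \<phi> (coords k)"
    and polys: "\<And>q. q \<in> polys k \<Longrightarrow> \<exists>h. (\<phi> ` coords k, h) \<in> B \<and> (\<forall>x\<in>coords k. h (\<phi> x) = q x)"
  shows "coord_chart k (generated_space B) \<phi>"
proof -
  define \<psi> where "\<psi> = inv_into (coords k) \<phi>"
  have \<psi>: "\<psi> (\<phi> x) = x" if "x \<in> coords k" for x unfolding \<psi>_def using inj that by (rule inv_into_f_f)
  obtain H where H: "\<And>q. q \<in> polys k \<Longrightarrow> (\<phi> ` coords k, H q) \<in> B \<and> (\<forall>x\<in>coords k. H q (\<phi> x) = q x)"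
    using polys by metis
  have op: "openin (zariski (generated_space B)) (\<phi> ` V)" if "openin (zariski (coord_space k)) V" for V
  proof -
    have "openin (zariski (generated_space B)) {y \<in> \<phi> ` coords k. \<psi> y \<in> V}"
    proof (rule openin_generated_preimage[OF _ that[unfolded coord_space_def]])
      fix W f assume Wf: "(W, f) \<in> {(coords k, f) |f. f \<in> polys k}"
      then have f: "W = coords k" "f \<in> polys k" by auto
      have "{y \<in> \<phi> ` coords k. \<psi> y \<in> W \<and> f (\<psi> y) \<noteq> 0} = {y \<in> \<phi> ` coords k. H f y \<noteq> 0}"
        using \<psi> f H by auto
      then show "openin (zariski (generated_space B)) {y \<in> \<phi> ` coords k. \<psi> y \<in> W \<and> f (\<psi> y) \<noteq> 0}"
        using openin_generated_basic H[OF f(2)] by auto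
    qed
    also have "{y \<in> \<phi> ` coords k. \<psi> y \<in> V} = \<phi> ` V"
      using \<psi> openin_subset[OF that] by force
    finally show ?thesis .
  qed
  have "regular (generated_space B) (\<phi> ` V) h"
    if V: "openin (zariski (coord_space k)) V" and r: "regular (coord_space k) V (\<lambda>x. h (\<phi> x))" for V h
    unfolding regular_generated
  proof (intro conjI ballI)
    show "openin (zariski (generated_space B)) (\<phi> ` V)" by (rule op[OF V])
    fix y assume "y \<in> \<phi> ` V"
    then obtain x where x: "x \<in> V" "y = \<phi> x" by blast
    obtain V' f g where *: "f \<in> polys k" "g \<in> polys k" "openin (zariski (coord_space k)) V'" "x \<in> V'"
      "V' \<subseteq> V" "\<forall>y\<in>V'. g y \<noteq> 0 \<and> h (\<phi> y) = f y / g y"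
      using r x(1) unfolding regular_coord_space by meson
    have V': "V' \<subseteq> coords k" using openin_subset[OF *(3)] by simp
    have "\<forall>y\<in>\<phi> ` V'. H g y \<noteq> 0 \<and> h y = H f y / H g y"
      using *(6) H[OF *(1)] H[OF *(2)] V' by auto
    moreover have "y \<in> \<phi> ` V'" "\<phi> ` V' \<subseteq> \<phi> ` V \<inter> \<phi> ` coords k" using x *(4,5) V' by auto
    ultimately show "\<exists>V' W f g. (W, f) \<in> B \<and> (W, g) \<in> B \<and> openin (zariski (generated_space B)) V' \<and> y \<in> V' \<and>
        V' \<subseteq> \<phi> ` V \<inter> W \<and> (\<forall>y\<in>V'. g y \<noteq> 0 \<and> h y = f y / g y)"
      using H[OF *(1)] H[OF *(2)] op[OF *(3)] by blast
  qed
  then show ?thesis unfolding coord_chart_def using mor inj op by blast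
qed

definition coord_atlas :: "nat \<Rightarrow> 'a fspace \<Rightarrow> 'i set \<Rightarrow> ('i \<Rightarrow> (nat \<Rightarrow> complex \<times> complex) \<Rightarrow> 'a) \<Rightarrow> bool" where
  "coord_atlas k X I \<phi> \<longleftrightarrow> (\<forall>i\<in>I. coord_chart k X (\<phi> i)) \<and> points X \<subseteq> (\<Union>i\<in>I. \<phi> i ` coords k)"

lemma coord_atlas_openin:
  assumes "coord_atlas k X I \<phi>" "U \<subseteq> points X"
  shows "openin (zariski X) U \<longleftrightarrow> (\<forall>i\<in>I. openin (zariski (coord_space k)) {x \<in> coords k. \<phi> i x \<in> U})"
proof
  assume "openin (zariski X) U"
  then show "\<forall>i\<in>I. openin (zariski (coord_space k)) {x \<in> coords k. \<phi> i x \<in> U}"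
    using assms(1) morphism_openin[of "coord_space k" X] unfolding coord_atlas_def coord_chart_def by fastforce
next
  assume r: "\<forall>i\<in>I. openin (zariski (coord_space k)) {x \<in> coords k. \<phi> i x \<in> U}"
  have "U = (\<Union>i\<in>I. \<phi> i ` {x \<in> coords k. \<phi> i x \<in> U})"
    using assms unfolding coord_atlas_def by blast
  also have "openin (zariski X) \<dots>"
    using r assms(1) unfolding coord_atlas_def coord_chart_def by (intro openin_Union) blast
  finally show "openin (zariski X) U" .
qed

lemma coord_atlas_regular:
  assumes X: "sheaf_of_functions X" and at: "coord_atlas k X I \<phi>" and U: "openin (zariski X) U"
  shows "regular X U h \<longleftrightarrow> (\<forall>i\<in>I. regular (coord_space k) {x \<in> coords k. \<phi> i x \<in> U} (\<lambda>x. h (\<phi> i x)))"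
proof
  assume r: "regular X U h"
  show "\<forall>i\<in>I. regular (coord_space k) {x \<in> coords k. \<phi> i x \<in> U} (\<lambda>x. h (\<phi> i x))"
  proof
    fix i assume "i \<in> I"
    then have "morphism (coord_space k) X (\<phi> i)" using at unfolding coord_atlas_def coord_chart_def by blast
    from morphism_regular[OF this r] show "regular (coord_space k) {x \<in> coords k. \<phi> i x \<in> U} (\<lambda>x. h (\<phi> i x))"
      by simp
  qed
next
  assume r: "\<forall>i\<in>I. regular (coord_space k) {x \<in> coords k. \<phi> i x \<in> U} (\<lambda>x. h (\<phi> i x))"
  show "regular X U h"
  proof (rule sheaf_glue[OF X U])
    fix y assume y: "y \<in> U"
    then have "y \<in> points X" using openin_subset[OF U] by blast
    then obtain i x where ix: "i \<in> I" "x \<in> coords k" "y = \<phi> i x" using at unfolding coord_atlas_def by blast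
    let ?V = "{x \<in> coords k. \<phi> i x \<in> U}"
    have ri: "regular (coord_space k) ?V (\<lambda>x. h (\<phi> i x))" using r ix(1) by blast
    have oi: "openin (zariski (coord_space k)) ?V" by (rule regular_coord_openin[OF ri])
    have ch: "coord_chart k X (\<phi> i)" using at ix(1) unfolding coord_atlas_def by blast
    have "openin (zariski X) (\<phi> i ` ?V)" "regular X (\<phi> i ` ?V) h"
      using ch oi ri unfolding coord_chart_def by blast+
    moreover have "y \<in> \<phi> i ` ?V" "\<phi> i ` ?V \<subseteq> U" using y ix by auto
    ultimately show "\<exists>V f. openin (zariski X) V \<and> y \<in> V \<and> V \<subseteq> U \<and> regular X V f \<and> (\<forall>y\<in>V. h y = f y)"
      by blast
  qed
qed

text \<open>Matching chart points define a map, well defined and injective by \<open>eq\<close>.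
  Openness and regularity are tested in the charts, where this map is the identity of the coordinate
  space.\<close>

theorem coord_atlas_isomorphic:
  assumes X: "sheaf_of_functions X" "coord_atlas k X I \<phi>" and Y: "sheaf_of_functions Y" "coord_atlas k Y I \<psi>"
    and eq: "\<And>i j x y. i \<in> I \<Longrightarrow> j \<in> I \<Longrightarrow> x \<in> coords k \<Longrightarrow> y \<in> coords k \<Longrightarrow>
      \<phi> i x = \<phi> j y \<longleftrightarrow> \<psi> i x = \<psi> j y"
  shows "isomorphic X Y"
proof -
  have mem: "\<phi> i x \<in> points X" "\<psi> i x \<in> points Y" if "i \<in> I" "x \<in> coords k" for i x
  proof -
    have "morphism (coord_space k) X (\<phi> i)" "morphism (coord_space k) Y (\<psi> i)"
      using X(2) Y(2) that(1) unfolding coord_atlas_def coord_chart_def by blast+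
    then show "\<phi> i x \<in> points X" "\<psi> i x \<in> points Y" using morphism_points that(2) by fastforce+
  qed
  have covX: "\<exists>i\<in>I. \<exists>x\<in>coords k. p = \<phi> i x" if "p \<in> points X" for p
    using X(2) that unfolding coord_atlas_def by blast
  have covY: "\<exists>i\<in>I. \<exists>x\<in>coords k. p = \<psi> i x" if "p \<in> points Y" for p
    using Y(2) that unfolding coord_atlas_def by blast
  define \<Phi> where "\<Phi> p = (SOME q. \<exists>i\<in>I. \<exists>x\<in>coords k. p = \<phi> i x \<and> q = \<psi> i x)" for p
  have \<Phi>: "\<Phi> (\<phi> i x) = \<psi> i x" if "i \<in> I" "x \<in> coords k" for i x
  proof -
    have "\<exists>j\<in>I. \<exists>y\<in>coords k. \<phi> i x = \<phi> j y \<and> \<Phi> (\<phi> i x) = \<psi> j y"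
      unfolding \<Phi>_def by (rule someI_ex) (use that in blast)
    then show ?thesis using eq that by metis
  qed
  have pre: "{x \<in> coords k. \<phi> i x \<in> {p \<in> points X. \<Phi> p \<in> U}} = {x \<in> coords k. \<psi> i x \<in> U}" if "i \<in> I" for i U
    using mem(1)[OF that] \<Phi>[OF that] by auto
  show ?thesis
  proof (rule isomorphicI[of \<Phi>])
    have "inj_on \<Phi> (points X)"
    proof (rule inj_onI)
      fix p p' assume "p \<in> points X" "p' \<in> points X" "\<Phi> p = \<Phi> p'"
      then show "p = p'" using covX \<Phi> eq by metis
    qed
    moreover have "\<Phi> ` points X = points Y"
    proof
      show "\<Phi> ` points X \<subseteq> points Y" using covX \<Phi> mem by (metis image_subsetI)
      show "points Y \<subseteq> \<Phi> ` points X" using covY \<Phi> mem by (metis image_eqI subsetI)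
    qed
    ultimately show "bij_betw \<Phi> (points X) (points Y)" by (simp add: bij_betw_def)
    show opn: "openin (zariski X) {x \<in> points X. \<Phi> x \<in> U} = openin (zariski Y) U" if "U \<subseteq> points Y" for U
      unfolding coord_atlas_openin[OF Y(2) that]
      using coord_atlas_openin[OF X(2), of "{x \<in> points X. \<Phi> x \<in> U}"] pre by auto
    fix U h assume U: "openin (zariski Y) U"
    then have oX: "openin (zariski X) {x \<in> points X. \<Phi> x \<in> U}" using opn openin_subset by blast
    have "regular (coord_space k) {x \<in> coords k. \<psi> i x \<in> U} (\<lambda>x. h (\<psi> i x)) =
       regular (coord_space k) {x \<in> coords k. \<psi> i x \<in> U} (\<lambda>x. (h \<circ> \<Phi>) (\<phi> i x))" if "i \<in> I" for i
      by (rule sheaf_cong[OF sheaf_coord_space]) (use \<Phi> that in simp)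
    then show "regular Y U h = regular X {x \<in> points X. \<Phi> x \<in> U} (h \<circ> \<Phi>)"
      unfolding coord_atlas_regular[OF Y U] coord_atlas_regular[OF X oX] using pre by simp
  qed
qed


lemma regular_generated_basic:
  assumes "(W, f) \<in> B" "(W, \<lambda>_. 1) \<in> B"
  shows "regular (generated_space B) W f"
proof -
  have "openin (zariski (generated_space B)) W" using openin_generated_basic[OF assms(2)] by simp
  then show ?thesis unfolding regular_generated using assms
    by (intro conjI ballI exI[of _ W] exI[of _ f] exI[of _ "\<lambda>_. 1"]) auto
qed

text \<open>Basic functions of a product are finite sums of products of functions of single
  coordinates; this is the shape in which polynomials are recognised as such.\<close>

lemma polys_normal_form:
  assumes "f \<in> polys k"
  shows "\<exists>(m::nat) c a b. \<forall>x. f x = (\<Sum>j<m. c j * (\<Prod>i<k. fst (x i) ^ a j i * snd (x i) ^ b j i))"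
  using assms
proof induction
  case (const c)
  show ?case by (intro exI[of _ 1] exI[of _ "\<lambda>_. c"] exI[of _ "\<lambda>_ _. 0"]) simp
next
  case (fst i)
  have "(\<Prod>l<k. fst (x l) ^ (if l = i then 1 else 0)) = fst (x i)" for x :: "nat \<Rightarrow> complex \<times> complex"
    using fst by (subst prod.remove[of _ i]) auto
  then show ?case
    by (intro exI[of _ 1] exI[of _ "\<lambda>_. 1"] exI[of _ "\<lambda>_ l. if l = i then 1 else 0"] exI[of _ "\<lambda>_ _. 0"]) simp
next
  case (snd i)
  have "(\<Prod>l<k. snd (x l) ^ (if l = i then 1 else 0)) = snd (x i)" for x :: "nat \<Rightarrow> complex \<times> complex"
    using snd by (subst prod.remove[of _ i]) auto
  then show ?case
    by (intro exI[of _ 1] exI[of _ "\<lambda>_. 1"] exI[of _ "\<lambda>_ _. 0"] exI[of _ "\<lambda>_ l. if l = i then 1 else 0"]) simp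
next
  case (add f g)
  obtain m c a b where f: "\<And>x. f x = (\<Sum>j<(m::nat). c j * (\<Prod>i<k. fst (x i) ^ a j i * snd (x i) ^ b j i))"
    using add by meson
  obtain m' c' a' b' where g: "\<And>x. g x = (\<Sum>j<(m'::nat). c' j * (\<Prod>i<k. fst (x i) ^ a' j i * snd (x i) ^ b' j i))"
    using add by meson
  have split: "(\<Sum>j<m + m'. F j) = (\<Sum>j<m. F j) + (\<Sum>j<m'. F (m + j))" for F :: "nat \<Rightarrow> complex"
    by (induction m') (auto simp: add_ac)
  show ?case
    by (intro exI[of _ "m + m'"] exI[of _ "\<lambda>j. if j < m then c j else c' (j - m)"]
        exI[of _ "\<lambda>j. if j < m then a j else a' (j - m)"] exI[of _ "\<lambda>j. if j < m then b j else b' (j - m)"])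
      (simp add: f g split)
next
  case (mult f g)
  obtain m c a b where f: "\<And>x. f x = (\<Sum>j<(m::nat). c j * (\<Prod>i<k. fst (x i) ^ a j i * snd (x i) ^ b j i))"
    using mult by meson
  obtain m' c' a' b' where g: "\<And>x. g x = (\<Sum>j<(m'::nat). c' j * (\<Prod>i<k. fst (x i) ^ a' j i * snd (x i) ^ b' j i))"
    using mult by meson
  \<comment> \<open>The terms of the product are indexed by pairs; \<pi> enumerates these, as the
    normal form sums over an initial segment of the naturals.\<close>
  obtain \<pi> where bij: "bij_betw \<pi> {..<card ({..<m} \<times> {..<m'})} ({..<m} \<times> {..<m'})"
    using ex_bij_betw_nat_finite[of "{..<m} \<times> {..<m'}"] by (auto simp: atLeast0LessThan)
  show ?case
  proof (intro exI allI)
    fix x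
    have "f x * g x = (\<Sum>w\<in>{..<m} \<times> {..<m'}. (c (fst w) * c' (snd w)) *
       (\<Prod>i<k. fst (x i) ^ (a (fst w) i + a' (snd w) i) * snd (x i) ^ (b (fst w) i + b' (snd w) i)))"
      unfolding f g sum_product sum.cartesian_product case_prod_unfold
      by (rule sum.cong) (simp_all add: power_add prod.distrib mult_ac)
    also have "\<dots> = (\<Sum>l<card ({..<m} \<times> {..<m'}). (c (fst (\<pi> l)) * c' (snd (\<pi> l))) *
       (\<Prod>i<k. fst (x i) ^ (a (fst (\<pi> l)) i + a' (snd (\<pi> l)) i) * snd (x i) ^ (b (fst (\<pi> l)) i + b' (snd (\<pi> l)) i)))"
      by (rule sum.reindex_bij_betw[OF bij, symmetric])
    finally show "f x * g x = \<dots>" .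
  qed
qed

section \<open>ALE spaces\<close>

definition ale_cone :: "nat \<Rightarrow> (real \<times> real) set" where
  "ale_cone i = {s *\<^sub>R (1, real i - 1) + t *\<^sub>R (1, real i) |s t. s \<ge> 0 \<and> t \<ge> 0}"

definition ale_fan :: "nat \<Rightarrow> (real \<times> real) set set" where
  "ale_fan n = {ale_cone i |i. i \<in> {1..n}}"

text \<open>The dual basis of the generators of the \<open>i\<close>-th cone is \<open>(i, -1), (1 - i, 1)\<close>; \<open>ale_coord i\<close> is the monoid
  homomorphism with the values \<open>p\<close>, \<open>q\<close> at these two elements.\<close>

definition ale_coord :: "nat \<Rightarrow> complex \<times> complex \<Rightarrow> int \<times> int \<Rightarrow> complex" where
  "ale_coord i x = (\<lambda>(a, b). if a + b * (int i - 1) \<ge> 0 \<and> a + b * int i \<ge> 0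
     then fst x ^ nat (a + b * (int i - 1)) * snd x ^ nat (a + b * int i) else 0)"

definition ale_point :: "nat \<Rightarrow> nat \<Rightarrow> complex \<times> complex \<Rightarrow> surface_point" where
  "ale_point n i x = glued_point (ale_fan n) (ale_cone i) (ale_coord i x)"

lemma ale_space_altdef: "ale_space n = toric_surface (ale_fan n)"
  by (simp add: ale_space_def ale_fan_def ale_cone_def)

lemma dual_monoid_add:
  assumes "m \<in> dual_monoid \<sigma>" "m' \<in> dual_monoid \<sigma>" shows "m + m' \<in> dual_monoid \<sigma>"
proof -
  obtain a b a' b' where m: "m = (a, b)" "m' = (a', b')" by fastforce
  have "real_of_int (a + a') * x + real_of_int (b + b') * y \<ge> 0" if "(x, y) \<in> \<sigma>" for x y
  proof -
    have "real_of_int a * x + real_of_int b * y \<ge> 0" "real_of_int a' * x + real_of_int b' * y \<ge> 0"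
      using assms that unfolding m dual_monoid_def by auto
    then show ?thesis by (simp add: algebra_simps)
  qed
  then show ?thesis unfolding m dual_monoid_def by auto
qed

lemma chart_add: "\<gamma> \<in> chart \<sigma> \<Longrightarrow> m \<in> dual_monoid \<sigma> \<Longrightarrow> m' \<in> dual_monoid \<sigma> \<Longrightarrow> \<gamma> (m + m') = \<gamma> m * \<gamma> m'"
  and chart_outside: "\<gamma> \<in> chart \<sigma> \<Longrightarrow> m \<notin> dual_monoid \<sigma> \<Longrightarrow> \<gamma> m = 0"
  unfolding chart_def by blast+

text \<open>Nonnegativity on a cone is tested on its generators, here \<open>(1, i - 1)\<close> and
  \<open>(1, i)\<close>, and the pairing with these is integral.\<close>

lemma dual_ale_cone:
  "(a, b) \<in> dual_monoid (ale_cone i) \<longleftrightarrow> a + b * (int i - 1) \<ge> 0 \<and> a + b * int i \<ge> 0"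
proof -
  have conv: "real_of_int a + real_of_int b * (real i - 1) \<ge> 0 \<longleftrightarrow> a + b * (int i - 1) \<ge> 0"
    "real_of_int a + real_of_int b * real i \<ge> 0 \<longleftrightarrow> a + b * int i \<ge> 0"
  proof -
    have "real_of_int a + real_of_int b * (real i - 1) = real_of_int (a + b * (int i - 1))"
      "real_of_int a + real_of_int b * real i = real_of_int (a + b * int i)" by simp_all
    then show "real_of_int a + real_of_int b * (real i - 1) \<ge> 0 \<longleftrightarrow> a + b * (int i - 1) \<ge> 0"
      "real_of_int a + real_of_int b * real i \<ge> 0 \<longleftrightarrow> a + b * int i \<ge> 0" by (simp_all only: of_int_0_le_iff)
  qed
  have "(\<forall>(x, y)\<in>ale_cone i. real_of_int a * x + real_of_int b * y \<ge> 0) \<longleftrightarrow>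
    real_of_int a + real_of_int b * (real i - 1) \<ge> 0 \<and> real_of_int a + real_of_int b * real i \<ge> 0" (is "?l \<longleftrightarrow> ?r")
  proof
    assume l: ?l
    have "(1, real i - 1) \<in> ale_cone i" unfolding ale_cone_def
      by (intro CollectI exI[of _ 1] exI[of _ 0]) simp
    moreover have "(1, real i) \<in> ale_cone i" unfolding ale_cone_def
      by (intro CollectI exI[of _ 0] exI[of _ 1]) simp
    ultimately show ?r using l by fastforce
  next
    assume r: ?r
    show ?l
    proof
      fix v assume "v \<in> ale_cone i"
      then obtain s t where v: "v = (s + t, s * (real i - 1) + t * real i)" "s \<ge> 0" "t \<ge> 0"
        unfolding ale_cone_def by auto
      have "real_of_int a * (s + t) + real_of_int b * (s * (real i - 1) + t * real i) =
        s * (real_of_int a + real_of_int b * (real i - 1)) + t * (real_of_int a + real_of_int b * real i)"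
        by (simp add: algebra_simps)
      also have "\<dots> \<ge> 0" using r v by simp
      finally show "case v of (x, y) \<Rightarrow> real_of_int a * x + real_of_int b * y \<ge> 0" using v by simp
    qed
  qed
  then show ?thesis unfolding dual_monoid_def conv by simp
qed

lemma ale_coord_chart: "ale_coord i x \<in> chart (ale_cone i)"
proof -
  have "ale_coord i x (m + m') = ale_coord i x m * ale_coord i x m'"
    if "m \<in> dual_monoid (ale_cone i)" "m' \<in> dual_monoid (ale_cone i)" for m m'
  proof -
    obtain a b a' b' where m: "m = (a, b)" "m' = (a', b')" by fastforce
    have *: "a + b * (int i - 1) \<ge> 0" "a + b * int i \<ge> 0" "a' + b' * (int i - 1) \<ge> 0" "a' + b' * int i \<ge> 0"
      using that unfolding m dual_ale_cone by auto
    have e: "a + a' + (b + b') * (int i - 1) = (a + b * (int i - 1)) + (a' + b' * (int i - 1))"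
      "a + a' + (b + b') * int i = (a + b * int i) + (a' + b' * int i)" by (simp_all add: algebra_simps)
    show ?thesis unfolding m ale_coord_def
      by (simp only: plus_prod_def fst_conv snd_conv prod.case e nat_add_distrib[OF *(1,3)] nat_add_distrib[OF *(2,4)])
        (use * in \<open>simp add: power_add\<close>)
  qed
  moreover have "ale_coord i x 0 = 1" by (simp add: ale_coord_def zero_prod_def)
  moreover have "ale_coord i x m = 0" if "m \<notin> dual_monoid (ale_cone i)" for m
    using that by (cases m) (auto simp: dual_ale_cone ale_coord_def)
  ultimately show ?thesis unfolding chart_def by blast
qed

text \<open>\<open>(1, 0)\<close> is the sum of the two dual generators and does not depend on
  \<open>i\<close>: its value, the product of the coordinates, is shared by all charts.\<close>

lemma ale_coord_basis:
  "ale_coord i x (int i, -1) = fst x" "ale_coord i x (1 - int i, 1) = snd x" "ale_coord i x (1, 0) = fst x * snd x"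
  by (simp_all add: ale_coord_def)

lemma chart_power:
  assumes "\<gamma> \<in> chart \<sigma>" "m \<in> dual_monoid \<sigma>"
  shows "(int n * fst m, int n * snd m) \<in> dual_monoid \<sigma> \<and> \<gamma> (int n * fst m, int n * snd m) = \<gamma> m ^ n"
proof (induction n)
  case 0
  have "(0, 0) \<in> dual_monoid \<sigma>" by (auto simp: dual_monoid_def)
  moreover have "\<gamma> (0, 0) = 1" using assms(1) by (simp add: chart_def zero_prod_def)
  ultimately show ?case by simp
next
  case (Suc n)
  obtain a b where m: "m = (a, b)" by fastforce
  have e: "(int (Suc n) * a, int (Suc n) * b) = m + (int n * a, int n * b)" unfolding m by (simp add: algebra_simps)
  have mem: "(int n * a, int n * b) \<in> dual_monoid \<sigma>" using Suc m by simp
  have "\<gamma> (m + (int n * a, int n * b)) = \<gamma> m * \<gamma> (int n * a, int n * b)"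
    by (rule chart_add[OF assms mem])
  moreover have "(int (Suc n) * a, int (Suc n) * b) \<in> dual_monoid \<sigma>"
    unfolding e by (rule dual_monoid_add[OF assms(2) mem])
  ultimately have "(int (Suc n) * a, int (Suc n) * b) \<in> dual_monoid \<sigma> \<and>
      \<gamma> (int (Suc n) * a, int (Suc n) * b) = \<gamma> m ^ Suc n"
    unfolding e[symmetric] using Suc m by simp
  then show ?case unfolding m fst_conv snd_conv .
qed

text \<open>The generators of the cone form a lattice basis, so the dual monoid is free on the dual
  basis and a monoid homomorphism is determined by its two values there.\<close>

lemma chart_ale_cone:
  assumes \<gamma>: "\<gamma> \<in> chart (ale_cone i)"
  shows "\<gamma> = ale_coord i (\<gamma> (int i, -1), \<gamma> (1 - int i, 1))"
proof
  fix m :: "int \<times> int"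
  obtain a b where m: "m = (a, b)" by fastforce
  show "\<gamma> m = ale_coord i (\<gamma> (int i, -1), \<gamma> (1 - int i, 1)) m"
  proof (cases "m \<in> dual_monoid (ale_cone i)")
    case False
    then show ?thesis using chart_outside[OF \<gamma>] chart_outside[OF ale_coord_chart] by simp
  next
    case True
    then have *: "a + b * (int i - 1) \<ge> 0" "a + b * int i \<ge> 0" unfolding m dual_ale_cone by auto
    define s t where "s = nat (a + b * (int i - 1))" and "t = nat (a + b * int i)"
    have st: "int s = a + b * (int i - 1)" "int t = a + b * int i" using * by (simp_all add: s_def t_def)
    have d: "(int i, -1) \<in> dual_monoid (ale_cone i)" "(1 - int i, 1) \<in> dual_monoid (ale_cone i)"
      by (simp_all add: dual_ale_cone)
    \<comment> \<open>The coefficients of \<open>m\<close> in the dual basis are its pairings with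
      the generators of the cone.\<close>
    have e: "m = (int s * int i, int s * -1) + (int t * (1 - int i), int t * 1)"
      unfolding m st by (simp add: algebra_simps)
    have "\<gamma> m = \<gamma> (int s * int i, int s * -1) * \<gamma> (int t * (1 - int i), int t * 1)"
      unfolding e using chart_power[OF \<gamma> d(1), of s] chart_power[OF \<gamma> d(2), of t] by (intro chart_add[OF \<gamma>]) auto
    also have "\<dots> = \<gamma> (int i, -1) ^ s * \<gamma> (1 - int i, 1) ^ t"
      using chart_power[OF \<gamma> d(1), of s] chart_power[OF \<gamma> d(2), of t] by simp
    also have "\<dots> = ale_coord i (\<gamma> (int i, -1), \<gamma> (1 - int i, 1)) m"
      using * by (simp add: m ale_coord_def s_def t_def)
    finally show ?thesis .
  qed
qed

text \<open>Homogeneous coordinates: the \<open>i\<close>-th chart normalises all pairs \<open>(Z\<^sub>l, W\<^sub>l)\<close> except the \<open>i\<close>-th, and all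
  products \<open>Z\<^sub>l W\<^sub>l\<close> agree.  Two normalised tuples describe the same point iff they differ by a torus element of
  determinant one.\<close>

definition cox_Z :: "nat \<Rightarrow> complex \<times> complex \<Rightarrow> nat \<Rightarrow> complex" where
  "cox_Z i x l = (if l < i then fst x * snd x else if l = i then snd x else 1)"

definition cox_W :: "nat \<Rightarrow> complex \<times> complex \<Rightarrow> nat \<Rightarrow> complex" where
  "cox_W i x l = (if l < i then 1 else if l = i then fst x else fst x * snd x)"

definition cox_equiv :: "nat \<Rightarrow> nat \<Rightarrow> complex \<times> complex \<Rightarrow> nat \<Rightarrow> complex \<times> complex \<Rightarrow> bool" where
  "cox_equiv n i x j y \<longleftrightarrow> (\<exists>s. (\<forall>l\<in>{1..n}. s l \<noteq> 0) \<and> (\<Prod>l=1..n. s l) = 1 \<and>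
     (\<forall>l\<in>{1..n}. cox_Z j y l = s l * cox_Z i x l \<and> cox_W i x l = s l * cox_W j y l))"

lemma cox_equiv_refl: "cox_equiv n i x i x"
  unfolding cox_equiv_def by (rule exI[of _ "\<lambda>_. 1"]) simp

lemma cox_equiv_sym: "cox_equiv n i x j y \<Longrightarrow> cox_equiv n j y i x"
proof -
  assume "cox_equiv n i x j y"
  then obtain s where "\<forall>l\<in>{1..n}. s l \<noteq> 0" "(\<Prod>l=1..n. s l) = 1"
     "\<forall>l\<in>{1..n}. cox_Z j y l = s l * cox_Z i x l \<and> cox_W i x l = s l * cox_W j y l"
    unfolding cox_equiv_def by blast
  then show ?thesis unfolding cox_equiv_def
    by (intro exI[of _ "\<lambda>l. inverse (s l)"]) (auto simp: prod_inversef[unfolded comp_def] field_simps simp flip: inverse_eq_divide)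
qed

lemma cox_equiv_trans: "cox_equiv n i x j y \<Longrightarrow> cox_equiv n j y k z \<Longrightarrow> cox_equiv n i x k z"
proof -
  assume "cox_equiv n i x j y" "cox_equiv n j y k z"
  then obtain s t where "\<forall>l\<in>{1..n}. s l \<noteq> 0" "(\<Prod>l=1..n. s l) = 1"
     "\<forall>l\<in>{1..n}. cox_Z j y l = s l * cox_Z i x l \<and> cox_W i x l = s l * cox_W j y l"
     "\<forall>l\<in>{1..n}. t l \<noteq> 0" "(\<Prod>l=1..n. t l) = 1"
     "\<forall>l\<in>{1..n}. cox_Z k z l = t l * cox_Z j y l \<and> cox_W j y l = t l * cox_W k z l"
    unfolding cox_equiv_def by blast
  then show ?thesis unfolding cox_equiv_def
    by (intro exI[of _ "\<lambda>l. s l * t l"]) (auto simp: prod.distrib)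
qed

lemma cox_ZW: "cox_Z i x l * cox_W i x l = fst x * snd x"
  by (simp add: cox_Z_def cox_W_def)

lemma cox_equiv_moment:
  assumes "cox_equiv n i x j y" "1 \<le> n"
  shows "fst x * snd x = fst y * snd y"
proof -
  obtain s where s: "s 1 \<noteq> 0" "cox_Z j y 1 = s 1 * cox_Z i x 1" "cox_W i x 1 = s 1 * cox_W j y 1"
    using assms unfolding cox_equiv_def by (auto dest!: bspec[of _ _ 1])
  then have "cox_Z j y 1 * cox_W j y 1 = cox_Z i x 1 * cox_W i x 1" by simp
  then show ?thesis by (simp add: cox_ZW)
qed

text \<open>Away from \<open>i\<close> each pair has an entry normalised to 1 in both tuples, which
  forces the torus parameter to be 1; determinant one then forces it to be 1 at \<open>i\<close> as
  well.\<close>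

lemma cox_equiv_same_chart:
  assumes "i \<in> {1..n}"
  shows "cox_equiv n i x i y \<longleftrightarrow> x = y"
proof
  assume "cox_equiv n i x i y"
  then obtain s where s: "\<forall>l\<in>{1..n}. s l \<noteq> 0" "(\<Prod>l=1..n. s l) = 1"
     "\<forall>l\<in>{1..n}. cox_Z i y l = s l * cox_Z i x l \<and> cox_W i x l = s l * cox_W i y l"
    unfolding cox_equiv_def by blast
  have "s l = 1" if "l \<in> {1..n} - {i}" for l
    using bspec[OF s(3), of l] that by (auto simp: cox_Z_def cox_W_def split: if_splits)
  then have "(\<Prod>l\<in>{1..n} - {i}. s l) = 1" by simp
  then have "s i = 1" using s(2) assms by (simp add: prod.remove[of _ i])
  then show "x = y" using bspec[OF s(3) assms] by (simp add: cox_Z_def cox_W_def prod_eq_iff)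
qed (simp add: cox_equiv_refl)

lemma prod_unit_outside:
  fixes s :: "nat \<Rightarrow> complex"
  assumes "1 \<le> i" "i < j" "j \<le> n" "\<And>l. l \<in> {1..n} \<Longrightarrow> l < i \<or> l > j \<Longrightarrow> s l = 1"
    "\<And>l. i < l \<Longrightarrow> l < j \<Longrightarrow> s l = c"
  shows "(\<Prod>l=1..n. s l) = s i * s j * c ^ (j - i - 1)"
proof -
  have "(\<Prod>l=1..n. s l) = (\<Prod>l\<in>{i..j}. s l)"
    by (rule prod.mono_neutral_right) (use assms in auto)
  also have "{i..j} = insert i (insert j {i<..<j})" using assms by auto
  also have "(\<Prod>l\<in>\<dots>. s l) = s i * (s j * (\<Prod>l\<in>{i<..<j}. s l))" using assms(2) by simp
  also have "(\<Prod>l\<in>{i<..<j}. s l) = (\<Prod>l\<in>{i<..<j}. c)" by (rule prod.cong) (use assms in auto)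
  also have "\<dots> = c ^ (j - i - 1)" by simp
  finally show ?thesis by simp
qed

text \<open>The normalised entries determine the torus element: 1 outside the interval from
  \<open>i\<close> to \<open>j\<close>, \<open>fst x\<close> at \<open>i\<close>,
  \<open>snd y\<close> at \<open>j\<close> and the common product strictly between. The second
  equation says that its determinant is one.\<close>

lemma cox_equiv_iff:
  assumes "1 \<le> i" "i < j" "j \<le> n"
  shows "cox_equiv n i x j y \<longleftrightarrow>
    fst x * snd x = fst y * snd y \<and> fst x * snd y * (fst x * snd x) ^ (j - i - 1) = 1"
proof
  assume eq: "cox_equiv n i x j y"
  then have m: "fst x * snd x = fst y * snd y" using cox_equiv_moment assms by fastforce
  obtain s where s: "\<forall>l\<in>{1..n}. s l \<noteq> 0" "(\<Prod>l=1..n. s l) = 1"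
     "\<forall>l\<in>{1..n}. cox_Z j y l = s l * cox_Z i x l \<and> cox_W i x l = s l * cox_W j y l"
    using eq unfolding cox_equiv_def by blast
  have "(\<Prod>l=1..n. s l) = s i * s j * (fst x * snd x) ^ (j - i - 1)"
  proof (rule prod_unit_outside[OF assms])
    show "s l = 1" if "l \<in> {1..n}" "l < i \<or> l > j" for l
      using bspec[OF s(3) that(1)] that(2) assms by (auto simp: cox_Z_def cox_W_def split: if_splits)
    show "s l = fst x * snd x" if "i < l" "l < j" for l
      using bspec[OF s(3), of l] that assms by (auto simp: cox_Z_def cox_W_def split: if_splits)
  qed
  moreover have "s i = fst x" "s j = snd y"
    using bspec[OF s(3), of i] bspec[OF s(3), of j] assms by (auto simp: cox_Z_def cox_W_def)
  ultimately show "fst x * snd x = fst y * snd y \<and> fst x * snd y * (fst x * snd x) ^ (j - i - 1) = 1"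
    using s(2) m by simp
next
  assume r: "fst x * snd x = fst y * snd y \<and> fst x * snd y * (fst x * snd x) ^ (j - i - 1) = 1"
  define s where "s l = (if l = i then fst x else if l = j then snd y else if i < l \<and> l < j then fst x * snd x else 1)" for l
  have "(\<Prod>l=1..n. s l) = s i * s j * (fst x * snd x) ^ (j - i - 1)"
    by (rule prod_unit_outside[OF assms]) (use assms in \<open>auto simp: s_def\<close>)
  then have p: "(\<Prod>l=1..n. s l) = 1"
    using conjunct2[OF r] assms by (simp only: s_def) simp
  then have "\<forall>l\<in>{1..n}. s l \<noteq> 0" by (metis finite_atLeastAtMost prod_zero_iff zero_neq_one)
  moreover have "cox_Z j y l = s l * cox_Z i x l \<and> cox_W i x l = s l * cox_W j y l" if "l \<in> {1..n}" for l
    using that assms r by (auto simp: cox_Z_def cox_W_def s_def)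
  ultimately show "cox_equiv n i x j y" unfolding cox_equiv_def using p by blast
qed

text \<open>In the lattice, the first dual generator of cone \<open>i\<close>, the second one of
  cone \<open>j\<close> and j - i - 1 copies of \<open>(1, 0)\<close> add up to zero. Applying
  \<open>\<delta>\<close> to this relation gives the equation of
  \<open>cox_equiv_iff\<close>.\<close>

lemma glue_imp_cox_equiv:
  assumes i: "i \<in> {1..n}" "j \<in> {1..n}" "i \<le> j" and \<delta>: "\<delta> \<in> chart (ale_cone i \<inter> ale_cone j)"
    and eq: "\<forall>m\<in>dual_monoid (ale_cone i). \<delta> m = ale_coord i x m" "\<forall>m\<in>dual_monoid (ale_cone j). \<delta> m = ale_coord j y m"
  shows "cox_equiv n i x j y"
proof -
  have dx: "\<delta> (int i, -1) = fst x" "\<delta> (1 - int i, 1) = snd x" "\<delta> (1, 0) = fst x * snd x"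
    using bspec[OF eq(1), of "(int i, -1)"] bspec[OF eq(1), of "(1 - int i, 1)"] bspec[OF eq(1), of "(1, 0)"]
    by (simp_all add: dual_ale_cone ale_coord_basis)
  have dy: "\<delta> (int j, -1) = fst y" "\<delta> (1 - int j, 1) = snd y" "\<delta> (1, 0) = fst y * snd y"
    using bspec[OF eq(2), of "(int j, -1)"] bspec[OF eq(2), of "(1 - int j, 1)"] bspec[OF eq(2), of "(1, 0)"]
    by (simp_all add: dual_ale_cone ale_coord_basis)
  show ?thesis
  proof (cases "i = j")
    case True
    then have "x = y" using dx dy by (simp add: prod_eq_iff)
    then show ?thesis using True cox_equiv_refl by simp
  next
    case False
    then have ij: "i < j" using i by simp
    have anti: "dual_monoid (ale_cone i) \<subseteq> dual_monoid (ale_cone i \<inter> ale_cone j)"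
      "dual_monoid (ale_cone j) \<subseteq> dual_monoid (ale_cone i \<inter> ale_cone j)"
      unfolding dual_monoid_def by blast+
    have mem: "(int i, -1) \<in> dual_monoid (ale_cone i \<inter> ale_cone j)" "(1 - int j, 1) \<in> dual_monoid (ale_cone i \<inter> ale_cone j)"
      "(1, 0) \<in> dual_monoid (ale_cone i \<inter> ale_cone j)"
      by (rule subsetD[OF anti(1)], simp add: dual_ale_cone, rule subsetD[OF anti(2)], simp add: dual_ale_cone,
          rule subsetD[OF anti(1)], simp add: dual_ale_cone)
    note pw = chart_power[OF \<delta> mem(3), of "j - i - 1"]
    note mult = chart_add[OF \<delta>] and add = dual_monoid_add
    have "\<delta> ((int i, -1) + (1 - int j, 1) + (int (j - i - 1) * fst (1::int, 0::int), int (j - i - 1) * snd (1::int, 0::int))) =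
      fst x * snd y * (fst x * snd x) ^ (j - i - 1)"
      using mult[OF add[OF mem(1,2)] conjunct1[OF pw]] conjunct2[OF pw] by (simp only: mult[OF mem(1,2)] dx dy)
    moreover have "(int i, -1) + (1 - int j, 1) + (int (j - i - 1) * fst (1::int, 0::int), int (j - i - 1) * snd (1::int, 0::int)) = 0"
      using ij by (simp add: zero_prod_def of_nat_diff)
    moreover have "\<delta> 0 = 1" using \<delta> by (simp add: chart_def)
    ultimately show ?thesis using cox_equiv_iff[of i j n x y] ij i dx dy by simp
  qed
qed

text \<open>The gluing equation makes the value \<open>p\<close> at \<open>(i, -1)\<close>
  invertible, so the common extension can be prescribed on the lattice basis \<open>(1, 0)\<close>,
  \<open>(i, -1)\<close>.\<close>

lemma cox_equiv_imp_glue: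
  assumes i: "i \<in> {1..n}" "j \<in> {1..n}" "i \<le> j" and eq: "cox_equiv n i x j y"
  shows "\<exists>\<delta>\<in>chart (ale_cone i \<inter> ale_cone j). (\<forall>m\<in>dual_monoid (ale_cone i). \<delta> m = ale_coord i x m) \<and>
    (\<forall>m\<in>dual_monoid (ale_cone j). \<delta> m = ale_coord j y m)"
proof (cases "i = j")
  case True
  then have "x = y" using eq cox_equiv_same_chart i(1) by blast
  then show ?thesis using True ale_coord_chart[of i x] by auto
next
  case False
  then have ij: "i < j" using i by simp
  define p q x0 where "p = fst x" and "q = snd y" and "x0 = fst x * snd x"
  have r: "fst y * snd y = x0" "p * q * x0 ^ (j - i - 1) = 1"
    using eq cox_equiv_iff[of i j n x y] ij i by (auto simp: p_def q_def x0_def)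
  \<comment> \<open>If the common product vanishes, its exponent in the gluing equation must be 0,
    so the cones are neighbours.\<close>
  have nz: "p \<noteq> 0" "q \<noteq> 0" "x0 = 0 \<Longrightarrow> j = Suc i" using r(2) ij by (auto simp: power_0_left split: if_splits)
  let ?D = "dual_monoid (ale_cone i \<inter> ale_cone j)"
  have anti: "dual_monoid (ale_cone i) \<subseteq> ?D" "dual_monoid (ale_cone j) \<subseteq> ?D"
    unfolding dual_monoid_def by blast+
  note add = dual_monoid_add
  \<comment> \<open>Neighbouring cones share the ray through \<open>(1, i)\<close>. So the exponent
    that \<open>x0\<close> gets below is nonnegative whenever \<open>x0\<close> is zero, and no
    inverse of zero is taken.\<close>
  have D: "a + b * int i \<ge> 0" if "(a, b) \<in> ?D" "x0 = 0" for a b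
  proof -
    have j: "j = Suc i" by (rule nz(3)[OF that(2)])
    have "(1, real i) \<in> ale_cone i" unfolding ale_cone_def
      by (intro CollectI exI[of _ 0] exI[of _ 1]) simp
    moreover have "(1, real i) \<in> ale_cone j" unfolding ale_cone_def j
      by (intro CollectI exI[of _ 1] exI[of _ 0]) simp
    ultimately have "real_of_int a * 1 + real_of_int b * real i \<ge> 0"
      using that(1) unfolding dual_monoid_def by blast
    then have "real_of_int (a + b * int i) \<ge> 0" by simp
    then show ?thesis by (simp only: of_int_0_le_iff)
  qed
  \<comment> \<open>\<open>(a, b)\<close> is a + b i times \<open>(1, 0)\<close> minus b times
    \<open>(i, -1)\<close>, and the values at these two are \<open>x0\<close> and
    \<open>p\<close>.\<close>
  define \<delta> where "\<delta> m = (if m \<in> ?D then x0 powi (fst m + snd m * int i) * p powi (- snd m) else 0)" for m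
  have "\<delta> \<in> chart (ale_cone i \<inter> ale_cone j)" unfolding chart_def
  proof (intro CollectI conjI ballI allI impI)
    have "(0::int \<times> int) \<in> ?D" by (auto simp: dual_monoid_def zero_prod_def)
    then show "\<delta> 0 = 1" by (simp add: \<delta>_def)
    show "\<delta> m = 0" if "m \<notin> ?D" for m using that by (simp add: \<delta>_def)
    fix m m' assume m: "m \<in> ?D" "m' \<in> ?D"
    obtain a b a' b' where ab: "m = (a, b)" "m' = (a', b')" by fastforce
    have "x0 powi ((a + b * int i) + (a' + b' * int i)) = x0 powi (a + b * int i) * x0 powi (a' + b' * int i)"
    proof (cases "x0 = 0")
      case True
      then have "a + b * int i \<ge> 0" "a' + b' * int i \<ge> 0" using D m ab by auto
      then show ?thesis by (simp add: power_int_def nat_add_distrib power_add)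
    qed (simp add: power_int_add)
    moreover have "p powi (- (b + b')) = p powi (- b) * p powi (- b')"
      using nz(1) power_int_add[of p "- b" "- b'"] by simp
    ultimately show "\<delta> (m + m') = \<delta> m * \<delta> m'"
      using add[OF m] m by (simp add: \<delta>_def ab algebra_simps)
  qed
  moreover have "\<delta> m = ale_coord i x m" if "m \<in> dual_monoid (ale_cone i)" for m
  proof -
    obtain a b where m: "m = (a, b)" by fastforce
    have *: "a + b * (int i - 1) \<ge> 0" "a + b * int i \<ge> 0" using that unfolding m dual_ale_cone by auto
    have "x0 powi (a + b * int i) * p powi (- b) = p powi (a + b * int i) * p powi (- b) * snd x powi (a + b * int i)"
      by (simp add: x0_def p_def power_int_mult_distrib)
    also have "p powi (a + b * int i) * p powi (- b) = p powi (a + b * int i + - b)"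
      by (subst power_int_add) (use nz in auto)
    also have "a + b * int i + - b = a + b * (int i - 1)" by (simp add: algebra_simps)
    finally show ?thesis using * that anti unfolding m by (simp add: \<delta>_def ale_coord_def power_int_def p_def subset_iff)
  qed
  moreover have "\<delta> m = ale_coord j y m" if "m \<in> dual_monoid (ale_cone j)" for m
  proof -
    obtain a b where m: "m = (a, b)" by fastforce
    have *: "a + b * (int j - 1) \<ge> 0" "a + b * int j \<ge> 0" using that unfolding m dual_ale_cone by auto
    have "fst y powi (a + b * (int j - 1)) * q powi (a + b * int j) =
       fst y powi (a + b * (int j - 1)) * (q powi (a + b * (int j - 1)) * q powi b)"
      by (subst power_int_add[symmetric]) (use nz in \<open>auto simp: algebra_simps\<close>)
    also have "\<dots> = x0 powi (a + b * (int j - 1)) * q powi b"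
      by (simp add: r(1)[symmetric] q_def power_int_mult_distrib mult.assoc)
    \<comment> \<open>The gluing equation eliminates \<open>q\<close>; for \<open>x0 = 0\<close> it
      reduces to p q = 1.\<close>
    also have "\<dots> = x0 powi (a + b * int i) * p powi (- b)"
    proof (cases "x0 = 0")
      case True
      then have "j = Suc i" by (rule nz(3))
      moreover from this have "q = inverse p" using r(2) True by (simp add: inverse_unique)
      then have "q powi b = p powi (- b)" by (simp add: power_int_minus power_int_inverse)
      ultimately show ?thesis by simp
    next
      case False
      have "q = inverse (p * x0 powi (int j - int i - 1))"
      proof -
        have "x0 powi (int j - int i - 1) = x0 powi int (j - i - 1)" using ij by (simp add: of_nat_diff diff_diff_eq add.commute)
        also have "\<dots> = x0 ^ (j - i - 1)" by (rule power_int_of_nat)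
        finally show ?thesis using r(2) by (metis inverse_unique inverse_inverse_eq mult.assoc mult.commute)
      qed
      then have "q powi b = p powi (- b) * x0 powi (- (b * (int j - int i - 1)))"
        by (simp add: power_int_inverse power_int_minus power_int_mult_distrib power_int_mult[symmetric] mult.commute)
      then have "x0 powi (a + b * (int j - 1)) * q powi b =
        p powi (- b) * (x0 powi (a + b * (int j - 1)) * x0 powi (- (b * (int j - int i - 1))))" by simp
      also have "x0 powi (a + b * (int j - 1)) * x0 powi (- (b * (int j - int i - 1))) = x0 powi (a + b * int i)"
        by (subst power_int_add[symmetric]) (use False in \<open>auto simp: algebra_simps\<close>)
      finally show ?thesis by simp
    qed
    finally show ?thesis using * that anti unfolding m by (simp add: \<delta>_def ale_coord_def power_int_def q_def subset_iff)
  qed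
  ultimately show ?thesis by blast
qed

lemma ale_point_mem:
  assumes i: "i \<in> {1..n}" "j \<in> {1..n}"
  shows "(ale_cone j, ale_coord j y) \<in> ale_point n i x \<longleftrightarrow> cox_equiv n i x j y"
proof -
  have "(ale_cone j, ale_coord j y) \<in> ale_point n i x \<longleftrightarrow>
    (\<exists>\<delta>\<in>chart (ale_cone i \<inter> ale_cone j). (\<forall>m\<in>dual_monoid (ale_cone i). \<delta> m = ale_coord i x m) \<and>
    (\<forall>m\<in>dual_monoid (ale_cone j). \<delta> m = ale_coord j y m))" (is "_ \<longleftrightarrow> ?R")
    using i ale_coord_chart by (auto simp: ale_point_def glued_point_def ale_fan_def)
  also have "?R \<longleftrightarrow> cox_equiv n i x j y"
  proof (cases "i \<le> j")
    case True
    then show ?thesis using glue_imp_cox_equiv[OF i True] cox_equiv_imp_glue[OF i True] by blast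
  next
    case False
    then have ji: "j \<le> i" by simp
    show ?thesis
    proof
      assume ?R
      then show "cox_equiv n i x j y"
        using glue_imp_cox_equiv[OF i(2,1) ji, of _ y x] cox_equiv_sym by (metis inf_commute)
    next
      assume "cox_equiv n i x j y"
      then have "cox_equiv n j y i x" by (rule cox_equiv_sym)
      from cox_equiv_imp_glue[OF i(2,1) ji this] show ?R by (metis inf_commute)
    qed
  qed
  finally show ?thesis .
qed

text \<open>A glued point is the set of all pairs glued to one of its members. That it does not
  depend on the member requires gluing to be transitive, which is inherited from
  \<open>cox_equiv\<close>.\<close>

lemma ale_point_eq_iff:
  assumes i: "i \<in> {1..n}" "j \<in> {1..n}"
  shows "ale_point n i x = ale_point n j y \<longleftrightarrow> cox_equiv n i x j y"
proof
  assume "ale_point n i x = ale_point n j y"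
  moreover have "(ale_cone j, ale_coord j y) \<in> ale_point n j y" using ale_point_mem i cox_equiv_refl by blast
  ultimately show "cox_equiv n i x j y" using ale_point_mem[OF i] by blast
next
  assume eq: "cox_equiv n i x j y"
  have el: "\<exists>k\<in>{1..n}. \<exists>z. e = (ale_cone k, ale_coord k z)" if "e \<in> ale_point n l w" for e l w
    using that chart_ale_cone unfolding ale_point_def glued_point_def ale_fan_def by blast
  show "ale_point n i x = ale_point n j y"
  proof (intro equalityI subsetI)
    fix e assume e: "e \<in> ale_point n i x"
    then obtain k z where k: "k \<in> {1..n}" "e = (ale_cone k, ale_coord k z)" using el by blast
    then have "cox_equiv n i x k z" using e ale_point_mem i by blast
    then have "cox_equiv n j y k z" using cox_equiv_trans[OF cox_equiv_sym[OF eq]] by blast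
    then show "e \<in> ale_point n j y" using ale_point_mem[OF i(2) k(1)] k(2) by blast
  next
    fix e assume e: "e \<in> ale_point n j y"
    then obtain k z where k: "k \<in> {1..n}" "e = (ale_cone k, ale_coord k z)" using el by blast
    then have "cox_equiv n j y k z" using e ale_point_mem i by blast
    then have "cox_equiv n i x k z" using cox_equiv_trans[OF eq] by blast
    then show "e \<in> ale_point n i x" using ale_point_mem[OF i(1) k(1)] k(2) by blast
  qed
qed

section \<open>The atlas of a product of ALE spaces\<close>

definition ale_basis :: "nat \<Rightarrow> (surface_point set \<times> (surface_point \<Rightarrow> complex)) set" where
  "ale_basis n = {(glued_point (ale_fan n) \<sigma> ` chart \<sigma>, f) |\<sigma> f. \<sigma> \<in> ale_fan n \<and>
        (\<exists>M c. finite M \<and> M \<subseteq> dual_monoid \<sigma> \<and>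
           (\<forall>\<gamma>\<in>chart \<sigma>. f (glued_point (ale_fan n) \<sigma> \<gamma>) = (\<Sum>m\<in>M. c m * \<gamma> m)))}"

lemma ale_space_generated: "ale_space n = generated_space (ale_basis n)"
  by (simp add: ale_space_altdef toric_surface_def ale_basis_def)

lemma chart_ale_cone_range: "chart (ale_cone i) = range (ale_coord i)"
  using chart_ale_cone ale_coord_chart by blast

lemma range_ale_point: "glued_point (ale_fan n) (ale_cone i) ` chart (ale_cone i) = range (ale_point n i)"
  by (simp add: chart_ale_cone_range ale_point_def image_image)

lemma ale_basisI:
  assumes "i \<in> {1..n}" "finite M" "M \<subseteq> dual_monoid (ale_cone i)"
    "\<And>y. f (ale_point n i y) = (\<Sum>m\<in>M. c m * ale_coord i y m)"
  shows "(range (ale_point n i), f) \<in> ale_basis n"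
proof -
  have "\<forall>\<gamma>\<in>chart (ale_cone i). f (glued_point (ale_fan n) (ale_cone i) \<gamma>) = (\<Sum>m\<in>M. c m * \<gamma> m)"
    unfolding chart_ale_cone_range using assms(4) by (simp add: ale_point_def)
  moreover have "ale_cone i \<in> ale_fan n" using assms(1) by (auto simp: ale_fan_def)
  ultimately show ?thesis unfolding ale_basis_def mem_Collect_eq
    using assms(2,3) range_ale_point[of n i] by (intro exI[of _ "ale_cone i"] exI[of _ f] conjI exI[of _ M] exI[of _ c]) simp_all
qed

lemma ale_basisE:
  assumes "(W, f) \<in> ale_basis n"
  obtains i M c where "i \<in> {1..n}" "W = range (ale_point n i)" "finite M" "M \<subseteq> dual_monoid (ale_cone i)"
    "\<And>y. f (ale_point n i y) = (\<Sum>m\<in>M. c m * ale_coord i y m)"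
proof -
  obtain \<sigma> M c where *: "W = glued_point (ale_fan n) \<sigma> ` chart \<sigma>" "\<sigma> \<in> ale_fan n" "finite M" "M \<subseteq> dual_monoid \<sigma>"
    "\<forall>\<gamma>\<in>chart \<sigma>. f (glued_point (ale_fan n) \<sigma> \<gamma>) = (\<Sum>m\<in>M. c m * \<gamma> m)"
    using assms unfolding ale_basis_def mem_Collect_eq prod.inject by iprover
  obtain i where i: "i \<in> {1..n}" "\<sigma> = ale_cone i" using *(2) by (auto simp: ale_fan_def)
  show ?thesis
    by (rule that[OF i(1) _ *(3) _ ]) (use * i range_ale_point ale_coord_chart in \<open>auto simp: ale_point_def\<close>)
qed

lemma ale_basis_const: "i \<in> {1..n} \<Longrightarrow> (range (ale_point n i), \<lambda>_. c) \<in> ale_basis n"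
  by (rule ale_basisI[where M = "{0}" and c = "\<lambda>_. c"])
    (auto simp: dual_monoid_def zero_prod_def ale_coord_def)

lemma points_ale: "points (ale_space n) = (\<Union>i\<in>{1..n}. range (ale_point n i))"
proof
  show "points (ale_space n) \<subseteq> (\<Union>i\<in>{1..n}. range (ale_point n i))"
    unfolding ale_space_generated points_generated by (auto elim!: ale_basisE)
  show "(\<Union>i\<in>{1..n}. range (ale_point n i)) \<subseteq> points (ale_space n)"
  proof (rule UN_least)
    fix i assume "i \<in> {1..n}"
    from openin_subset[OF openin_generated_basic[OF ale_basis_const[OF this, of 1]]]
    show "range (ale_point n i) \<subseteq> points (ale_space n)" by (simp add: ale_space_generated)
  qed
qed

text \<open>Two charts meet in the principal open set of a polynomial \<open>D\<close>. For
  \<open>s \<noteq> s'\<close> the equation of \<open>cox_equiv_iff\<close> is solved for the new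
  coordinates: one is \<open>1 / D\<close>, the other the common product times
  \<open>D\<close>.\<close>

lemma ale_transition:
  assumes i: "i < k" and s: "s \<in> {1..n}" "s' \<in> {1..n}"
  obtains D P Q where "D \<in> polys k"
    "regular (coord_space k) {x \<in> coords k. D x \<noteq> 0} P" "regular (coord_space k) {x \<in> coords k. D x \<noteq> 0} Q"
    "\<And>x. D x \<noteq> 0 \<Longrightarrow> cox_equiv n s (x i) s' (P x, Q x)"
    "\<And>x y. cox_equiv n s (x i) s' y \<Longrightarrow> D x \<noteq> 0"
proof -
  note pf = polys.fst[OF i] and ps = polys.snd[OF i]
  note px = polys.mult[OF pf ps]
  consider "s = s'" | "s < s'" | "s' < s" by linarith
  then show ?thesis
  proof cases
    case 1
    have o: "openin (zariski (coord_space k)) {x \<in> coords k. (1::complex) \<noteq> 0}"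
      by (rule openin_polys_nonzero) (rule polys.const)
    show ?thesis
      by (rule that[of "\<lambda>_. 1" "\<lambda>x. fst (x i)" "\<lambda>x. snd (x i)"])
        (use 1 o pf ps in \<open>auto intro: polys.const regular_coord_polys simp: cox_equiv_refl\<close>)
  next
    case 2
    define D where "D x = fst (x i) * (fst (x i) * snd (x i)) ^ (s' - s - 1)" for x :: "nat \<Rightarrow> complex \<times> complex"
    have D: "D \<in> polys k" unfolding D_def by (intro polys.mult pf polys_power px)
    have o: "openin (zariski (coord_space k)) {x \<in> coords k. D x \<noteq> 0}" by (rule openin_polys_nonzero[OF D])
    show ?thesis
    proof (rule that[OF D])
      show "regular (coord_space k) {x \<in> coords k. D x \<noteq> 0} (\<lambda>x. fst (x i) * snd (x i) * D x)"
        by (rule regular_coord_polys[OF polys.mult[OF px D] o]) simp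
      show "regular (coord_space k) {x \<in> coords k. D x \<noteq> 0} (\<lambda>x. 1 / D x)"
        by (rule regular_coord_divide) (use o D in \<open>auto intro: regular_coord_polys polys.const\<close>)
      show "cox_equiv n s (x i) s' (fst (x i) * snd (x i) * D x, 1 / D x)" if "D x \<noteq> 0" for x
        using that 2 s by (subst cox_equiv_iff) (auto simp: D_def field_simps)
      show "D x \<noteq> 0" if "cox_equiv n s (x i) s' y" for x y
      proof -
        have "fst (x i) * snd y * (fst (x i) * snd (x i)) ^ (s' - s - 1) = 1"
          using that 2 s by (subst (asm) cox_equiv_iff) auto
        then have "D x * snd y = 1" by (simp add: D_def mult_ac)
        then show ?thesis by auto
      qed
    qed
  next
    case 3
    define D where "D x = snd (x i) * (fst (x i) * snd (x i)) ^ (s - s' - 1)" for x :: "nat \<Rightarrow> complex \<times> complex"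
    have D: "D \<in> polys k" unfolding D_def by (intro polys.mult ps polys_power px)
    have o: "openin (zariski (coord_space k)) {x \<in> coords k. D x \<noteq> 0}" by (rule openin_polys_nonzero[OF D])
    show ?thesis
    proof (rule that[OF D])
      show "regular (coord_space k) {x \<in> coords k. D x \<noteq> 0} (\<lambda>x. 1 / D x)"
        by (rule regular_coord_divide) (use o D in \<open>auto intro: regular_coord_polys polys.const\<close>)
      show "regular (coord_space k) {x \<in> coords k. D x \<noteq> 0} (\<lambda>x. fst (x i) * snd (x i) * D x)"
        by (rule regular_coord_polys[OF polys.mult[OF px D] o]) simp
      show "cox_equiv n s (x i) s' (1 / D x, fst (x i) * snd (x i) * D x)" if "D x \<noteq> 0" for x
        by (rule cox_equiv_sym) (use that 3 s in \<open>subst cox_equiv_iff; auto simp: D_def field_simps\<close>)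
      show "D x \<noteq> 0" if "cox_equiv n s (x i) s' y" for x y
      proof -
        have "1 \<le> s'" "s' < s" "s \<le> n" using 3 s by auto
        have r: "fst y * snd y = fst (x i) * snd (x i)" "fst y * snd (x i) * (fst y * snd y) ^ (s - s' - 1) = 1"
          using iffD1[OF cox_equiv_iff[OF \<open>1 \<le> s'\<close> \<open>s' < s\<close> \<open>s \<le> n\<close>] cox_equiv_sym[OF that]] by auto
        have "D x * fst y = 1" using r(2) unfolding r(1) by (simp add: D_def mult_ac)
        then show ?thesis by auto
      qed
    qed
  qed
qed

lemma regular_coord_power:
  "regular (coord_space k) U h \<Longrightarrow> regular (coord_space k) U (\<lambda>x. h x ^ n)"
proof (induction n)
  case 0 then show ?case
    by (auto intro!: regular_coord_polys[OF polys.const[of 1]] dest: regular_coord_openin)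
next
  case (Suc n) then show ?case using regular_coord_mult by fastforce
qed

lemma regular_coord_const:
  "openin (zariski (coord_space k)) U \<Longrightarrow> regular (coord_space k) U (\<lambda>_. c)"
  by (rule regular_coord_polys[OF polys.const]) simp_all

lemma regular_ale_coord:
  assumes "regular (coord_space k) U P" "regular (coord_space k) U Q"
  shows "regular (coord_space k) U (\<lambda>x. ale_coord i (P x, Q x) m)"
proof -
  obtain a b where m: "m = (a, b)" by fastforce
  show ?thesis
  proof (cases "a + b * (int i - 1) \<ge> 0 \<and> a + b * int i \<ge> 0")
    case True
    then show ?thesis unfolding m ale_coord_def
      by (simp add: assms regular_coord_mult regular_coord_power)
  next
    case False
    have "regular (coord_space k) U (\<lambda>_. 0)" using assms(1) regular_coord_openin regular_coord_const by blast
    then show ?thesis using False unfolding m ale_coord_def by (simp add: False)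
  qed
qed

lemma ale_point_morphism:
  assumes i: "i < k" and s: "s \<in> {1..n}"
  shows "morphism (coord_space k) (ale_space n) (\<lambda>x. ale_point n s (x i))"
proof -
  have *: "openin (zariski (coord_space k)) {x \<in> coords k. ale_point n s (x i) \<in> W} \<and>
    regular (coord_space k) {x \<in> coords k. ale_point n s (x i) \<in> W} (\<lambda>x. f (ale_point n s (x i)))"
    if Wf: "(W, f) \<in> ale_basis n" for W f
  proof -
    obtain s' M c where s': "s' \<in> {1..n}" and W: "W = range (ale_point n s')" "finite M"
      "\<And>y. f (ale_point n s' y) = (\<Sum>m\<in>M. c m * ale_coord s' y m)"
      using ale_basisE[OF Wf] by metis
    obtain D P Q where D: "D \<in> polys k"
      and PQ: "regular (coord_space k) {x \<in> coords k. D x \<noteq> 0} P" "regular (coord_space k) {x \<in> coords k. D x \<noteq> 0} Q"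
      and eq: "\<And>x. D x \<noteq> 0 \<Longrightarrow> cox_equiv n s (x i) s' (P x, Q x)"
        "\<And>x y. cox_equiv n s (x i) s' y \<Longrightarrow> D x \<noteq> 0"
      by (rule ale_transition[OF i s s'], rule that)
    have set: "{x \<in> coords k. ale_point n s (x i) \<in> W} = {x \<in> coords k. D x \<noteq> 0}"
      unfolding W(1) using eq ale_point_eq_iff[OF s s'] by (auto simp: image_iff)
    have o: "openin (zariski (coord_space k)) {x \<in> coords k. D x \<noteq> 0}" by (rule openin_polys_nonzero[OF D])
    have reg: "regular (coord_space k) {x \<in> coords k. D x \<noteq> 0} (\<lambda>x. \<Sum>m\<in>M. c m * ale_coord s' (P x, Q x) m)"
      by (intro regular_coord_sum o regular_coord_mult regular_coord_const regular_ale_coord PQ)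
    have feq: "f (ale_point n s (x i)) = (\<Sum>m\<in>M. c m * ale_coord s' (P x, Q x) m)"
      if "x \<in> {x \<in> coords k. D x \<noteq> 0}" for x
    proof -
      have "ale_point n s (x i) = ale_point n s' (P x, Q x)"
        using eq(1) that ale_point_eq_iff[OF s s'] by blast
      then show ?thesis by (simp add: W(3))
    qed
    have "regular (coord_space k) {x \<in> coords k. D x \<noteq> 0} (\<lambda>x. f (ale_point n s (x i))) =
      regular (coord_space k) {x \<in> coords k. D x \<noteq> 0} (\<lambda>x. \<Sum>m\<in>M. c m * ale_coord s' (P x, Q x) m)"
      by (rule sheaf_cong[OF sheaf_coord_space feq])
    with reg have "regular (coord_space k) {x \<in> coords k. D x \<noteq> 0} (\<lambda>x. f (ale_point n s (x i)))" by simp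
    then show ?thesis unfolding set using o by blast
  qed
  have "ale_point n s (x i) \<in> points (ale_space n)" for x
    unfolding points_ale using s by blast
  then show ?thesis unfolding ale_space_generated using * by (intro morphism_coord_generated) blast+
qed

lemma ale_monomial:
  assumes s: "s \<in> {1..n}"
  obtains g where "regular (ale_space n) (range (ale_point n s)) g" "\<And>y. g (ale_point n s y) = fst y ^ a * snd y ^ b"
proof -
  define g where "g P = (let y = inv_into UNIV (ale_point n s) P in fst y ^ a * snd y ^ b)" for P
  have "inj (ale_point n s)"
    by (rule injI) (simp add: ale_point_eq_iff[OF s s] cox_equiv_same_chart[OF s])
  then have g: "g (ale_point n s y) = fst y ^ a * snd y ^ b" for y by (simp add: g_def)
  \<comment> \<open>The combination of the dual basis \<open>(s, -1)\<close>,
    \<open>(1 - s, 1)\<close> with coefficients \<open>a\<close> and \<open>b\<close>.\<close>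
  let ?m = "(int a * int s + int b * (1 - int s), int b - int a)"
  have e: "fst ?m + snd ?m * (int s - 1) = int a" "fst ?m + snd ?m * int s = int b" by (simp_all add: algebra_simps)
  have "(range (ale_point n s), g) \<in> ale_basis n"
  proof (rule ale_basisI[OF s, where M = "{?m}" and c = "\<lambda>_. 1"])
    show "{?m} \<subseteq> dual_monoid (ale_cone s)" using e by (simp add: dual_ale_cone)
    show "g (ale_point n s y) = (\<Sum>m\<in>{?m}. 1 * ale_coord s y m)" for y
      using e by (simp add: g ale_coord_def)
  qed simp
  then have "regular (ale_space n) (range (ale_point n s)) g"
    unfolding ale_space_generated using ale_basis_const[OF s] by (rule regular_generated_basic)
  then show ?thesis using g that by blast
qed

definition ale_product_chart :: "nat \<Rightarrow> (nat \<Rightarrow> nat) \<Rightarrow> (nat \<Rightarrow> nat) \<Rightarrow> (nat \<Rightarrow> complex \<times> complex) \<Rightarrow> nat \<Rightarrow> surface_point" where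
  "ale_product_chart k n s x = (\<lambda>i\<in>{..<k}. ale_point (n i) (s i) (x i))"

lemma ale_product_chart_eq_iff:
  assumes "\<And>i. i < k \<Longrightarrow> s i \<in> {1..n i}" "\<And>i. i < k \<Longrightarrow> t i \<in> {1..n i}"
  shows "ale_product_chart k n s x = ale_product_chart k n t y \<longleftrightarrow> (\<forall>i<k. cox_equiv (n i) (s i) (x i) (t i) (y i))"
proof -
  have "ale_product_chart k n s x = ale_product_chart k n t y \<longleftrightarrow>
     (\<forall>i<k. ale_point (n i) (s i) (x i) = ale_point (n i) (t i) (y i))"
    unfolding ale_product_chart_def by (auto simp: fun_eq_iff restrict_def)
  then show ?thesis using ale_point_eq_iff assms by metis
qed

lemma ale_product_chart_image:
  "ale_product_chart k n s ` coords k = PiE {..<k} (\<lambda>i. range (ale_point (n i) (s i)))"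
proof
  show "ale_product_chart k n s ` coords k \<subseteq> PiE {..<k} (\<lambda>i. range (ale_point (n i) (s i)))"
    by (auto simp: ale_product_chart_def)
  show "PiE {..<k} (\<lambda>i. range (ale_point (n i) (s i))) \<subseteq> ale_product_chart k n s ` coords k"
  proof
    fix P assume P: "P \<in> PiE {..<k} (\<lambda>i. range (ale_point (n i) (s i)))"
    then have "\<forall>i\<in>{..<k}. \<exists>y. P i = ale_point (n i) (s i) y" by blast
    then obtain y where y: "\<forall>i\<in>{..<k}. P i = ale_point (n i) (s i) (y i)" by metis
    have "P = ale_product_chart k n s (restrict y {..<k})"
      using P y unfolding ale_product_chart_def by (auto simp: fun_eq_iff PiE_def extensional_def)
    moreover have "restrict y {..<k} \<in> coords k" by (simp add: coords_def)
    ultimately show "P \<in> ale_product_chart k n s ` coords k" by blast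
  qed
qed

lemma points_ale_product: "points (product_fspace k (\<lambda>i. ale_space (n i))) \<subseteq>
   (\<Union>s\<in>PiE {..<k} (\<lambda>i. {1..n i}). ale_product_chart k n s ` coords k)"
proof
  fix P assume "P \<in> points (product_fspace k (\<lambda>i. ale_space (n i)))"
  then have P: "P \<in> PiE {..<k} (\<lambda>i. points (ale_space (n i)))" using points_product_subset by blast
  then have "\<forall>i\<in>{..<k}. \<exists>s. s \<in> {1..n i} \<and> P i \<in> range (ale_point (n i) s)" unfolding points_ale by blast
  then obtain s where s: "\<forall>i\<in>{..<k}. s i \<in> {1..n i} \<and> P i \<in> range (ale_point (n i) (s i))" by metis
  have "P \<in> ale_product_chart k n (restrict s {..<k}) ` coords k"
    unfolding ale_product_chart_image using P s by (auto simp: PiE_iff)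
  moreover have "restrict s {..<k} \<in> PiE {..<k} (\<lambda>i. {1..n i})" using s by auto
  ultimately show "P \<in> (\<Union>s\<in>PiE {..<k} (\<lambda>i. {1..n i}). ale_product_chart k n s ` coords k)" by blast
qed

text \<open>A polynomial in normal form is a basic function on the image of the chart, because every
  factor \<open>fst y ^ a * snd y ^ b\<close> is regular on one ALE chart by
  \<open>ale_monomial\<close>.\<close>

lemma ale_product_coord_chart:
  assumes s: "\<And>i. i < k \<Longrightarrow> s i \<in> {1..n i}"
  shows "coord_chart k (product_fspace k (\<lambda>i. ale_space (n i))) (ale_product_chart k n s)"
  unfolding product_fspace_def
proof (rule coord_chart_generated)
  let ?B = "{(PiE {..<k} U, \<lambda>x. \<Sum>j<m. c j * (\<Prod>i<k. g j i (x i))) |U (m :: nat) c g.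
        (\<forall>i<k. openin (zariski (ale_space (n i))) (U i)) \<and> (\<forall>j<m. \<forall>i<k. regular (ale_space (n i)) (U i) (g j i))}"
  have oU: "openin (zariski (ale_space (n i))) (range (ale_point (n i) (s i)))" if "i < k" for i
    using openin_generated_basic[OF ale_basis_const[OF s[OF that], of 1]] by (simp add: ale_space_generated)
  have polys: "\<exists>h. (ale_product_chart k n s ` coords k, h) \<in> ?B \<and> (\<forall>x\<in>coords k. h (ale_product_chart k n s x) = q x)"
    if q: "q \<in> polys k" for q
  proof -
    obtain m c a b where f: "\<And>x. q x = (\<Sum>j<(m::nat). c j * (\<Prod>i<k. fst (x i) ^ a j i * snd (x i) ^ b j i))"
      using polys_normal_form[OF q] by meson
    have "\<forall>j i. \<exists>g. i < k \<longrightarrow> regular (ale_space (n i)) (range (ale_point (n i) (s i))) g \<and>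
       (\<forall>y. g (ale_point (n i) (s i) y) = fst y ^ a j i * snd y ^ b j i)"
      using ale_monomial[OF s] by metis
    then obtain g where g: "\<And>j i. i < k \<Longrightarrow> regular (ale_space (n i)) (range (ale_point (n i) (s i))) (g j i)"
      "\<And>j i y. i < k \<Longrightarrow> g j i (ale_point (n i) (s i) y) = fst y ^ a j i * snd y ^ b j i" by metis
    have "(PiE {..<k} (\<lambda>i. range (ale_point (n i) (s i))), \<lambda>x. \<Sum>j<m. c j * (\<Prod>i<k. g j i (x i))) \<in> ?B"
      by (rule sum_prod_in_product_basis) (use oU g in auto)
    moreover have "(\<Sum>j<m. c j * (\<Prod>i<k. g j i (ale_product_chart k n s x i))) = q x" for x
      unfolding f by (intro sum.cong prod.cong arg_cong2[of _ _ _ _ "times"]) (simp_all add: ale_product_chart_def g)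
    ultimately show ?thesis unfolding ale_product_chart_image
      by (intro exI[of _ "\<lambda>x. \<Sum>j<m. c j * (\<Prod>i<k. g j i (x i))"] conjI) simp_all
  qed
  then show "\<exists>h. (ale_product_chart k n s ` coords k, h) \<in> ?B \<and> (\<forall>x\<in>coords k. h (ale_product_chart k n s x) = q x)"
    if "q \<in> polys k" for q using that by blast
  show "inj_on (ale_product_chart k n s) (coords k)"
  proof (rule inj_onI)
    fix x y assume xy: "x \<in> coords k" "y \<in> coords k" "ale_product_chart k n s x = ale_product_chart k n s y"
    then have "\<forall>i<k. x i = y i" using ale_product_chart_eq_iff[of k s n s x y] s cox_equiv_same_chart by blast
    then show "x = y" using xy(1,2) unfolding coords_def by (intro PiE_ext) auto
  qed
  have mor: "morphism (coord_space k) (ale_space (n i)) (\<lambda>x. ale_point (n i) (s i) (x i))" if "i < k" for i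
    by (rule ale_point_morphism[OF that s[OF that]])
  have *: "openin (zariski (coord_space k)) {x \<in> coords k. ale_product_chart k n s x \<in> W} \<and>
     regular (coord_space k) {x \<in> coords k. ale_product_chart k n s x \<in> W} (\<lambda>x. f (ale_product_chart k n s x))"
    if Wf: "(W, f) \<in> ?B" for W f
  proof -
    obtain U m c g where W: "W = PiE {..<k} U" "f = (\<lambda>x. \<Sum>j<(m::nat). c j * (\<Prod>i<k. g j i (x i)))"
      "\<forall>i<k. openin (zariski (ale_space (n i))) (U i)" "\<forall>j<m. \<forall>i<k. regular (ale_space (n i)) (U i) (g j i)"
      using Wf unfolding mem_Collect_eq prod.inject by iprover
    define V where "V i = {x \<in> coords k. ale_point (n i) (s i) (x i) \<in> U i}" for i
    have oV: "openin (zariski (coord_space k)) (V i)" if "i < k" for i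
      using morphism_openin[OF mor[OF that], of "U i"] W(3) that by (simp add: V_def)
    have rV: "regular (coord_space k) (V i) (\<lambda>x. g j i (ale_point (n i) (s i) (x i)))" if "i < k" "j < m" for i j
      using morphism_regular[OF mor[OF that(1)], of "U i" "g j i"] W(4) that by (simp add: V_def)
    define V0 where "V0 = {x \<in> coords k. ale_product_chart k n s x \<in> W}"
    \<comment> \<open>For \<open>k = 0\<close> the empty intersection would be the whole type
      instead of \<open>coords k\<close>.\<close>
    have V0: "V0 = (if k = 0 then coords k else (\<Inter>i\<in>{..<k}. V i))"
      unfolding V0_def V_def W(1) by (auto simp: ale_product_chart_def PiE_iff)
    have o0: "openin (zariski (coord_space k)) V0"
    proof (cases "k = 0")
      case True
      then show ?thesis using openin_topspace[of "zariski (coord_space k)"] by (simp add: V0)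
    next
      case False
      then show ?thesis unfolding V0 using oV by (auto intro!: openin_INT2)
    qed
    have sub: "V0 \<subseteq> V i" if "i < k" for i unfolding V0 using that by auto
    have "regular (coord_space k) V0 (\<lambda>x. \<Sum>j<m. c j * (\<Prod>i<k. g j i (ale_point (n i) (s i) (x i))))"
    proof (intro regular_coord_sum o0 regular_coord_mult regular_coord_const regular_coord_prod)
      fix j i assume "j \<in> {..<m}" "i \<in> {..<k}"
      then show "regular (coord_space k) V0 (\<lambda>x. g j i (ale_point (n i) (s i) (x i)))"
        using sheaf_restrict[OF sheaf_coord_space rV o0 sub] by auto
    qed
    moreover have "f (ale_product_chart k n s x) = (\<Sum>j<m. c j * (\<Prod>i<k. g j i (ale_point (n i) (s i) (x i))))" for x
      unfolding W(2) by (intro sum.cong prod.cong arg_cong2[of _ _ _ _ "times"]) (simp_all add: ale_product_chart_def)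
    ultimately show ?thesis using o0 unfolding V0_def by simp
  qed
  show "morphism (coord_space k) (generated_space ?B) (ale_product_chart k n s)"
  proof (rule morphism_coord_generated)
    fix x assume x: "x \<in> coords k"
    obtain h where h: "(ale_product_chart k n s ` coords k, h) \<in> ?B" "\<forall>x\<in>coords k. h (ale_product_chart k n s x) = 1"
      using polys[OF polys.const[of 1]] by (elim exE conjE) (rule that)
    have "ale_product_chart k n s x \<in> {y \<in> ale_product_chart k n s ` coords k. h y \<noteq> 0}" using h(2) x by simp
    then show "ale_product_chart k n s x \<in> points (generated_space ?B)"
      using openin_subset[OF openin_generated_basic[OF h(1)]] by blast
  qed (use * in blast)+
qed

theorem ale_product_atlas:
  "coord_atlas k (product_fspace k (\<lambda>i. ale_space (n i))) (PiE {..<k} (\<lambda>i. {1..n i})) (ale_product_chart k n)"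
  unfolding coord_atlas_def
proof (intro conjI ballI)
  fix s assume "s \<in> PiE {..<k} (\<lambda>i. {1..n i})"
  then show "coord_chart k (product_fspace k (\<lambda>i. ale_space (n i))) (ale_product_chart k n s)"
    by (intro ale_product_coord_chart) (auto simp: PiE_iff)
qed (rule points_ale_product)

lemma sheaf_product: "sheaf_of_functions (product_fspace k X)"
  unfolding product_fspace_def by (rule sheaf_generated)

section \<open>Homogeneous ideals of the section ring\<close>

definition eval_monomial :: "('v \<Rightarrow> complex) \<Rightarrow> ('v \<Rightarrow>\<^sub>0 nat) \<Rightarrow> complex" where
  "eval_monomial x m = (\<Prod>v\<in>Poly_Mapping.keys m. x v ^ Poly_Mapping.lookup m v)"

lemma eval_monomial_superset:
  assumes "finite S" "Poly_Mapping.keys m \<subseteq> S"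
  shows "eval_monomial x m = (\<Prod>v\<in>S. x v ^ Poly_Mapping.lookup m v)"
  unfolding eval_monomial_def by (rule prod.mono_neutral_left) (use assms in \<open>auto simp: in_keys_iff\<close>)

lemma eval_monomial_0 [simp]: "eval_monomial x 0 = 1"
  by (simp add: eval_monomial_def)

lemma eval_monomial_add: "eval_monomial x (m + m') = eval_monomial x m * eval_monomial x m'"
proof -
  let ?S = "Poly_Mapping.keys m \<union> Poly_Mapping.keys m'"
  have "eval_monomial x (m + m') = (\<Prod>v\<in>?S. x v ^ Poly_Mapping.lookup (m + m') v)"
    using Poly_Mapping.keys_add[of m m'] by (intro eval_monomial_superset) auto
  also have "\<dots> = (\<Prod>v\<in>?S. x v ^ Poly_Mapping.lookup m v) * (\<Prod>v\<in>?S. x v ^ Poly_Mapping.lookup m' v)"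
    by (simp add: lookup_add power_add prod.distrib)
  also have "\<dots> = eval_monomial x m * eval_monomial x m'"
    using eval_monomial_superset[of ?S m x] eval_monomial_superset[of ?S m' x] by simp
  finally show ?thesis .
qed

lemma eval_monomial_single: "eval_monomial x (Poly_Mapping.single v n) = x v ^ n"
  by (cases "n = 0") (simp_all add: eval_monomial_def)

lemma eval_monomial_mult: "eval_monomial (\<lambda>v. t v * x v) m = eval_monomial t m * eval_monomial x m"
  by (simp add: eval_monomial_def power_mult_distrib prod.distrib)

lemma eval_mpoly_superset:
  assumes "finite S" "Poly_Mapping.keys f \<subseteq> S"
  shows "eval_mpoly x f = (\<Sum>m\<in>S. Poly_Mapping.lookup f m * eval_monomial x m)"
  unfolding eval_mpoly_def eval_monomial_def[symmetric]
  by (rule sum.mono_neutral_left) (use assms in \<open>auto simp: in_keys_iff\<close>)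

lemma eval_mpoly_0 [simp]: "eval_mpoly x 0 = 0"
  by (simp add: eval_mpoly_def)

lemma eval_mpoly_add: "eval_mpoly x (f + g) = eval_mpoly x f + eval_mpoly x g"
proof -
  let ?S = "Poly_Mapping.keys f \<union> Poly_Mapping.keys g"
  have "eval_mpoly x (f + g) = (\<Sum>m\<in>?S. Poly_Mapping.lookup (f + g) m * eval_monomial x m)"
    using Poly_Mapping.keys_add[of f g] by (intro eval_mpoly_superset) auto
  also have "\<dots> = (\<Sum>m\<in>?S. Poly_Mapping.lookup f m * eval_monomial x m) + (\<Sum>m\<in>?S. Poly_Mapping.lookup g m * eval_monomial x m)"
    by (simp add: lookup_add distrib_right sum.distrib)
  also have "\<dots> = eval_mpoly x f + eval_mpoly x g"
    using eval_mpoly_superset[of ?S f x] eval_mpoly_superset[of ?S g x] by simp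
  finally show ?thesis .
qed

lemma eval_mpoly_single: "eval_mpoly x (Poly_Mapping.single m c) = c * eval_monomial x m"
  using eval_mpoly_superset[of "{m}" "Poly_Mapping.single m c" x] by simp

lemma mpoly_sum_monomials: "(\<Sum>m\<in>Poly_Mapping.keys f. Poly_Mapping.single m (Poly_Mapping.lookup f m)) = f"
  by (rule poly_mapping_eqI)
    (auto simp: lookup_sum lookup_single when_def sum.delta' in_keys_iff if_distrib cong: if_cong)

lemma mpoly_induct [case_names zero single add]:
  assumes "P 0" "\<And>m c. P (Poly_Mapping.single m c)" "\<And>f g. P f \<Longrightarrow> P g \<Longrightarrow> P (f + g)"
  shows "P (f :: 'v mpoly)"
proof -
  have "P (\<Sum>m\<in>S. Poly_Mapping.single m (Poly_Mapping.lookup f m))" for S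
    by (induction S rule: infinite_finite_induct) (use assms in auto)
  then show ?thesis using mpoly_sum_monomials[of f] by metis
qed

lemma eval_mpoly_mult: "eval_mpoly x (f * g) = eval_mpoly x f * eval_mpoly x g"
proof (induction f rule: mpoly_induct)
  case (single m c)
  show ?case
  proof (induction g rule: mpoly_induct)
    case (single m' c')
    then show ?case by (simp add: mult_single eval_mpoly_single eval_monomial_add)
  qed (simp_all add: eval_mpoly_add distrib_left)
qed (simp_all add: eval_mpoly_add distrib_right)

lemma eval_mpoly_const [simp]: "eval_mpoly x (const c) = c"
  by (simp add: const_def eval_mpoly_single)

lemma eval_mpoly_var [simp]: "eval_mpoly x (var v) = x v"
  by (simp add: var_def eval_mpoly_single eval_monomial_single)

lemma eval_mpoly_1 [simp]: "eval_mpoly x 1 = 1"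
  using eval_mpoly_single[of x 0 1] by simp

lemma eval_mpoly_uminus: "eval_mpoly x (- f) = - eval_mpoly x f"
  using eval_mpoly_add[of x f "- f"] by (simp add: eq_neg_iff_add_eq_0 add.commute)

lemma eval_mpoly_diff: "eval_mpoly x (f - g) = eval_mpoly x f - eval_mpoly x g"
  using eval_mpoly_add[of x f "- g"] by (simp add: eval_mpoly_uminus)

lemma eval_mpoly_sum: "eval_mpoly x (\<Sum>i\<in>I. f i) = (\<Sum>i\<in>I. eval_mpoly x (f i))"
  by (induction I rule: infinite_finite_induct) (simp_all add: eval_mpoly_add)

lemma const_mult_single: "const c * Poly_Mapping.single m d = Poly_Mapping.single m (c * d)"
  by (simp add: const_def mult_single)

lemma const_add: "const (c + d) = (const c + const d :: 'v mpoly)"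
  and const_diff: "const (c - d) = (const c - const d :: 'v mpoly)"
  and const_mult: "const (c * d) = (const c * const d :: 'v mpoly)"
  and const_0 [simp]: "const 0 = (0 :: 'v mpoly)" and const_1 [simp]: "const 1 = (1 :: 'v mpoly)"
  by (simp_all add: const_def single_add single_diff mult_single)

lemma lookup_rescale: "Poly_Mapping.lookup (rescale t f) m = Poly_Mapping.lookup f m * eval_monomial t m"
  unfolding rescale_def eval_monomial_def[symmetric]
  by (simp add: lookup_sum lookup_single when_def sum.delta' in_keys_iff)

lemma eval_rescale: "eval_mpoly x (rescale t f) = eval_mpoly (\<lambda>v. t v * x v) f"
proof -
  have "Poly_Mapping.keys (rescale t f) \<subseteq> Poly_Mapping.keys f" by (auto simp: in_keys_iff lookup_rescale)
  then have "eval_mpoly x (rescale t f) = (\<Sum>m\<in>Poly_Mapping.keys f. Poly_Mapping.lookup (rescale t f) m * eval_monomial x m)"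
    by (intro eval_mpoly_superset) auto
  also have "\<dots> = eval_mpoly (\<lambda>v. t v * x v) f"
    by (simp add: eval_mpoly_superset[OF _ subset_refl] lookup_rescale eval_monomial_mult mult_ac)
  finally show ?thesis .
qed

lemma rescale_0 [simp]: "rescale t 0 = 0"
  by (simp add: rescale_def)

section \<open>Graded pieces and the ring of sections\<close>

definition graded_keys :: "int mat \<Rightarrow> int vec \<Rightarrow> ((nat + nat) \<Rightarrow>\<^sub>0 nat) set" where
  "graded_keys A v = {m. Poly_Mapping.keys m \<subseteq> Inl ` {..<dim_col A} \<union> Inr ` {..<dim_col A} \<and> monomial_degree A m = v}"

lemma graded_piece_iff: "f \<in> graded_piece A v \<longleftrightarrow> Poly_Mapping.keys f \<subseteq> graded_keys A v"
  by (auto simp: graded_piece_def graded_keys_def)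

lemma graded_piece_single: "m \<in> graded_keys A v \<Longrightarrow> Poly_Mapping.single m c \<in> graded_piece A v"
  by (cases "c = 0") (auto simp: graded_piece_iff)

lemma graded_piece_0: "0 \<in> graded_piece A v"
  by (simp add: graded_piece_iff)

lemma graded_piece_add: "f \<in> graded_piece A v \<Longrightarrow> g \<in> graded_piece A v \<Longrightarrow> f + g \<in> graded_piece A v"
  using Poly_Mapping.keys_add[of f g] by (auto simp: graded_piece_iff)

lemma graded_piece_uminus: "f \<in> graded_piece A v \<Longrightarrow> - f \<in> graded_piece A v"
  by (auto simp: graded_piece_iff in_keys_iff)

lemma graded_piece_diff: "f \<in> graded_piece A v \<Longrightarrow> g \<in> graded_piece A v \<Longrightarrow> f - g \<in> graded_piece A v"
  using graded_piece_add[of f A v "- g"] graded_piece_uminus[of g A v] by simp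

lemma graded_piece_sum: "(\<And>i. i \<in> I \<Longrightarrow> f i \<in> graded_piece A v) \<Longrightarrow> (\<Sum>i\<in>I. f i) \<in> graded_piece A v"
  by (induction I rule: infinite_finite_induct) (auto intro: graded_piece_add graded_piece_0)

lemma graded_piece_rescale: "f \<in> graded_piece A v \<Longrightarrow> rescale t f \<in> graded_piece A v"
  by (auto simp: graded_piece_iff in_keys_iff lookup_rescale subset_iff)

lemma monomial_degree_add: "monomial_degree A (m + m') = monomial_degree A m + monomial_degree A m'"
  by (rule eq_vecI) (auto simp: monomial_degree_def lookup_add algebra_simps sum.distrib sum_subtractf)

lemma monomial_degree_dim [simp]: "monomial_degree A m \<in> carrier_vec (dim_row A)"
  by (simp add: monomial_degree_def)

definition sections :: "int mat \<Rightarrow> int vec \<Rightarrow> nat \<Rightarrow> zw_poly set" where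
  "sections A \<theta> r = graded_piece A (int r \<cdot>\<^sub>v \<theta>)"

definition section_keys :: "int mat \<Rightarrow> int vec \<Rightarrow> nat \<Rightarrow> ((nat + nat) \<Rightarrow>\<^sub>0 nat) set" where
  "section_keys A \<theta> r = graded_keys A (int r \<cdot>\<^sub>v \<theta>)"

lemma section_keys_add:
  assumes "\<theta> \<in> carrier_vec (dim_row A)" "m \<in> section_keys A \<theta> r" "m' \<in> section_keys A \<theta> s"
  shows "m + m' \<in> section_keys A \<theta> (r + s)"
proof -
  have "Poly_Mapping.keys (m + m') \<subseteq> Inl ` {..<dim_col A} \<union> Inr ` {..<dim_col A}"
    using Poly_Mapping.keys_add[of m m'] assms(2,3) by (auto simp: section_keys_def graded_keys_def)
  moreover have "monomial_degree A (m + m') = int (r + s) \<cdot>\<^sub>v \<theta>"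
    using assms unfolding monomial_degree_add
    by (auto simp: section_keys_def graded_keys_def add_smult_distrib_vec)
  ultimately show ?thesis by (simp add: section_keys_def graded_keys_def)
qed

lemma sections_iff: "f \<in> sections A \<theta> r \<longleftrightarrow> Poly_Mapping.keys f \<subseteq> section_keys A \<theta> r"
  by (simp add: sections_def section_keys_def graded_piece_iff)

lemma sections_single: "m \<in> section_keys A \<theta> r \<Longrightarrow> Poly_Mapping.single m c \<in> sections A \<theta> r"
  by (simp add: sections_def section_keys_def graded_piece_single)

lemma sections_mult:
  assumes "\<theta> \<in> carrier_vec (dim_row A)" "f \<in> sections A \<theta> r" "g \<in> sections A \<theta> s"
  shows "f * g \<in> sections A \<theta> (r + s)"
proof -
  have "Poly_Mapping.keys (f * g) \<subseteq> {a + b |a b. a \<in> Poly_Mapping.keys f \<and> b \<in> Poly_Mapping.keys g}"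
    by (rule Poly_Mapping.keys_mult)
  also have "\<dots> \<subseteq> section_keys A \<theta> (r + s)"
    using section_keys_add[OF assms(1)] assms(2,3) unfolding sections_iff by blast
  finally show ?thesis by (simp add: sections_iff)
qed

lemma zero_in_section_keys: "\<theta> \<in> carrier_vec (dim_row A) \<Longrightarrow> 0 \<in> section_keys A \<theta> 0"
  by (auto simp: section_keys_def graded_keys_def monomial_degree_def intro!: eq_vecI)

lemma sections_const: "\<theta> \<in> carrier_vec (dim_row A) \<Longrightarrow> const c \<in> sections A \<theta> 0"
  unfolding const_def by (intro sections_single zero_in_section_keys)

lemma sections_1: "\<theta> \<in> carrier_vec (dim_row A) \<Longrightarrow> 1 \<in> sections A \<theta> 0"
  using sections_const[of \<theta> A 1] by simp

lemma sections_power: "\<theta> \<in> carrier_vec (dim_row A) \<Longrightarrow> f \<in> sections A \<theta> r \<Longrightarrow> f ^ n \<in> sections A \<theta> (n * r)"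
  by (induction n) (auto intro: sections_1 sections_mult)

lemma sections_smult: "\<theta> \<in> carrier_vec (dim_row A) \<Longrightarrow> f \<in> sections A \<theta> r \<Longrightarrow> const c * f \<in> sections A \<theta> r"
  using sections_mult[OF _ sections_const, of \<theta> A f r c] by simp

lemmas sections_add = graded_piece_add[of _ A "int r \<cdot>\<^sub>v \<theta>" for A \<theta> r, folded sections_def]
lemmas sections_diff = graded_piece_diff[of _ A "int r \<cdot>\<^sub>v \<theta>" for A \<theta> r, folded sections_def]
lemmas sections_0 = graded_piece_0[of A "int r \<cdot>\<^sub>v \<theta>" for A \<theta> r, folded sections_def]
lemmas sections_uminus = graded_piece_uminus[of _ A "int r \<cdot>\<^sub>v \<theta>" for A \<theta> r, folded sections_def]
lemmas sections_sum = graded_piece_sum[of _ _ A "int r \<cdot>\<^sub>v \<theta>" for A \<theta> r, folded sections_def]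
lemmas sections_rescale = graded_piece_rescale[of _ A "int r \<cdot>\<^sub>v \<theta>" for A \<theta> r, folded sections_def]

lemma carrier_section_ring: "F \<in> carrier (section_ring A \<theta>) \<longleftrightarrow> (\<forall>r. coeff F r \<in> sections A \<theta> r)"
  by (simp add: section_ring_def sections_def)

lemma section_ring_simps [simp]:
  "mult (section_ring A \<theta>) = times" "one (section_ring A \<theta>) = 1"
  "zero (section_ring A \<theta>) = 0" "add (section_ring A \<theta>) = (+)"
  by (simp_all add: section_ring_def)

lemma monom_in_section_ring: "f \<in> sections A \<theta> r \<Longrightarrow> monom f r \<in> carrier (section_ring A \<theta>)"
  by (auto simp: carrier_section_ring coeff_monom intro: sections_0)

lemma section_ring_mult_closed:
  assumes "\<theta> \<in> carrier_vec (dim_row A)" "F \<in> carrier (section_ring A \<theta>)" "G \<in> carrier (section_ring A \<theta>)"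
  shows "F * G \<in> carrier (section_ring A \<theta>)"
  unfolding carrier_section_ring coeff_mult
proof (intro allI sections_sum)
  fix r i :: nat assume "i \<in> {..r}"
  then show "coeff F i * coeff G (r - i) \<in> sections A \<theta> r"
    using sections_mult[OF assms(1), of "coeff F i" i "coeff G (r - i)" "r - i"] assms(2,3)
    by (simp add: carrier_section_ring)
qed

lemma section_ring_add_closed:
  "F \<in> carrier (section_ring A \<theta>) \<Longrightarrow> G \<in> carrier (section_ring A \<theta>) \<Longrightarrow> F + G \<in> carrier (section_ring A \<theta>)"
  and section_ring_uminus_closed: "F \<in> carrier (section_ring A \<theta>) \<Longrightarrow> - F \<in> carrier (section_ring A \<theta>)"
  and section_ring_0_closed: "0 \<in> carrier (section_ring A \<theta>)"
  by (auto simp: carrier_section_ring intro: sections_add sections_uminus sections_0)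

lemma section_ring_1_closed: "\<theta> \<in> carrier_vec (dim_row A) \<Longrightarrow> 1 \<in> carrier (section_ring A \<theta>)"
  by (auto simp: carrier_section_ring coeff_1 intro: sections_1 sections_0)

lemma cring_section_ring:
  assumes "\<theta> \<in> carrier_vec (dim_row A)" shows "cring (section_ring A \<theta>)"
proof (rule cringI)
  show "abelian_group (section_ring A \<theta>)"
  proof (rule abelian_groupI)
    show "\<exists>y\<in>carrier (section_ring A \<theta>). y \<oplus>\<^bsub>section_ring A \<theta>\<^esub> x = \<zero>\<^bsub>section_ring A \<theta>\<^esub>"
      if "x \<in> carrier (section_ring A \<theta>)" for x
      using section_ring_uminus_closed[OF that] by (intro bexI[of _ "- x"]) simp_all
  qed (auto simp: section_ring_add_closed section_ring_0_closed add_ac)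
  show "comm_monoid (section_ring A \<theta>)"
    by (rule comm_monoidI) (auto simp: section_ring_mult_closed section_ring_1_closed assms mult_ac)
qed (auto simp: distrib_right)

section \<open>Values of sections at a point of Proj\<close>

definition hpart :: "zw_poly poly set \<Rightarrow> int mat \<Rightarrow> int vec \<Rightarrow> nat \<Rightarrow> zw_poly set" where
  "hpart p A \<theta> r = {f \<in> sections A \<theta> r. monom f r \<in> p}"

locale proj_point =
  fixes A :: "int mat" and \<theta> :: "int vec" and p :: "zw_poly poly set"
  assumes \<theta>: "\<theta> \<in> carrier_vec (dim_row A)" and p: "p \<in> proj_points A \<theta>"
begin

abbreviation "S \<equiv> sections A \<theta>"
abbreviation "H \<equiv> hpart p A \<theta>"

lemma prime: "primeideal p (section_ring A \<theta>)"
  using p by (simp add: proj_points_def)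

lemma p_carrier: "F \<in> p \<Longrightarrow> F \<in> carrier (section_ring A \<theta>)"
  using additive_subgroup.a_subset[OF ideal.axioms(1)[OF primeideal.axioms(1)[OF prime]]] by blast

lemma p_add: "F \<in> p \<Longrightarrow> G \<in> p \<Longrightarrow> F + G \<in> p"
  using additive_subgroup.a_closed[OF ideal.axioms(1)[OF primeideal.axioms(1)[OF prime]]] by simp

lemma p_mult: "F \<in> p \<Longrightarrow> G \<in> carrier (section_ring A \<theta>) \<Longrightarrow> G * F \<in> p"
  using ideal.I_l_closed[OF primeideal.axioms(1)[OF prime]] by simp

lemma p_prime: "F \<in> carrier (section_ring A \<theta>) \<Longrightarrow> G \<in> carrier (section_ring A \<theta>) \<Longrightarrow> F * G \<in> p \<Longrightarrow> F \<in> p \<or> G \<in> p"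
  using primeideal.I_prime[OF prime] by simp

lemma p_one: "1 \<notin> p"
proof
  assume "1 \<in> p"
  then have "carrier (section_ring A \<theta>) \<subseteq> p" using p_mult[of 1] by auto
  then show False using primeideal.I_notcarr[OF prime] p_carrier by blast
qed

lemma p_zero: "0 \<in> p"
  using additive_subgroup.zero_closed[OF ideal.axioms(1)[OF primeideal.axioms(1)[OF prime]]] by simp

lemma p_homogeneous: "F \<in> p \<Longrightarrow> monom (coeff F r) r \<in> p"
  using p by (simp add: proj_points_def)

lemma p_iff: "F \<in> p \<longleftrightarrow> (\<forall>r. coeff F r \<in> H r)"
proof
  assume "F \<in> p"
  then show "\<forall>r. coeff F r \<in> H r"
    using p_homogeneous p_carrier by (auto simp: hpart_def carrier_section_ring)
next
  assume r: "\<forall>r. coeff F r \<in> H r"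
  have "(\<Sum>r\<in>R. monom (coeff F r) r) \<in> p" for R
    by (induction R rule: infinite_finite_induct) (use r p_zero p_add in \<open>auto simp: hpart_def\<close>)
  then have "(\<Sum>r\<le>degree F. monom (coeff F r) r) \<in> p" by blast
  then show "F \<in> p" by (simp add: poly_as_sum_of_monoms)
qed

lemma H_sub: "f \<in> H r \<Longrightarrow> f \<in> S r" by (simp add: hpart_def)

lemma H_monom: "f \<in> S r \<Longrightarrow> f \<in> H r \<longleftrightarrow> monom f r \<in> p" by (simp add: hpart_def)

lemma H_0: "0 \<in> H r" by (simp add: hpart_def sections_0 p_zero)

lemma H_add: "f \<in> H r \<Longrightarrow> g \<in> H r \<Longrightarrow> f + g \<in> H r"
  using p_add by (auto simp: hpart_def sections_add add_monom[symmetric])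

lemma H_mult: "f \<in> H r \<Longrightarrow> g \<in> S s \<Longrightarrow> g * f \<in> H (s + r)"
  using p_mult[of "monom f r" "monom g s"] monom_in_section_ring[of g A \<theta> s] sections_mult[OF \<theta>, of g s f r]
  by (auto simp: hpart_def mult_monom)

lemma H_mult': "f \<in> H r \<Longrightarrow> g \<in> S s \<Longrightarrow> f * g \<in> H (r + s)"
  using H_mult[of f r g s] by (simp add: mult.commute add.commute)

lemma H_smult: "f \<in> H r \<Longrightarrow> const c * f \<in> H r"
  using H_mult[OF _ sections_const[OF \<theta>]] by fastforce

lemma H_uminus: "f \<in> H r \<Longrightarrow> - f \<in> H r"
proof -
  assume "f \<in> H r"
  then have "const (-1) * f \<in> H r" by (rule H_smult)
  moreover have "const (-1) * f = - f" using const_diff[of 0 1, where 'v = "nat + nat"] by simp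
  ultimately show ?thesis by simp
qed

lemma H_diff: "f \<in> H r \<Longrightarrow> g \<in> H r \<Longrightarrow> f - g \<in> H r"
  using H_add[of f r "- g"] H_uminus by simp

lemma H_sum: "(\<And>i. i \<in> I \<Longrightarrow> f i \<in> H r) \<Longrightarrow> (\<Sum>i\<in>I. f i) \<in> H r"
  by (induction I rule: infinite_finite_induct) (auto intro: H_add H_0)

lemma H_prime: "f \<in> S r \<Longrightarrow> g \<in> S s \<Longrightarrow> f * g \<in> H (r + s) \<Longrightarrow> f \<in> H r \<or> g \<in> H s"
  using p_prime[of "monom f r" "monom g s"] monom_in_section_ring
  by (auto simp: hpart_def mult_monom)

lemma H_one: "1 \<notin> H 0"
  using p_one by (simp add: hpart_def monom_0 flip: one_pCons)

lemma H_power: "f \<in> S r \<Longrightarrow> f ^ n \<in> H (n * r) \<Longrightarrow> f \<in> H r"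
proof (induction n)
  case 0 then show ?case using H_one by simp
next
  case (Suc n)
  then have "f * f ^ n \<in> H (r + n * r)" by simp
  from H_prime[OF Suc.prems(1) sections_power[OF \<theta> Suc.prems(1)] this] Suc show ?case by blast
qed

lemma semistable: "\<exists>r>0. \<exists>f\<in>S r. f \<notin> H r"
  using p by (auto simp: proj_points_def sections_def hpart_def)

lemma residue: "f \<in> S r \<Longrightarrow> g \<in> S r \<Longrightarrow> g \<notin> H r \<Longrightarrow> \<exists>c. f - const c * g \<in> H r"
  using p sections_diff sections_smult[OF \<theta>] by (fastforce simp: proj_points_def sections_def hpart_def)

lemma residue_unique:
  assumes "g \<in> S r" "g \<notin> H r" "f - const c * g \<in> H r" "f - const d * g \<in> H r"
  shows "c = d"
proof (rule ccontr)
  assume "c \<noteq> d"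
  have "(f - const d * g) - (f - const c * g) \<in> H r" by (rule H_diff[OF assms(4,3)])
  then have "const (c - d) * g \<in> H r" by (simp add: const_diff algebra_simps)
  from H_smult[OF this, of "1 / (c - d)"] \<open>c \<noteq> d\<close> have "const 1 * g \<in> H r"
    by (simp add: mult.assoc[symmetric] const_mult[symmetric])
  then show False using assms by simp
qed

text \<open>The class of the fraction \<open>f / g\<close> in the residue field \<complex> at
  \<open>p\<close>; meaningful for sections \<open>f\<close>, \<open>g\<close> of degree
  \<open>r\<close> with \<open>g\<close> outside \<open>p\<close>.\<close>

definition val :: "nat \<Rightarrow> zw_poly \<Rightarrow> zw_poly \<Rightarrow> complex" where
  "val r g f = (THE c. f - const c * g \<in> H r)"

lemma val_iff:
  assumes "g \<in> S r" "g \<notin> H r" "f \<in> S r"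
  shows "val r g f = c \<longleftrightarrow> f - const c * g \<in> H r"
proof -
  obtain d where d: "f - const d * g \<in> H r" using residue assms by blast
  have "val r g f = d" unfolding val_def using residue_unique[OF assms(1,2) _ d] d by blast
  then show ?thesis using residue_unique[OF assms(1,2) _ d] d by blast
qed

lemma val_self: "g \<in> S r \<Longrightarrow> g \<notin> H r \<Longrightarrow> val r g g = 1"
  by (subst val_iff) (auto simp: H_0)

lemma val_add:
  assumes "g \<in> S r" "g \<notin> H r" "f \<in> S r" "f' \<in> S r"
  shows "val r g (f + f') = val r g f + val r g f'"
proof -
  have "f - const (val r g f) * g \<in> H r" "f' - const (val r g f') * g \<in> H r"
    using val_iff[OF assms(1,2)] assms by blast+
  from H_add[OF this] show ?thesis
    using assms by (subst val_iff) (auto simp: sections_add const_add algebra_simps)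
qed

lemma val_smult:
  assumes "g \<in> S r" "g \<notin> H r" "f \<in> S r"
  shows "val r g (const c * f) = c * val r g f"
proof -
  have "f - const (val r g f) * g \<in> H r" using val_iff[OF assms(1,2)] assms by blast
  from H_smult[OF this, of c] show ?thesis
    using assms by (subst val_iff) (simp_all add: sections_smult[OF \<theta>], simp add: const_mult algebra_simps)
qed

lemma val_mult:
  assumes "g \<in> S r" "g \<notin> H r" "g' \<in> S s" "g' \<notin> H s" "f \<in> S r" "f' \<in> S s"
  shows "val (r + s) (g * g') (f * f') = val r g f * val s g' f'"
proof -
  have 1: "f - const (val r g f) * g \<in> H r" "f' - const (val s g' f') * g' \<in> H s"
    using val_iff[OF assms(1,2)] val_iff[OF assms(3,4)] assms by blast+
  have "(f - const (val r g f) * g) * f' + (const (val r g f) * g) * (f' - const (val s g' f') * g') \<in> H (r + s)"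
    using 1 assms by (intro H_add H_mult' H_mult sections_smult \<theta>)
  moreover have "g * g' \<notin> H (r + s)" using H_prime assms by blast
  ultimately show ?thesis
    using assms by (subst val_iff) (auto simp: sections_mult[OF \<theta>] const_mult algebra_simps)
qed

lemma val_eq_0_iff: "g \<in> S r \<Longrightarrow> g \<notin> H r \<Longrightarrow> f \<in> S r \<Longrightarrow> val r g f = 0 \<longleftrightarrow> f \<in> H r"
  by (subst val_iff) auto

lemma val_sum:
  assumes "g \<in> S r" "g \<notin> H r" "\<And>i. i \<in> I \<Longrightarrow> f i \<in> S r"
  shows "val r g (\<Sum>i\<in>I. f i) = (\<Sum>i\<in>I. val r g (f i))"
  using assms(3)
proof (induction I rule: infinite_finite_induct)
  case (insert i I)
  then show ?case using val_add[OF assms(1,2), of "f i" "\<Sum>i\<in>I. f i"] by (simp add: sections_sum)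
qed (use assms val_eq_0_iff H_0 sections_0 in auto)

end

text \<open>The image of a point \<open>x\<close> of affine space under the quotient map to Proj, if
  \<open>x\<close> is semistable.\<close>

definition point_ideal :: "int mat \<Rightarrow> int vec \<Rightarrow> (nat + nat \<Rightarrow> complex) \<Rightarrow> zw_poly poly set" where
  "point_ideal A \<theta> x = {F \<in> carrier (section_ring A \<theta>). \<forall>r. eval_mpoly x (coeff F r) = 0}"

lemma monom_point_ideal: "f \<in> sections A \<theta> r \<Longrightarrow> monom f r \<in> point_ideal A \<theta> x \<longleftrightarrow> eval_mpoly x f = 0"
  by (auto simp: point_ideal_def monom_in_section_ring coeff_monom)

lemma hpart_point_ideal: "hpart (point_ideal A \<theta> x) A \<theta> r = {f \<in> sections A \<theta> r. eval_mpoly x f = 0}"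
  by (auto simp: hpart_def monom_point_ideal)

text \<open>The kernel of evaluation at \<open>x\<close> with values in the polynomials in one
  variable over \<complex>, an integral domain; the variable keeps the degrees apart.\<close>

lemma primeideal_point_ideal:
  assumes \<theta>: "\<theta> \<in> carrier_vec (dim_row A)"
  shows "primeideal (point_ideal A \<theta> x) (section_ring A \<theta>)"
proof -
  define E where "E F = map_poly (eval_mpoly x) F" for F :: "zw_poly poly"
  have cE: "coeff (E F) r = eval_mpoly x (coeff F r)" for F r by (simp add: E_def coeff_map_poly)
  have mem: "F \<in> point_ideal A \<theta> x \<longleftrightarrow> F \<in> carrier (section_ring A \<theta>) \<and> E F = 0" for F
    by (auto simp: point_ideal_def poly_eq_iff cE)
  have Emult: "E (F * G) = E F * E G" for F G
    by (simp add: poly_eq_iff cE coeff_mult eval_mpoly_sum eval_mpoly_mult)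
  have Eadd: "E (F + G) = E F + E G" for F G by (simp add: poly_eq_iff cE eval_mpoly_add)
  have E1: "E 1 = 1" by (simp add: poly_eq_iff cE coeff_1)
  show ?thesis
  proof (rule primeidealI2)
    show "additive_subgroup (point_ideal A \<theta> x) (section_ring A \<theta>)"
    proof (rule additive_subgroupI)
      interpret cring "section_ring A \<theta>" by (rule cring_section_ring[OF \<theta>])
      show "subgroup (point_ideal A \<theta> x) (add_monoid (section_ring A \<theta>))"
      proof (rule add.subgroupI)
        show "point_ideal A \<theta> x \<subseteq> carrier (section_ring A \<theta>)" by (auto simp: point_ideal_def)
        have "0 \<in> point_ideal A \<theta> x" by (simp add: mem section_ring_0_closed E_def)
        then show "point_ideal A \<theta> x \<noteq> {}" by blast
        show "\<ominus>\<^bsub>section_ring A \<theta>\<^esub> F \<in> point_ideal A \<theta> x" if "F \<in> point_ideal A \<theta> x" for F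
        proof -
          have c: "F \<in> carrier (section_ring A \<theta>)" using that by (simp add: mem)
          have "\<ominus>\<^bsub>section_ring A \<theta>\<^esub> F = - F"
            by (rule minus_equality) (use c section_ring_uminus_closed in auto)
          moreover have "E F + E (- F) = 0" using Eadd[of F "- F"] by (simp add: E_def)
          ultimately show ?thesis using that c section_ring_uminus_closed by (simp add: mem)
        qed
        show "F \<oplus>\<^bsub>section_ring A \<theta>\<^esub> G \<in> point_ideal A \<theta> x"
          if "F \<in> point_ideal A \<theta> x" "G \<in> point_ideal A \<theta> x" for F G
          using that by (simp add: mem Eadd section_ring_add_closed)
      qed
    qed
    show "cring (section_ring A \<theta>)" by (rule cring_section_ring[OF \<theta>])
    have "1 \<in> carrier (section_ring A \<theta>)" "1 \<notin> point_ideal A \<theta> x"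
      using section_ring_1_closed[OF \<theta>] by (simp_all add: mem E1)
    then show "carrier (section_ring A \<theta>) \<noteq> point_ideal A \<theta> x" by blast
  qed (auto simp: mem Emult section_ring_mult_closed[OF \<theta>])
qed

text \<open>The hypothesis on \<open>f\<close> is semistability of \<open>x\<close>. Residues are
  quotients of values at \<open>x\<close>, so the residue field is \<complex>.\<close>

lemma point_ideal_in_proj:
  assumes \<theta>: "\<theta> \<in> carrier_vec (dim_row A)" and "r > 0" "f \<in> sections A \<theta> r" "eval_mpoly x f \<noteq> 0"
  shows "point_ideal A \<theta> x \<in> proj_points A \<theta>"
proof -
  have "\<exists>c. monom (f - const c * g) r \<in> point_ideal A \<theta> x"
    if "f \<in> sections A \<theta> r" "g \<in> sections A \<theta> r" "monom g r \<notin> point_ideal A \<theta> x" for r f g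
  proof -
    have "f - const (eval_mpoly x f / eval_mpoly x g) * g \<in> sections A \<theta> r"
      using that by (intro sections_diff sections_smult \<theta>)
    moreover have "eval_mpoly x g \<noteq> 0" using that monom_point_ideal by blast
    ultimately show ?thesis
      by (intro exI[of _ "eval_mpoly x f / eval_mpoly x g"]) (simp add: monom_point_ideal eval_mpoly_diff eval_mpoly_mult)
  qed
  moreover have "\<forall>F\<in>point_ideal A \<theta> x. \<forall>r. monom (coeff F r) r \<in> point_ideal A \<theta> x"
    by (auto simp: point_ideal_def monom_in_section_ring carrier_section_ring coeff_monom sections_0)
  moreover have "\<exists>r>0. \<exists>f\<in>sections A \<theta> r. monom f r \<notin> point_ideal A \<theta> x"
    using assms monom_point_ideal by blast
  ultimately show ?thesis
    unfolding proj_points_def sections_def[symmetric] using primeideal_point_ideal[OF \<theta>] by blast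
qed

text \<open>Where \<open>g\<close> is nonzero, a point of Proj is known from the values of the
  monomials divided by powers of \<open>g\<close>; it suffices to match these with evaluation at
  \<open>x\<close>.\<close>

lemma (in proj_point) eq_point_ideal:
  assumes g: "g \<in> S 1" "g \<notin> H 1"
    and val: "\<And>r m. m \<in> section_keys A \<theta> r \<Longrightarrow> val r (g ^ r) (Poly_Mapping.single m 1) = eval_monomial x m"
  shows "p = point_ideal A \<theta> x"
proof -
  have gr: "g ^ r \<in> S r" "g ^ r \<notin> H r" for r
    using sections_power[OF \<theta> g(1), of r] H_power[OF g(1), of r] g(2) by auto
  have "val r (g ^ r) f = eval_mpoly x f" if f: "f \<in> S r" for f r
  proof -
    have k: "m \<in> section_keys A \<theta> r" if "m \<in> Poly_Mapping.keys f" for m using f that by (auto simp: sections_iff)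
    have "val r (g ^ r) f = val r (g ^ r) (\<Sum>m\<in>Poly_Mapping.keys f. const (Poly_Mapping.lookup f m) * Poly_Mapping.single m 1)"
      by (simp add: const_mult_single mpoly_sum_monomials)
    also have "\<dots> = (\<Sum>m\<in>Poly_Mapping.keys f. val r (g ^ r) (const (Poly_Mapping.lookup f m) * Poly_Mapping.single m 1))"
      by (rule val_sum[OF gr]) (simp add: const_mult_single sections_single k)
    also have "\<dots> = (\<Sum>m\<in>Poly_Mapping.keys f. Poly_Mapping.lookup f m * eval_monomial x m)"
      by (rule sum.cong) (simp_all add: val_smult[OF gr] sections_single k val)
    also have "\<dots> = eval_mpoly x f" by (simp add: eval_mpoly_superset[OF _ subset_refl])
    finally show ?thesis .
  qed
  then have "f \<in> H r \<longleftrightarrow> f \<in> S r \<and> eval_mpoly x f = 0" for f r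
    using val_eq_0_iff[OF gr] H_sub by metis
  then show ?thesis using p_iff unfolding point_ideal_def carrier_section_ring by blast
qed

lemma torus_map_point_ideal:
  "torus_map A \<theta> t (point_ideal A \<theta> x) = point_ideal A \<theta> (\<lambda>v. t v * x v)"
  by (auto simp: torus_map_def point_ideal_def carrier_section_ring coeff_map_poly eval_rescale sections_rescale)

section \<open>The Lawrence toric variety\<close>

definition lawrence_basis :: "int mat \<Rightarrow> int vec \<Rightarrow> (zw_poly poly set set \<times> (zw_poly poly set \<Rightarrow> complex)) set" where
  "lawrence_basis A \<theta> = {({p \<in> proj_points A \<theta>. monom g r \<notin> p}, h) |r f g h.
        f \<in> sections A \<theta> r \<and> g \<in> sections A \<theta> r \<and>
        (\<forall>p \<in> proj_points A \<theta>. monom g r \<notin> p \<longrightarrow> monom (f - const (h p) * g) r \<in> p)}"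

lemma lawrence_generated: "lawrence_variety A \<theta> = generated_space (lawrence_basis A \<theta>)"
  by (simp add: lawrence_variety_def lawrence_basis_def sections_def)

lemma lawrence_basisE:
  assumes "(W, h) \<in> lawrence_basis A \<theta>"
  obtains r f g where "f \<in> sections A \<theta> r" "g \<in> sections A \<theta> r" "W = {p \<in> proj_points A \<theta>. monom g r \<notin> p}"
    "\<And>p. p \<in> W \<Longrightarrow> monom (f - const (h p) * g) r \<in> p"
proof -
  obtain r f g where *: "f \<in> sections A \<theta> r" "g \<in> sections A \<theta> r" "W = {p \<in> proj_points A \<theta>. monom g r \<notin> p}"
    "\<forall>p \<in> proj_points A \<theta>. monom g r \<notin> p \<longrightarrow> monom (f - const (h p) * g) r \<in> p"
    using assms unfolding lawrence_basis_def mem_Collect_eq prod.inject by iprover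
  show ?thesis by (rule that[OF *(1-3)]) (use *(3,4) in auto)
qed

lemma lawrence_basisI:
  assumes "f \<in> sections A \<theta> r" "g \<in> sections A \<theta> r" "W = {p \<in> proj_points A \<theta>. monom g r \<notin> p}"
    "\<And>p. p \<in> W \<Longrightarrow> monom (f - const (h p) * g) r \<in> p"
  shows "(W, h) \<in> lawrence_basis A \<theta>"
proof -
  have "\<forall>p \<in> proj_points A \<theta>. monom g r \<notin> p \<longrightarrow> monom (f - const (h p) * g) r \<in> p"
    using assms(3,4) by blast
  then show ?thesis unfolding lawrence_basis_def mem_Collect_eq
    using assms(1-3) by (intro exI[of _ r] exI[of _ f] exI[of _ g] exI[of _ h] conjI) simp_all
qed

context
  fixes A :: "int mat" and \<theta> :: "int vec"
  assumes \<theta>: "\<theta> \<in> carrier_vec (dim_row A)"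
begin

lemma proj_pointI: "p \<in> proj_points A \<theta> \<Longrightarrow> proj_point A \<theta> p"
  using \<theta> by (simp add: proj_point_def)

text \<open>Fractions are brought to the common denominator \<open>g * g'\<close>. The first claim
  is the hypothesis of \<open>induced_generated\<close>; sums and products serve to write
  polynomials in chart coordinates as basic functions.\<close>

lemma lawrence_combine:
  assumes "(W, h) \<in> lawrence_basis A \<theta>" "(W', h') \<in> lawrence_basis A \<theta>"
  shows "(W \<inter> W', h) \<in> lawrence_basis A \<theta>" "(W \<inter> W', \<lambda>p. h p + h' p) \<in> lawrence_basis A \<theta>"
    "(W \<inter> W', \<lambda>p. h p * h' p) \<in> lawrence_basis A \<theta>"
proof -
  obtain r f g where 1: "f \<in> sections A \<theta> r" "g \<in> sections A \<theta> r" "W = {p \<in> proj_points A \<theta>. monom g r \<notin> p}"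
    "\<And>p. p \<in> W \<Longrightarrow> monom (f - const (h p) * g) r \<in> p"
    by (rule lawrence_basisE[OF assms(1)], rule that)
  obtain s f' g' where 2: "f' \<in> sections A \<theta> s" "g' \<in> sections A \<theta> s" "W' = {p \<in> proj_points A \<theta>. monom g' s \<notin> p}"
    "\<And>p. p \<in> W' \<Longrightarrow> monom (f' - const (h' p) * g') s \<in> p"
    by (rule lawrence_basisE[OF assms(2)], rule that)
  have gg: "g * g' \<in> sections A \<theta> (r + s)" by (rule sections_mult[OF \<theta> 1(2) 2(2)])
  have fg: "f * g' \<in> sections A \<theta> (r + s)" by (rule sections_mult[OF \<theta> 1(1) 2(2)])
  have gf: "g * f' \<in> sections A \<theta> (r + s)" by (rule sections_mult[OF \<theta> 1(2) 2(1)])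
  have ff: "f * f' \<in> sections A \<theta> (r + s)" by (rule sections_mult[OF \<theta> 1(1) 2(1)])
  have W: "W \<inter> W' = {p \<in> proj_points A \<theta>. monom (g * g') (r + s) \<notin> p}"
  proof -
    have "monom (g * g') (r + s) \<in> p \<longleftrightarrow> monom g r \<in> p \<or> monom g' s \<in> p" if "p \<in> proj_points A \<theta>" for p
    proof -
      interpret proj_point A \<theta> p by (rule proj_pointI[OF that])
      show ?thesis using H_prime[OF 1(2) 2(2)] H_mult[of g' s g r] H_mult'[of g r g' s] H_monom 1(2) 2(2) gg by metis
    qed
    then show ?thesis unfolding 1(3) 2(3) by blast
  qed
  have key: "monom (f * g' - const (h p) * (g * g')) (r + s) \<in> p"
     "monom (g * f' - const (h' p) * (g * g')) (r + s) \<in> p"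
     "monom (f * f' - const (h p * h' p) * (g * g')) (r + s) \<in> p" if "p \<in> W \<inter> W'" for p
  proof -
    have p: "p \<in> proj_points A \<theta>" using that 1(3) by blast
    interpret proj_point A \<theta> p by (rule proj_pointI[OF p])
    have a: "f - const (h p) * g \<in> H r" "f' - const (h' p) * g' \<in> H s"
      using that 1 2 by (auto simp: H_monom sections_diff sections_smult[OF \<theta>])
    have "(f - const (h p) * g) * g' \<in> H (r + s)" by (rule H_mult'[OF a(1) 2(2)])
    then show b: "monom (f * g' - const (h p) * (g * g')) (r + s) \<in> p"
      by (simp add: hpart_def algebra_simps)
    have "g * (f' - const (h' p) * g') \<in> H (r + s)" by (rule H_mult[OF a(2) 1(2)])
    then show "monom (g * f' - const (h' p) * (g * g')) (r + s) \<in> p"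
      by (simp add: hpart_def algebra_simps)
    have "(f - const (h p) * g) * f' + (const (h p) * g) * (f' - const (h' p) * g') \<in> H (r + s)"
      using a 1 2 by (intro H_add H_mult' H_mult sections_smult \<theta>)
    then show "monom (f * f' - const (h p * h' p) * (g * g')) (r + s) \<in> p"
      by (simp add: hpart_def algebra_simps const_mult)
  qed
  show "(W \<inter> W', h) \<in> lawrence_basis A \<theta>"
    by (rule lawrence_basisI[OF fg gg W key(1)])
  show "(W \<inter> W', \<lambda>p. h p * h' p) \<in> lawrence_basis A \<theta>"
    by (rule lawrence_basisI[OF ff gg W key(3)])
  show "(W \<inter> W', \<lambda>p. h p + h' p) \<in> lawrence_basis A \<theta>"
  proof (rule lawrence_basisI[OF sections_add[OF fg gf] gg W])
    fix p assume pW: "p \<in> W \<inter> W'"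
    have p: "p \<in> proj_points A \<theta>" using pW 1(3) by blast
    interpret proj_point A \<theta> p by (rule proj_pointI[OF p])
    from p_add[OF key(1)[OF pW] key(2)[OF pW]]
    show "monom (f * g' + g * f' - const (h p + h' p) * (g * g')) (r + s) \<in> p"
      by (simp add: add_monom const_add algebra_simps)
  qed
qed

lemma lawrence_basis_val:
  assumes "f \<in> sections A \<theta> r" "g \<in> sections A \<theta> r"
  shows "({p \<in> proj_points A \<theta>. monom g r \<notin> p}, \<lambda>p. proj_point.val A \<theta> p r g f) \<in> lawrence_basis A \<theta>"
proof (rule lawrence_basisI[OF assms refl])
  fix p assume "p \<in> {p \<in> proj_points A \<theta>. monom g r \<notin> p}"
  then have pp: "p \<in> proj_points A \<theta>" "monom g r \<notin> p" by auto
  interpret proj_point A \<theta> p by (rule proj_pointI[OF pp(1)])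
  have "g \<notin> H r" using pp(2) by (simp add: hpart_def)
  then have "f - const (val r g f) * g \<in> H r" using val_iff[OF assms(2) _ assms(1)] by blast
  then show "monom (f - const (val r g f) * g) r \<in> p" by (simp add: hpart_def)
qed

lemma lawrence_basis_all: "(proj_points A \<theta>, \<lambda>_. c) \<in> lawrence_basis A \<theta>"
proof (rule lawrence_basisI[OF sections_const[OF \<theta>, of c] sections_1[OF \<theta>]])
  have "monom 1 0 \<notin> p" if "p \<in> proj_points A \<theta>" for p
    using proj_point.p_one[OF proj_pointI[OF that]] by (simp add: monom_0 flip: one_pCons)
  then show "proj_points A \<theta> = {p \<in> proj_points A \<theta>. monom 1 0 \<notin> p}" by blast
  show "monom (const c - const c * 1) 0 \<in> p" if "p \<in> proj_points A \<theta>" for p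
    using proj_point.p_zero[OF proj_pointI[OF that]] by simp
qed

lemma points_lawrence: "points (lawrence_variety A \<theta>) = proj_points A \<theta>"
proof
  show "points (lawrence_variety A \<theta>) \<subseteq> proj_points A \<theta>"
    unfolding lawrence_generated points_generated by (auto elim!: lawrence_basisE)
  show "proj_points A \<theta> \<subseteq> points (lawrence_variety A \<theta>)"
    using openin_subset[OF openin_generated_basic[OF lawrence_basis_all[of 1]]] by (simp add: lawrence_generated)
qed

lemma hyperkaehler_generated:
  "toric_hyperkaehler A \<theta> = generated_space {(W \<inter> hk_points A \<theta>, f) |W f. (W, f) \<in> lawrence_basis A \<theta>}"
  unfolding toric_hyperkaehler_def lawrence_generated
  by (rule induced_generated) (rule lawrence_combine(1))

lemma openin_lawrence_nonzero:
  assumes "f \<in> sections A \<theta> 0"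
  shows "openin (zariski (lawrence_variety A \<theta>)) {p \<in> proj_points A \<theta>. monom f 0 \<notin> p}"
proof -
  have one: "monom 1 0 \<notin> p" if "p \<in> proj_points A \<theta>" for p
    using proj_point.p_one[OF proj_pointI[OF that]] by (simp add: monom_0 flip: one_pCons)
  have "{p \<in> {p \<in> proj_points A \<theta>. monom 1 0 \<notin> p}. proj_point.val A \<theta> p 0 1 f \<noteq> 0} =
    {p \<in> proj_points A \<theta>. monom f 0 \<notin> p}"
  proof -
    have "proj_point.val A \<theta> p 0 1 f = 0 \<longleftrightarrow> monom f 0 \<in> p" if "p \<in> proj_points A \<theta>" for p
    proof -
      interpret proj_point A \<theta> p by (rule proj_pointI[OF that])
      show ?thesis using val_eq_0_iff[OF sections_1[OF \<theta>] H_one assms] H_monom[OF assms] by blast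
    qed
    then show ?thesis using one by blast
  qed
  then show ?thesis
    using openin_generated_basic[OF lawrence_basis_val[OF assms sections_1[OF \<theta>]]] by (simp add: lawrence_generated)
qed

section \<open>The hyperkaehler equations and the functions
  \<open>z\<^sub>i w\<^sub>i\<close>\<close>

definition moment :: "nat \<Rightarrow> zw_poly" where
  "moment j = (\<Sum>i<dim_col A. const (of_int (A $$ (j, i))) * var (Inl i) * var (Inr i))"

lemma zw_eq_single: "var v * var w = Poly_Mapping.single (Poly_Mapping.single v 1 + Poly_Mapping.single w 1) 1"
  by (simp add: var_def mult_single)

lemma zw_key: "i < dim_col A \<Longrightarrow> Poly_Mapping.single (Inl i) 1 + Poly_Mapping.single (Inr i) 1 \<in> section_keys A \<theta> 0"
proof -
  assume i: "i < dim_col A"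
  have "Poly_Mapping.keys (Poly_Mapping.single (Inl i) (1::nat) + Poly_Mapping.single (Inr i) 1) \<subseteq> {Inl i, Inr i}"
    using Poly_Mapping.keys_add[of "Poly_Mapping.single (Inl i) (1::nat)" "Poly_Mapping.single (Inr i) 1"] by auto
  moreover have "monomial_degree A (Poly_Mapping.single (Inl i) 1 + Poly_Mapping.single (Inr i) 1) = int 0 \<cdot>\<^sub>v \<theta>"
    using \<theta> by (intro eq_vecI) (auto simp: monomial_degree_def lookup_add lookup_single when_def)
  ultimately show ?thesis using i by (auto simp: section_keys_def graded_keys_def)
qed

lemma zw_section: "i < dim_col A \<Longrightarrow> var (Inl i) * var (Inr i) \<in> sections A \<theta> 0"
  unfolding zw_eq_single by (intro sections_single zw_key)

lemma moment_section: "moment j \<in> sections A \<theta> 0"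
  unfolding moment_def mult.assoc by (intro sections_sum sections_smult \<theta> zw_section) simp

lemma hk_points_iff: "p \<in> hk_points A \<theta> \<longleftrightarrow> p \<in> proj_points A \<theta> \<and> (\<forall>j<dim_row A. moment j \<in> hpart p A \<theta> 0)"
  by (auto simp: hk_points_def moment_def[symmetric] hpart_def moment_section)

lemma closedin_hk_points: "closedin (zariski (lawrence_variety A \<theta>)) (hk_points A \<theta>)"
proof -
  have "proj_points A \<theta> - hk_points A \<theta> = (\<Union>j<dim_row A. {p \<in> proj_points A \<theta>. monom (moment j) 0 \<notin> p})"
    unfolding set_eq_iff by (auto simp: hk_points_iff hpart_def moment_section)
  moreover have "openin (zariski (lawrence_variety A \<theta>)) (\<Union>j<dim_row A. {p \<in> proj_points A \<theta>. monom (moment j) 0 \<notin> p})"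
    by (intro openin_Union) (auto intro: openin_lawrence_nonzero moment_section)
  ultimately show ?thesis unfolding closedin_def points_lawrence by (auto simp: hk_points_iff)
qed

text \<open>\<open>z\<^sub>i w\<^sub>i\<close> has degree 0, so 1 can serve as denominator and the
  value exists at every point of X.\<close>

definition zw_val :: "zw_poly poly set \<Rightarrow> nat \<Rightarrow> complex" where
  "zw_val p i = proj_point.val A \<theta> p 0 1 (var (Inl i) * var (Inr i))"

lemma val_linear:
  assumes p: "p \<in> proj_points A \<theta>"
  shows "proj_point.val A \<theta> p 0 1 (\<Sum>i<dim_col A. const (a i) * var (Inl i) * var (Inr i)) = (\<Sum>i<dim_col A. a i * zw_val p i)"
proof -
  interpret proj_point A \<theta> p by (rule proj_pointI[OF p])
  show ?thesis unfolding zw_val_def mult.assoc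
    by (subst val_sum[OF sections_1[OF \<theta>] H_one])
      (simp_all add: sections_smult[OF \<theta>] zw_section val_smult[OF sections_1[OF \<theta>] H_one])
qed

text \<open>The equations are linear in the \<open>z\<^sub>i w\<^sub>i\<close>: Y is the preimage of
  the complex kernel of \<open>A\<close> under the vector of these functions. This is the bridge
  from geometry to linear algebra.\<close>

lemma hk_points_zw_val:
  "p \<in> hk_points A \<theta> \<longleftrightarrow> p \<in> proj_points A \<theta> \<and>
     (\<forall>j<dim_row A. (\<Sum>i<dim_col A. of_int (A $$ (j, i)) * zw_val p i) = 0)"
proof -
  have "moment j \<in> hpart p A \<theta> 0 \<longleftrightarrow> (\<Sum>i<dim_col A. of_int (A $$ (j, i)) * zw_val p i) = 0"
    if "p \<in> proj_points A \<theta>" for j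
  proof -
    interpret proj_point A \<theta> p by (rule proj_pointI[OF that])
    show ?thesis using val_eq_0_iff[OF sections_1[OF \<theta>] H_one moment_section, of j]
      unfolding moment_def val_linear[OF that] by simp
  qed
  then show ?thesis unfolding hk_points_iff by blast
qed

lemma zw_val_point_ideal:
  assumes "point_ideal A \<theta> x \<in> proj_points A \<theta>" "i < dim_col A"
  shows "zw_val (point_ideal A \<theta> x) i = x (Inl i) * x (Inr i)"
proof -
  interpret proj_point A \<theta> "point_ideal A \<theta> x" by (rule proj_pointI[OF assms(1)])
  show ?thesis unfolding zw_val_def
    by (subst val_iff[OF sections_1[OF \<theta>] H_one zw_section[OF assms(2)]])
      (simp add: hpart_point_ideal sections_diff zw_section[OF assms(2)] sections_const[OF \<theta>] eval_mpoly_diff eval_mpoly_mult)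
qed

end

section \<open>Matrices whose kernel is spanned by vectors with disjoint supports\<close>

text \<open>The columns fall into \<open>k\<close> classes; \<open>ix c l\<close> is the \<open>l\<close>-th column of the class \<open>c\<close>, and the kernel is spanned by
  the sign vectors \<open>\<epsilon>\<close> of the classes.  Each class is ordered by the values of \<open>\<epsilon> u\<close>, where \<open>A u = \<theta>\<close>; that these
  are distinct is the genericity of \<open>\<theta>\<close>.\<close>

locale circuit_matrix =
  fixes A :: "int mat" and \<theta> :: "int vec" and k :: nat and N :: "nat \<Rightarrow> nat"
    and ix :: "nat \<Rightarrow> nat \<Rightarrow> nat" and \<epsilon> u :: "nat \<Rightarrow> int"
  assumes ix: "bij_betw (\<lambda>(c, l). ix c l) (SIGMA c:{..<k}. {1..N c}) {..<dim_col A}"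
    and N: "\<And>c. c < k \<Longrightarrow> 1 \<le> N c"
    and \<epsilon>: "\<And>i. \<epsilon> i = 1 \<or> \<epsilon> i = -1"
    and kernel: "\<And>y :: nat \<Rightarrow> complex. (\<forall>j<dim_row A. (\<Sum>i<dim_col A. of_int (A $$ (j, i)) * y i) = 0) \<longleftrightarrow>
      (\<exists>t. \<forall>c<k. \<forall>l\<in>{1..N c}. y (ix c l) = of_int (\<epsilon> (ix c l)) * t c)"
    and \<theta>: "\<theta> = vec (dim_row A) (\<lambda>j. \<Sum>i<dim_col A. A $$ (j, i) * u i)"
    and generic: "\<And>c l l'. c < k \<Longrightarrow> 1 \<le> l \<Longrightarrow> l < l' \<Longrightarrow> l' \<le> N c \<Longrightarrow>
      \<epsilon> (ix c l) * u (ix c l) < \<epsilon> (ix c l') * u (ix c l')"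
begin

lemma \<theta>_carrier: "\<theta> \<in> carrier_vec (dim_row A)"
  by (simp add: \<theta>)

definition e :: "nat \<Rightarrow> nat \<Rightarrow> int" where "e c l = \<epsilon> (ix c l)"
definition U :: "nat \<Rightarrow> nat \<Rightarrow> int" where "U c l = e c l * u (ix c l)"
text \<open>Exchanging z and w where the sign is -1 removes the signs from the degree condition: the
  exponent differences of a monomial of degree 0 are then constant on each class.\<close>

definition Zv :: "nat \<Rightarrow> nat \<Rightarrow> nat + nat" where "Zv c l = (if e c l = 1 then Inl (ix c l) else Inr (ix c l))"
definition Wv :: "nat \<Rightarrow> nat \<Rightarrow> nat + nat" where "Wv c l = (if e c l = 1 then Inr (ix c l) else Inl (ix c l))"

abbreviation "inx c l \<equiv> c < k \<and> 1 \<le> l \<and> l \<le> N c"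

lemma e: "e c l = 1 \<or> e c l = -1"
  by (simp add: e_def \<epsilon>)

lemma U_less_iff: "inx c l \<Longrightarrow> inx c l' \<Longrightarrow> U c l < U c l' \<longleftrightarrow> l < l'"
  using generic[of c l l'] generic[of c l' l] by (cases l l' rule: linorder_cases) (auto simp: U_def e_def)

lemma ix_less: "inx c l \<Longrightarrow> ix c l < dim_col A"
  using bij_betw_apply[OF ix, of "(c, l)"] by simp

lemma ix_inj: "inx c l \<Longrightarrow> inx c' l' \<Longrightarrow> ix c l = ix c' l' \<Longrightarrow> c = c' \<and> l = l'"
  using inj_onD[OF bij_betw_imp_inj_on[OF ix], of "(c, l)" "(c', l')"] by simp

lemma ix_surj: "i < dim_col A \<Longrightarrow> \<exists>c l. inx c l \<and> i = ix c l"
proof -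
  assume "i < dim_col A"
  then have "i \<in> (\<lambda>(c, l). ix c l) ` (SIGMA c:{..<k}. {1..N c})" using bij_betw_imp_surj_on[OF ix] by simp
  then obtain c l where "i = ix c l" "c < k" "l \<in> {1..N c}" by auto
  then show ?thesis by (intro exI[of _ c] exI[of _ l]) simp
qed

lemma prod_ix: "(\<Prod>i<dim_col A. f i) = (\<Prod>c<k. \<Prod>l=1..N c. f (ix c l))" for f :: "nat \<Rightarrow> complex"
proof -
  have "(\<Prod>i<dim_col A. f i) = (\<Prod>x\<in>(SIGMA c:{..<k}. {1..N c}). f (case x of (c, l) \<Rightarrow> ix c l))"
    by (rule prod.reindex_bij_betw[OF ix, symmetric])
  also have "\<dots> = (\<Prod>c<k. \<Prod>l=1..N c. f (ix c l))" by (subst prod.Sigma) (auto simp: case_prod_unfold)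
  finally show ?thesis .
qed

definition vars :: "(nat + nat) set" where "vars = Inl ` {..<dim_col A} \<union> Inr ` {..<dim_col A}"

lemma finite_vars: "finite vars" by (simp add: vars_def)

lemma vars_cases: "v \<in> vars \<Longrightarrow> \<exists>c l. inx c l \<and> (v = Zv c l \<or> v = Wv c l)"
  using ix_surj unfolding vars_def Zv_def Wv_def by (metis UnE imageE lessThan_iff)

lemma vars_mem: "inx c l \<Longrightarrow> Zv c l \<in> vars" "inx c l \<Longrightarrow> Wv c l \<in> vars"
  using ix_less by (auto simp: vars_def Zv_def Wv_def)

lemma Zv_eq_iff: "inx c l \<Longrightarrow> inx c' l' \<Longrightarrow> Zv c l = Zv c' l' \<longleftrightarrow> c = c' \<and> l = l'"
  using ix_inj[of c l c' l'] by (cases "e c l = 1"; cases "e c' l' = 1") (fastforce simp: Zv_def)+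

lemma Wv_eq_iff: "inx c l \<Longrightarrow> inx c' l' \<Longrightarrow> Wv c l = Wv c' l' \<longleftrightarrow> c = c' \<and> l = l'"
  using ix_inj[of c l c' l'] by (cases "e c l = 1"; cases "e c' l' = 1") (fastforce simp: Wv_def)+

lemma Zv_neq_Wv: "inx c l \<Longrightarrow> inx c' l' \<Longrightarrow> Zv c l \<noteq> Wv c' l'"
  using ix_inj[of c l c' l'] by (cases "e c l = 1"; cases "e c' l' = 1") (fastforce simp: Zv_def Wv_def)+

lemma prod_vars: "(\<Prod>v\<in>vars. f v) = (\<Prod>c<k. \<Prod>l=1..N c. f (Zv c l) * f (Wv c l))" for f :: "nat + nat \<Rightarrow> complex"
proof -
  have "(\<Prod>v\<in>vars. f v) = (\<Prod>v\<in>Inl ` {..<dim_col A}. f v) * (\<Prod>v\<in>Inr ` {..<dim_col A}. f v)"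
    unfolding vars_def by (rule prod.union_disjoint) auto
  also have "\<dots> = (\<Prod>i<dim_col A. f (Inl i) * f (Inr i))"
    by (simp add: prod.reindex prod.distrib)
  also have "\<dots> = (\<Prod>c<k. \<Prod>l=1..N c. f (Inl (ix c l)) * f (Inr (ix c l)))" by (rule prod_ix)
  also have "\<dots> = (\<Prod>c<k. \<Prod>l=1..N c. f (Zv c l) * f (Wv c l))"
    by (intro prod.cong refl) (auto simp: Zv_def Wv_def)
  finally show ?thesis .
qed

section \<open>Monomials sorted by classes, and their degrees\<close>

definition expZ :: "((nat + nat) \<Rightarrow>\<^sub>0 nat) \<Rightarrow> nat \<Rightarrow> nat \<Rightarrow> nat" where "expZ m c l = Poly_Mapping.lookup m (Zv c l)"
definition expW :: "((nat + nat) \<Rightarrow>\<^sub>0 nat) \<Rightarrow> nat \<Rightarrow> nat \<Rightarrow> nat" where "expW m c l = Poly_Mapping.lookup m (Wv c l)"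

lemma expZ_add [simp]: "expZ (m + m') c l = expZ m c l + expZ m' c l"
  and expW_add [simp]: "expW (m + m') c l = expW m c l + expW m' c l"
  by (simp_all add: expZ_def expW_def lookup_add)

lemma expZ_sum: "expZ (\<Sum>i\<in>I. f i) c l = (\<Sum>i\<in>I. expZ (f i) c l)"
  and expW_sum: "expW (\<Sum>i\<in>I. f i) c l = (\<Sum>i\<in>I. expW (f i) c l)"
  by (simp_all add: expZ_def expW_def lookup_sum)

lemma eval_monomial_vars:
  assumes "Poly_Mapping.keys m \<subseteq> vars"
  shows "eval_monomial x m = (\<Prod>c<k. \<Prod>l=1..N c. x (Zv c l) ^ expZ m c l * x (Wv c l) ^ expW m c l)"
  using eval_monomial_superset[OF finite_vars assms, of x] by (simp add: prod_vars expZ_def expW_def)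

lemma monomial_eqI:
  assumes "Poly_Mapping.keys m \<subseteq> vars" "Poly_Mapping.keys m' \<subseteq> vars"
    "\<And>c l. inx c l \<Longrightarrow> expZ m c l = expZ m' c l" "\<And>c l. inx c l \<Longrightarrow> expW m c l = expW m' c l"
  shows "m = m'"
proof (rule poly_mapping_eqI)
  fix v
  show "Poly_Mapping.lookup m v = Poly_Mapping.lookup m' v"
  proof (cases "v \<in> vars")
    case True
    then obtain c l where "inx c l" "v = Zv c l \<or> v = Wv c l" using vars_cases by blast
    then show ?thesis using assms(3,4) by (auto simp: expZ_def expW_def)
  next
    case False
    then have "v \<notin> Poly_Mapping.keys m" "v \<notin> Poly_Mapping.keys m'" using assms(1,2) by blast+
    then show ?thesis by (simp add: in_keys_iff)
  qed
qed

definition mono :: "(nat \<Rightarrow> nat \<Rightarrow> nat) \<Rightarrow> (nat \<Rightarrow> nat \<Rightarrow> nat) \<Rightarrow> ((nat + nat) \<Rightarrow>\<^sub>0 nat)" where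
  "mono a b = (\<Sum>c<k. \<Sum>l=1..N c. Poly_Mapping.single (Zv c l) (a c l) + Poly_Mapping.single (Wv c l) (b c l))"

lemma exp_mono:
  assumes "inx c l"
  shows "expZ (mono a b) c l = a c l" "expW (mono a b) c l = b c l"
proof -
  have zw: "Zv c' l' = Zv c l \<longleftrightarrow> c' = c \<and> l' = l" "Wv c' l' = Wv c l \<longleftrightarrow> c' = c \<and> l' = l"
     "Wv c' l' \<noteq> Zv c l" "Zv c' l' \<noteq> Wv c l" if "c' \<in> {..<k}" "l' \<in> {1..N c'}" for c' l'
    using that assms Zv_eq_iff[of c' l' c l] Wv_eq_iff[of c' l' c l] Zv_neq_Wv[of c l c' l'] Zv_neq_Wv[of c' l' c l]
    by auto
  have "expZ (mono a b) c l = (\<Sum>c'<k. \<Sum>l'=1..N c'. if c' = c \<and> l' = l then a c l else 0)"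
    unfolding mono_def expZ_sum expZ_add unfolding expZ_def
    by (intro sum.cong refl) (simp add: lookup_single when_def zw)
  also have "\<dots> = (\<Sum>c'<k. if c' = c then a c l else 0)"
    by (intro sum.cong refl) (use assms in auto)
  finally show "expZ (mono a b) c l = a c l" using assms by simp
  have "expW (mono a b) c l = (\<Sum>c'<k. \<Sum>l'=1..N c'. if c' = c \<and> l' = l then b c l else 0)"
    unfolding mono_def expW_sum expW_add unfolding expW_def
    by (intro sum.cong refl) (simp add: lookup_single when_def zw)
  also have "\<dots> = (\<Sum>c'<k. if c' = c then b c l else 0)"
    by (intro sum.cong refl) (use assms in auto)
  finally show "expW (mono a b) c l = b c l" using assms by simp
qed

lemma keys_sum_subset: "finite I \<Longrightarrow> (\<And>i. i \<in> I \<Longrightarrow> Poly_Mapping.keys (f i) \<subseteq> V) \<Longrightarrow> Poly_Mapping.keys (\<Sum>i\<in>I. f i :: 'x \<Rightarrow>\<^sub>0 nat) \<subseteq> V"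
proof (induction I rule: finite_induct)
  case (insert i I)
  then show ?case using Poly_Mapping.keys_add[of "f i" "\<Sum>i\<in>I. f i"] by auto
qed simp

lemma keys_mono: "Poly_Mapping.keys (mono a b) \<subseteq> vars"
  unfolding mono_def
proof (intro keys_sum_subset)
  fix c l assume "c \<in> {..<k}" "l \<in> {1..N c}"
  then have "Zv c l \<in> vars" "Wv c l \<in> vars" using vars_mem by auto
  then show "Poly_Mapping.keys (Poly_Mapping.single (Zv c l) (a c l) + Poly_Mapping.single (Wv c l) (b c l)) \<subseteq> vars"
    using Poly_Mapping.keys_add[of "Poly_Mapping.single (Zv c l) (a c l)" "Poly_Mapping.single (Wv c l) (b c l)"]
    by (auto split: if_splits)
qed simp_all

text \<open>The parameter of a class is a signed entry of \<open>y\<close>, hence an integer as soon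
  as \<open>y\<close> is integral.\<close>

lemma kernel_int:
  fixes y :: "nat \<Rightarrow> int"
  shows "(\<forall>j<dim_row A. (\<Sum>i<dim_col A. A $$ (j, i) * y i) = 0) \<longleftrightarrow>
    (\<exists>t. \<forall>c l. inx c l \<longrightarrow> e c l * y (ix c l) = t c)"
proof -
  have "(\<forall>j<dim_row A. (\<Sum>i<dim_col A. A $$ (j, i) * y i) = 0) \<longleftrightarrow>
    (\<forall>j<dim_row A. (\<Sum>i<dim_col A. of_int (A $$ (j, i)) * (of_int (y i) :: complex)) = 0)"
  proof -
    have "(\<Sum>i<dim_col A. of_int (A $$ (j, i)) * (of_int (y i) :: complex)) = of_int (\<Sum>i<dim_col A. A $$ (j, i) * y i)" for j
      by simp
    then show ?thesis by (simp only: of_int_eq_0_iff)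
  qed
  also have "\<dots> \<longleftrightarrow> (\<exists>t :: nat \<Rightarrow> complex. \<forall>c<k. \<forall>l\<in>{1..N c}. of_int (y (ix c l)) = of_int (e c l) * t c)"
    unfolding kernel e_def ..
  also have "\<dots> \<longleftrightarrow> (\<exists>t. \<forall>c l. inx c l \<longrightarrow> e c l * y (ix c l) = t c)"
  proof
    assume "\<exists>t :: nat \<Rightarrow> complex. \<forall>c<k. \<forall>l\<in>{1..N c}. of_int (y (ix c l)) = of_int (e c l) * t c"
    then obtain t :: "nat \<Rightarrow> complex" where t0: "\<forall>c<k. \<forall>l\<in>{1..N c}. of_int (y (ix c l)) = of_int (e c l) * t c"
      by blast
    have t: "of_int (y (ix c l)) = of_int (e c l) * t c" if "inx c l" for c l
      using t0 that atLeastAtMost_iff by blast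
    have t': "of_int (e c l * y (ix c l)) = t c" if "inx c l" for c l
      using t[OF that] e[of c l] by auto
    have "e c l * y (ix c l) = e c 1 * y (ix c 1)" if "inx c l" for c l
    proof -
      have "(of_int (e c l * y (ix c l)) :: complex) = of_int (e c 1 * y (ix c 1))"
        using t'[OF that] t'[of c 1] that by simp
      then show ?thesis by (simp only: of_int_eq_iff)
    qed
    then show "\<exists>t. \<forall>c l. inx c l \<longrightarrow> e c l * y (ix c l) = t c" by (intro exI[of _ "\<lambda>c. e c 1 * y (ix c 1)"]) blast
  next
    assume "\<exists>t. \<forall>c l. inx c l \<longrightarrow> e c l * y (ix c l) = t c"
    then obtain t where t: "\<And>c l. inx c l \<Longrightarrow> e c l * y (ix c l) = t c" by blast
    have "y (ix c l) = e c l * t c" if "inx c l" for c l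
      using t[OF that] e[of c l] by auto
    then show "\<exists>t :: nat \<Rightarrow> complex. \<forall>c<k. \<forall>l\<in>{1..N c}. of_int (y (ix c l)) = of_int (e c l) * t c"
      by (intro exI[of _ "\<lambda>c. of_int (t c)"]) simp
  qed
  finally show ?thesis .
qed

lemma exp_diff: "int (expZ m c l) - int (expW m c l) =
   e c l * (int (Poly_Mapping.lookup m (Inl (ix c l))) - int (Poly_Mapping.lookup m (Inr (ix c l))))"
  using e[of c l] by (auto simp: expZ_def expW_def Zv_def Wv_def)

text \<open>Degree r \<theta> means that the exponent differences minus r u lie in the kernel of
  \<open>A\<close>; once the signs are absorbed, this is a constant \<open>M c\<close> on every
  class.\<close>

lemma section_keys_iff: "m \<in> section_keys A \<theta> r \<longleftrightarrow> Poly_Mapping.keys m \<subseteq> vars \<and>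
   (\<exists>M. \<forall>c l. inx c l \<longrightarrow> int (expZ m c l) - int (expW m c l) = int r * U c l + M c)"
proof -
  define y where "y i = int (Poly_Mapping.lookup m (Inl i)) - int (Poly_Mapping.lookup m (Inr i)) - int r * u i" for i
  have "monomial_degree A m = int r \<cdot>\<^sub>v \<theta> \<longleftrightarrow>
    (\<forall>j<dim_row A. (\<Sum>i<dim_col A. A $$ (j, i) *
     (int (Poly_Mapping.lookup m (Inl i)) - int (Poly_Mapping.lookup m (Inr i)))) = int r * (\<Sum>i<dim_col A. A $$ (j, i) * u i))"
    unfolding monomial_degree_def \<theta> vec_eq_iff by auto
  also have "\<dots> \<longleftrightarrow> (\<forall>j<dim_row A. (\<Sum>i<dim_col A. A $$ (j, i) * y i) = 0)"
    by (simp add: y_def right_diff_distrib sum_subtractf sum_distrib_left mult_ac)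
  also have "\<dots> \<longleftrightarrow> (\<exists>t. \<forall>c l. inx c l \<longrightarrow> e c l * y (ix c l) = t c)" by (rule kernel_int)
  also have "\<dots> \<longleftrightarrow> (\<exists>M. \<forall>c l. inx c l \<longrightarrow> int (expZ m c l) - int (expW m c l) = int r * U c l + M c)"
  proof -
    have "e c l * y (ix c l) = int (expZ m c l) - int (expW m c l) - int r * U c l" for c l
      unfolding exp_diff y_def U_def by (simp add: algebra_simps)
    then have "e c l * y (ix c l) = t \<longleftrightarrow> int (expZ m c l) - int (expW m c l) = int r * U c l + t" for c l t
      by auto
    then show ?thesis by (simp only:)
  qed
  finally show ?thesis unfolding section_keys_def graded_keys_def vars_def by auto
qed

text \<open>The smallest monomial with exponent differences \<open>E\<close>: the two variables of
  one column never occur in it together.\<close>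

definition cmono :: "(nat \<Rightarrow> nat \<Rightarrow> int) \<Rightarrow> ((nat + nat) \<Rightarrow>\<^sub>0 nat)" where
  "cmono E = mono (\<lambda>c l. nat (E c l)) (\<lambda>c l. nat (- E c l))"

lemma cmono_key:
  assumes "\<And>c l. inx c l \<Longrightarrow> E c l = int r * U c l + M c"
  shows "cmono E \<in> section_keys A \<theta> r"
  unfolding section_keys_iff
proof (intro conjI exI[of _ M] allI impI)
  show "Poly_Mapping.keys (cmono E) \<subseteq> vars" unfolding cmono_def by (rule keys_mono)
  fix c l assume "inx c l"
  then show "int (expZ (cmono E) c l) - int (expW (cmono E) c l) = int r * U c l + M c"
    by (simp add: cmono_def exp_mono assms)
qed

text \<open>The chart \<open>\<sigma>\<close> is the locus where the monomial \<open>gmon \<sigma>\<close> of degree \<open>\<theta>\<close> does not vanish; its coordinates in the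
  class \<open>b\<close> are, up to sign, the quotients of \<open>fmon \<sigma> b 1\<close> and \<open>fmon \<sigma> b (-1)\<close> by \<open>gmon \<sigma>\<close>.\<close>

definition gexp :: "(nat \<Rightarrow> nat) \<Rightarrow> nat \<Rightarrow> nat \<Rightarrow> int" where "gexp \<sigma> c l = U c l - U c (\<sigma> c)"
definition gmon where "gmon \<sigma> = cmono (gexp \<sigma>)"
definition fmon where "fmon \<sigma> b d = cmono (\<lambda>c l. gexp \<sigma> c l + (if c = b then d else 0))"
definition gpol :: "(nat \<Rightarrow> nat) \<Rightarrow> zw_poly" where "gpol \<sigma> = Poly_Mapping.single (gmon \<sigma>) 1"
definition fpol :: "(nat \<Rightarrow> nat) \<Rightarrow> nat \<Rightarrow> int \<Rightarrow> zw_poly" where "fpol \<sigma> b d = Poly_Mapping.single (fmon \<sigma> b d) 1"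

lemma gmon_key: "gmon \<sigma> \<in> section_keys A \<theta> 1"
  unfolding gmon_def by (rule cmono_key[of _ _ "\<lambda>c. - U c (\<sigma> c)"]) (simp add: gexp_def)

lemma fmon_key: "fmon \<sigma> b d \<in> section_keys A \<theta> 1"
  unfolding fmon_def by (rule cmono_key[of _ _ "\<lambda>c. - U c (\<sigma> c) + (if c = b then d else 0)"]) (simp add: gexp_def)

lemma gpol_section: "gpol \<sigma> \<in> sections A \<theta> 1" and fpol_section: "fpol \<sigma> b d \<in> sections A \<theta> 1"
  unfolding gpol_def fpol_def by (intro sections_single gmon_key fmon_key)+

lemma exp_gmon:
  assumes "inx c l"
  shows "expZ (gmon \<sigma>) c l = nat (gexp \<sigma> c l)" "expW (gmon \<sigma>) c l = nat (- gexp \<sigma> c l)"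
  using assms by (simp_all add: gmon_def cmono_def exp_mono)

lemma exp_fmon:
  assumes "inx c l"
  shows "expZ (fmon \<sigma> b d) c l = nat (gexp \<sigma> c l + (if c = b then d else 0))"
    "expW (fmon \<sigma> b d) c l = nat (- (gexp \<sigma> c l + (if c = b then d else 0)))"
  using assms by (simp_all add: fmon_def cmono_def exp_mono)

abbreviation "chart_index \<sigma> \<equiv> (\<forall>c<k. 1 \<le> \<sigma> c \<and> \<sigma> c \<le> N c)"

text \<open>Consequently \<open>gmon \<sigma>\<close> consists of the Z with
  \<open>l > \<sigma> c\<close> and the W with \<open>l < \<sigma> c\<close>, exactly the variables
  that \<open>cox_Z\<close> and \<open>cox_W\<close> normalise to 1.\<close>

lemma gexp_sign:
  assumes "chart_index \<sigma>" "inx c l"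
  shows "gexp \<sigma> c l > 0 \<longleftrightarrow> l > \<sigma> c" "gexp \<sigma> c l < 0 \<longleftrightarrow> l < \<sigma> c" "gexp \<sigma> c l = 0 \<longleftrightarrow> l = \<sigma> c"
  using U_less_iff[of c l "\<sigma> c"] U_less_iff[of c "\<sigma> c" l] assms by (auto simp: gexp_def)

text \<open>The products Z W must carry the sign \<open>e\<close>, but normalised entries must stay
  1, so below \<open>j\<close> the sign goes to Z and above \<open>j\<close> to W.
  \<open>eta\<close> is the sign of Z at \<open>j\<close> that makes the product of all Z-signs 1
  (\<open>prod_sgnZ\<close>), as determinant one requires.\<close>

definition eta :: "nat \<Rightarrow> nat \<Rightarrow> int" where "eta c j = (\<Prod>l\<in>{1..<j}. e c l)"

lemma eta: "eta c j = 1 \<or> eta c j = -1"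
proof -
  have "(\<Prod>l\<in>L. e c l) = 1 \<or> (\<Prod>l\<in>L. e c l) = -1" for L
  proof (induction L rule: infinite_finite_induct)
    case (insert l L) then show ?case using e[of c l] by auto
  qed simp_all
  then show ?thesis by (simp add: eta_def)
qed

definition sgnZ :: "nat \<Rightarrow> nat \<Rightarrow> nat \<Rightarrow> int" where
  "sgnZ c j l = (if l < j then e c l else if l = j then eta c j else 1)"
definition sgnW :: "nat \<Rightarrow> nat \<Rightarrow> nat \<Rightarrow> int" where
  "sgnW c j l = (if l < j then 1 else if l = j then e c j * eta c j else e c l)"

lemma sgn_mult: "sgnZ c j l * sgnW c j l = e c l"
  using eta[of c j] by (auto simp: sgnZ_def sgnW_def)

lemma sgnZ: "sgnZ c j l = 1 \<or> sgnZ c j l = -1" and sgnW: "sgnW c j l = 1 \<or> sgnW c j l = -1"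
  using eta[of c j] e[of c l] e[of c j] by (auto simp: sgnZ_def sgnW_def)

lemma prod_sgnZ: "1 \<le> j \<Longrightarrow> j \<le> N c \<Longrightarrow> (\<Prod>l=1..N c. sgnZ c j l) = 1"
proof -
  assume j: "1 \<le> j" "j \<le> N c"
  have "(\<Prod>l=1..N c. sgnZ c j l) = (\<Prod>l\<in>{1..j}. sgnZ c j l)"
    by (rule prod.mono_neutral_right) (use j in \<open>auto simp: sgnZ_def\<close>)
  also have "{1..j} = insert j {1..<j}" using j by auto
  also have "(\<Prod>l\<in>\<dots>. sgnZ c j l) = sgnZ c j j * (\<Prod>l\<in>{1..<j}. sgnZ c j l)" by simp
  also have "(\<Prod>l\<in>{1..<j}. sgnZ c j l) = eta c j" unfolding eta_def by (rule prod.cong) (auto simp: sgnZ_def)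
  finally show ?thesis using eta[of c j] by (auto simp: sgnZ_def)
qed

text \<open>The point of affine space with prescribed values at the \<open>Zv\<close> and
  \<open>Wv\<close>, written in z and w by undoing the exchange of variables.\<close>

definition cox :: "(nat \<Rightarrow> nat \<Rightarrow> complex) \<Rightarrow> (nat \<Rightarrow> nat \<Rightarrow> complex) \<Rightarrow> nat + nat \<Rightarrow> complex" where
  "cox Z W v = (case v of Inl i \<Rightarrow> (THE z. \<exists>c l. inx c l \<and> i = ix c l \<and> z = (if e c l = 1 then Z c l else W c l))
     | Inr i \<Rightarrow> (THE z. \<exists>c l. inx c l \<and> i = ix c l \<and> z = (if e c l = 1 then W c l else Z c l)))"

lemma cox_simps:
  assumes "inx c l"
  shows "cox Z W (Zv c l) = Z c l" "cox Z W (Wv c l) = W c l"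
proof -
  have *: "cox Z W (Inl (ix c l)) = (if e c l = 1 then Z c l else W c l)"
    "cox Z W (Inr (ix c l)) = (if e c l = 1 then W c l else Z c l)"
    unfolding cox_def sum.case using assms ix_inj by (blast intro!: the_equality)+
  show "cox Z W (Zv c l) = Z c l" "cox Z W (Wv c l) = W c l" by (simp_all add: Zv_def Wv_def *)
qed

definition chart_point :: "(nat \<Rightarrow> nat) \<Rightarrow> (nat \<Rightarrow> complex \<times> complex) \<Rightarrow> nat + nat \<Rightarrow> complex" where
  "chart_point \<sigma> x = cox (\<lambda>c l. of_int (sgnZ c (\<sigma> c) l) * cox_Z (\<sigma> c) (x c) l)
     (\<lambda>c l. of_int (sgnW c (\<sigma> c) l) * cox_W (\<sigma> c) (x c) l)"

lemma chart_point_simps: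
  assumes "inx c l"
  shows "chart_point \<sigma> x (Zv c l) = of_int (sgnZ c (\<sigma> c) l) * cox_Z (\<sigma> c) (x c) l"
    "chart_point \<sigma> x (Wv c l) = of_int (sgnW c (\<sigma> c) l) * cox_W (\<sigma> c) (x c) l"
  by (simp_all add: chart_point_def cox_simps[OF assms])

lemma cox_mult: "chart_point \<sigma> x (Zv c l) * chart_point \<sigma> x (Wv c l) = of_int (e c l) * (fst (x c) * snd (x c))" if "inx c l"
proof -
  have "chart_point \<sigma> x (Zv c l) * chart_point \<sigma> x (Wv c l) =
    of_int (sgnZ c (\<sigma> c) l * sgnW c (\<sigma> c) l) * (cox_Z (\<sigma> c) (x c) l * cox_W (\<sigma> c) (x c) l)"
    by (simp add: chart_point_simps[OF that])
  then show ?thesis by (simp only: sgn_mult cox_ZW)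
qed

lemma eval_gpol:
  assumes "chart_index \<sigma>"
  shows "eval_mpoly (chart_point \<sigma> x) (gpol \<sigma>) = 1"
proof -
  have "chart_point \<sigma> x (Zv c l) ^ expZ (gmon \<sigma>) c l * chart_point \<sigma> x (Wv c l) ^ expW (gmon \<sigma>) c l = 1"
    if "inx c l" for c l
    using gexp_sign[OF assms that] that
    by (cases l "\<sigma> c" rule: linorder_cases)
      (auto simp: exp_gmon chart_point_simps cox_Z_def cox_W_def sgnZ_def sgnW_def)
  then have "eval_monomial (chart_point \<sigma> x) (gmon \<sigma>) = 1"
    using gmon_key[of \<sigma>] by (subst eval_monomial_vars) (auto simp: section_keys_iff intro!: prod.neutral)
  then show ?thesis by (simp add: gpol_def eval_mpoly_single)
qed

text \<open>Shifting a nonzero exponent by 1 or -1 cannot reverse its sign, so off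
  \<open>\<sigma> b\<close> still only variables with value 1 occur. At \<open>\<sigma> b\<close>
  the exponent is \<open>d\<close> itself and selects one of the two coordinates.\<close>

lemma eval_fpol:
  assumes "chart_index \<sigma>" "b < k"
  shows "eval_mpoly (chart_point \<sigma> x) (fpol \<sigma> b 1) = of_int (eta b (\<sigma> b)) * snd (x b)"
    "eval_mpoly (chart_point \<sigma> x) (fpol \<sigma> b (-1)) = of_int (e b (\<sigma> b) * eta b (\<sigma> b)) * fst (x b)"
proof -
  have *: "eval_mpoly (chart_point \<sigma> x) (fpol \<sigma> b d) = y"
    if d: "d = 1 \<and> y = of_int (eta b (\<sigma> b)) * snd (x b) \<or> d = -1 \<and> y = of_int (e b (\<sigma> b) * eta b (\<sigma> b)) * fst (x b)" for d y
  proof -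
    have el: "chart_point \<sigma> x (Zv c l) ^ expZ (fmon \<sigma> b d) c l * chart_point \<sigma> x (Wv c l) ^ expW (fmon \<sigma> b d) c l =
      (if c = b \<and> l = \<sigma> b then y else 1)" if "inx c l" for c l
    proof (cases l "\<sigma> c" rule: linorder_cases)
      case less
      then have "expZ (fmon \<sigma> b d) c l = 0" using gexp_sign(2)[OF assms(1) that] d by (auto simp: exp_fmon[OF that])
      moreover have "chart_point \<sigma> x (Wv c l) = 1"
        using less by (simp add: chart_point_simps[OF that] sgnW_def cox_W_def)
      ultimately show ?thesis using less by auto
    next
      case greater
      then have "expW (fmon \<sigma> b d) c l = 0" using gexp_sign(1)[OF assms(1) that] d by (auto simp: exp_fmon[OF that])
      moreover have "chart_point \<sigma> x (Zv c l) = 1"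
        using greater by (simp add: chart_point_simps[OF that] sgnZ_def cox_Z_def)
      ultimately show ?thesis using greater by auto
    next
      case equal
      then have "gexp \<sigma> c l = 0" by (simp add: gexp_def)
      then show ?thesis using equal d that
        by (auto simp: exp_fmon chart_point_simps sgnZ_def sgnW_def cox_Z_def cox_W_def)
    qed
    have "eval_monomial (chart_point \<sigma> x) (fmon \<sigma> b d) = (\<Prod>c<k. \<Prod>l=1..N c. if c = b \<and> l = \<sigma> b then y else 1)"
      using fmon_key[of \<sigma> b d] by (subst eval_monomial_vars) (auto simp: section_keys_iff el intro!: prod.cong)
    also have "\<dots> = (\<Prod>c<k. if c = b then y else 1)"
      by (intro prod.cong refl) (use assms in auto)
    also have "\<dots> = y" using assms(2) by simp
    finally show ?thesis by (simp add: fpol_def eval_mpoly_single)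
  qed
  show "eval_mpoly (chart_point \<sigma> x) (fpol \<sigma> b 1) = of_int (eta b (\<sigma> b)) * snd (x b)"
    "eval_mpoly (chart_point \<sigma> x) (fpol \<sigma> b (-1)) = of_int (e b (\<sigma> b) * eta b (\<sigma> b)) * fst (x b)"
    by (rule *; simp)+
qed

definition hchart :: "(nat \<Rightarrow> nat) \<Rightarrow> (nat \<Rightarrow> complex \<times> complex) \<Rightarrow> zw_poly poly set" where
  "hchart \<sigma> x = point_ideal A \<theta> (chart_point \<sigma> x)"

lemma hchart_proj: "chart_index \<sigma> \<Longrightarrow> hchart \<sigma> x \<in> proj_points A \<theta>"
  unfolding hchart_def
  by (rule point_ideal_in_proj[OF \<theta>_carrier, of 1 "gpol \<sigma>"]) (simp_all add: gpol_section[simplified] eval_gpol)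

lemma hchart_hk:
  assumes "chart_index \<sigma>" shows "hchart \<sigma> x \<in> hk_points A \<theta>"
  unfolding hk_points_zw_val[OF \<theta>_carrier]
proof
  show "hchart \<sigma> x \<in> proj_points A \<theta>" by (rule hchart_proj[OF assms])
  have "zw_val A \<theta> (hchart \<sigma> x) (ix c l) = of_int (\<epsilon> (ix c l)) * (fst (x c) * snd (x c))" if "inx c l" for c l
  proof -
    have "zw_val A \<theta> (hchart \<sigma> x) (ix c l) = chart_point \<sigma> x (Inl (ix c l)) * chart_point \<sigma> x (Inr (ix c l))"
      using zw_val_point_ideal[OF \<theta>_carrier] hchart_proj[OF assms] ix_less[OF that] unfolding hchart_def by blast
    also have "\<dots> = chart_point \<sigma> x (Zv c l) * chart_point \<sigma> x (Wv c l)" by (simp add: Zv_def Wv_def)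
    finally show ?thesis using cox_mult[OF that] by (simp add: e_def)
  qed
  then show "\<forall>j<dim_row A. (\<Sum>i<dim_col A. of_int (A $$ (j, i)) * zw_val A \<theta> (hchart \<sigma> x) i) = 0"
    unfolding kernel by (intro exI[of _ "\<lambda>c. fst (x c) * snd (x c)"]) auto
qed

end

text \<open>The equation of \<open>cox_equiv_iff\<close> is solved by inverting \<open>D\<close>.
  The hypotheses say that \<open>D\<close> is nonzero; for neighbouring indices the power of the
  product in it is trivial.\<close>

lemma cox_transition_exists:
  assumes "i \<in> {1..n}" "j \<in> {1..n}" "i < j \<Longrightarrow> fst x \<noteq> 0" "j < i \<Longrightarrow> snd x \<noteq> 0"
    "Suc i < j \<or> Suc j < i \<Longrightarrow> fst x * snd x \<noteq> 0"
  shows "\<exists>y. cox_equiv n i x j y"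
proof (cases i j rule: linorder_cases)
  case less
  define D where "D = fst x * (fst x * snd x) ^ (j - i - 1)"
  have "D \<noteq> 0"
  proof (cases "j = Suc i")
    case True then show ?thesis using assms(3) by (simp add: D_def)
  next
    case False
    then have "fst x * snd x \<noteq> 0" using assms(5) less by simp
    then show ?thesis by (simp add: D_def)
  qed
  then have "cox_equiv n i x j (fst x * snd x * D, 1 / D)"
    using assms less by (subst cox_equiv_iff) (auto simp: D_def field_simps)
  then show ?thesis by blast
next
  case equal then show ?thesis using cox_equiv_refl by blast
next
  case greater
  define D where "D = snd x * (fst x * snd x) ^ (i - j - 1)"
  have "D \<noteq> 0"
  proof (cases "i = Suc j")
    case True then show ?thesis using assms(4) by (simp add: D_def)
  next
    case False
    then have "fst x * snd x \<noteq> 0" using assms(5) greater by simp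
    then show ?thesis by (simp add: D_def)
  qed
  then have "cox_equiv n j (1 / D, fst x * snd x * D) i x"
    using assms greater by (subst cox_equiv_iff) (auto simp: D_def field_simps)
  then show ?thesis using cox_equiv_sym by blast
qed

lemma point_ideal_eq_ratio:
  assumes "\<theta> \<in> carrier_vec (dim_row A)" "point_ideal A \<theta> x = point_ideal A \<theta> y"
    "f \<in> sections A \<theta> r" "g \<in> sections A \<theta> r"
  shows "eval_mpoly x f * eval_mpoly y g = eval_mpoly x g * eval_mpoly y f"
proof -
  \<comment> \<open>This combination of \<open>f\<close> and \<open>g\<close> vanishes at
    \<open>x\<close> by construction, hence also at \<open>y\<close>.\<close>
  let ?F = "const (eval_mpoly x f) * g - const (eval_mpoly x g) * f"
  have F: "?F \<in> sections A \<theta> r" using assms by (intro sections_diff sections_smult)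
  have "monom ?F r \<in> point_ideal A \<theta> x" by (simp add: monom_point_ideal[OF F] eval_mpoly_diff eval_mpoly_mult)
  then have "eval_mpoly y ?F = 0" unfolding assms(2) by (simp add: monom_point_ideal[OF F])
  then show ?thesis by (simp add: eval_mpoly_diff eval_mpoly_mult)
qed

text \<open>The factor may depend on the degree \<open>r\<close> but not on the monomial; in
  \<open>hchart_eqI\<close> it is the character of degree r \<theta> at the torus element that
  relates the two points.\<close>

lemma point_ideal_eqI:
  assumes "\<And>r. c r \<noteq> 0" "\<And>r m. m \<in> section_keys A \<theta> r \<Longrightarrow> eval_monomial y m = c r * eval_monomial x m"
  shows "point_ideal A \<theta> x = point_ideal A \<theta> y"
proof -
  have "eval_mpoly y f = c r * eval_mpoly x f" if "f \<in> sections A \<theta> r" for f r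
  proof -
    have "eval_mpoly y f = (\<Sum>m\<in>Poly_Mapping.keys f. Poly_Mapping.lookup f m * eval_monomial y m)"
      by (rule eval_mpoly_superset) simp_all
    also have "\<dots> = (\<Sum>m\<in>Poly_Mapping.keys f. c r * (Poly_Mapping.lookup f m * eval_monomial x m))"
      by (rule sum.cong) (use that assms(2) in \<open>auto simp: sections_iff\<close>)
    also have "\<dots> = c r * eval_mpoly x f"
      by (simp add: eval_mpoly_superset[OF _ subset_refl] sum_distrib_left)
    finally show ?thesis .
  qed
  then have "eval_mpoly y f = 0 \<longleftrightarrow> eval_mpoly x f = 0" if "f \<in> sections A \<theta> r" for f r
    using that assms(1)[of r] by simp
  then show ?thesis unfolding point_ideal_def carrier_section_ring by blast
qed

lemma prod_power_int: "(\<Prod>i\<in>I. f i powi m) = (\<Prod>i\<in>I. f i :: complex) powi m"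
  by (induction I rule: infinite_finite_induct) (auto simp: power_int_mult_distrib)

section \<open>Coincidence of chart points, and covering of Y by the charts\<close>

context circuit_matrix
begin

text \<open>A torus element \<open>S\<close> relates the two representatives. It multiplies a
  monomial of degree r \<theta> by powers of \<open>S\<close> with exponents r U + M; determinant
  one on each class cancels the part with \<open>M\<close>, and the remaining factor depends on
  \<open>r\<close> only.\<close>

lemma hchart_eqI:
  assumes \<sigma>: "chart_index \<sigma>" and \<tau>: "chart_index \<tau>"
    and eq: "\<And>c. c < k \<Longrightarrow> cox_equiv (N c) (\<sigma> c) (x c) (\<tau> c) (y c)"
  shows "hchart \<sigma> x = hchart \<tau> y"
proof -
  have "\<forall>c. \<exists>s. c < k \<longrightarrow> (\<forall>l\<in>{1..N c}. s l \<noteq> 0) \<and> (\<Prod>l=1..N c. s l) = 1 \<and>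
     (\<forall>l\<in>{1..N c}. cox_Z (\<tau> c) (y c) l = s l * cox_Z (\<sigma> c) (x c) l \<and> cox_W (\<sigma> c) (x c) l = s l * cox_W (\<tau> c) (y c) l)"
    using eq unfolding cox_equiv_def by meson
  from choice[OF this] obtain s where s0: "\<forall>c. c < k \<longrightarrow> (\<forall>l\<in>{1..N c}. s c l \<noteq> 0) \<and> (\<Prod>l=1..N c. s c l) = 1 \<and>
     (\<forall>l\<in>{1..N c}. cox_Z (\<tau> c) (y c) l = s c l * cox_Z (\<sigma> c) (x c) l \<and> cox_W (\<sigma> c) (x c) l = s c l * cox_W (\<tau> c) (y c) l)" ..
  then have s: "\<And>c l. inx c l \<Longrightarrow> s c l \<noteq> 0" "\<And>c. c < k \<Longrightarrow> (\<Prod>l=1..N c. s c l) = 1"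
     "\<And>c l. inx c l \<Longrightarrow> cox_Z (\<tau> c) (y c) l = s c l * cox_Z (\<sigma> c) (x c) l"
     "\<And>c l. inx c l \<Longrightarrow> cox_W (\<sigma> c) (x c) l = s c l * cox_W (\<tau> c) (y c) l"
    by simp_all
  \<comment> \<open>The torus element of \<open>cox_equiv\<close>, corrected by the signs of both
    representatives.\<close>
  define S where "S c l = of_int (sgnZ c (\<tau> c) l * sgnZ c (\<sigma> c) l) * s c l" for c l
  have Snz: "S c l \<noteq> 0" if "inx c l" for c l
    using s(1)[OF that] sgnZ[of c "\<tau> c" l] sgnZ[of c "\<sigma> c" l] by (auto simp: S_def)
  have Sprod: "(\<Prod>l=1..N c. S c l) = 1" if "c < k" for c
  proof -
    have "(\<Prod>l=1..N c. S c l) = of_int ((\<Prod>l=1..N c. sgnZ c (\<tau> c) l) * (\<Prod>l=1..N c. sgnZ c (\<sigma> c) l)) * (\<Prod>l=1..N c. s c l)"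
      by (simp add: S_def prod.distrib)
    moreover have "(\<Prod>l=1..N c. sgnZ c (\<tau> c) l) = 1" "(\<Prod>l=1..N c. sgnZ c (\<sigma> c) l) = 1"
      using prod_sgnZ \<sigma> \<tau> that by auto
    ultimately show ?thesis using s(2)[OF that] by (simp only:) simp
  qed
  have Z: "chart_point \<tau> y (Zv c l) = S c l * chart_point \<sigma> x (Zv c l)" if "inx c l" for c l
    using sgnZ[of c "\<sigma> c" l] by (auto simp: chart_point_simps[OF that] S_def s(3)[OF that])
  have W: "chart_point \<sigma> x (Wv c l) = S c l * chart_point \<tau> y (Wv c l)" if "inx c l" for c l
  proof -
    have "sgnZ c (\<tau> c) l * sgnZ c (\<sigma> c) l * sgnW c (\<tau> c) l = sgnZ c (\<sigma> c) l * (sgnZ c (\<tau> c) l * sgnW c (\<tau> c) l)"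
      by simp
    also have "\<dots> = (sgnZ c (\<sigma> c) l * sgnZ c (\<sigma> c) l) * sgnW c (\<sigma> c) l"
      unfolding sgn_mult[of c "\<tau> c" l] sgn_mult[of c "\<sigma> c" l, symmetric] by simp
    also have "sgnZ c (\<sigma> c) l * sgnZ c (\<sigma> c) l = 1" using sgnZ[of c "\<sigma> c" l] by auto
    finally have "sgnW c (\<sigma> c) l = sgnZ c (\<tau> c) l * sgnZ c (\<sigma> c) l * sgnW c (\<tau> c) l" by simp
    then have "of_int (sgnW c (\<sigma> c) l) = (of_int (sgnZ c (\<tau> c) l * sgnZ c (\<sigma> c) l * sgnW c (\<tau> c) l) :: complex)"
      by (simp only:)
    then show ?thesis by (simp add: chart_point_simps[OF that] S_def s(4)[OF that])
  qed
  define \<kappa> where "\<kappa> r = (\<Prod>c<k. \<Prod>l=1..N c. S c l powi (int r * U c l))" for r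
  show ?thesis unfolding hchart_def
  proof (rule point_ideal_eqI)
    show "\<kappa> r \<noteq> 0" for r using Snz by (auto simp: \<kappa>_def)
    fix r m assume m: "m \<in> section_keys A \<theta> r"
    then obtain M where keys: "Poly_Mapping.keys m \<subseteq> vars"
      and M: "\<And>c l. inx c l \<Longrightarrow> int (expZ m c l) - int (expW m c l) = int r * U c l + M c"
      unfolding section_keys_iff by blast
    have el: "chart_point \<tau> y (Zv c l) ^ expZ m c l * chart_point \<tau> y (Wv c l) ^ expW m c l =
      S c l powi (int r * U c l) * S c l powi M c *
        (chart_point \<sigma> x (Zv c l) ^ expZ m c l * chart_point \<sigma> x (Wv c l) ^ expW m c l)" if "inx c l" for c l
    proof -
      have "S c l powi (int r * U c l) * S c l powi M c * S c l ^ expW m c l = S c l ^ expZ m c l"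
      proof -
        have "S c l powi (int r * U c l) * S c l powi M c * S c l powi int (expW m c l) =
          S c l powi (int r * U c l + M c + int (expW m c l))"
          using Snz[OF that] by (simp add: power_int_add)
        also have "int r * U c l + M c + int (expW m c l) = int (expZ m c l)" using M[OF that] by simp
        finally show ?thesis by (simp add: power_int_of_nat)
      qed
      then show ?thesis unfolding Z[OF that] W[OF that] power_mult_distrib by (simp add: mult_ac)
    qed
    have "eval_monomial (chart_point \<tau> y) m = (\<Prod>c<k. \<Prod>l=1..N c. S c l powi (int r * U c l) * S c l powi M c *
        (chart_point \<sigma> x (Zv c l) ^ expZ m c l * chart_point \<sigma> x (Wv c l) ^ expW m c l))"
      unfolding eval_monomial_vars[OF keys] by (intro prod.cong refl el) auto
    also have "\<dots> = \<kappa> r * (\<Prod>c<k. (\<Prod>l=1..N c. S c l) powi M c) * eval_monomial (chart_point \<sigma> x) m"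
      unfolding eval_monomial_vars[OF keys] \<kappa>_def prod.distrib prod_power_int ..
    also have "(\<Prod>c<k. (\<Prod>l=1..N c. S c l) powi M c) = 1" by (intro prod.neutral ballI) (simp only: Sprod lessThan_iff power_int_1_left)
    finally show "eval_monomial (chart_point \<tau> y) m = \<kappa> r * eval_monomial (chart_point \<sigma> x) m" by simp
  qed
qed

text \<open>The coordinates are recovered, up to nonzero signs, as quotients of \<open>fpol\<close>
  by \<open>gpol\<close>, which depend on the ideal only.\<close>

lemma hchart_inj:
  assumes \<sigma>: "chart_index \<sigma>" and eq: "hchart \<sigma> x = hchart \<sigma> y" and c: "c < k"
  shows "x c = y c"
proof -
  have *: "eval_mpoly (chart_point \<sigma> x) (fpol \<sigma> c d) = eval_mpoly (chart_point \<sigma> y) (fpol \<sigma> c d)" for d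
    using point_ideal_eq_ratio[OF \<theta>_carrier eq[unfolded hchart_def] fpol_section gpol_section, of \<sigma> c d \<sigma>]
    by (simp add: eval_gpol[OF \<sigma>])
  have "eta c (\<sigma> c) \<noteq> 0" "e c (\<sigma> c) \<noteq> 0" using eta[of c "\<sigma> c"] e[of c "\<sigma> c"] by auto
  then show ?thesis using *[of 1] *[of "-1"] by (simp add: eval_fpol[OF \<sigma> c] prod_eq_iff)
qed

text \<open>Nonvanishing of \<open>gpol \<tau>\<close> at the point gives the inequalities under
  which transitions exist, so the point has coordinates \<open>x'\<close> in the chart
  \<open>\<tau>\<close>. Injectivity of this chart identifies them with \<open>y\<close>.\<close>

lemma hchart_eqD:
  assumes \<sigma>: "chart_index \<sigma>" and \<tau>: "chart_index \<tau>" and eq: "hchart \<sigma> x = hchart \<tau> y" and c: "c < k"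
  shows "cox_equiv (N c) (\<sigma> c) (x c) (\<tau> c) (y c)"
proof -
  let ?v = "chart_point \<sigma> x"
  have "monom (gpol \<tau>) 1 \<notin> hchart \<tau> y"
    unfolding hchart_def by (subst monom_point_ideal[OF gpol_section]) (simp add: eval_gpol[OF \<tau>])
  then have "eval_mpoly ?v (gpol \<tau>) \<noteq> 0"
    unfolding eq[symmetric] unfolding hchart_def by (subst (asm) monom_point_ideal[OF gpol_section])
  then have "eval_monomial ?v (gmon \<tau>) \<noteq> 0" by (simp add: gpol_def eval_mpoly_single)
  then have nz0: "(\<Prod>c<k. \<Prod>l=1..N c. ?v (Zv c l) ^ expZ (gmon \<tau>) c l * ?v (Wv c l) ^ expW (gmon \<tau>) c l) \<noteq> 0"
    using gmon_key[of \<tau>] by (subst (asm) eval_monomial_vars) (auto simp: section_keys_iff)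
  have nz: "?v (Zv c l) ^ expZ (gmon \<tau>) c l * ?v (Wv c l) ^ expW (gmon \<tau>) c l \<noteq> 0" if "inx c l" for c l
  proof -
    have "(\<Prod>l=1..N c. ?v (Zv c l) ^ expZ (gmon \<tau>) c l * ?v (Wv c l) ^ expW (gmon \<tau>) c l) \<noteq> 0"
      using nz0 that by (metis (no_types, lifting) finite_lessThan lessThan_iff prod_zero_iff)
    then show ?thesis using that by (metis (no_types, lifting) atLeastAtMost_iff finite_atLeastAtMost prod_zero_iff)
  qed
  have Znz: "cox_Z (\<sigma> c) (x c) l \<noteq> 0" if "inx c l" "l > \<tau> c" for c l
  proof -
    have "expZ (gmon \<tau>) c l > 0" using gexp_sign(1)[OF \<tau> that(1)] that(2) by (simp add: exp_gmon[OF that(1)])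
    then have "?v (Zv c l) \<noteq> 0" using nz[OF that(1)] by auto
    then show ?thesis by (simp add: chart_point_simps[OF that(1)])
  qed
  have Wnz: "cox_W (\<sigma> c) (x c) l \<noteq> 0" if "inx c l" "l < \<tau> c" for c l
  proof -
    have "expW (gmon \<tau>) c l > 0" using gexp_sign(2)[OF \<tau> that(1)] that(2) by (simp add: exp_gmon[OF that(1)])
    then have "?v (Wv c l) \<noteq> 0" using nz[OF that(1)] by auto
    then show ?thesis by (simp add: chart_point_simps[OF that(1)])
  qed
  have "\<exists>x'. cox_equiv (N c) (\<sigma> c) (x c) (\<tau> c) x'" if "c < k" for c
  proof (rule cox_transition_exists)
    show "\<sigma> c \<in> {1..N c}" "\<tau> c \<in> {1..N c}" using \<sigma> \<tau> that by auto
    show "fst (x c) \<noteq> 0" if "\<sigma> c < \<tau> c" using Wnz[of c "\<sigma> c"] that \<sigma> \<open>c < k\<close> by (simp add: cox_W_def)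
    show "snd (x c) \<noteq> 0" if "\<tau> c < \<sigma> c" using Znz[of c "\<sigma> c"] that \<sigma> \<open>c < k\<close> by (simp add: cox_Z_def)
    show "fst (x c) * snd (x c) \<noteq> 0" if "Suc (\<sigma> c) < \<tau> c \<or> Suc (\<tau> c) < \<sigma> c"
      using that
    proof
      assume l: "Suc (\<sigma> c) < \<tau> c"
      moreover have "\<tau> c \<le> N c" using \<tau> \<open>c < k\<close> by simp
      ultimately show ?thesis using Wnz[of c "Suc (\<sigma> c)"] \<open>c < k\<close> by (simp add: cox_W_def)
    next
      assume l: "Suc (\<tau> c) < \<sigma> c"
      moreover have "\<sigma> c \<le> N c" using \<sigma> \<open>c < k\<close> by simp
      ultimately show ?thesis using Znz[of c "Suc (\<tau> c)"] \<open>c < k\<close> by (simp add: cox_Z_def)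
    qed
  qed
  then obtain x' where x': "\<And>c. c < k \<Longrightarrow> cox_equiv (N c) (\<sigma> c) (x c) (\<tau> c) (x' c)" by metis
  have "hchart \<tau> x' = hchart \<tau> y" using hchart_eqI[OF \<sigma> \<tau> x'] eq by simp
  from hchart_inj[OF \<tau> this c] x'[OF c] show ?thesis by simp
qed

text \<open>A monomial of degree \<open>r \<theta>\<close> not vanishing at the point is \<open>z\<^sup>\<alpha> w\<^sup>\<beta>\<close> with \<open>\<alpha> - \<beta> = r U + M\<close> on each class; the
  chart is read off the index where \<open>r U + M\<close> is smallest in absolute value.\<close>

lemma hk_chart_exists:
  assumes p: "p \<in> hk_points A \<theta>"
  obtains \<sigma> where "chart_index \<sigma>" "gpol \<sigma> \<notin> hpart p A \<theta> 1"
proof -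
  have pp: "p \<in> proj_points A \<theta>" using p by (simp add: hk_points_def)
  interpret proj_point A \<theta> p by (rule proj_pointI[OF \<theta>_carrier pp])
  obtain r f where f: "r > 0" "f \<in> S r" "f \<notin> H r" using semistable by blast
  have "\<exists>m\<in>Poly_Mapping.keys f. Poly_Mapping.single m 1 \<notin> H r"
  proof (rule ccontr)
    assume "\<not> ?thesis"
    then have "(\<Sum>m\<in>Poly_Mapping.keys f. const (Poly_Mapping.lookup f m) * Poly_Mapping.single m 1) \<in> H r"
      by (intro H_sum H_smult) blast
    then show False using f(3) by (simp add: const_mult_single mpoly_sum_monomials)
  qed
  then obtain m where m: "m \<in> section_keys A \<theta> r" "Poly_Mapping.single m 1 \<notin> H r"
    using f(2) by (auto simp: sections_iff)
  then obtain M where keys: "Poly_Mapping.keys m \<subseteq> vars"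
    and M: "\<And>c l. inx c l \<Longrightarrow> int (expZ m c l) - int (expW m c l) = int r * U c l + M c"
    unfolding section_keys_iff by blast
  define \<sigma> where "\<sigma> c = arg_min_on (\<lambda>l. \<bar>int r * U c l + M c\<bar>) {1..N c}" for c
  have \<sigma>: "chart_index \<sigma>"
  proof (intro allI impI)
    fix c assume "c < k"
    then have "\<sigma> c \<in> {1..N c}" unfolding \<sigma>_def using N by (intro arg_min_if_finite(1)) auto
    then show "1 \<le> \<sigma> c \<and> \<sigma> c \<le> N c" by simp
  qed
  have min: "\<bar>int r * U c (\<sigma> c) + M c\<bar> \<le> \<bar>int r * U c l + M c\<bar>" if "inx c l" for c l
    unfolding \<sigma>_def using that by (intro arg_min_least) auto
  \<comment> \<open>Of two values a < b with |a| at most |b|, the larger one is positive.\<close>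
  have pos: "expZ m c l > 0" if "inx c l" "gexp \<sigma> c l > 0" for c l
  proof -
    have "int r * U c l > int r * U c (\<sigma> c)" using that f(1) by (simp add: gexp_def)
    then have "int r * U c l + M c > 0" using min[OF that(1)] by linarith
    then show ?thesis using M[OF that(1)] by linarith
  qed
  have neg: "expW m c l > 0" if "inx c l" "gexp \<sigma> c l < 0" for c l
  proof -
    have "int r * U c l < int r * U c (\<sigma> c)" using that f(1) by (simp add: gexp_def)
    then have "int r * U c l + M c < 0" using min[OF that(1)] by linarith
    then show ?thesis using M[OF that(1)] by linarith
  qed
  \<comment> \<open>Large enough for the n-th power of \<open>m\<close> to be divisible by
    \<open>gmon \<sigma>\<close>; \<open>Suc\<close> ensures that the degree n r - 1 of the quotient
    is not cut off at zero.\<close>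
  define n where "n = Suc (\<Sum>c<k. \<Sum>l=1..N c. nat \<bar>gexp \<sigma> c l\<bar>)"
  have n: "nat \<bar>gexp \<sigma> c l\<bar> \<le> n" if "inx c l" for c l
  proof -
    have "nat \<bar>gexp \<sigma> c l\<bar> \<le> (\<Sum>l=1..N c. nat \<bar>gexp \<sigma> c l\<bar>)" using that by (intro member_le_sum) auto
    also have "\<dots> \<le> (\<Sum>c<k. \<Sum>l=1..N c. nat \<bar>gexp \<sigma> c l\<bar>)" using that by (intro member_le_sum) auto
    finally show ?thesis by (simp add: n_def)
  qed
  define m' where "m' = mono (\<lambda>c l. n * expZ m c l - nat (gexp \<sigma> c l)) (\<lambda>c l. n * expW m c l - nat (- gexp \<sigma> c l))"
  have leZ: "nat (gexp \<sigma> c l) \<le> n * expZ m c l" if "inx c l" for c l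
  proof (cases "gexp \<sigma> c l > 0")
    case True
    then have "nat (gexp \<sigma> c l) \<le> n" "1 \<le> expZ m c l" using n[OF that] pos[OF that] by auto
    then show ?thesis using mult_le_mono[of "nat (gexp \<sigma> c l)" n 1 "expZ m c l"] by simp
  qed simp
  have leW: "nat (- gexp \<sigma> c l) \<le> n * expW m c l" if "inx c l" for c l
  proof (cases "gexp \<sigma> c l < 0")
    case True
    then have "nat (- gexp \<sigma> c l) \<le> n" "1 \<le> expW m c l" using n[OF that] neg[OF that] by auto
    then show ?thesis using mult_le_mono[of "nat (- gexp \<sigma> c l)" n 1 "expW m c l"] by simp
  qed simp
  have eq: "(\<Sum>i<n. m) = gmon \<sigma> + m'"
  proof (rule monomial_eqI)
    show "Poly_Mapping.keys (\<Sum>i<n. m) \<subseteq> vars" using keys by (intro keys_sum_subset) auto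
    have "Poly_Mapping.keys (gmon \<sigma>) \<subseteq> vars" "Poly_Mapping.keys m' \<subseteq> vars"
      using gmon_key keys_mono by (auto simp: section_keys_iff m'_def)
    then show "Poly_Mapping.keys (gmon \<sigma> + m') \<subseteq> vars" using Poly_Mapping.keys_add[of "gmon \<sigma>" m'] by auto
    fix c l assume i: "inx c l"
    show "expZ (\<Sum>i<n. m) c l = expZ (gmon \<sigma> + m') c l"
      using leZ[OF i] by (simp add: expZ_sum exp_gmon[OF i] m'_def exp_mono[OF i])
    show "expW (\<Sum>i<n. m) c l = expW (gmon \<sigma> + m') c l"
      using leW[OF i] by (simp add: expW_sum exp_gmon[OF i] m'_def exp_mono[OF i])
  qed
  have nr: "1 + (n * r - 1) = n * r" using f(1) by (simp add: n_def)
  have m'_key: "m' \<in> section_keys A \<theta> (n * r - 1)"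
    unfolding section_keys_iff
  proof (intro conjI exI[of _ "\<lambda>c. int n * M c + U c (\<sigma> c)"] allI impI)
    show "Poly_Mapping.keys m' \<subseteq> vars" unfolding m'_def by (rule keys_mono)
    fix c l assume i: "inx c l"
    have r1: "int (n * r - 1) = int n * int r - 1" using nr by (metis add_diff_cancel_left' of_nat_1 of_nat_add of_nat_mult)
    have "int (expZ m' c l) - int (expW m' c l) = int n * (int (expZ m c l) - int (expW m c l)) - gexp \<sigma> c l"
      using leZ[OF i] leW[OF i] by (simp add: m'_def exp_mono[OF i] of_nat_diff algebra_simps)
    also have "\<dots> = int (n * r - 1) * U c l + (int n * M c + U c (\<sigma> c))"
      unfolding M[OF i] gexp_def r1 by (simp add: algebra_simps)
    finally show "int (expZ m' c l) - int (expW m' c l) = int (n * r - 1) * U c l + (int n * M c + U c (\<sigma> c))" .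
  qed
  have pw: "(Poly_Mapping.single m 1 :: zw_poly) ^ j = Poly_Mapping.single (\<Sum>i<j. m) 1" for j
    by (induction j) (simp_all add: mult_single add.commute)
  have "gpol \<sigma> \<notin> H 1"
  proof
    assume "gpol \<sigma> \<in> H 1"
    from H_mult'[OF this sections_single[OF m'_key, of 1]]
    have "Poly_Mapping.single m 1 ^ n \<in> H (n * r)"
      unfolding nr gpol_def mult_single eq[symmetric] pw by simp
    then show False using H_power[OF sections_single[OF m(1)]] m(2) by blast
  qed
  with \<sigma> that show ?thesis by blast
qed

definition zwmon :: "nat \<Rightarrow> nat \<Rightarrow> ((nat + nat) \<Rightarrow>\<^sub>0 nat)" where
  "zwmon c l = mono (\<lambda>c' l'. of_bool (c' = c \<and> l' = l)) (\<lambda>c' l'. of_bool (c' = c \<and> l' = l))"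

lemma exp_zwmon:
  assumes "inx c' l'"
  shows "expZ (zwmon c l) c' l' = of_bool (c' = c \<and> l' = l)" "expW (zwmon c l) c' l' = of_bool (c' = c \<and> l' = l)"
  using assms by (simp_all add: zwmon_def exp_mono)

lemma zwmon_key: "zwmon c l \<in> section_keys A \<theta> 0"
  unfolding section_keys_iff
  using keys_mono by (intro conjI exI[of _ "\<lambda>_. 0"]) (auto simp: zwmon_def exp_mono)

lemma zwmon_eq:
  assumes "inx c l"
  shows "zwmon c l = Poly_Mapping.single (Inl (ix c l)) 1 + Poly_Mapping.single (Inr (ix c l)) 1"
proof -
  have "zwmon c l = Poly_Mapping.single (Zv c l) 1 + Poly_Mapping.single (Wv c l) 1"
  proof (rule monomial_eqI)
    show "Poly_Mapping.keys (zwmon c l) \<subseteq> vars" unfolding zwmon_def by (rule keys_mono)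
    show "Poly_Mapping.keys (Poly_Mapping.single (Zv c l) (1::nat) + Poly_Mapping.single (Wv c l) 1) \<subseteq> vars"
      using Poly_Mapping.keys_add[of "Poly_Mapping.single (Zv c l) (1::nat)" "Poly_Mapping.single (Wv c l) 1"] vars_mem[OF assms]
      by auto
    fix c' l' assume i: "inx c' l'"
    show "expZ (zwmon c l) c' l' = expZ (Poly_Mapping.single (Zv c l) 1 + Poly_Mapping.single (Wv c l) 1) c' l'"
      unfolding exp_zwmon[OF i] unfolding expZ_def lookup_add lookup_single
      using Zv_eq_iff[OF i assms] Zv_neq_Wv[OF i assms] by (auto simp: when_def)
    show "expW (zwmon c l) c' l' = expW (Poly_Mapping.single (Zv c l) 1 + Poly_Mapping.single (Wv c l) 1) c' l'"
      unfolding exp_zwmon[OF i] unfolding expW_def lookup_add lookup_single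
      using Wv_eq_iff[OF i assms] Zv_neq_Wv[OF assms i] by (auto simp: when_def)
  qed
  then show ?thesis by (simp add: Zv_def Wv_def add.commute)
qed

text \<open>Shifts by 1 and -1 cancel where the exponent of \<open>gmon\<close> is nonzero; at
  \<open>\<sigma> b\<close>, where it is zero, they contribute one Z and one W. This yields the
  product of the two coordinates at a point.\<close>

lemma fmon_product:
  assumes "chart_index \<sigma>" "b < k"
  shows "fmon \<sigma> b 1 + fmon \<sigma> b (-1) = gmon \<sigma> + gmon \<sigma> + zwmon b (\<sigma> b)"
proof (rule monomial_eqI)
  have k: "Poly_Mapping.keys (fmon \<sigma> b d) \<subseteq> vars" "Poly_Mapping.keys (gmon \<sigma>) \<subseteq> vars"
     "Poly_Mapping.keys (zwmon b (\<sigma> b)) \<subseteq> vars" for d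
    using fmon_key gmon_key zwmon_key by (auto simp: section_keys_iff)
  show "Poly_Mapping.keys (fmon \<sigma> b 1 + fmon \<sigma> b (-1)) \<subseteq> vars"
    using Poly_Mapping.keys_add[of "fmon \<sigma> b 1" "fmon \<sigma> b (-1)"] k by blast
  show "Poly_Mapping.keys (gmon \<sigma> + gmon \<sigma> + zwmon b (\<sigma> b)) \<subseteq> vars"
    using Poly_Mapping.keys_add[of "gmon \<sigma> + gmon \<sigma>" "zwmon b (\<sigma> b)"] Poly_Mapping.keys_add[of "gmon \<sigma>" "gmon \<sigma>"] k by blast
  fix c l assume i: "inx c l"
  have g: "gexp \<sigma> c l > 0 \<or> gexp \<sigma> c l < 0 \<or> gexp \<sigma> c l = 0 \<and> l = \<sigma> c" using gexp_sign[OF assms(1) i] by linarith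
  have g': "l = \<sigma> c \<Longrightarrow> gexp \<sigma> c l = 0" by (simp add: gexp_def)
  show "expZ (fmon \<sigma> b 1 + fmon \<sigma> b (-1)) c l = expZ (gmon \<sigma> + gmon \<sigma> + zwmon b (\<sigma> b)) c l"
    using g g' by (auto simp: exp_fmon[OF i] exp_gmon[OF i] exp_zwmon[OF i])
  show "expW (fmon \<sigma> b 1 + fmon \<sigma> b (-1)) c l = expW (gmon \<sigma> + gmon \<sigma> + zwmon b (\<sigma> b)) c l"
    using g g' by (auto simp: exp_fmon[OF i] exp_gmon[OF i] exp_zwmon[OF i])
qed

text \<open>Every monomial becomes, after multiplication by a power of \<open>gmon \<sigma>\<close>, a product of the coordinate monomials
  \<open>fmon \<sigma> c 1\<close>, \<open>fmon \<sigma> c (-1)\<close>, of \<open>gmon \<sigma>\<close> and of the \<open>z\<^sub>i w\<^sub>i\<close>.\<close>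

lemma monomial_decomposition:
  assumes \<sigma>: "chart_index \<sigma>" and m: "m \<in> section_keys A \<theta> r"
  obtains t :: "nat \<Rightarrow> nat" and d :: "nat \<Rightarrow> int" and \<kappa> :: "nat \<Rightarrow> nat \<Rightarrow> nat" where "\<And>c. d c = 1 \<or> d c = (-1 :: int)"
    "m + (\<Sum>i<(\<Sum>c<k. t c). gmon \<sigma>) =
      (\<Sum>c<k. \<Sum>i<t c. fmon \<sigma> c (d c)) + (\<Sum>i<r. gmon \<sigma>) + (\<Sum>c<k. \<Sum>l=1..N c. \<Sum>i<\<kappa> c l. zwmon c l)"
proof -
  obtain M where keys: "Poly_Mapping.keys m \<subseteq> vars"
    and M: "\<And>c l. inx c l \<Longrightarrow> int (expZ m c l) - int (expW m c l) = int r * U c l + M c"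
    using m unfolding section_keys_iff by blast
  \<comment> \<open>The exponent difference of \<open>m\<close> at the chart index;
    \<open>t c\<close> coordinate monomials of sign \<open>d c\<close> account for it.\<close>
  define T where "T c = M c + int r * U c (\<sigma> c)" for c
  define t where "t c = nat \<bar>T c\<bar>" for c
  define d where "d c = (if T c \<ge> 0 then 1 else -1 :: int)" for c
  have td: "int (t c) * d c = T c" for c by (simp add: t_def d_def)
  \<comment> \<open>The exponent of the variable that \<open>gmon\<close> does not contain and, at
    the chart index, the smaller of the two exponents: as many pairs Z W are split off.\<close>
  define \<kappa> where "\<kappa> c l = (if l > \<sigma> c \<or> l = \<sigma> c \<and> T c \<ge> 0 then expW m c l else expZ m c l)" for c l
  have k: "Poly_Mapping.keys (fmon \<sigma> b d) \<subseteq> vars" "Poly_Mapping.keys (gmon \<sigma>) \<subseteq> vars"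
     "Poly_Mapping.keys (zwmon b l) \<subseteq> vars" for b d l
    using fmon_key gmon_key zwmon_key by (auto simp: section_keys_iff)
  have add: "Poly_Mapping.keys (a + b) \<subseteq> vars" if "Poly_Mapping.keys a \<subseteq> vars" "Poly_Mapping.keys b \<subseteq> vars"
    for a b :: "(nat + nat) \<Rightarrow>\<^sub>0 nat"
    using Poly_Mapping.keys_add[of a b] that by blast
  have dec: "m + (\<Sum>i<(\<Sum>c<k. t c). gmon \<sigma>) =
      (\<Sum>c<k. \<Sum>i<t c. fmon \<sigma> c (d c)) + (\<Sum>i<r. gmon \<sigma>) + (\<Sum>c<k. \<Sum>l=1..N c. \<Sum>i<\<kappa> c l. zwmon c l)"
  proof (rule monomial_eqI)
    show "Poly_Mapping.keys (m + (\<Sum>i<(\<Sum>c<k. t c). gmon \<sigma>)) \<subseteq> vars"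
      by (intro add keys keys_sum_subset k) simp
    show "Poly_Mapping.keys ((\<Sum>c<k. \<Sum>i<t c. fmon \<sigma> c (d c)) + (\<Sum>i<r. gmon \<sigma>) + (\<Sum>c<k. \<Sum>l=1..N c. \<Sum>i<\<kappa> c l. zwmon c l)) \<subseteq> vars"
      by (intro add keys keys_sum_subset k) simp_all
    fix c l assume i: "inx c l"
    have split: "(\<Sum>c'<k. t c' * F c') = t c * F c + (\<Sum>c'\<in>{..<k} - {c}. t c' * G)"
      if "\<And>c'. c' < k \<Longrightarrow> c' \<noteq> c \<Longrightarrow> F c' = G" for F and G :: nat
      using i that by (subst sum.remove[of _ c]) auto
    have splitT: "(\<Sum>c'<k. t c') = t c + (\<Sum>c'\<in>{..<k} - {c}. t c')"
      using i by (subst sum.remove[of _ c]) auto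
    have zwsum: "(\<Sum>c'<k. \<Sum>l'=1..N c'. \<kappa> c' l' * of_bool (c = c' \<and> l = l')) = \<kappa> c l"
    proof -
      have "(\<Sum>l'=1..N c'. \<kappa> c' l' * of_bool (c = c' \<and> l = l')) = (if c' = c then \<kappa> c l else 0)" for c'
      proof (cases "c' = c")
        case True
        have "(\<Sum>l'=1..N c'. \<kappa> c' l' * of_bool (c = c' \<and> l = l')) = (\<Sum>l'=1..N c. if l' = l then \<kappa> c l else 0)"
          using True by (intro sum.cong) auto
        then show ?thesis using True i by simp
      qed auto
      then show ?thesis using i by simp
    qed
    have zwZ: "expZ (\<Sum>c<k. \<Sum>l=1..N c. \<Sum>i<\<kappa> c l. zwmon c l) c l = \<kappa> c l"
      and zwW: "expW (\<Sum>c<k. \<Sum>l=1..N c. \<Sum>i<\<kappa> c l. zwmon c l) c l = \<kappa> c l"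
      by (simp_all only: expZ_sum expW_sum exp_zwmon[OF i] sum_constant card_lessThan of_nat_id zwsum)
    consider "l > \<sigma> c" "gexp \<sigma> c l > 0" | "l < \<sigma> c" "gexp \<sigma> c l < 0" | "l = \<sigma> c" "gexp \<sigma> c l = 0"
      using gexp_sign[OF \<sigma> i] by linarith
    note cs = this
    have diff: "int (expZ m c l) - int (expW m c l) = int r * gexp \<sigma> c l + T c"
      unfolding M[OF i] gexp_def T_def by (simp add: algebra_simps)
    have keyZ: "expZ m c l + t c * nat (gexp \<sigma> c l) = t c * nat (gexp \<sigma> c l + d c) + r * nat (gexp \<sigma> c l) + \<kappa> c l"
      and keyW: "expW m c l + t c * nat (- gexp \<sigma> c l) = t c * nat (- (gexp \<sigma> c l + d c)) + r * nat (- gexp \<sigma> c l) + \<kappa> c l"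
    proof -
      have "(expZ m c l + t c * nat (gexp \<sigma> c l) = t c * nat (gexp \<sigma> c l + d c) + r * nat (gexp \<sigma> c l) + \<kappa> c l) \<and>
        (expW m c l + t c * nat (- gexp \<sigma> c l) = t c * nat (- (gexp \<sigma> c l + d c)) + r * nat (- gexp \<sigma> c l) + \<kappa> c l)"
      proof (cases rule: cs)
        case 1
        have "gexp \<sigma> c l + d c \<ge> 0" using 1(2) by (simp add: d_def)
        moreover have "int (expZ m c l) + int (t c) * gexp \<sigma> c l =
            int (t c) * (gexp \<sigma> c l + d c) + int r * gexp \<sigma> c l + int (expW m c l)"
          using diff td[of c] by (simp add: algebra_simps)
        then have "int (expZ m c l + t c * nat (gexp \<sigma> c l)) =
            int (t c * nat (gexp \<sigma> c l + d c) + r * nat (gexp \<sigma> c l) + expW m c l)"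
          using calculation 1(2) by simp
        ultimately show ?thesis using 1 unfolding \<kappa>_def of_nat_eq_iff by simp
      next
        case 2
        have "gexp \<sigma> c l + d c \<le> 0" using 2(2) by (simp add: d_def)
        moreover have "int (expW m c l) - int (t c) * gexp \<sigma> c l =
            - (int (t c) * (gexp \<sigma> c l + d c)) - int r * gexp \<sigma> c l + int (expZ m c l)"
          using diff td[of c] by (simp add: algebra_simps)
        then have "int (expW m c l + t c * nat (- gexp \<sigma> c l)) =
            int (t c * nat (- (gexp \<sigma> c l + d c)) + r * nat (- gexp \<sigma> c l) + expZ m c l)"
          using calculation 2(2) by (simp add: algebra_simps)
        ultimately show ?thesis using 2 unfolding \<kappa>_def of_nat_eq_iff by simp
      next
        case 3
        have "int (expZ m c l) - int (expW m c l) = T c" using diff 3 by simp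
        then show ?thesis using 3 by (auto simp: \<kappa>_def d_def t_def)
      qed
      then show "expZ m c l + t c * nat (gexp \<sigma> c l) = t c * nat (gexp \<sigma> c l + d c) + r * nat (gexp \<sigma> c l) + \<kappa> c l"
        "expW m c l + t c * nat (- gexp \<sigma> c l) = t c * nat (- (gexp \<sigma> c l + d c)) + r * nat (- gexp \<sigma> c l) + \<kappa> c l"
        by blast+
    qed
    have "(\<Sum>c'<k. t c' * expZ (fmon \<sigma> c' (d c')) c l) =
       t c * nat (gexp \<sigma> c l + d c) + (\<Sum>c'\<in>{..<k} - {c}. t c' * nat (gexp \<sigma> c l))"
      by (subst split[of _ "nat (gexp \<sigma> c l)"]) (auto simp: exp_fmon[OF i])
    then show "expZ (m + (\<Sum>i<(\<Sum>c<k. t c). gmon \<sigma>)) c l = expZ ((\<Sum>c<k. \<Sum>i<t c. fmon \<sigma> c (d c)) + (\<Sum>i<r. gmon \<sigma>) +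
       (\<Sum>c<k. \<Sum>l=1..N c. \<Sum>i<\<kappa> c l. zwmon c l)) c l"
      unfolding expZ_add zwZ
      using keyZ by (simp add: expZ_sum exp_gmon[OF i] splitT add_mult_distrib sum_distrib_right del: One_nat_def)
    have "(\<Sum>c'<k. t c' * expW (fmon \<sigma> c' (d c')) c l) =
       t c * nat (- (gexp \<sigma> c l + d c)) + (\<Sum>c'\<in>{..<k} - {c}. t c' * nat (- gexp \<sigma> c l))"
      by (subst split[of _ "nat (- gexp \<sigma> c l)"]) (auto simp: exp_fmon[OF i])
    then show "expW (m + (\<Sum>i<(\<Sum>c<k. t c). gmon \<sigma>)) c l = expW ((\<Sum>c<k. \<Sum>i<t c. fmon \<sigma> c (d c)) + (\<Sum>i<r. gmon \<sigma>) +
       (\<Sum>c<k. \<Sum>l=1..N c. \<Sum>i<\<kappa> c l. zwmon c l)) c l"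
      unfolding expW_add zwW
      using keyW by (simp add: expW_sum exp_gmon[OF i] splitT add_mult_distrib sum_distrib_right del: One_nat_def)
  qed
  have d: "d c = 1 \<or> d c = -1" for c by (simp add: d_def)
  show ?thesis by (rule that[of d t \<kappa>], rule d, rule dec)
qed

text \<open>The coordinates are read off as signed values of \<open>fmon / gmon\<close>. Monomials
  on which \<open>p\<close> and the resulting chart point agree are closed under products and
  include all factors of \<open>monomial_decomposition\<close>, so \<open>eq_point_ideal\<close>
  applies.\<close>

lemma hk_in_hchart:
  assumes hkp: "p \<in> hk_points A \<theta>" and \<sigma>: "chart_index \<sigma>" and g: "gpol \<sigma> \<notin> hpart p A \<theta> 1"
  shows "\<exists>x\<in>coords k. p = hchart \<sigma> x"
proof -
  have pp: "p \<in> proj_points A \<theta>" using hkp by (simp add: hk_points_def)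
  interpret proj_point A \<theta> p by (rule proj_pointI[OF \<theta>_carrier pp])
  let ?G = "gpol \<sigma>"
  have G: "?G ^ r \<in> S r" "?G ^ r \<notin> H r" for r
    using sections_power[OF \<theta>_carrier gpol_section, of \<sigma> r] H_power[OF gpol_section, of \<sigma> r] g by auto
  define \<phi> where "\<phi> r m = val r (?G ^ r) (Poly_Mapping.single m 1)" for r m
  have \<phi>_add: "\<phi> (r + s) (m + m') = \<phi> r m * \<phi> s m'" if "m \<in> section_keys A \<theta> r" "m' \<in> section_keys A \<theta> s" for r s m m'
    unfolding \<phi>_def power_add
    using val_mult[OF G(1) G(2) G(1) G(2) sections_single[OF that(1), of 1] sections_single[OF that(2), of 1]]
    by (simp add: mult_single)
  have \<phi>_g: "\<phi> 1 (gmon \<sigma>) = 1"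
    unfolding \<phi>_def using val_self[OF G[of 1]] by (simp add: gpol_def)
  \<comment> \<open>Membership in Y enters here: the values of the
    \<open>z\<^sub>i w\<^sub>i\<close> form a kernel vector, with a single parameter for each
    class.\<close>
  obtain t where t: "\<forall>c<k. \<forall>l\<in>{1..N c}. zw_val A \<theta> p (ix c l) = of_int (\<epsilon> (ix c l)) * t c"
    using hkp kernel[of "zw_val A \<theta> p"] unfolding hk_points_zw_val[OF \<theta>_carrier] by blast
  have \<phi>_zw: "\<phi> 0 (zwmon c l) = of_int (e c l) * t c" if "inx c l" for c l
    using t that unfolding \<phi>_def zwmon_eq[OF that] zw_val_def[OF \<theta>_carrier] zw_eq_single[OF \<theta>_carrier] e_def by simp
  define x where "x = (\<lambda>c\<in>{..<k}. (of_int (e c (\<sigma> c) * eta c (\<sigma> c)) * \<phi> 1 (fmon \<sigma> c (-1)),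
     of_int (eta c (\<sigma> c)) * \<phi> 1 (fmon \<sigma> c 1)))"
  have xk: "x \<in> coords k" by (simp add: x_def coords_def)
  have x: "fst (x c) = of_int (e c (\<sigma> c) * eta c (\<sigma> c)) * \<phi> 1 (fmon \<sigma> c (-1))"
    "snd (x c) = of_int (eta c (\<sigma> c)) * \<phi> 1 (fmon \<sigma> c 1)" if "c < k" for c
    using that by (simp_all add: x_def)
  define v where "v = chart_point \<sigma> x"
  define Eq where "Eq r m \<longleftrightarrow> m \<in> section_keys A \<theta> r \<and> \<phi> r m = eval_monomial v m" for r m
  have Eq_add: "Eq (r + s) (m + m')" if "Eq r m" "Eq s m'" for r s m m'
    using that section_keys_add[OF \<theta>_carrier] \<phi>_add by (simp add: Eq_def eval_monomial_add)
  have Eq_0: "Eq 0 0"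
    unfolding Eq_def \<phi>_def using zero_in_section_keys[OF \<theta>_carrier] val_self[OF sections_1[OF \<theta>_carrier] H_one] by simp
  have Eq_sum: "Eq (\<Sum>i\<in>I. r i) (\<Sum>i\<in>I. m i)" if "\<And>i. i \<in> I \<Longrightarrow> Eq (r i) (m i)" for I :: "nat set" and r m
    using that by (induction I rule: infinite_finite_induct) (auto intro: Eq_add Eq_0)
  have eval_g: "eval_monomial v (gmon \<sigma>) = 1"
    using eval_gpol[OF \<sigma>, of x] by (simp add: gpol_def eval_mpoly_single v_def)
  have Eq_g: "Eq 1 (gmon \<sigma>)" unfolding Eq_def using gmon_key \<phi>_g eval_g by simp
  have eta2: "(of_int (eta c j) :: complex) * of_int (eta c j) = 1" for c j using eta[of c j] by auto
  have e2: "(of_int (e c j) :: complex) * of_int (e c j) = 1" for c j using e[of c j] by auto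
  have Eq_f: "Eq 1 (fmon \<sigma> c d)" if c: "c < k" and d: "d = 1 \<or> d = -1" for c d
  proof -
    have "eval_monomial v (fmon \<sigma> c d) = \<phi> 1 (fmon \<sigma> c d)"
      using d eval_fpol[OF \<sigma> c, of x] eta2[of c "\<sigma> c"] e2[of c "\<sigma> c"]
      by (auto simp: fpol_def eval_mpoly_single v_def x[OF c]) (metis mult.assoc mult.commute mult.left_neutral)+
    then show ?thesis unfolding Eq_def using fmon_key by simp
  qed
  have Eq_zw: "Eq 0 (zwmon c l)" if i: "inx c l" for c l
  proof -
    have isg: "inx c (\<sigma> c)" using i \<sigma> by simp
    have "\<phi> (1 + 1) (fmon \<sigma> c 1 + fmon \<sigma> c (-1)) = \<phi> 1 (fmon \<sigma> c 1) * \<phi> 1 (fmon \<sigma> c (-1))"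
      by (rule \<phi>_add[OF fmon_key fmon_key])
    moreover have "\<phi> (1 + 1 + 0) (gmon \<sigma> + gmon \<sigma> + zwmon c (\<sigma> c)) = of_int (e c (\<sigma> c)) * t c"
      using \<phi>_add[OF section_keys_add[OF \<theta>_carrier gmon_key gmon_key] zwmon_key, of \<sigma> \<sigma> c "\<sigma> c"]
        \<phi>_add[OF gmon_key gmon_key, of \<sigma> \<sigma>] \<phi>_g \<phi>_zw[OF isg] by simp
    ultimately have "\<phi> 1 (fmon \<sigma> c 1) * \<phi> 1 (fmon \<sigma> c (-1)) = of_int (e c (\<sigma> c)) * t c"
      using fmon_product[OF \<sigma>, of c] i by simp
    moreover have "fst (x c) * snd (x c) = of_int (e c (\<sigma> c)) * (of_int (eta c (\<sigma> c)) * of_int (eta c (\<sigma> c))) *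
      (\<phi> 1 (fmon \<sigma> c 1) * \<phi> 1 (fmon \<sigma> c (-1)))"
      using i by (simp add: x)
    ultimately have "fst (x c) * snd (x c) = (of_int (e c (\<sigma> c)) * of_int (e c (\<sigma> c))) * t c"
      by (simp add: eta2)
    \<comment> \<open>The product of the coordinates is the class parameter, so all products Z W of
      the class have the same value at \<open>p\<close> and at the chart point.\<close>
    then have xt: "fst (x c) * snd (x c) = t c" by (simp add: e2)
    have "eval_monomial v (zwmon c l) = v (Zv c l) * v (Wv c l)"
      unfolding zwmon_eq[OF i] eval_monomial_add eval_monomial_single by (simp add: Zv_def Wv_def)
    also have "\<dots> = \<phi> 0 (zwmon c l)" unfolding \<phi>_zw[OF i] v_def cox_mult[OF i] xt ..
    finally show ?thesis unfolding Eq_def using zwmon_key by simp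
  qed
  have "p = point_ideal A \<theta> v"
  proof (rule eq_point_ideal[OF gpol_section g])
    fix r m assume m: "m \<in> section_keys A \<theta> r"
    obtain t :: "nat \<Rightarrow> nat" and d :: "nat \<Rightarrow> int" and \<kappa> :: "nat \<Rightarrow> nat \<Rightarrow> nat" where d: "\<And>c. d c = 1 \<or> d c = (-1 :: int)"
      and dec: "m + (\<Sum>i<(\<Sum>c<k. t c). gmon \<sigma>) =
      (\<Sum>c<k. \<Sum>i<t c. fmon \<sigma> c (d c)) + (\<Sum>i<r. gmon \<sigma>) + (\<Sum>c<k. \<Sum>l=1..N c. \<Sum>i<\<kappa> c l. zwmon c l)"
      by (rule monomial_decomposition[OF \<sigma> m], rule that)
    let ?T = "\<Sum>c<k. t c"
    have "Eq ((\<Sum>c<k. \<Sum>i<t c. 1) + (\<Sum>i<r. 1) + (\<Sum>c<k. \<Sum>l=1..N c. \<Sum>i<\<kappa> c l. 0))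
      ((\<Sum>c<k. \<Sum>i<t c. fmon \<sigma> c (d c)) + (\<Sum>i<r. gmon \<sigma>) + (\<Sum>c<k. \<Sum>l=1..N c. \<Sum>i<\<kappa> c l. zwmon c l))"
      by (intro Eq_add Eq_sum Eq_f Eq_g Eq_zw d) auto
    then have E1: "\<phi> (r + ?T) (m + (\<Sum>i<?T. gmon \<sigma>)) = eval_monomial v (m + (\<Sum>i<?T. gmon \<sigma>))"
      unfolding dec[symmetric] Eq_def by (simp add: add.commute)
    have "Eq (\<Sum>i<?T. 1) (\<Sum>i<?T. gmon \<sigma>)" by (intro Eq_sum Eq_g)
    then have E2: "(\<Sum>i<?T. gmon \<sigma>) \<in> section_keys A \<theta> ?T" "\<phi> ?T (\<Sum>i<?T. gmon \<sigma>) = eval_monomial v (\<Sum>i<?T. gmon \<sigma>)"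
      by (simp_all add: Eq_def)
    have "eval_monomial v (\<Sum>i<n. gmon \<sigma>) = 1" for n :: nat
      by (induction n) (simp_all add: eval_monomial_add eval_g)
    \<comment> \<open>The power of \<open>gmon \<sigma>\<close> added in the decomposition has value
      1 and can be cancelled.\<close>
    with E1 E2(2) have "\<phi> r m = eval_monomial v m"
      unfolding \<phi>_add[OF m E2(1)] eval_monomial_add by simp
    then show "val r (?G ^ r) (Poly_Mapping.single m 1) = eval_monomial v m" by (simp add: \<phi>_def)
  qed
  then show ?thesis using xk unfolding v_def hchart_def by blast
qed

end

lemma (in proj_point) val_point_ideal:
  assumes "p = point_ideal A \<theta> v" "f \<in> S r" "g \<in> S r" "eval_mpoly v g \<noteq> 0"
  shows "val r g f = eval_mpoly v f / eval_mpoly v g"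
proof -
  have g: "g \<notin> H r" using assms by (simp add: hpart_point_ideal)
  show ?thesis unfolding val_iff[OF assms(3) g assms(2)]
    using assms by (simp add: hpart_point_ideal sections_diff sections_smult[OF \<theta>] eval_mpoly_diff eval_mpoly_mult)
qed

text \<open>Moving all coordinates by the same parameter \<open>t\<close> gives a line along which polynomials are continuous and all
  but finitely many points have nonzero coordinates.\<close>

lemma coord_torus_dense:
  assumes V: "openin (zariski (coord_space k)) V" and y: "y \<in> V"
  shows "\<exists>x\<in>V. \<forall>c<k. fst (x c) \<noteq> 0 \<and> snd (x c) \<noteq> 0"
proof -
  define \<gamma> where "\<gamma> t = (\<lambda>c\<in>{..<k}. (fst (y c) + t, snd (y c) + t))" for t :: complex
  have \<gamma>k: "\<gamma> t \<in> coords k" for t by (simp add: \<gamma>_def coords_def)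
  have cont: "continuous_on UNIV (\<lambda>t. f (\<gamma> t))" if "f \<in> polys k" for f
    using that
  proof induction
    case (fst i)
    then show ?case by (auto simp: \<gamma>_def intro!: continuous_intros)
  next
    case (snd i)
    then show ?case by (auto simp: \<gamma>_def intro!: continuous_intros)
  qed (auto intro!: continuous_intros)
  have "openin euclidean {t \<in> UNIV. \<gamma> t \<in> V}"
  proof (rule openin_generated_preimage[OF _ V[unfolded coord_space_def]])
    fix W f assume "(W, f) \<in> {(coords k, f) |f. f \<in> polys k}"
    then have "W = coords k" "f \<in> polys k" by auto
    then show "openin euclidean {t \<in> UNIV. \<gamma> t \<in> W \<and> f (\<gamma> t) \<noteq> 0}"
      using cont[of f] \<gamma>k by (simp add: open_Collect_neq)
  qed
  then have "open {t. \<gamma> t \<in> V}" by simp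
  moreover have "0 \<in> {t. \<gamma> t \<in> V}"
  proof -
    have "y \<in> coords k" using y openin_subset[OF V] by auto
    then have "\<gamma> 0 = y" by (auto simp: \<gamma>_def coords_def PiE_def extensional_def fun_eq_iff)
    then show ?thesis using y by simp
  qed
  ultimately have "infinite {t. \<gamma> t \<in> V}" using finite_imp_not_open by blast
  moreover have "finite ((\<lambda>c. - fst (y c)) ` {..<k} \<union> (\<lambda>c. - snd (y c)) ` {..<k})" by simp
  ultimately have "\<not> {t. \<gamma> t \<in> V} \<subseteq> (\<lambda>c. - fst (y c)) ` {..<k} \<union> (\<lambda>c. - snd (y c)) ` {..<k}"
    using finite_subset by blast
  then obtain t where t: "\<gamma> t \<in> V" "t \<notin> (\<lambda>c. - fst (y c)) ` {..<k} \<union> (\<lambda>c. - snd (y c)) ` {..<k}"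
    by blast
  have "fst (\<gamma> t c) \<noteq> 0 \<and> snd (\<gamma> t c) \<noteq> 0" if "c < k" for c
    using t(2) that by (auto simp: \<gamma>_def add_eq_0_iff image_iff)
  then show ?thesis using t(1) by blast
qed

section \<open>Y as a space with an atlas\<close>

context circuit_matrix
begin

abbreviation "hk_basis \<equiv> {(W \<inter> hk_points A \<theta>, f) |W f. (W, f) \<in> lawrence_basis A \<theta>}"

lemma hk_basisI: "(W, f) \<in> lawrence_basis A \<theta> \<Longrightarrow> (W \<inter> hk_points A \<theta>, f) \<in> hk_basis"
  by auto

lemma hchart_image:
  assumes "chart_index \<sigma>"
  shows "hchart \<sigma> ` coords k = {p \<in> proj_points A \<theta>. monom (gpol \<sigma>) 1 \<notin> p} \<inter> hk_points A \<theta>"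
proof
  show "hchart \<sigma> ` coords k \<subseteq> {p \<in> proj_points A \<theta>. monom (gpol \<sigma>) 1 \<notin> p} \<inter> hk_points A \<theta>"
  proof
    fix p assume "p \<in> hchart \<sigma> ` coords k"
    then obtain x where x: "p = hchart \<sigma> x" by blast
    have "monom (gpol \<sigma>) 1 \<notin> p"
      unfolding x hchart_def monom_point_ideal[OF gpol_section] by (simp add: eval_gpol[OF assms])
    then show "p \<in> {p \<in> proj_points A \<theta>. monom (gpol \<sigma>) 1 \<notin> p} \<inter> hk_points A \<theta>"
      using hchart_proj[OF assms] hchart_hk[OF assms] x by blast
  qed
  show "{p \<in> proj_points A \<theta>. monom (gpol \<sigma>) 1 \<notin> p} \<inter> hk_points A \<theta> \<subseteq> hchart \<sigma> ` coords k"
  proof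
    fix p assume p: "p \<in> {p \<in> proj_points A \<theta>. monom (gpol \<sigma>) 1 \<notin> p} \<inter> hk_points A \<theta>"
    then have "gpol \<sigma> \<notin> hpart p A \<theta> 1" "p \<in> hk_points A \<theta>" by (auto simp: hpart_def)
    then show "p \<in> hchart \<sigma> ` coords k" using hk_in_hchart[OF _ assms] by blast
  qed
qed

lemma eval_chart_point_polys:
  assumes "f \<in> sections A \<theta> r"
  shows "(\<lambda>x. eval_mpoly (chart_point \<sigma> x) f) \<in> polys k"
proof -
  have "(\<lambda>x. eval_monomial (chart_point \<sigma> x) m) \<in> polys k" if "m \<in> Poly_Mapping.keys f" for m
  proof -
    have "m \<in> section_keys A \<theta> r" using assms that by (auto simp: sections_iff)
    then have m: "Poly_Mapping.keys m \<subseteq> vars" by (simp add: section_keys_iff)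
    have Z: "(\<lambda>x. chart_point \<sigma> x (Zv c l)) \<in> polys k" if "inx c l" for c l
      unfolding chart_point_simps[OF that] using that
      by (cases l "\<sigma> c" rule: linorder_cases) (auto simp: cox_Z_def intro!: polys.intros)
    have W: "(\<lambda>x. chart_point \<sigma> x (Wv c l)) \<in> polys k" if "inx c l" for c l
      unfolding chart_point_simps[OF that] using that
      by (cases l "\<sigma> c" rule: linorder_cases) (auto simp: cox_W_def intro!: polys.intros)
    show ?thesis unfolding eval_monomial_vars[OF m]
      by (intro polys_prod polys.mult polys_power Z W) auto
  qed
  then show ?thesis unfolding eval_mpoly_superset[OF finite_keys subset_refl]
    by (intro polys_sum polys.mult polys.const)
qed

lemma hchart_morphism:
  assumes \<sigma>: "chart_index \<sigma>"
  shows "morphism (coord_space k) (generated_space hk_basis) (hchart \<sigma>)"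
proof (rule morphism_coord_generated)
  have *: "openin (zariski (coord_space k)) {x \<in> coords k. hchart \<sigma> x \<in> W} \<and>
     regular (coord_space k) {x \<in> coords k. hchart \<sigma> x \<in> W} (\<lambda>x. h (hchart \<sigma> x))"
    if Wh: "(W, h) \<in> hk_basis" for W h
  proof -
    obtain W0 where W0: "W = W0 \<inter> hk_points A \<theta>" "(W0, h) \<in> lawrence_basis A \<theta>"
      using Wh unfolding mem_Collect_eq prod.inject by iprover
    obtain r f g where 1: "f \<in> sections A \<theta> r" "g \<in> sections A \<theta> r" "W0 = {p \<in> proj_points A \<theta>. monom g r \<notin> p}"
      "\<And>p. p \<in> W0 \<Longrightarrow> monom (f - const (h p) * g) r \<in> p"
      by (rule lawrence_basisE[OF W0(2)], rule that)
    let ?F = "\<lambda>x. eval_mpoly (chart_point \<sigma> x) f" and ?G = "\<lambda>x. eval_mpoly (chart_point \<sigma> x) g"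
    have set: "{x \<in> coords k. hchart \<sigma> x \<in> W} = {x \<in> coords k. ?G x \<noteq> 0}"
      unfolding W0(1) 1(3) using hchart_hk[OF \<sigma>] hchart_proj[OF \<sigma>]
      by (auto simp: hchart_def monom_point_ideal[OF 1(2)])
    have o: "openin (zariski (coord_space k)) {x \<in> coords k. ?G x \<noteq> 0}"
      by (rule openin_polys_nonzero[OF eval_chart_point_polys[OF 1(2)]])
    have "regular (coord_space k) {x \<in> coords k. ?G x \<noteq> 0} (\<lambda>x. ?F x / ?G x)"
      by (intro regular_coord_divide regular_coord_polys[OF eval_chart_point_polys[OF 1(1)] o]
          regular_coord_polys[OF eval_chart_point_polys[OF 1(2)] o]) auto
    moreover have "h (hchart \<sigma> x) = ?F x / ?G x" if "x \<in> {x \<in> coords k. ?G x \<noteq> 0}" for x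
    proof -
      have "hchart \<sigma> x \<in> W0" using that hchart_proj[OF \<sigma>] unfolding 1(3)
        by (auto simp: hchart_def monom_point_ideal[OF 1(2)])
      from 1(4)[OF this] have "eval_mpoly (chart_point \<sigma> x) (f - const (h (hchart \<sigma> x)) * g) = 0"
        using monom_point_ideal[OF sections_diff[OF 1(1) sections_smult[OF \<theta>_carrier 1(2)]]] unfolding hchart_def by blast
      then show ?thesis using that by (simp add: eval_mpoly_diff eval_mpoly_mult field_simps)
    qed
    then have "regular (coord_space k) {x \<in> coords k. ?G x \<noteq> 0} (\<lambda>x. h (hchart \<sigma> x)) =
      regular (coord_space k) {x \<in> coords k. ?G x \<noteq> 0} (\<lambda>x. ?F x / ?G x)"
      by (rule sheaf_cong[OF sheaf_coord_space])
    ultimately show ?thesis unfolding set using o by simp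
  qed
  show "openin (zariski (coord_space k)) {x \<in> coords k. hchart \<sigma> x \<in> W}" if "(W, h) \<in> hk_basis" for W h
    using *[OF that] by blast
  show "regular (coord_space k) {x \<in> coords k. hchart \<sigma> x \<in> W} (\<lambda>x. h (hchart \<sigma> x))" if "(W, h) \<in> hk_basis" for W h
    using *[OF that] by blast
  show "hchart \<sigma> x \<in> points (generated_space hk_basis)" for x
  proof -
    have "{p \<in> proj_points A \<theta> \<inter> hk_points A \<theta>. (1::complex) \<noteq> 0} \<subseteq> points (generated_space hk_basis)"
      by (rule openin_subset[OF openin_generated_basic[OF hk_basisI[OF lawrence_basis_all[OF \<theta>_carrier]]]])
    then show ?thesis by (rule subsetD) (simp add: hchart_hk[OF \<sigma>] hchart_proj[OF \<sigma>])
  qed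
qed

text \<open>Coordinates are \<open>fpol / gpol\<close> up to signs that square to 1; constants, sums
  and products stay basic functions on the same locus by \<open>lawrence_combine\<close>.\<close>

lemma hchart_polys:
  assumes \<sigma>: "chart_index \<sigma>" and q: "q \<in> polys k"
  shows "\<exists>h. ({p \<in> proj_points A \<theta>. monom (gpol \<sigma>) 1 \<notin> p}, h) \<in> lawrence_basis A \<theta> \<and> (\<forall>x\<in>coords k. h (hchart \<sigma> x) = q x)"
    (is "\<exists>h. (?W, h) \<in> _ \<and> _")
  using q
proof induction
  case (const a)
  have "(proj_points A \<theta> \<inter> ?W, \<lambda>_. a) \<in> lawrence_basis A \<theta>"
    by (rule lawrence_combine(1)[OF \<theta>_carrier lawrence_basis_all[OF \<theta>_carrier] lawrence_basis_val[OF \<theta>_carrier gpol_section gpol_section]])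
  moreover have "proj_points A \<theta> \<inter> ?W = ?W" by blast
  ultimately show ?case by (intro exI[of _ "\<lambda>_. a"]) simp
next
  case (fst i)
  let ?f = "const (of_int (e i (\<sigma> i) * eta i (\<sigma> i))) * fpol \<sigma> i (-1)"
  have f: "?f \<in> sections A \<theta> 1" by (rule sections_smult[OF \<theta>_carrier fpol_section])
  have ee: "(of_int (e i (\<sigma> i) * eta i (\<sigma> i)) :: complex) * of_int (e i (\<sigma> i) * eta i (\<sigma> i)) = 1"
    using e[of i "\<sigma> i"] eta[of i "\<sigma> i"] by auto
  have "proj_point.val A \<theta> (hchart \<sigma> x) 1 (gpol \<sigma>) ?f = fst (x i)" for x
  proof -
    interpret proj_point A \<theta> "hchart \<sigma> x" by (rule proj_pointI[OF \<theta>_carrier hchart_proj[OF \<sigma>]])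
    have "val 1 (gpol \<sigma>) ?f = eval_mpoly (chart_point \<sigma> x) ?f / eval_mpoly (chart_point \<sigma> x) (gpol \<sigma>)"
      by (rule val_point_ideal[OF hchart_def f gpol_section]) (simp add: eval_gpol[OF \<sigma>])
    also have "\<dots> = (of_int (e i (\<sigma> i) * eta i (\<sigma> i)) * of_int (e i (\<sigma> i) * eta i (\<sigma> i))) * fst (x i)"
      by (simp only: eval_gpol[OF \<sigma>] eval_mpoly_mult eval_mpoly_const eval_fpol[OF \<sigma> fst] mult.assoc div_by_1)
    finally show ?thesis unfolding ee by simp
  qed
  then show ?case using lawrence_basis_val[OF \<theta>_carrier f gpol_section] by blast
next
  case (snd i)
  let ?f = "const (of_int (eta i (\<sigma> i))) * fpol \<sigma> i 1"
  have f: "?f \<in> sections A \<theta> 1" by (rule sections_smult[OF \<theta>_carrier fpol_section])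
  have ee: "(of_int (eta i (\<sigma> i)) :: complex) * of_int (eta i (\<sigma> i)) = 1"
    using eta[of i "\<sigma> i"] by auto
  have "proj_point.val A \<theta> (hchart \<sigma> x) 1 (gpol \<sigma>) ?f = snd (x i)" for x
  proof -
    interpret proj_point A \<theta> "hchart \<sigma> x" by (rule proj_pointI[OF \<theta>_carrier hchart_proj[OF \<sigma>]])
    have "val 1 (gpol \<sigma>) ?f = eval_mpoly (chart_point \<sigma> x) ?f / eval_mpoly (chart_point \<sigma> x) (gpol \<sigma>)"
      by (rule val_point_ideal[OF hchart_def f gpol_section]) (simp add: eval_gpol[OF \<sigma>])
    also have "\<dots> = (of_int (eta i (\<sigma> i)) * of_int (eta i (\<sigma> i))) * snd (x i)"
      by (simp only: eval_gpol[OF \<sigma>] eval_mpoly_mult eval_mpoly_const eval_fpol[OF \<sigma> snd] mult.assoc div_by_1)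
    finally show ?thesis unfolding ee by simp
  qed
  then show ?case using lawrence_basis_val[OF \<theta>_carrier f gpol_section] by blast
next
  case (add f g)
  then obtain h h' where *: "(?W, h) \<in> lawrence_basis A \<theta>" "\<forall>x\<in>coords k. h (hchart \<sigma> x) = f x"
    "(?W, h') \<in> lawrence_basis A \<theta>" "\<forall>x\<in>coords k. h' (hchart \<sigma> x) = g x" by (elim exE conjE)
  show ?case using lawrence_combine(2)[OF \<theta>_carrier *(1,3)] *(2,4)
    by (intro exI[of _ "\<lambda>p. h p + h' p"]) simp
next
  case (mult f g)
  then obtain h h' where *: "(?W, h) \<in> lawrence_basis A \<theta>" "\<forall>x\<in>coords k. h (hchart \<sigma> x) = f x"
    "(?W, h') \<in> lawrence_basis A \<theta>" "\<forall>x\<in>coords k. h' (hchart \<sigma> x) = g x" by (elim exE conjE)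
  show ?case using lawrence_combine(3)[OF \<theta>_carrier *(1,3)] *(2,4)
    by (intro exI[of _ "\<lambda>p. h p * h' p"]) simp
qed

lemma hchart_coord_chart:
  assumes \<sigma>: "chart_index \<sigma>"
  shows "coord_chart k (generated_space hk_basis) (hchart \<sigma>)"
proof (rule coord_chart_generated[OF hchart_morphism[OF \<sigma>]])
  show "inj_on (hchart \<sigma>) (coords k)"
  proof (rule inj_onI)
    fix x y assume "x \<in> coords k" "y \<in> coords k" "hchart \<sigma> x = hchart \<sigma> y"
    then show "x = y" using hchart_inj[OF \<sigma>] unfolding coords_def by (intro PiE_ext) auto
  qed
  fix q assume "q \<in> polys k"
  from hchart_polys[OF \<sigma> this] obtain h where
    h: "({p \<in> proj_points A \<theta>. monom (gpol \<sigma>) 1 \<notin> p}, h) \<in> lawrence_basis A \<theta>" "\<forall>x\<in>coords k. h (hchart \<sigma> x) = q x"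
    by (elim exE conjE)
  from hk_basisI[OF h(1)] h(2) show "\<exists>h. (hchart \<sigma> ` coords k, h) \<in> hk_basis \<and> (\<forall>x\<in>coords k. h (hchart \<sigma> x) = q x)"
    unfolding hchart_image[OF \<sigma>] by (intro exI[of _ h] conjI)
qed

lemma chart_index_iff: "\<sigma> \<in> PiE {..<k} (\<lambda>c. {1..N c}) \<Longrightarrow> chart_index \<sigma>"
  by (auto simp: PiE_iff)

lemma hk_points_covered:
  assumes "p \<in> hk_points A \<theta>"
  shows "\<exists>\<sigma>\<in>PiE {..<k} (\<lambda>c. {1..N c}). \<exists>x\<in>coords k. p = hchart \<sigma> x"
proof -
  obtain \<sigma> where \<sigma>: "chart_index \<sigma>" "gpol \<sigma> \<notin> hpart p A \<theta> 1" using hk_chart_exists[OF assms] by blast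
  obtain x where x: "x \<in> coords k" "p = hchart \<sigma> x" using hk_in_hchart[OF assms \<sigma>] by blast
  \<comment> \<open>The chart index is made extensional to match the index set of the ALE atlas; the
    charts depend on its values below \<open>k\<close> only.\<close>
  have "chart_index (restrict \<sigma> {..<k})" using \<sigma>(1) by simp
  moreover have "hchart \<sigma> x = hchart (restrict \<sigma> {..<k}) x"
    by (rule hchart_eqI[OF \<sigma>(1) calculation]) (simp add: cox_equiv_refl)
  moreover have "restrict \<sigma> {..<k} \<in> PiE {..<k} (\<lambda>c. {1..N c})" using \<sigma>(1) by auto
  ultimately show ?thesis using x by blast
qed

text \<open>In either atlas, two chart points coincide exactly when they are
  \<open>cox_equiv\<close> in every class.\<close>

theorem circuit_isomorphic:
  "isomorphic (toric_hyperkaehler A \<theta>) (product_fspace k (\<lambda>i. ale_space (N i)))"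
  unfolding hyperkaehler_generated[OF \<theta>_carrier]
proof (rule coord_atlas_isomorphic[OF sheaf_generated _ sheaf_product ale_product_atlas])
  show "coord_atlas k (generated_space hk_basis) (PiE {..<k} (\<lambda>i. {1..N i})) hchart"
    unfolding coord_atlas_def
  proof (intro conjI ballI)
    fix \<sigma> assume "\<sigma> \<in> PiE {..<k} (\<lambda>i. {1..N i})"
    then show "coord_chart k (generated_space hk_basis) (hchart \<sigma>)"
      by (intro hchart_coord_chart chart_index_iff)
  next
    have "points (generated_space hk_basis) \<subseteq> hk_points A \<theta>" unfolding points_generated by blast
    then show "points (generated_space hk_basis) \<subseteq> (\<Union>\<sigma>\<in>PiE {..<k} (\<lambda>i. {1..N i}). hchart \<sigma> ` coords k)"
      using hk_points_covered by blast
  qed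
  fix \<sigma> \<tau> x y assume *: "\<sigma> \<in> PiE {..<k} (\<lambda>i. {1..N i})" "\<tau> \<in> PiE {..<k} (\<lambda>i. {1..N i})" "x \<in> coords k" "y \<in> coords k"
  note \<sigma> = chart_index_iff[OF *(1)] and \<tau> = chart_index_iff[OF *(2)]
  have "hchart \<sigma> x = hchart \<tau> y \<longleftrightarrow> (\<forall>c<k. cox_equiv (N c) (\<sigma> c) (x c) (\<tau> c) (y c))"
    using hchart_eqD[OF \<sigma> \<tau>] hchart_eqI[OF \<sigma> \<tau>] by blast
  also have "\<dots> \<longleftrightarrow> ale_product_chart k N \<sigma> x = ale_product_chart k N \<tau> y"
    by (subst ale_product_chart_eq_iff) (use \<sigma> \<tau> in auto)
  finally show "hchart \<sigma> x = hchart \<tau> y \<longleftrightarrow> ale_product_chart k N \<sigma> x = ale_product_chart k N \<tau> y" .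
qed

lemma point_ideal_cong:
  assumes "\<And>v. v \<in> vars \<Longrightarrow> x v = y v"
  shows "point_ideal A \<theta> x = point_ideal A \<theta> y"
proof (rule point_ideal_eqI[of "\<lambda>_. 1"])
  fix r m assume "m \<in> section_keys A \<theta> r"
  then have "Poly_Mapping.keys m \<subseteq> vars" by (simp add: section_keys_iff)
  then show "eval_monomial y m = 1 * eval_monomial x m"
    unfolding eval_monomial_def using assms by (auto intro!: prod.cong)
qed simp

text \<open>The torus acts on the chart with all indices \<open>1\<close> by the parameters \<open>s (2 c)\<close> and \<open>s (2 c + 1)\<close> on the
  coordinates of the class \<open>c\<close>; \<open>torus_exp\<close> are the resulting weights of the variables.\<close>

definition torus_exp :: "nat + nat \<Rightarrow> nat \<Rightarrow> int" where
  "torus_exp v j = of_bool (\<exists>c<k. v = Zv c 1 \<and> j = 2 * c + 1) +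
     of_bool (\<exists>c l. inx c l \<and> v = Wv c l \<and> (j = 2 * c \<or> l > 1 \<and> j = 2 * c + 1))"

lemma torus_exp_prod:
  fixes s :: "nat \<Rightarrow> complex"
  assumes "inx c l"
  shows "(\<Prod>j<2 * k. s j powi torus_exp (Zv c l) j) = cox_Z 1 (s (2 * c), s (2 * c + 1)) l"
    "(\<Prod>j<2 * k. s j powi torus_exp (Wv c l) j) = cox_W 1 (s (2 * c), s (2 * c + 1)) l"
proof -
  have N1: "inx c' 1" if "c' < k" for c' using that N by auto
  have Z1: "torus_exp (Zv c l) j = of_bool (l = 1 \<and> j = 2 * c + 1)" for j
  proof -
    have "(\<exists>c'<k. Zv c l = Zv c' 1 \<and> j = 2 * c' + 1) \<longleftrightarrow> l = 1 \<and> j = 2 * c + 1"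
      using Zv_eq_iff[OF assms N1] assms by blast
    moreover have "\<not> (\<exists>c' l'. inx c' l' \<and> Zv c l = Wv c' l' \<and> (j = 2 * c' \<or> l' > 1 \<and> j = 2 * c' + 1))"
      using Zv_neq_Wv[OF assms] by blast
    ultimately show ?thesis unfolding torus_exp_def by (simp only: of_bool_def if_False)
  qed
  have W1: "torus_exp (Wv c l) j = of_bool (j = 2 * c \<or> l > 1 \<and> j = 2 * c + 1)" for j
  proof -
    have "\<not> (\<exists>c'<k. Wv c l = Zv c' 1 \<and> j = 2 * c' + 1)"
      using Zv_neq_Wv[OF N1 assms] by metis
    moreover have "(\<exists>c' l'. inx c' l' \<and> Wv c l = Wv c' l' \<and> (j = 2 * c' \<or> l' > 1 \<and> j = 2 * c' + 1)) \<longleftrightarrow>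
      (j = 2 * c \<or> l > 1 \<and> j = 2 * c + 1)"
      using Wv_eq_iff[OF assms] assms by blast
    ultimately show ?thesis unfolding torus_exp_def by (simp only: of_bool_def if_False)
  qed
  have pick: "(\<Prod>j<2 * k. s j powi of_bool (P \<and> j = i)) = (if P then s i else 1)" if "i < 2 * k" for i P
  proof -
    have "(\<Prod>j<2 * k. s j powi of_bool (P \<and> j = i)) = (\<Prod>j<2 * k. if j = i then (if P then s i else 1) else 1)"
      by (rule prod.cong) auto
    then show ?thesis using that by simp
  qed
  have ck: "2 * c < 2 * k" "2 * c + 1 < 2 * k" using assms by auto
  show "(\<Prod>j<2 * k. s j powi torus_exp (Zv c l) j) = cox_Z 1 (s (2 * c), s (2 * c + 1)) l"
    unfolding Z1 pick[OF ck(2)] using assms by (auto simp: cox_Z_def)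
  have "(\<Prod>j<2 * k. s j powi torus_exp (Wv c l) j) =
    (\<Prod>j<2 * k. s j powi of_bool (True \<and> j = 2 * c) * s j powi of_bool (l > 1 \<and> j = 2 * c + 1))"
    unfolding W1 by (rule prod.cong) auto
  also have "\<dots> = s (2 * c) * (if l > 1 then s (2 * c + 1) else 1)"
    unfolding prod.distrib pick[OF ck(1)] pick[OF ck(2)] by simp
  finally show "(\<Prod>j<2 * k. s j powi torus_exp (Wv c l) j) = cox_W 1 (s (2 * c), s (2 * c + 1)) l"
    using assms by (auto simp: cox_W_def)
qed

lemma torus_orbit:
  "torus_map A \<theta> (\<lambda>v. \<Prod>j<2 * k. s j powi torus_exp v j) (hchart (\<lambda>_. 1) (\<lambda>_. (1, 1))) =
     hchart (\<lambda>_. 1) (\<lambda>c. (s (2 * c), s (2 * c + 1)))"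
  unfolding hchart_def torus_map_point_ideal
proof (rule point_ideal_cong)
  fix v assume "v \<in> vars"
  then obtain c l where i: "inx c l" and v: "v = Zv c l \<or> v = Wv c l" using vars_cases by blast
  have one: "cox_Z 1 (1, 1) l = 1" "cox_W 1 (1, 1) l = 1" by (simp_all add: cox_Z_def cox_W_def)
  show "(\<Prod>j<2 * k. s j powi torus_exp v j) * chart_point (\<lambda>_. 1) (\<lambda>_. (1, 1)) v =
    chart_point (\<lambda>_. 1) (\<lambda>c. (s (2 * c), s (2 * c + 1))) v"
    using v unfolding chart_point_simps[OF i, of "\<lambda>_. 1"]
  proof
    assume "v = Zv c l"
    then show ?thesis by (simp only: torus_exp_prod[OF i] chart_point_simps[OF i] one) simp
  next
    assume "v = Wv c l"
    then show ?thesis by (simp only: torus_exp_prod[OF i] chart_point_simps[OF i] one) simp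
  qed
qed

text \<open>The orbit of the point with all coordinates 1 in the chart with all indices 1 consists
  of the points with nonzero coordinates there. It is dense: an open set meeting some chart contains
  points with nonzero coordinates in that chart, and these have nonzero coordinates in the first
  chart too.\<close>

theorem circuit_toric: "is_toric A \<theta>"
proof -
  define H where "H = {torus_map A \<theta> (\<lambda>v. \<Prod>j<2 * k. s j powi torus_exp v j) |s. \<forall>j<2 * k. s j \<noteq> 0}"
  let ?p = "hchart (\<lambda>_. 1) (\<lambda>_. (1, 1))"
  have \<sigma>0: "chart_index (\<lambda>_. 1)" using N by simp
  have "H \<subseteq> dense_torus A \<theta>"
  proof
    fix \<tau> assume "\<tau> \<in> H"
    then obtain s where s: "\<tau> = torus_map A \<theta> (\<lambda>v. \<Prod>j<2 * k. s j powi torus_exp v j)" "\<forall>j<2 * k. s j \<noteq> 0"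
      unfolding H_def by blast
    have "\<forall>v. (\<Prod>j<2 * k. s j powi torus_exp v j) \<noteq> 0" using s(2) by simp
    then show "\<tau> \<in> dense_torus A \<theta>" unfolding dense_torus_def s(1) by blast
  qed
  then have sub: "subtorus A \<theta> H" unfolding subtorus_def H_def by blast
  have orbit: "{\<tau> ?p |\<tau>. \<tau> \<in> H} = {hchart (\<lambda>_. 1) (\<lambda>c. (s (2 * c), s (2 * c + 1))) |s. \<forall>j<2 * k. s j \<noteq> 0}"
    unfolding H_def using torus_orbit by blast
  have "hk_points A \<theta> = zariski (lawrence_variety A \<theta>) closure_of {\<tau> ?p |\<tau>. \<tau> \<in> H}"
  proof
    show "zariski (lawrence_variety A \<theta>) closure_of {\<tau> ?p |\<tau>. \<tau> \<in> H} \<subseteq> hk_points A \<theta>"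
    proof (rule closure_of_minimal[OF _ closedin_hk_points[OF \<theta>_carrier]])
      show "{\<tau> ?p |\<tau>. \<tau> \<in> H} \<subseteq> hk_points A \<theta>" unfolding orbit using hchart_hk[OF \<sigma>0] by auto
    qed
    show "hk_points A \<theta> \<subseteq> zariski (lawrence_variety A \<theta>) closure_of {\<tau> ?p |\<tau>. \<tau> \<in> H}"
    proof
      fix p assume p: "p \<in> hk_points A \<theta>"
      obtain \<tau> y where \<tau>: "\<tau> \<in> PiE {..<k} (\<lambda>c. {1..N c})" and y: "y \<in> coords k" "p = hchart \<tau> y"
        using hk_points_covered[OF p] by blast
      note \<tau>i = chart_index_iff[OF \<tau>]
      show "p \<in> zariski (lawrence_variety A \<theta>) closure_of {\<tau> ?p |\<tau>. \<tau> \<in> H}"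
        unfolding in_closure_of points_lawrence[OF \<theta>_carrier]
      proof (intro conjI allI impI)
        show "p \<in> proj_points A \<theta>" using p by (simp add: hk_points_def)
        fix T assume T: "p \<in> T \<and> openin (zariski (lawrence_variety A \<theta>)) T"
        have zar: "zariski (generated_space hk_basis) = subtopology (zariski (lawrence_variety A \<theta>)) (hk_points A \<theta>)"
          unfolding hyperkaehler_generated[OF \<theta>_carrier, symmetric] toric_hyperkaehler_def zariski_induced ..
        have "openin (zariski (generated_space hk_basis)) (T \<inter> hk_points A \<theta>)"
          unfolding zar openin_subtopology using T by blast
        from morphism_openin[OF hchart_morphism[OF \<tau>i] this]
        have "openin (zariski (coord_space k)) {x \<in> coords k. hchart \<tau> x \<in> T \<inter> hk_points A \<theta>}" by simp
        moreover have "y \<in> {x \<in> coords k. hchart \<tau> x \<in> T \<inter> hk_points A \<theta>}" using T p y by blast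
        ultimately obtain x where x: "hchart \<tau> x \<in> T" "\<forall>c<k. fst (x c) \<noteq> 0 \<and> snd (x c) \<noteq> 0"
          using coord_torus_dense by blast
        have "\<exists>z. cox_equiv (N c) (\<tau> c) (x c) 1 z" if "c < k" for c
          by (rule cox_transition_exists) (use \<tau>i N that x(2) in auto)
        then obtain z where z: "\<And>c. c < k \<Longrightarrow> cox_equiv (N c) (\<tau> c) (x c) 1 (z c)" by metis
        \<comment> \<open>The product of the coordinates in a class is the same in both
          charts.\<close>
        have znz: "fst (z c) \<noteq> 0 \<and> snd (z c) \<noteq> 0" if "c < k" for c
          using cox_equiv_moment[OF z[OF that] N[OF that]] x(2) that by auto
        \<comment> \<open>Even parameters are first coordinates and odd ones second coordinates, as
          \<open>torus_orbit\<close> expects.\<close>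
        define s where "s j = (if even j then fst (z (j div 2)) else snd (z (j div 2)))" for j
        have sz: "s (2 * c) = fst (z c)" "s (2 * c + 1) = snd (z c)" for c by (simp_all add: s_def)
        have "\<forall>j<2 * k. s j \<noteq> 0" using znz by (auto simp: s_def)
        moreover have "hchart \<tau> x = hchart (\<lambda>_. 1) (\<lambda>c. (s (2 * c), s (2 * c + 1)))"
          by (rule hchart_eqI[OF \<tau>i \<sigma>0]) (simp add: sz[simplified] z[simplified])
        ultimately have "hchart \<tau> x \<in> {\<tau> ?p |\<tau>. \<tau> \<in> H}" unfolding orbit by blast
        then show "\<exists>q. q \<in> {\<tau> ?p |\<tau>. \<tau> \<in> H} \<and> q \<in> T" using x(1) by blast
      qed
    qed
  qed
  moreover have "?p \<in> points (lawrence_variety A \<theta>)"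
    unfolding points_lawrence[OF \<theta>_carrier] by (rule hchart_proj[OF \<sigma>0])
  ultimately show ?thesis unfolding is_toric_def using sub by blast
qed

end

section \<open>Integer matrices with disjoint circuits\<close>

text \<open>\<open>A y\<close> over any commutative ring: kernels are needed over the integers for
  minors, over the reals for genericity and over \<complex> for the values of the
  \<open>z\<^sub>i w\<^sub>i\<close>.\<close>

definition lin :: "int mat \<Rightarrow> (nat \<Rightarrow> 'a :: comm_ring_1) \<Rightarrow> nat \<Rightarrow> 'a" where
  "lin A y j = (\<Sum>i<dim_col A. of_int (A $$ (j, i)) * y i)"

lemma lin_add: "lin A (\<lambda>i. x i + y i) j = lin A x j + lin A y j"
  and lin_diff: "lin A (\<lambda>i. x i - y i) j = lin A x j - lin A y j"
  and lin_smult: "lin A (\<lambda>i. c * x i) j = c * lin A x j"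
  and lin_zero: "lin A (\<lambda>i. 0) j = 0"
  by (simp_all add: lin_def algebra_simps sum.distrib sum_subtractf sum_distrib_left)

lemma lin_sum: "lin A (\<lambda>i. \<Sum>a\<in>I. f a i) j = (\<Sum>a\<in>I. lin A (f a) j)"
  by (induction I rule: infinite_finite_induct) (simp_all add: lin_add lin_zero)

lemma lin_unit: "m < dim_col A \<Longrightarrow> lin A (\<lambda>i. if i = m then c else 0) j = of_int (A $$ (j, m)) * c"
  by (simp add: lin_def if_distrib cong: if_cong)

lemma lin_of_int: "lin A (\<lambda>i. of_int (y i)) j = of_int (lin A y j)"
  by (simp add: lin_def)

section \<open>Column submatrices and their determinants\<close>

lemma bij_betw_pick: "bij_betw (pick J) {..<card {i. i < n \<and> i \<in> J}} {i. i < n \<and> i \<in> J}"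
proof -
  let ?J = "{i. i < n \<and> i \<in> J}"
  have "?J \<subseteq> pick J ` {..<card ?J}"
  proof
    fix i assume i: "i \<in> ?J"
    have "{a \<in> J. a < i} \<subset> ?J" using i by auto
    then have "card {a \<in> J. a < i} < card ?J" by (intro psubset_card_mono) auto
    moreover have "pick J (card {a \<in> J. a < i}) = i" using i by (intro pick_card_in_set) simp
    ultimately show "i \<in> pick J ` {..<card ?J}" by (intro image_eqI[of _ _ "card {a \<in> J. a < i}"]) simp_all
  qed
  moreover have "card (pick J ` {..<card ?J}) \<le> card ?J" using card_image_le[of "{..<card ?J}" "pick J"] by simp
  ultimately have eq: "pick J ` {..<card ?J} = ?J" by (metis card_seteq finite_imageI finite_lessThan)
  then show ?thesis by (simp add: bij_betw_def eq_card_imp_inj_on)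
qed

lemma lin_pick:
  assumes "\<And>i. i < dim_col A \<Longrightarrow> i \<notin> J \<Longrightarrow> y i = 0"
  shows "lin A y j = (\<Sum>a<card {i. i < dim_col A \<and> i \<in> J}. of_int (A $$ (j, pick J a)) * y (pick J a))"
proof -
  have "lin A y j = (\<Sum>i\<in>{i. i < dim_col A \<and> i \<in> J}. of_int (A $$ (j, i)) * y i)"
    unfolding lin_def by (rule sum.mono_neutral_right) (use assms in auto)
  also have "\<dots> = (\<Sum>a<card {i. i < dim_col A \<and> i \<in> J}. of_int (A $$ (j, pick J a)) * y (pick J a))"
    by (rule sum.reindex_bij_betw[OF bij_betw_pick, symmetric])
  finally show ?thesis .
qed

abbreviation "ncols A J \<equiv> card {i. i < dim_col A \<and> i \<in> J}"

lemma submatrix_cols: "submatrix A UNIV J \<in> carrier_mat (dim_row A) (ncols A J)"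
  by (intro carrier_matI) (simp_all add: dim_submatrix)

lemma submatrix_cols_index:
  "j < dim_row A \<Longrightarrow> a < ncols A J \<Longrightarrow> submatrix A UNIV J $$ (j, a) = A $$ (j, pick J a)"
  by (subst submatrix_index) (simp_all add: pick_UNIV)

lemma submatrix_mult_index:
  assumes "\<And>i. i < dim_col A \<Longrightarrow> i \<notin> J \<Longrightarrow> y i = (0 :: 'a :: comm_ring_1)" "j < dim_row A"
  shows "(map_mat of_int (submatrix A UNIV J) *\<^sub>v vec (ncols A J) (\<lambda>a. y (pick J a))) $ j = lin A y j"
proof -
  have "(map_mat of_int (submatrix A UNIV J) *\<^sub>v vec (ncols A J) (\<lambda>a. y (pick J a))) $ j =
    (\<Sum>a\<in>{0..<ncols A J}. map_mat of_int (submatrix A UNIV J) $$ (j, a) * y (pick J a))"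
    using assms(2) by (simp add: scalar_prod_def dim_submatrix)
  also have "\<dots> = (\<Sum>a<ncols A J. of_int (A $$ (j, pick J a)) * y (pick J a))"
    using assms(2) by (intro sum.cong) (auto simp: submatrix_cols_index dim_submatrix)
  finally show ?thesis using lin_pick[of A J y j] assms(1) by simp
qed

lemma submatrix_mult_vec:
  assumes "\<And>i. i < dim_col A \<Longrightarrow> i \<notin> J \<Longrightarrow> y i = (0 :: 'a :: comm_ring_1)"
  shows "map_mat of_int (submatrix A UNIV J) *\<^sub>v vec (ncols A J) (\<lambda>a. y (pick J a)) = vec (dim_row A) (lin A y)"
  using submatrix_mult_index[OF assms] by (intro eq_vecI) (simp_all add: dim_submatrix)

lemma submatrix_mult_int:
  assumes "\<And>i. i < dim_col A \<Longrightarrow> i \<notin> J \<Longrightarrow> y i = (0 :: int)"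
  shows "submatrix A UNIV J *\<^sub>v vec (ncols A J) (\<lambda>a. y (pick J a)) = vec (dim_row A) (lin A y)"
proof -
  have "map_mat of_int (submatrix A UNIV J) = submatrix A UNIV J" by (rule eq_matI) simp_all
  moreover have "map_mat of_int (submatrix A UNIV J) *\<^sub>v vec (ncols A J) (\<lambda>a. y (pick J a)) = vec (dim_row A) (lin A y)"
    by (rule submatrix_mult_vec) (rule assms)
  ultimately show ?thesis by (simp only:)
qed

lemma submatrix_vec_exists:
  assumes "w \<in> carrier_vec (ncols A J)"
  obtains y :: "nat \<Rightarrow> 'a :: comm_ring_1" where "\<And>i. i < dim_col A \<Longrightarrow> i \<notin> J \<Longrightarrow> y i = 0"
    "w = vec (ncols A J) (\<lambda>a. y (pick J a))"
proof -
  let ?J = "{i. i < dim_col A \<and> i \<in> J}"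
  define y where "y i = (if i \<in> ?J then w $ inv_into {..<card ?J} (pick J) i else 0)" for i
  have "w = vec (card ?J) (\<lambda>a. y (pick J a))"
  proof (rule eq_vecI)
    fix a assume "a < dim_vec (vec (card ?J) (\<lambda>a. y (pick J a)))"
    then have a: "a \<in> {..<card ?J}" by simp
    then have "pick J a \<in> ?J" using bij_betw_apply[OF bij_betw_pick] by blast
    moreover have "inv_into {..<card ?J} (pick J) (pick J a) = a"
      using bij_betw_imp_inj_on[OF bij_betw_pick] a by (rule inv_into_f_f)
    ultimately show "w $ a = vec (card ?J) (\<lambda>a. y (pick J a)) $ a" using a by (simp add: y_def)
  qed (use assms in simp)
  then show ?thesis by (intro that[of y]) (auto simp: y_def)
qed

text \<open>The determinant is its own inverse, so the determinant times the adjugate is an integral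
  inverse; the solution is extended by zero outside \<open>J\<close>.\<close>

lemma det_submatrix_inverse:
  assumes "ncols A J = dim_row A" "\<bar>det (submatrix A UNIV J)\<bar> = 1"
  shows "\<exists>y. (\<forall>i<dim_col A. i \<notin> J \<longrightarrow> y i = 0) \<and> (\<forall>j<dim_row A. lin A y j = (v j :: int))"
proof -
  let ?M = "submatrix A UNIV J" and ?d = "dim_row A"
  have M: "?M \<in> carrier_mat ?d ?d" using submatrix_cols[of A J] assms(1) by simp
  define w where "w = (det ?M \<cdot>\<^sub>m adj_mat ?M) *\<^sub>v vec ?d v"
  have adj: "adj_mat ?M \<in> carrier_mat ?d ?d" using adj_mat(1)[OF M] .
  then have wc: "w \<in> carrier_vec ?d" unfolding w_def by (intro mult_mat_vec_carrier[of _ ?d ?d]) auto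
  have det2: "det ?M * det ?M = 1" using assms(2) by (metis abs_mult_self_eq mult_1)
  have "?M * (det ?M \<cdot>\<^sub>m adj_mat ?M) = det ?M \<cdot>\<^sub>m (?M * adj_mat ?M)" by (rule mult_smult_distrib[OF M adj])
  also have "\<dots> = 1\<^sub>m ?d" unfolding adj_mat(2)[OF M] using det2 by (intro eq_matI) (auto simp: mult.assoc[symmetric])
  finally have inv: "?M * (det ?M \<cdot>\<^sub>m adj_mat ?M) = 1\<^sub>m ?d" .
  have "?M *\<^sub>v w = (?M * (det ?M \<cdot>\<^sub>m adj_mat ?M)) *\<^sub>v vec ?d v"
    unfolding w_def by (rule assoc_mult_mat_vec[symmetric, OF M]) (use adj in auto)
  then have eq: "?M *\<^sub>v w = vec ?d v" unfolding inv by simp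
  obtain y where y: "\<And>i. i < dim_col A \<Longrightarrow> i \<notin> J \<Longrightarrow> y i = 0" "w = vec (ncols A J) (\<lambda>a. y (pick J a))"
    using submatrix_vec_exists[of w A J] wc assms(1) by auto
  have "lin A y j = v j" if "j < ?d" for j
  proof -
    have "vec ?d v = vec ?d (lin A y)" using submatrix_mult_int[of A J y] y eq by simp
    then show ?thesis using that by (metis index_vec)
  qed
  then show ?thesis using y(1) by blast
qed

text \<open>The solutions for the unit vectors are the columns of an integral right inverse, so the
  determinant is a unit of the integers.\<close>

lemma det_submatrix_unit:
  assumes "ncols A J = dim_row A"
    and "\<And>j. j < dim_row A \<Longrightarrow> \<exists>y. (\<forall>i<dim_col A. i \<notin> J \<longrightarrow> y i = 0) \<and> (\<forall>i<dim_row A. lin A y i = (if i = j then 1 else (0 :: int)))"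
  shows "\<bar>det (submatrix A UNIV J)\<bar> = 1"
proof -
  let ?M = "submatrix A UNIV J" and ?d = "dim_row A"
  have M: "?M \<in> carrier_mat ?d ?d" using submatrix_cols[of A J] assms(1) by simp
  have "\<forall>j. \<exists>y. j < ?d \<longrightarrow> (\<forall>i<dim_col A. i \<notin> J \<longrightarrow> y i = 0) \<and> (\<forall>i<?d. lin A y i = (if i = j then 1 else (0 :: int)))"
    using assms(2) by blast
  from choice[OF this] obtain y where y0: "\<forall>j. j < ?d \<longrightarrow> (\<forall>i<dim_col A. i \<notin> J \<longrightarrow> y j i = 0) \<and>
      (\<forall>i<?d. lin A (y j) i = (if i = j then 1 else (0 :: int)))" ..
  then have y: "\<And>j i. j < ?d \<Longrightarrow> i < dim_col A \<Longrightarrow> i \<notin> J \<Longrightarrow> y j i = 0"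
    "\<And>j i. j < ?d \<Longrightarrow> i < ?d \<Longrightarrow> lin A (y j) i = (if i = j then 1 else 0)"
    by simp_all
  define B where "B = mat ?d ?d (\<lambda>(a, j). y j (pick J a))"
  have B: "B \<in> carrier_mat ?d ?d" by (simp add: B_def)
  have "?M * B = 1\<^sub>m ?d"
  proof (rule eq_matI)
    fix i j assume "i < dim_row (1\<^sub>m ?d :: int mat)" "j < dim_col (1\<^sub>m ?d :: int mat)"
    then have ij: "i < ?d" "j < ?d" by simp_all
    have "col B j = vec (ncols A J) (\<lambda>a. y j (pick J a))" using ij assms(1) by (intro eq_vecI) (simp_all add: B_def)
    then have "?M *\<^sub>v col B j = vec ?d (lin A (y j))" using submatrix_mult_int[of A J "y j"] y(1)[OF ij(2)] by simp
    then have "(?M *\<^sub>v col B j) $ i = lin A (y j) i" using ij(1) by simp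
    then show "(?M * B) $$ (i, j) = 1\<^sub>m ?d $$ (i, j)"
      using ij M B y(2) by auto
  qed (use M B in auto)
  then have "det ?M * det B = 1" using det_mult[OF M B] by simp
  then show ?thesis by (metis abs_mult abs_1 zmult_eq_1_iff abs_minus_cancel)
qed

lemma det_submatrix_zero:
  assumes "ncols A J = dim_row A"
  shows "det (submatrix A UNIV J) = 0 \<longleftrightarrow>
    (\<exists>y :: nat \<Rightarrow> int. (\<forall>i<dim_col A. i \<notin> J \<longrightarrow> y i = 0) \<and> (\<exists>i<dim_col A. y i \<noteq> 0) \<and> (\<forall>j<dim_row A. lin A y j = 0))"
proof -
  let ?M = "submatrix A UNIV J" and ?d = "dim_row A"
  have M: "?M \<in> carrier_mat ?d ?d" using submatrix_cols[of A J] assms(1) by simp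
  show ?thesis unfolding det_0_iff_vec_prod_zero[OF M]
  proof
    assume "\<exists>v. v \<in> carrier_vec ?d \<and> v \<noteq> 0\<^sub>v ?d \<and> ?M *\<^sub>v v = 0\<^sub>v ?d"
    then obtain v where v: "v \<in> carrier_vec ?d" "v \<noteq> 0\<^sub>v ?d" "?M *\<^sub>v v = 0\<^sub>v ?d" by blast
    obtain y where y: "\<And>i. i < dim_col A \<Longrightarrow> i \<notin> J \<Longrightarrow> y i = 0" "v = vec (ncols A J) (\<lambda>a. y (pick J a))"
      using submatrix_vec_exists[of v A J] v(1) assms by auto
    have "vec ?d (lin A y) = 0\<^sub>v ?d" using submatrix_mult_int[of A J y] y v(3) by simp
    then have "lin A y j = 0" if "j < ?d" for j using that by (metis index_vec index_zero_vec(1))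
    moreover have "\<exists>i<dim_col A. y i \<noteq> 0"
    proof (rule ccontr)
      assume n: "\<not> ?thesis"
      have "v = 0\<^sub>v ?d"
      proof (rule eq_vecI)
        fix a assume "a < dim_vec (0\<^sub>v ?d :: int vec)"
        then have a: "a < ncols A J" using assms by simp
        then have "pick J a < dim_col A" using bij_betw_apply[OF bij_betw_pick, of a _ J] by blast
        then show "v $ a = 0\<^sub>v ?d $ a" using n a assms unfolding y(2) by simp
      qed (use v(1) in simp)
      with v(2) show False by simp
    qed
    ultimately show "\<exists>y :: nat \<Rightarrow> int. (\<forall>i<dim_col A. i \<notin> J \<longrightarrow> y i = 0) \<and> (\<exists>i<dim_col A. y i \<noteq> 0) \<and> (\<forall>j<?d. lin A y j = 0)"
      using y(1) by blast
  next
    assume "\<exists>y :: nat \<Rightarrow> int. (\<forall>i<dim_col A. i \<notin> J \<longrightarrow> y i = 0) \<and> (\<exists>i<dim_col A. y i \<noteq> 0) \<and> (\<forall>j<?d. lin A y j = 0)"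
    then obtain y :: "nat \<Rightarrow> int" and i where y: "\<And>i. i < dim_col A \<Longrightarrow> i \<notin> J \<Longrightarrow> y i = 0" "i < dim_col A" "y i \<noteq> 0"
      "\<And>j. j < ?d \<Longrightarrow> lin A y j = 0" by blast
    let ?v = "vec (ncols A J) (\<lambda>a. y (pick J a))"
    have "i \<in> {i. i < dim_col A \<and> i \<in> J}" using y(1-3) by blast
    then have "i \<in> pick J ` {..<ncols A J}"
      using bij_betw_imp_surj_on[OF bij_betw_pick[of J "dim_col A"]] by blast
    then obtain a where a: "a < ncols A J" "pick J a = i" by auto
    have "?v $ a \<noteq> 0" using a y(3) by simp
    moreover have "0\<^sub>v ?d $ a = (0 :: int)" using a(1) assms by simp
    ultimately have "?v \<noteq> 0\<^sub>v ?d" by metis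
    moreover have "?M *\<^sub>v ?v = 0\<^sub>v ?d"
      using submatrix_mult_int[of A J y] y(1,4) by (auto intro!: eq_vecI)
    moreover have "?v \<in> carrier_vec ?d" using assms by simp
    ultimately show "\<exists>v. v \<in> carrier_vec ?d \<and> v \<noteq> 0\<^sub>v ?d \<and> ?M *\<^sub>v v = 0\<^sub>v ?d" by blast
  qed
qed

text \<open>The complex kernel is a direct sum of \<open>K\<close> lines with disjoint supports, one
  for each nonempty class, spanned by sign vectors. \<open>\<epsilon>\<close> is a sign also at
  indices beyond the columns, which avoids side conditions.\<close>

definition sign_classes :: "int mat \<Rightarrow> nat \<Rightarrow> (nat \<Rightarrow> nat) \<Rightarrow> (nat \<Rightarrow> int) \<Rightarrow> bool" where
  "sign_classes A K cls \<epsilon> \<longleftrightarrow> (\<forall>i. \<epsilon> i = 1 \<or> \<epsilon> i = -1) \<and> cls ` {..<dim_col A} = {..<K} \<and>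
     (\<forall>y :: nat \<Rightarrow> complex. (\<forall>j<dim_row A. lin A y j = 0) \<longleftrightarrow> (\<exists>t. \<forall>i<dim_col A. y i = of_int (\<epsilon> i) * t (cls i)))"

definition int_surjective :: "int mat \<Rightarrow> bool" where
  "int_surjective A \<longleftrightarrow> (\<forall>v :: nat \<Rightarrow> int. \<exists>y. \<forall>j<dim_row A. lin A y j = v j)"

lemma sign_classes_sq:
  assumes "sign_classes A K cls \<epsilon>" shows "\<epsilon> i * \<epsilon> i = 1"
proof -
  have "\<forall>i. \<epsilon> i = 1 \<or> \<epsilon> i = -1" using assms unfolding sign_classes_def by (elim conjE)
  then have "\<epsilon> i = 1 \<or> \<epsilon> i = -1" by blast
  then show ?thesis by auto
qed

lemma sign_classes_kernel_real:
  fixes y :: "nat \<Rightarrow> real"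
  assumes "sign_classes A K cls \<epsilon>"
  shows "(\<forall>j<dim_row A. lin A y j = 0) \<longleftrightarrow> (\<exists>t. \<forall>i<dim_col A. y i = of_int (\<epsilon> i) * t (cls i))"
proof -
  have kc: "\<forall>y :: nat \<Rightarrow> complex. (\<forall>j<dim_row A. lin A y j = 0) \<longleftrightarrow> (\<exists>t. \<forall>i<dim_col A. y i = of_int (\<epsilon> i) * t (cls i))"
    using assms unfolding sign_classes_def by (elim conjE)
  have lc: "lin A (\<lambda>i. complex_of_real (y i)) j = of_real (lin A y j)" for j
    by (simp add: lin_def)
  have "(\<forall>j<dim_row A. lin A y j = 0) \<longleftrightarrow> (\<forall>j<dim_row A. lin A (\<lambda>i. complex_of_real (y i)) j = 0)"
    by (simp add: lc)
  also have "\<dots> \<longleftrightarrow> (\<exists>t. \<forall>i<dim_col A. complex_of_real (y i) = of_int (\<epsilon> i) * t (cls i))"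
    by (rule spec[OF kc])
  also have "\<dots> \<longleftrightarrow> (\<exists>t. \<forall>i<dim_col A. y i = of_int (\<epsilon> i) * t (cls i))"
  proof
    assume "\<exists>t. \<forall>i<dim_col A. complex_of_real (y i) = of_int (\<epsilon> i) * t (cls i)"
    then obtain t where t: "\<forall>i<dim_col A. complex_of_real (y i) = of_int (\<epsilon> i) * t (cls i)" by blast
    have "y i = of_int (\<epsilon> i) * Re (t (cls i))" if "i < dim_col A" for i
    proof -
      have "y i = Re (of_int (\<epsilon> i) * t (cls i))" using t that by (metis Re_complex_of_real)
      then show ?thesis by simp
    qed
    then show "\<exists>t. \<forall>i<dim_col A. y i = of_int (\<epsilon> i) * t (cls i)" by (intro exI[of _ "\<lambda>c. Re (t c)"]) blast
  next
    assume "\<exists>t. \<forall>i<dim_col A. y i = of_int (\<epsilon> i) * t (cls i)"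
    then obtain t where "\<forall>i<dim_col A. y i = of_int (\<epsilon> i) * t (cls i)" by blast
    then show "\<exists>t. \<forall>i<dim_col A. complex_of_real (y i) = of_int (\<epsilon> i) * t (cls i)"
      by (intro exI[of _ "\<lambda>c. of_real (t c)"]) simp
  qed
  finally show ?thesis .
qed

text \<open>A sign is its own inverse, so the parameter is a signed entry of \<open>y\<close>; the
  floor only turns a real function with integral values into an integer-valued one.\<close>

lemma sign_classes_kernel_int:
  fixes y :: "nat \<Rightarrow> int"
  assumes sc: "sign_classes A K cls \<epsilon>"
  shows "(\<forall>j<dim_row A. lin A y j = 0) \<longleftrightarrow> (\<exists>t. \<forall>i<dim_col A. y i = \<epsilon> i * t (cls i))"
proof -
  have \<epsilon>: "\<epsilon> i * \<epsilon> i = 1" for i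
    by (rule sign_classes_sq[OF sc])
  have "(\<forall>j<dim_row A. lin A y j = 0) \<longleftrightarrow> (\<forall>j<dim_row A. lin A (\<lambda>i. real_of_int (y i)) j = 0)"
    by (simp add: lin_of_int)
  also have "\<dots> \<longleftrightarrow> (\<exists>t. \<forall>i<dim_col A. real_of_int (y i) = of_int (\<epsilon> i) * t (cls i))"
    by (rule sign_classes_kernel_real[OF sc])
  also have "\<dots> \<longleftrightarrow> (\<exists>t. \<forall>i<dim_col A. y i = \<epsilon> i * t (cls i))"
  proof
    assume "\<exists>t. \<forall>i<dim_col A. real_of_int (y i) = of_int (\<epsilon> i) * t (cls i)"
    then obtain t where t: "\<forall>i<dim_col A. real_of_int (y i) = of_int (\<epsilon> i) * t (cls i)" by blast
    have ti: "t (cls i) = of_int (\<epsilon> i * y i)" if "i < dim_col A" for i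
      using t that \<epsilon>[of i] by (metis mult.assoc mult_1 of_int_1 of_int_mult)
    have "y i = \<epsilon> i * \<lfloor>t (cls i)\<rfloor>" if "i < dim_col A" for i
      unfolding ti[OF that] using \<epsilon>[of i] by (metis floor_of_int mult.assoc mult_1)
    then show "\<exists>t. \<forall>i<dim_col A. y i = \<epsilon> i * t (cls i)" by (intro exI[of _ "\<lambda>c. \<lfloor>t c\<rfloor>"]) blast
  next
    assume "\<exists>t. \<forall>i<dim_col A. y i = \<epsilon> i * t (cls i)"
    then obtain t where "\<forall>i<dim_col A. y i = \<epsilon> i * t (cls i)" by blast
    then show "\<exists>t. \<forall>i<dim_col A. real_of_int (y i) = of_int (\<epsilon> i) * t (cls i)"
      by (intro exI[of _ "\<lambda>c. of_int (t c)"]) simp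
  qed
  finally show ?thesis .
qed

lemma lin_real_surjective:
  assumes "int_surjective A"
  shows "\<exists>w. \<forall>v :: nat \<Rightarrow> real. \<forall>j<dim_row A. lin A (\<lambda>i. \<Sum>m<dim_row A. v m * of_int (w m i)) j = v j"
proof -
  have "\<forall>m. \<exists>y. \<forall>j<dim_row A. lin A y j = (if j = m then 1 else (0::int))"
  proof
    fix m
    show "\<exists>y. \<forall>j<dim_row A. lin A y j = (if j = m then 1 else (0::int))"
      using spec[OF assms[unfolded int_surjective_def], of "\<lambda>j. if j = m then 1 else 0"] .
  qed
  from choice[OF this] obtain w where w0: "\<forall>m. \<forall>j<dim_row A. lin A (w m) j = (if j = m then 1 else (0::int))" ..
  then have w: "\<And>m j. j < dim_row A \<Longrightarrow> lin A (w m) j = (if j = m then 1 else (0::int))" by simp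
  have "lin A (\<lambda>i. \<Sum>m<dim_row A. v m * of_int (w m i)) j = v j" if "j < dim_row A" for v :: "nat \<Rightarrow> real" and j
    unfolding lin_sum lin_smult lin_of_int using that by (simp add: w if_distrib cong: if_cong)
  then show ?thesis by blast
qed

text \<open>If two signed values in one class agree, \<theta> lies on the hyperplane spanned by all
  columns other than these two.\<close>

lemma generic_imp_distinct:
  assumes sc: "sign_classes A K cls \<epsilon>" and surj: "int_surjective A"
    and gen: "generic A \<theta>" and \<theta>: "\<theta> = vec (dim_row A) (lin A u)"
    and i: "i < dim_col A" "i' < dim_col A" "i \<noteq> i'" "cls i = cls i'"
  shows "\<epsilon> i * u i \<noteq> \<epsilon> i' * u i'"
proof
  assume eq: "\<epsilon> i * u i = \<epsilon> i' * u i'"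
  let ?d = "dim_row A" and ?n = "dim_col A"
  have \<epsilon>: "\<epsilon> i * \<epsilon> i = 1" for i
    by (rule sign_classes_sq[OF sc])
  have \<epsilon>r: "real_of_int (\<epsilon> i) * real_of_int (\<epsilon> i) = 1" for i using \<epsilon>[of i] by (metis of_int_1 of_int_mult)
  obtain w where w: "\<And>v j. j < ?d \<Longrightarrow> lin A (\<lambda>i. \<Sum>m<?d. (v m :: real) * of_int (w m i)) j = v j"
    using lin_real_surjective[OF surj] by blast
  text \<open>The functional \<open>A x \<mapsto> \<epsilon>\<^sub>i x\<^sub>i - \<epsilon>\<^sub>i\<^sub>' x\<^sub>i\<^sub>'\<close> is well defined; its kernel is spanned by the other columns.\<close>
  define c where "c = vec ?d (\<lambda>m. real_of_int (\<epsilon> i) * of_int (w m i) - real_of_int (\<epsilon> i') * of_int (w m i'))"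
  have cx: "c \<bullet> vec ?d (lin A x) = of_int (\<epsilon> i) * x i - of_int (\<epsilon> i') * x i'" for x :: "nat \<Rightarrow> real"
  proof -
    define x' where "x' i = (\<Sum>m<?d. lin A x m * of_int (w m i))" for i
    have "\<forall>j<?d. lin A (\<lambda>i. x i - x' i) j = 0" unfolding lin_diff x'_def using w by simp
    then obtain t where t: "\<forall>i<?n. x i - x' i = of_int (\<epsilon> i) * t (cls i)"
      unfolding sign_classes_kernel_real[OF sc] by blast
    have "of_int (\<epsilon> i) * x i - of_int (\<epsilon> i) * x' i = of_int (\<epsilon> i') * x i' - of_int (\<epsilon> i') * x' i'"
    proof -
      have "of_int (\<epsilon> i) * (x i - x' i) = t (cls i)" "of_int (\<epsilon> i') * (x i' - x' i') = t (cls i')"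
        using t i \<epsilon>r[of i] \<epsilon>r[of i'] by (metis mult.assoc mult_1)+
      then show ?thesis using i(4) by (simp add: right_diff_distrib)
    qed
    moreover have "c \<bullet> vec ?d (lin A x) = of_int (\<epsilon> i) * x' i - of_int (\<epsilon> i') * x' i'"
      by (simp add: c_def scalar_prod_def x'_def sum_distrib_left algebra_simps sum_subtractf lessThan_atLeast0)
    ultimately show ?thesis by simp
  qed
  have c0: "c \<noteq> 0\<^sub>v ?d"
  proof
    assume "c = 0\<^sub>v ?d"
    then have "c \<bullet> vec ?d (lin A (\<lambda>m. if m = i then 1 else 0)) = 0" by simp
    then show False unfolding cx using i(3) \<epsilon>r[of i] by simp
  qed
  let ?J = "{..<?n} - {i, i'}"
  let ?M = "map_mat real_of_int (submatrix A UNIV ?J)"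
  have dM: "dim_col ?M = ncols A ?J" "dim_row ?M = ?d" by (simp_all add: dim_submatrix)
  have span: "{?M *\<^sub>v x |x. x \<in> carrier_vec (dim_col ?M)} = {v \<in> carrier_vec ?d. c \<bullet> v = 0}"
  proof (intro equalityI subsetI)
    fix v assume "v \<in> {?M *\<^sub>v x |x. x \<in> carrier_vec (dim_col ?M)}"
    then obtain x where x: "v = ?M *\<^sub>v x" "x \<in> carrier_vec (ncols A ?J)" unfolding dM by blast
    obtain y where y: "\<And>m. m < ?n \<Longrightarrow> m \<notin> ?J \<Longrightarrow> y m = 0" "x = vec (ncols A ?J) (\<lambda>a. y (pick ?J a))"
      using submatrix_vec_exists[OF x(2)] by blast
    have "v = vec ?d (lin A y)"
      unfolding x(1) y(2) using submatrix_mult_vec[of A ?J y] y(1) by blast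
    then show "v \<in> {v \<in> carrier_vec ?d. c \<bullet> v = 0}" using cx[of y] y(1) i by simp
  next
    fix v assume "v \<in> {v \<in> carrier_vec ?d. c \<bullet> v = 0}"
    then have v: "v \<in> carrier_vec ?d" "c \<bullet> v = 0" by auto
    define x where "x m = (\<Sum>j<?d. v $ j * of_int (w j m))" for m
    have vx: "v = vec ?d (lin A x)" using v(1) w unfolding x_def by (intro eq_vecI) simp_all
    have e0: "of_int (\<epsilon> i) * x i = of_int (\<epsilon> i') * x i'" using v(2) cx[of x] unfolding vx by simp
    \<comment> \<open>Subtracting one multiple of the sign vector of the class clears the entries at
      \<open>i\<close> and \<open>i'\<close> simultaneously, by \<open>e0\<close>.\<close>
    define y where "y m = x m - of_int (\<epsilon> m) * (if cls m = cls i then of_int (\<epsilon> i) * x i else 0)" for m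
    have "\<forall>j<?d. lin A (\<lambda>m. of_int (\<epsilon> m) * (if cls m = cls i then of_int (\<epsilon> i) * x i else 0)) j = 0"
      unfolding sign_classes_kernel_real[OF sc] by (intro exI[of _ "\<lambda>c. if c = cls i then of_int (\<epsilon> i) * x i else 0"]) simp
    then have ly: "lin A y j = lin A x j" if "j < ?d" for j unfolding y_def lin_diff using that by simp
    have y0: "y m = 0" if "m < ?n" "m \<notin> ?J" for m
    proof -
      have "m = i \<or> m = i'" using that by blast
      moreover have "of_int (\<epsilon> i) * (of_int (\<epsilon> i) * x i) = x i" using \<epsilon>r[of i] by (metis mult.assoc mult_1)
      moreover have "of_int (\<epsilon> i') * (of_int (\<epsilon> i) * x i) = x i'" unfolding e0 using \<epsilon>r[of i'] by (metis mult.assoc mult_1)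
      ultimately show ?thesis using i(4) by (auto simp: y_def)
    qed
    have "?M *\<^sub>v vec (ncols A ?J) (\<lambda>a. y (pick ?J a)) = vec ?d (lin A y)"
      by (rule submatrix_mult_vec) (use y0 in blast)
    also have "\<dots> = v" unfolding vx using ly by (intro eq_vecI) simp_all
    finally have "v = ?M *\<^sub>v vec (ncols A ?J) (\<lambda>a. y (pick ?J a))" ..
    then show "v \<in> {?M *\<^sub>v x |x. x \<in> carrier_vec (dim_col ?M)}" unfolding dM by auto
  qed
  have "map_vec real_of_int \<theta> \<notin> {v \<in> carrier_vec ?d. c \<bullet> v = 0}"
    using gen[unfolded generic_def Let_def, rule_format, of ?J c] c0 span by (auto simp: c_def)
  moreover have "map_vec real_of_int \<theta> = vec ?d (lin A (\<lambda>i. real_of_int (u i)))"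
    unfolding \<theta> by (intro eq_vecI) (simp_all add: lin_of_int)
  moreover have "real_of_int (\<epsilon> i) * of_int (u i) - of_int (\<epsilon> i') * of_int (u i') = 0"
    using eq by (metis diff_self of_int_mult)
  ultimately show False using cx[of "\<lambda>i. real_of_int (u i)"] by simp
qed

text \<open>Suppose that the kernel of \<open>c\<close> is spanned by the columns in
  \<open>J\<close> and contains \<theta>. Some column \<open>i\<close> is off this hyperplane; as
  \<open>c\<close> annihilates the signed sum of the columns of its class, so is a second column
  \<open>i'\<close> of the class. Both are outside \<open>J\<close>, so \<theta> has a preimage
  vanishing at both, and comparing it with \<open>u\<close> modulo the kernel makes the two signed
  values equal.\<close>

lemma distinct_imp_generic:
  assumes sc: "sign_classes A K cls \<epsilon>" and surj: "int_surjective A" and \<theta>: "\<theta> = vec (dim_row A) (lin A u)"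
    and dist: "\<And>i i'. i < dim_col A \<Longrightarrow> i' < dim_col A \<Longrightarrow> i \<noteq> i' \<Longrightarrow> cls i = cls i' \<Longrightarrow> \<epsilon> i * u i \<noteq> \<epsilon> i' * u i'"
  shows "generic A \<theta>"
  unfolding generic_def Let_def
proof (intro allI impI ballI notI)
  let ?d = "dim_row A" and ?n = "dim_col A"
  fix J and c :: "real vec"
  let ?M = "map_mat real_of_int (submatrix A UNIV J)"
  assume c: "c \<in> carrier_vec ?d" "c \<noteq> 0\<^sub>v ?d"
    and span: "{?M *\<^sub>v x |x. x \<in> carrier_vec (dim_col ?M)} = {v \<in> carrier_vec ?d. c \<bullet> v = 0}"
    and \<theta>H: "map_vec real_of_int \<theta> \<in> {v \<in> carrier_vec ?d. c \<bullet> v = 0}"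
  have dM: "dim_col ?M = ncols A J" "dim_row ?M = ?d" by (simp_all add: dim_submatrix)
  have \<epsilon>: "\<epsilon> i * \<epsilon> i = 1" for i
    by (rule sign_classes_sq[OF sc])
  have \<epsilon>r: "real_of_int (\<epsilon> i) * real_of_int (\<epsilon> i) = 1" for i using \<epsilon>[of i] by (metis of_int_1 of_int_mult)
  define a where "a i = (\<Sum>j<?d. c $ j * of_int (A $$ (j, i)))" for i
  have ca: "c \<bullet> vec ?d (lin A x) = (\<Sum>i<?n. a i * x i)" for x :: "nat \<Rightarrow> real"
  proof -
    have "c \<bullet> vec ?d (lin A x) = (\<Sum>j<?d. \<Sum>i<?n. c $ j * of_int (A $$ (j, i)) * x i)"
      by (simp add: scalar_prod_def lin_def sum_distrib_left lessThan_atLeast0 mult.assoc)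
    also have "\<dots> = (\<Sum>i<?n. a i * x i)" unfolding a_def sum_distrib_right by (rule sum.swap)
    finally show ?thesis .
  qed
  have "\<exists>i<?n. a i \<noteq> 0"
  proof (rule ccontr)
    assume "\<not> ?thesis"
    then have z: "c \<bullet> vec ?d (lin A x) = 0" for x :: "nat \<Rightarrow> real" unfolding ca by (intro sum.neutral) auto
    obtain w where w: "\<And>v j. j < ?d \<Longrightarrow> lin A (\<lambda>i. \<Sum>m<?d. (v m :: real) * of_int (w m i)) j = v j"
      using lin_real_surjective[OF surj] by blast
    have "c $ j = 0" if j: "j < ?d" for j
    proof -
      have uv: "vec ?d (lin A (\<lambda>i. \<Sum>m<?d. (if m = j then 1 else 0) * of_int (w m i))) = (unit_vec ?d j :: real vec)"
        by (rule eq_vecI) (simp_all only: index_vec dim_vec w index_unit_vec j)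
      have "c \<bullet> unit_vec ?d j = 0" unfolding uv[symmetric] by (rule z)
      moreover have "c \<bullet> unit_vec ?d j = c $ j" by (rule scalar_prod_right_unit[OF j])
      ultimately show ?thesis by (rule trans[OF sym, rotated])
    qed
    then have "c = 0\<^sub>v ?d" using c(1) by (intro eq_vecI) auto
    with c(2) show False by simp
  qed
  then obtain i where i: "i < ?n" "a i \<noteq> 0" by blast
  have "\<exists>i'<?n. i' \<noteq> i \<and> cls i' = cls i \<and> a i' \<noteq> 0"
  proof (rule ccontr)
    assume n: "\<not> ?thesis"
    let ?y = "\<lambda>m. real_of_int (\<epsilon> m) * (if cls m = cls i then 1 else 0)"
    have "\<forall>j<?d. lin A ?y j = 0"
      unfolding sign_classes_kernel_real[OF sc] by (intro exI[of _ "\<lambda>c. if c = cls i then 1 else 0"]) simp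
    then have "vec ?d (lin A ?y) = 0\<^sub>v ?d" by (intro eq_vecI) simp_all
    then have "(\<Sum>m<?n. a m * ?y m) = 0" using ca[of ?y] c(1) by simp
    moreover have "(\<Sum>m<?n. a m * ?y m) = (\<Sum>m<?n. if m = i then a i * of_int (\<epsilon> i) else 0)"
      using n by (intro sum.cong) auto
    ultimately have "a i * of_int (\<epsilon> i) = 0" using i(1) by simp
    then show False using i(2) \<epsilon>r[of i] by auto
  qed
  then obtain i' where i': "i' < ?n" "i' \<noteq> i" "cls i' = cls i" "a i' \<noteq> 0" by blast
  have aJ: "a m = 0" if m: "m < ?n" "m \<in> J" for m
  proof -
    let ?y = "\<lambda>l. if l = m then 1 else (0::real)"
    have meq: "?M *\<^sub>v vec (ncols A J) (\<lambda>b. ?y (pick J b)) = vec ?d (lin A ?y)"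
      by (rule submatrix_mult_vec) (use m in auto)
    have "vec ?d (lin A ?y) \<in> {?M *\<^sub>v x |x. x \<in> carrier_vec (dim_col ?M)}"
      unfolding dM by (intro CollectI exI[of _ "vec (ncols A J) (\<lambda>b. ?y (pick J b))"] conjI meq[symmetric]) simp
    then have "vec ?d (lin A ?y) \<in> {v \<in> carrier_vec ?d. c \<bullet> v = 0}" unfolding span .
    then have "(\<Sum>l<?n. a l * ?y l) = 0" using ca[of ?y] by simp
    then show ?thesis using m(1) by (simp add: if_distrib cong: if_cong)
  qed
  obtain x where x: "map_vec real_of_int \<theta> = ?M *\<^sub>v x" "x \<in> carrier_vec (ncols A J)"
    using \<theta>H unfolding span[symmetric] dM by blast
  obtain y where y: "\<And>m. m < ?n \<Longrightarrow> m \<notin> J \<Longrightarrow> y m = 0" "x = vec (ncols A J) (\<lambda>a. y (pick J a))"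
    using submatrix_vec_exists[OF x(2)] by blast
  have "lin A (\<lambda>m. of_int (u m) - y m) j = 0" if j: "j < ?d" for j
  proof -
    have "map_vec real_of_int \<theta> = vec ?d (lin A y)" unfolding x(1) y(2) using submatrix_mult_vec[of A J y] y(1) by blast
    then have "lin A y j = map_vec real_of_int \<theta> $ j" using j by simp
    also have "\<dots> = of_int (lin A u j)" unfolding \<theta> using j by simp
    finally show ?thesis unfolding lin_diff lin_of_int by simp
  qed
  then obtain t where t: "\<forall>m<?n. of_int (u m) - y m = of_int (\<epsilon> m) * t (cls m)"
    using sign_classes_kernel_real[OF sc, of "\<lambda>m. of_int (u m) - y m"] by blast
  have "y i = 0" "y i' = 0" using y(1) aJ i i' by blast+
  then have "real_of_int (\<epsilon> i * u i) = t (cls i)" "real_of_int (\<epsilon> i' * u i') = t (cls i')"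
    using t i(1) i'(1) \<epsilon>r[of i] \<epsilon>r[of i'] by (metis diff_zero mult.assoc mult_1 of_int_mult)+
  then have "\<epsilon> i * u i = \<epsilon> i' * u i'" using i'(3) by (metis of_int_eq_iff)
  then show False using dist[OF i(1) i'(1)] i'(2,3) by simp
qed

lemma sign_classesD:
  assumes "sign_classes A K cls \<epsilon>"
  shows "\<epsilon> i = 1 \<or> \<epsilon> i = -1" "cls ` {..<dim_col A} = {..<K}"
    "(\<forall>j<dim_row A. lin A (y :: nat \<Rightarrow> complex) j = 0) \<longleftrightarrow> (\<exists>t. \<forall>i<dim_col A. y i = of_int (\<epsilon> i) * t (cls i))"
proof -
  have c: "(\<forall>i. \<epsilon> i = 1 \<or> \<epsilon> i = -1) \<and> cls ` {..<dim_col A} = {..<K} \<and>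
    (\<forall>y :: nat \<Rightarrow> complex. (\<forall>j<dim_row A. lin A y j = 0) \<longleftrightarrow> (\<exists>t. \<forall>i<dim_col A. y i = of_int (\<epsilon> i) * t (cls i)))"
    using assms unfolding sign_classes_def .
  show "\<epsilon> i = 1 \<or> \<epsilon> i = -1" using conjunct1[OF c] by (rule spec)
  show "cls ` {..<dim_col A} = {..<K}" using conjunct1[OF conjunct2[OF c]] .
  show "(\<forall>j<dim_row A. lin A (y :: nat \<Rightarrow> complex) j = 0) \<longleftrightarrow> (\<exists>t. \<forall>i<dim_col A. y i = of_int (\<epsilon> i) * t (cls i))"
    using conjunct2[OF conjunct2[OF c]] by (rule spec)
qed

text \<open>Each class is listed in increasing order of its signed values, which are distinct by
  assumption.\<close>

lemma sign_classes_circuit: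
  assumes sc: "sign_classes A K cls \<epsilon>" and \<theta>: "\<theta> = vec (dim_row A) (lin A u)"
    and dist: "\<And>i i'. i < dim_col A \<Longrightarrow> i' < dim_col A \<Longrightarrow> i \<noteq> i' \<Longrightarrow> cls i = cls i' \<Longrightarrow> \<epsilon> i * u i \<noteq> \<epsilon> i' * u i'"
  shows "\<exists>ix. circuit_matrix A \<theta> K (\<lambda>c. card {i. i < dim_col A \<and> cls i = c}) ix \<epsilon> u"
proof -
  let ?n = "dim_col A"
  define C where "C c = {i. i < ?n \<and> cls i = c}" for c
  define h where "h i = \<epsilon> i * u i" for i
  define xs where "xs c = sorted_list_of_set (h ` C c)" for c
  define N where "N c = card (C c)" for c
  define ix where "ix c l = inv_into (C c) h (xs c ! (l - 1))" for c l
  have finC: "finite (C c)" for c by (simp add: C_def)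
  have inj: "inj_on h (C c)" for c
    using dist unfolding inj_on_def C_def h_def by blast
  have len: "length (xs c) = N c" for c
    unfolding xs_def N_def using inj[of c] by (simp add: card_image)
  have set_xs: "set (xs c) = h ` C c" for c unfolding xs_def using finC by simp
  have hix: "ix c l \<in> C c" "h (ix c l) = xs c ! (l - 1)" if "1 \<le> l" "l \<le> N c" for c l
  proof -
    have "xs c ! (l - 1) \<in> h ` C c" unfolding set_xs[symmetric] using that len[of c] by (intro nth_mem) auto
    then show "ix c l \<in> C c" "h (ix c l) = xs c ! (l - 1)"
      unfolding ix_def by (auto intro: inv_into_into f_inv_into_f)
  qed
  have less: "h (ix c l) < h (ix c l')" if "1 \<le> l" "l < l'" "l' \<le> N c" for c l l'
  proof -
    have "sorted_wrt (<) (xs c)" unfolding xs_def by (rule sorted_list_of_set.strict_sorted_key_list_of_set)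
    then have "xs c ! (l - 1) < xs c ! (l' - 1)" by (rule sorted_wrt_nth_less) (use that len[of c] in auto)
    then show ?thesis using hix that by simp
  qed
  have surj: "\<exists>l\<ge>1. l \<le> N c \<and> i = ix c l" if "i \<in> C c" for c i
  proof -
    have "h i \<in> set (xs c)" unfolding set_xs using that by blast
    then obtain m where m: "m < N c" "xs c ! m = h i" using len[of c] by (metis in_set_conv_nth)
    have "ix c (Suc m) = i" unfolding ix_def using m inj[of c] that by simp
    then show ?thesis using m(1) by (intro exI[of _ "Suc m"]) auto
  qed
  have cls_ix: "cls (ix c l) = c" "ix c l < ?n" if "1 \<le> l" "l \<le> N c" for c l
    using hix(1)[OF that] by (auto simp: C_def)
  have clsK: "cls i < K" if "i < ?n" for i using sign_classesD(2)[OF sc] that by blast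
  have "circuit_matrix A \<theta> K N ix \<epsilon> u"
  proof
    have "inj_on (\<lambda>(c, l). ix c l) (SIGMA c:{..<K}. {1..N c})"
    proof (rule inj_onI, clarify)
      fix c l c' l' assume *: "l \<in> {1..N c}" "l' \<in> {1..N c'}" "ix c l = ix c' l'"
      then have c: "c = c'" using cls_ix(1)[of l c] cls_ix(1)[of l' c'] by simp
      moreover have "l = l'" using less[of l l' c] less[of l' l c] * c by (cases l l' rule: linorder_cases) auto
      ultimately show "c = c' \<and> l = l'" by simp
    qed
    moreover have "(\<lambda>(c, l). ix c l) ` (SIGMA c:{..<K}. {1..N c}) = {..<?n}"
    proof (intro equalityI subsetI)
      fix i assume "i \<in> (\<lambda>(c, l). ix c l) ` (SIGMA c:{..<K}. {1..N c})"
      then show "i \<in> {..<?n}" using cls_ix(2) by auto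
    next
      fix i assume i: "i \<in> {..<?n}"
      then have "i \<in> C (cls i)" by (simp add: C_def)
      then obtain l where "1 \<le> l" "l \<le> N (cls i)" "i = ix (cls i) l" using surj by blast
      then show "i \<in> (\<lambda>(c, l). ix c l) ` (SIGMA c:{..<K}. {1..N c})"
        using clsK i by (intro image_eqI[of _ _ "(cls i, l)"]) auto
    qed
    ultimately show "bij_betw (\<lambda>(c, l). ix c l) (SIGMA c:{..<K}. {1..N c}) {..<?n}" by (simp add: bij_betw_def)
    show "1 \<le> N c" if "c < K" for c
    proof -
      obtain i where "i < ?n" "cls i = c" using sign_classesD(2)[OF sc] \<open>c < K\<close> by (metis imageE lessThan_iff)
      then have "C c \<noteq> {}" by (auto simp: C_def)
      then have "card (C c) > 0" using finC by (simp add: card_gt_0_iff)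
      then show ?thesis by (simp add: N_def)
    qed
    show "\<epsilon> i = 1 \<or> \<epsilon> i = -1" for i by (rule sign_classesD(1)[OF sc])
    show "\<theta> = vec (dim_row A) (\<lambda>j. \<Sum>i<?n. A $$ (j, i) * u i)" unfolding \<theta> by (rule eq_vecI) (simp_all add: lin_def)
    show "\<epsilon> (ix c l) * u (ix c l) < \<epsilon> (ix c l') * u (ix c l')" if "c < K" "1 \<le> l" "l < l'" "l' \<le> N c" for c l l'
      using less[OF that(2-4)] by (simp add: h_def)
    fix y :: "nat \<Rightarrow> complex"
    have "(\<exists>t. \<forall>i<?n. y i = of_int (\<epsilon> i) * t (cls i)) \<longleftrightarrow>
      (\<exists>t. \<forall>c<K. \<forall>l\<in>{1..N c}. y (ix c l) = of_int (\<epsilon> (ix c l)) * t c)"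
    proof
      assume "\<exists>t. \<forall>i<?n. y i = of_int (\<epsilon> i) * t (cls i)"
      then obtain t where t: "\<And>i. i < ?n \<Longrightarrow> y i = of_int (\<epsilon> i) * t (cls i)" by blast
      have "y (ix c l) = of_int (\<epsilon> (ix c l)) * t c" if "l \<in> {1..N c}" for c l
        using t[of "ix c l"] cls_ix[of l c] that by simp
      then show "\<exists>t. \<forall>c<K. \<forall>l\<in>{1..N c}. y (ix c l) = of_int (\<epsilon> (ix c l)) * t c" by blast
    next
      assume "\<exists>t. \<forall>c<K. \<forall>l\<in>{1..N c}. y (ix c l) = of_int (\<epsilon> (ix c l)) * t c"
      then obtain t where t: "\<forall>c<K. \<forall>l\<in>{1..N c}. y (ix c l) = of_int (\<epsilon> (ix c l)) * t c" by blast
      have "y i = of_int (\<epsilon> i) * t (cls i)" if i: "i < ?n" for i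
      proof -
        have "i \<in> C (cls i)" using i by (simp add: C_def)
        then obtain l where l: "1 \<le> l" "l \<le> N (cls i)" "i = ix (cls i) l" using surj by blast
        then have "l \<in> {1..N (cls i)}" by simp
        then show ?thesis using t clsK[OF i] l(3) by metis
      qed
      then show "\<exists>t. \<forall>i<?n. y i = of_int (\<epsilon> i) * t (cls i)" by blast
    qed
    then show "(\<forall>j<dim_row A. (\<Sum>i<?n. of_int (A $$ (j, i)) * y i) = 0) \<longleftrightarrow>
      (\<exists>t. \<forall>c<K. \<forall>l\<in>{1..N c}. y (ix c l) = of_int (\<epsilon> (ix c l)) * t c)"
      using sign_classesD(3)[OF sc, of y] unfolding lin_def by simp
  qed
  then show ?thesis unfolding N_def C_def by (rule exI[of _ ix])
qed

text \<open>The complement of \<open>J\<close> has \<open>K\<close> elements. If it meets every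
  class it is a transversal, and multiples of the class vectors move any integral solution into
  \<open>J\<close>. If it misses a class, the vector of that class is a kernel vector supported in
  \<open>J\<close>.\<close>

lemma sign_classes_minor:
  assumes sc: "sign_classes A K cls \<epsilon>" and surj: "int_surjective A" and dim: "dim_row A + K = dim_col A"
    and J: "ncols A J = dim_row A"
  shows "\<bar>det (submatrix A UNIV J)\<bar> = (if \<forall>c<K. \<exists>i<dim_col A. i \<notin> J \<and> cls i = c then 1 else 0)"
proof (cases "\<forall>c<K. \<exists>i<dim_col A. i \<notin> J \<and> cls i = c")
  case True
  let ?n = "dim_col A" and ?d = "dim_row A"
  obtain r where r: "\<And>c. c < K \<Longrightarrow> r c < ?n \<and> r c \<notin> J \<and> cls (r c) = c" using True by metis
  have card_compl: "card {i. i < ?n \<and> i \<notin> J} = K"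
  proof -
    have "{..<?n} = {i. i < ?n \<and> i \<in> J} \<union> {i. i < ?n \<and> i \<notin> J}" by auto
    then have "?n = ncols A J + card {i. i < ?n \<and> i \<notin> J}"
      by (metis (no_types, lifting) card_Un_disjoint card_lessThan disjoint_iff finite_Un finite_lessThan mem_Collect_eq)
    then show ?thesis using J dim by simp
  qed
  have "inj_on r {..<K}" using r by (metis inj_onI lessThan_iff)
  then have "card (r ` {..<K}) = K" by (simp add: card_image)
  moreover have "r ` {..<K} \<subseteq> {i. i < ?n \<and> i \<notin> J}" using r by auto
  ultimately have compl: "r ` {..<K} = {i. i < ?n \<and> i \<notin> J}" using card_compl by (intro card_subset_eq) auto
  have rcls: "r (cls i) = i" if "i < ?n" "i \<notin> J" for i
  proof -
    have "i \<in> r ` {..<K}" using that compl by blast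
    then show ?thesis using r by auto
  qed
  have clsK: "cls i < K" if "i < ?n" for i using sign_classesD(2)[OF sc] that by blast
  have "\<bar>det (submatrix A UNIV J)\<bar> = 1"
  proof (rule det_submatrix_unit[OF J])
    fix j assume j: "j < ?d"
    obtain w where w: "\<forall>i<?d. lin A w i = (if i = j then 1 else (0 :: int))"
      using spec[OF surj[unfolded int_surjective_def], of "\<lambda>i. if i = j then 1 else 0"] by blast
    \<comment> \<open>Adds a multiple of each class vector so that the entry at the representative
      of the class becomes zero.\<close>
    define y where "y i = w i - \<epsilon> i * (\<epsilon> (r (cls i)) * w (r (cls i)))" for i
    have "\<forall>j<?d. lin A (\<lambda>i. \<epsilon> i * (\<epsilon> (r (cls i)) * w (r (cls i)))) j = 0"
      unfolding sign_classes_kernel_int[OF sc] by (intro exI[of _ "\<lambda>c. \<epsilon> (r c) * w (r c)"]) simp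
    then have "lin A y i = (if i = j then 1 else 0)" if "i < ?d" for i
      unfolding y_def lin_diff using w that by simp
    moreover have "y i = 0" if "i < ?n" "i \<notin> J" for i
      unfolding y_def rcls[OF that] using sign_classes_sq[OF sc, of i] by (simp add: mult.assoc[symmetric])
    ultimately show "\<exists>y. (\<forall>i<?n. i \<notin> J \<longrightarrow> y i = 0) \<and> (\<forall>i<?d. lin A y i = (if i = j then 1 else (0 :: int)))" by blast
  qed
  with True show ?thesis by simp
next
  case False
  then obtain c where c: "c < K" "\<And>i. i < dim_col A \<Longrightarrow> cls i = c \<Longrightarrow> i \<in> J" by blast
  define y where "y i = \<epsilon> i * (if cls i = c then 1 else 0)" for i
  obtain i where i: "i < dim_col A" "cls i = c" using sign_classesD(2)[OF sc] c(1) by (metis imageE lessThan_iff)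
  have "\<forall>j<dim_row A. lin A y j = 0"
    unfolding sign_classes_kernel_int[OF sc] y_def by (intro exI[of _ "\<lambda>b. if b = c then 1 else 0"]) simp
  moreover have "y i \<noteq> 0" using sign_classes_sq[OF sc, of i] i(2) by (auto simp: y_def)
  moreover have "\<forall>i<dim_col A. i \<notin> J \<longrightarrow> y i = 0" using c(2) by (auto simp: y_def)
  ultimately have "det (submatrix A UNIV J) = 0" unfolding det_submatrix_zero[OF J] using i(1) by blast
  then show ?thesis unfolding if_not_P[OF False] by simp
qed

lemma maximal_minors_ncols:
  assumes "x \<in> maximal_minors A"
  obtains J where "J \<subseteq> {..<dim_col A}" "ncols A J = dim_row A" "x = det (submatrix A UNIV J)"
proof -
  obtain J where J: "J \<subseteq> {..<dim_col A}" "card J = dim_row A" "x = det (submatrix A UNIV J)"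
    using assms unfolding maximal_minors_def by blast
  moreover have "{i. i < dim_col A \<and> i \<in> J} = J" using J(1) by auto
  ultimately show ?thesis using that by simp
qed

lemma maximal_minorsI:
  assumes "J \<subseteq> {..<dim_col A}" "card J = dim_row A"
  shows "det (submatrix A UNIV J) \<in> maximal_minors A" "ncols A J = dim_row A"
proof -
  show "det (submatrix A UNIV J) \<in> maximal_minors A" using assms unfolding maximal_minors_def by blast
  have "{i. i < dim_col A \<and> i \<in> J} = J" using assms(1) by auto
  then show "ncols A J = dim_row A" using assms(2) by simp
qed

text \<open>All minors are 0 or units by \<open>sign_classes_minor\<close>, and dropping one column
  of every class gives a unit. The sign vectors of the classes are the columns of \<open>B\<close>,
  whose rows have one nonzero entry each.\<close>

lemma sign_classes_unimodular:
  assumes sc: "sign_classes A K cls \<epsilon>" and surj: "int_surjective A" and dim: "dim_row A + K = dim_col A"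
  shows "unimodular A" "admissible A"
proof -
  let ?n = "dim_col A" and ?d = "dim_row A"
  have minor: "\<bar>x\<bar> = 0 \<or> \<bar>x\<bar> = 1" if x: "x \<in> maximal_minors A" for x
  proof -
    obtain J where J: "J \<subseteq> {..<dim_col A}" "ncols A J = dim_row A" "x = det (submatrix A UNIV J)"
      by (rule maximal_minors_ncols[OF x], rule that)
    show ?thesis unfolding J(3) sign_classes_minor[OF sc surj dim J(2)] by simp
  qed
  then show "unimodular A" unfolding unimodular_def by (metis abs_eq_0)
  have "\<forall>c<K. \<exists>i<?n. cls i = c" using sign_classesD(2)[OF sc] by (metis imageE lessThan_iff)
  then obtain r where r: "\<And>c. c < K \<Longrightarrow> r c < ?n \<and> cls (r c) = c" by metis
  have "inj_on r {..<K}" using r by (metis inj_onI lessThan_iff)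
  then have cr: "card (r ` {..<K}) = K" by (simp add: card_image)
  define J where "J = {..<?n} - r ` {..<K}"
  have "card J = ?d" unfolding J_def using cr r dim by (subst card_Diff_subset) auto
  note J = maximal_minorsI[of J A, OF _ this]
  have JJ: "J \<subseteq> {..<?n}" by (auto simp: J_def)
  have "\<forall>c<K. \<exists>i<?n. i \<notin> J \<and> cls i = c" using r unfolding J_def by blast
  then have det1: "\<bar>det (submatrix A UNIV J)\<bar> = 1" using sign_classes_minor[OF sc surj dim J(2)[OF JJ]] by simp
  have "Gcd (maximal_minors A) dvd det (submatrix A UNIV J)" using J(1)[OF JJ] by (rule Gcd_dvd)
  then have "Gcd (maximal_minors A) dvd 1" using det1 by (metis dvd_abs_iff)
  then have gcd: "Gcd (maximal_minors A) = 1" by (metis Gcd_int_greater_eq_0 zdvd1_eq abs_of_nonneg)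
  define B where "B = mat ?n K (\<lambda>(i, c). if cls i = c then \<epsilon> i else 0)"
  have Bc: "B \<in> carrier_mat ?n K" by (simp add: B_def)
  have By: "(B *\<^sub>v y) $ i = \<epsilon> i * y $ (cls i)" if y: "y \<in> carrier_vec K" and i: "i < ?n" for y i
  proof -
    have "cls i < K" using sign_classesD(2)[OF sc] i by blast
    have "(B *\<^sub>v y) $ i = (\<Sum>c\<in>{0..<K}. (if cls i = c then \<epsilon> i else 0) * y $ c)"
      using y i by (simp add: B_def scalar_prod_def)
    also have "\<dots> = (\<Sum>c\<in>{0..<K}. if c = cls i then \<epsilon> i * y $ c else 0)" by (rule sum.cong) auto
    also have "\<dots> = \<epsilon> i * y $ (cls i)" using \<open>cls i < K\<close> by simp
    finally show ?thesis .
  qed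
  have mk: "v \<in> mat_kernel A \<longleftrightarrow> v \<in> carrier_vec ?n \<and> (\<forall>j<?d. lin A (\<lambda>i. v $ i) j = 0)" for v
  proof -
    have "A *\<^sub>v v = 0\<^sub>v ?d \<longleftrightarrow> (\<forall>j<?d. lin A (\<lambda>i. v $ i) j = 0)" if "v \<in> carrier_vec ?n"
      using that by (auto simp: vec_eq_iff scalar_prod_def lin_def lessThan_atLeast0)
    then show ?thesis unfolding mat_kernel_def by blast
  qed
  have "kernel_basis A B"
    unfolding kernel_basis_def
  proof
    show "B \<in> carrier_mat ?n (?n - ?d)" using Bc dim by (metis diff_add_inverse)
    have "dim_col B = K" by (simp add: B_def)
    show "bij_betw (\<lambda>y. B *\<^sub>v y) (carrier_vec (dim_col B)) (mat_kernel A)"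
      unfolding bij_betw_def \<open>dim_col B = K\<close>
    proof
      show "inj_on (\<lambda>y. B *\<^sub>v y) (carrier_vec K)"
      proof (rule inj_onI)
        fix y z assume yz: "y \<in> carrier_vec K" "z \<in> carrier_vec K" "B *\<^sub>v y = B *\<^sub>v z"
        show "y = z"
        proof (rule eq_vecI)
          fix c assume "c < dim_vec z"
          then have c: "c < K" using yz by simp
          have "\<epsilon> (r c) * y $ c = \<epsilon> (r c) * z $ c"
            using By[OF yz(1), of "r c"] By[OF yz(2), of "r c"] yz(3) r[OF c] by metis
          moreover have "\<epsilon> (r c) \<noteq> 0" using sign_classesD(1)[OF sc, of "r c"] by auto
          ultimately show "y $ c = z $ c" by simp
        qed (use yz in simp)
      qed
      show "(\<lambda>y. B *\<^sub>v y) ` carrier_vec K = mat_kernel A"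
      proof (intro equalityI subsetI)
        fix v assume "v \<in> (\<lambda>y. B *\<^sub>v y) ` carrier_vec K"
        then obtain y where y: "y \<in> carrier_vec K" "v = B *\<^sub>v y" by blast
        have "\<exists>t. \<forall>i<?n. v $ i = \<epsilon> i * t (cls i)" using By[OF y(1)] y(2) by (intro exI[of _ "\<lambda>c. y $ c"]) simp
        moreover have "v \<in> carrier_vec ?n" using y Bc by auto
        ultimately show "v \<in> mat_kernel A" unfolding mk using sign_classes_kernel_int[OF sc, of "\<lambda>i. v $ i"] by blast
      next
        fix v assume "v \<in> mat_kernel A"
        then have v: "v \<in> carrier_vec ?n" "\<exists>t. \<forall>i<?n. v $ i = \<epsilon> i * t (cls i)"
          unfolding mk using sign_classes_kernel_int[OF sc, of "\<lambda>i. v $ i"] by blast+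
        then obtain t where t: "\<forall>i<?n. v $ i = \<epsilon> i * t (cls i)" by blast
        have "cls i < K" if "i < ?n" for i using sign_classesD(2)[OF sc] that by blast
        then have "v = B *\<^sub>v vec K t" using v(1) t By[of "vec K t"] Bc by (intro eq_vecI) auto
        then show "v \<in> (\<lambda>y. B *\<^sub>v y) ` carrier_vec K" by auto
      qed
    qed
  qed
  moreover have "\<forall>i<?n. row B i \<noteq> 0\<^sub>v (dim_col B)"
  proof (intro allI impI notI)
    fix i assume i: "i < ?n" and z: "row B i = 0\<^sub>v (dim_col B)"
    have ck: "cls i < K" using sign_classesD(2)[OF sc] i by blast
    have "row B i $ cls i = \<epsilon> i" using i ck by (simp add: B_def)
    moreover have "(0\<^sub>v (dim_col B) :: int vec) $ cls i = 0" using ck by (simp add: B_def)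
    ultimately show False using z sign_classes_sq[OF sc, of i] by auto
  qed
  ultimately show "admissible A" unfolding admissible_def using gcd by blast
qed

text \<open>The nonzero minors have a common absolute value, which divides the gcd of all minors and
  so is 1.\<close>

lemma unimodular_unit_minor:
  assumes "admissible A" "unimodular A"
  obtains J where "J \<subseteq> {..<dim_col A}" "ncols A J = dim_row A" "\<bar>det (submatrix A UNIV J)\<bar> = 1"
    "\<And>x. x \<in> maximal_minors A \<Longrightarrow> x = 0 \<or> \<bar>x\<bar> = 1"
proof -
  have gcd: "Gcd (maximal_minors A) = 1" using assms(1) unfolding admissible_def by blast
  have "\<not> maximal_minors A \<subseteq> {0}"
  proof
    assume "maximal_minors A \<subseteq> {0}"
    then have "Gcd (maximal_minors A) = 0" by (simp add: Gcd_0_iff)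
    then show False using gcd by simp
  qed
  then obtain x where x: "x \<in> maximal_minors A" "x \<noteq> 0" by blast
  have y: "y = 0 \<or> \<bar>y\<bar> = \<bar>x\<bar>" if "y \<in> maximal_minors A" for y
    using assms(2) x that unfolding unimodular_def by blast
  then have "x dvd y" if "y \<in> maximal_minors A" for y
    using that by (metis dvd_0_right dvd_abs_iff abs_dvd_iff dvd_refl)
  then have "x dvd Gcd (maximal_minors A)" by (rule Gcd_greatest)
  then have x1: "\<bar>x\<bar> = 1" using gcd by simp
  obtain J where "J \<subseteq> {..<dim_col A}" "ncols A J = dim_row A" "x = det (submatrix A UNIV J)"
    by (rule maximal_minors_ncols[OF x(1)], rule that)
  then show ?thesis using that x1 y by simp
qed

lemma unimodular_int_surjective:
  assumes "admissible A" "unimodular A" shows "int_surjective A"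
proof -
  obtain J where J: "J \<subseteq> {..<dim_col A}" "ncols A J = dim_row A" "\<bar>det (submatrix A UNIV J)\<bar> = 1"
    "\<And>x. x \<in> maximal_minors A \<Longrightarrow> x = 0 \<or> \<bar>x\<bar> = 1"
    by (rule unimodular_unit_minor[OF assms], rule that)
  show ?thesis unfolding int_surjective_def
  proof
    fix v :: "nat \<Rightarrow> int"
    show "\<exists>y. \<forall>j<dim_row A. lin A y j = v j" using det_submatrix_inverse[OF J(2,3), of v] by blast
  qed
qed

text \<open>If the kernel is a direct sum of lines with disjoint supports, unimodularity makes the lines be spanned by sign
  vectors: for every index \<open>i\<close> there is a maximal minor avoiding \<open>i\<close> that is a unit, hence an integral kernel vector
  with the entry \<open>1\<close> at \<open>i\<close>.\<close>

lemma line_classes_sign_classes: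
  fixes x :: "nat \<Rightarrow> complex" and b :: "nat \<Rightarrow> int"
  assumes adm: "admissible A" "unimodular A"
    and cls: "cls ` {..<dim_col A} = {..<K}"
    and kernel: "\<And>y :: nat \<Rightarrow> complex. (\<forall>j<dim_row A. lin A y j = 0) \<longleftrightarrow> (\<exists>t. \<forall>i<dim_col A. y i = x i * t (cls i))"
    and b: "\<And>j. j < dim_row A \<Longrightarrow> lin A b j = 0" "\<And>i. i < dim_col A \<Longrightarrow> b i \<noteq> 0"
  shows "\<exists>\<epsilon>. sign_classes A K cls \<epsilon>"
proof -
  let ?n = "dim_col A" and ?d = "dim_row A"
  have kernel_int: "(\<forall>j<?d. lin A y j = 0) \<longleftrightarrow> (\<exists>t. \<forall>i<?n. of_int (y i) = x i * t (cls i))" for y :: "nat \<Rightarrow> int"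
    using kernel[of "\<lambda>i. of_int (y i)"] by (simp add: lin_of_int)
  obtain \<tau> where \<tau>: "\<And>i. i < ?n \<Longrightarrow> of_int (b i) = x i * \<tau> (cls i)" using kernel_int[of b] b(1) by blast
  have \<tau>0: "\<tau> (cls i) \<noteq> 0" if "i < ?n" for i using \<tau>[OF that] b(2)[OF that] by auto
  \<comment> \<open>Integral kernel vectors are proportional to \<open>b\<close> on each class,
    written without division.\<close>
  have ratio: "y i * b m = y m * b i"
    if y: "\<And>j. j < ?d \<Longrightarrow> lin A y j = 0" and i: "i < ?n" "m < ?n" "cls i = cls m" for y :: "nat \<Rightarrow> int" and i m
  proof -
    obtain t where t: "\<And>i. i < ?n \<Longrightarrow> of_int (y i) = x i * t (cls i)" using kernel_int[of y] y by blast
    have "(of_int (y i * b m) :: complex) = of_int (y m * b i)"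
      by (simp add: t[OF i(1)] t[OF i(2)] \<tau>[OF i(1)] \<tau>[OF i(2)] i(3) mult_ac)
    then show ?thesis by (simp only: of_int_eq_iff)
  qed
  obtain J0 where J0: "J0 \<subseteq> {..<?n}" "ncols A J0 = ?d" "\<bar>det (submatrix A UNIV J0)\<bar> = 1"
    and minors: "\<And>x. x \<in> maximal_minors A \<Longrightarrow> x = 0 \<or> \<bar>x\<bar> = 1"
    by (rule unimodular_unit_minor[OF adm], rule that)
  have meet: "\<exists>i<?n. i \<notin> J0 \<and> cls i = c" if c: "c < K" for c
  proof (rule ccontr)
    assume n: "\<not> ?thesis"
    define y where "y i = (if cls i = c then b i else 0)" for i
    have "\<forall>j<?d. lin A y j = 0"
      unfolding kernel_int by (intro exI[of _ "\<lambda>c'. if c' = c then \<tau> c else 0"]) (auto simp: y_def \<tau>)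
    moreover have "\<forall>i<?n. i \<notin> J0 \<longrightarrow> y i = 0" using n by (auto simp: y_def)
    moreover obtain i where "i < ?n" "cls i = c" using cls c by (metis imageE lessThan_iff)
    moreover from this have "y i \<noteq> 0" using b(2) by (simp add: y_def)
    ultimately have "det (submatrix A UNIV J0) = 0" unfolding det_submatrix_zero[OF J0(2)] by blast
    then show False using J0(3) by simp
  qed
  \<comment> \<open>The column \<open>i\<close> is an integral combination of the columns in
    \<open>J\<close>, as their minor is a unit; the difference is a kernel vector.\<close>
  have unit_vec: "\<exists>y. (\<forall>j<?d. lin A y j = 0) \<and> y i = (1 :: int) \<and> (\<forall>m<?n. m \<notin> J \<longrightarrow> m \<noteq> i \<longrightarrow> y m = 0)"
    if J: "ncols A J = ?d" "\<bar>det (submatrix A UNIV J)\<bar> = 1" and i: "i < ?n" "i \<notin> J" for J i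
  proof -
    obtain w where w: "\<forall>m<?n. m \<notin> J \<longrightarrow> w m = 0" "\<forall>j<?d. lin A w j = A $$ (j, i)"
      using det_submatrix_inverse[OF J, of "\<lambda>j. A $$ (j, i)"] by blast
    define y where "y m = (if m = i then 1 else 0) - w m" for m
    have "lin A y j = 0" if "j < ?d" for j
      unfolding y_def lin_diff lin_unit[OF i(1)] using w(2) that by simp
    moreover have "y i = 1" using w(1) i by (simp add: y_def)
    moreover have "\<forall>m<?n. m \<notin> J \<longrightarrow> m \<noteq> i \<longrightarrow> y m = 0" using w(1) by (simp add: y_def)
    ultimately show ?thesis by blast
  qed
  \<comment> \<open>Two indices of one class outside \<open>J0\<close> would admit a kernel vector
    with entries 1 and 0 there, contrary to \<open>ratio\<close>.\<close>
  have unique: "i = i'" if i: "i < ?n" "i \<notin> J0" and i': "i' < ?n" "i' \<notin> J0" and c: "cls i = cls i'" for i i'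
  proof (rule ccontr)
    assume "i \<noteq> i'"
    obtain y where y: "\<forall>j<?d. lin A y j = 0" "y i = (1 :: int)" "\<forall>m<?n. m \<notin> J0 \<longrightarrow> m \<noteq> i \<longrightarrow> y m = 0"
      using unit_vec[OF J0(2,3) i] by blast
    have "y i * b i' = y i' * b i" by (rule ratio) (use y(1) i i' c in auto)
    then show False using y(2,3) i' \<open>i \<noteq> i'\<close> b(2) by auto
  qed
  have "bij_betw cls {i. i < ?n \<and> i \<notin> J0} {..<K}"
    unfolding bij_betw_def
  proof
    show "inj_on cls {i. i < ?n \<and> i \<notin> J0}" using unique by (auto simp: inj_on_def)
    show "cls ` {i. i < ?n \<and> i \<notin> J0} = {..<K}" using meet cls by force
  qed
  then have "card {i. i < ?n \<and> i \<notin> J0} = K" by (metis bij_betw_same_card card_lessThan)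
  moreover have "card {i. i < ?n \<and> i \<in> J0} + card {i. i < ?n \<and> i \<notin> J0} = ?n"
  proof -
    have "card {i. i < ?n \<and> i \<in> J0} + card {i. i < ?n \<and> i \<notin> J0} = card ({i. i < ?n \<and> i \<in> J0} \<union> {i. i < ?n \<and> i \<notin> J0})"
      by (rule card_Un_disjoint[symmetric]) auto
    also have "{i. i < ?n \<and> i \<in> J0} \<union> {i. i < ?n \<and> i \<notin> J0} = {..<?n}" by auto
    finally show ?thesis by simp
  qed
  ultimately have dim: "?d + K = ?n" using J0(2) by simp
  \<comment> \<open>A transversal through \<open>i0\<close> has a complement with nonzero minor,
    again by \<open>ratio\<close>, so \<open>unit_vec\<close> applies at \<open>i0\<close>.\<close>
  have unit: "\<exists>y. (\<forall>j<?d. lin A y j = 0) \<and> y i0 = (1 :: int)" if i0: "i0 < ?n" for i0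
  proof -
    obtain r0 where r0: "\<And>c. c < K \<Longrightarrow> r0 c < ?n \<and> cls (r0 c) = c" using meet by metis
    define r where "r c = (if c = cls i0 then i0 else r0 c)" for c
    have r: "r c < ?n \<and> cls (r c) = c" if "c < K" for c using r0[OF that] i0 by (simp add: r_def)
    have "inj_on r {..<K}" using r by (metis inj_onI lessThan_iff)
    then have cr: "card (r ` {..<K}) = K" by (simp add: card_image)
    define J where "J = {..<?n} - r ` {..<K}"
    have JJ: "J \<subseteq> {..<?n}" by (auto simp: J_def)
    have "card J = ?d" unfolding J_def using cr r dim by (subst card_Diff_subset) auto
    note J = maximal_minorsI[OF JJ this]
    have clsK: "cls i < K" if "i < ?n" for i using cls that by blast
    have "det (submatrix A UNIV J) \<noteq> 0"
    proof
      assume "det (submatrix A UNIV J) = 0"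
      then obtain y :: "nat \<Rightarrow> int" and i where y: "\<forall>i<?n. i \<notin> J \<longrightarrow> y i = 0" "i < ?n" "y i \<noteq> 0" "\<forall>j<?d. lin A y j = 0"
        unfolding det_submatrix_zero[OF J(2)] by blast
      let ?m = "r (cls i)"
      have m: "?m < ?n" "cls ?m = cls i" "?m \<notin> J" using r[OF clsK[OF y(2)]] clsK[OF y(2)] by (auto simp: J_def)
      have "y i * b ?m = y ?m * b i" by (rule ratio) (use y m in auto)
      moreover have "y ?m = 0" using y(1) m by blast
      ultimately show False using y(3) b(2)[OF m(1)] by simp
    qed
    then have "\<bar>det (submatrix A UNIV J)\<bar> = 1" using minors[OF J(1)] by blast
    moreover have "i0 \<notin> J" using clsK[OF i0] by (auto simp: J_def r_def image_iff)
    ultimately show ?thesis using unit_vec[OF J(2) _ i0] by blast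
  qed
  \<comment> \<open>Comparison with a kernel vector that is 1 at \<open>i\<close>. Used in both
    directions, it makes the absolute value of \<open>b\<close> constant on each class.\<close>
  have dvd: "b i dvd b m" if i: "i < ?n" "m < ?n" "cls i = cls m" for i m
  proof -
    obtain y where y: "\<forall>j<?d. lin A y j = 0" "y i = (1 :: int)" using unit[OF i(1)] by blast
    have "y i * b m = y m * b i" by (rule ratio) (use y i in auto)
    then show ?thesis using y(2) by simp
  qed
  define \<epsilon> where "\<epsilon> i = (if i < ?n then sgn (b i) else 1)" for i
  have \<epsilon>: "\<epsilon> i = 1 \<or> \<epsilon> i = -1" for i using b(2)[of i] by (auto simp: \<epsilon>_def sgn_if)
  obtain r where r: "\<And>c. c < K \<Longrightarrow> r c < ?n \<and> cls (r c) = c" using meet by metis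
  define \<beta> where "\<beta> c = \<bar>b (r c)\<bar>" for c
  have bi: "b i = \<epsilon> i * \<beta> (cls i)" "\<beta> (cls i) \<noteq> 0" if i: "i < ?n" for i
  proof -
    have c: "cls i < K" using cls i by blast
    have "\<bar>b i\<bar> = \<beta> (cls i)" unfolding \<beta>_def
      by (rule zdvd_antisym_abs) (simp_all add: dvd i r[OF c])
    then show "b i = \<epsilon> i * \<beta> (cls i)" "\<beta> (cls i) \<noteq> 0" using b(2)[OF i] i sgn_mult_abs[of "b i"] by (auto simp: \<epsilon>_def)
  qed
  have xi: "x i = of_int (\<epsilon> i) * (of_int (\<beta> (cls i)) / \<tau> (cls i))" if "i < ?n" for i
  proof -
    have "x i * \<tau> (cls i) = of_int (\<epsilon> i) * of_int (\<beta> (cls i))" using \<tau>[OF that] bi(1)[OF that] by (metis of_int_mult)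
    then show ?thesis using \<tau>0[OF that] by (simp add: field_simps)
  qed
  have "(\<exists>t. \<forall>i<?n. y i = x i * t (cls i)) \<longleftrightarrow> (\<exists>t. \<forall>i<?n. y i = of_int (\<epsilon> i) * t (cls i))" for y :: "nat \<Rightarrow> complex"
  proof
    assume "\<exists>t. \<forall>i<?n. y i = x i * t (cls i)"
    then obtain t where "\<forall>i<?n. y i = x i * t (cls i)" by blast
    then show "\<exists>t. \<forall>i<?n. y i = of_int (\<epsilon> i) * t (cls i)"
      by (intro exI[of _ "\<lambda>c. of_int (\<beta> c) / \<tau> c * t c"]) (simp add: xi)
  next
    assume "\<exists>t. \<forall>i<?n. y i = of_int (\<epsilon> i) * t (cls i)"
    then obtain t where t: "\<forall>i<?n. y i = of_int (\<epsilon> i) * t (cls i)" by blast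
    show "\<exists>t. \<forall>i<?n. y i = x i * t (cls i)"
      by (intro exI[of _ "\<lambda>c. t c * \<tau> c / of_int (\<beta> c)"]) (use t \<tau>0 bi(2) in \<open>simp add: xi\<close>)
  qed
  then have "sign_classes A K cls \<epsilon>" unfolding sign_classes_def kernel using \<epsilon> cls by blast
  then show ?thesis by blast
qed

section \<open>Toric varieties among the toric hyperkaehler varieties\<close>

lemma rescale_add: "rescale t (f + g) = rescale t f + rescale t g"
  by (rule poly_mapping_eqI) (simp add: lookup_rescale lookup_add distrib_right)

lemma rescale_single: "rescale t (Poly_Mapping.single m c) = Poly_Mapping.single m (c * eval_monomial t m)"
  by (rule poly_mapping_eqI) (auto simp: lookup_rescale lookup_single when_def)

lemma rescale_const: "rescale t (const c) = const c"
  by (simp add: const_def rescale_single)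

lemma rescale_mult: "rescale t (f * g) = rescale t f * rescale t g"
proof (induction f rule: mpoly_induct)
  case (single m c)
  show ?case
  proof (induction g rule: mpoly_induct)
    case (single m' c')
    then show ?case by (simp add: mult_single rescale_single eval_monomial_add mult_ac)
  qed (simp_all add: rescale_add distrib_left)
qed (simp_all add: rescale_add distrib_right)

lemma rescale_uminus: "rescale t (- f) = - rescale t f"
  by (rule poly_mapping_eqI) (simp add: lookup_rescale)

lemma rescale_diff: "rescale t (f - g) = rescale t f - rescale t g"
  using rescale_add[of t f "- g"] by (simp add: rescale_uminus)

lemma rescale_sum: "rescale t (\<Sum>i\<in>I. f i) = (\<Sum>i\<in>I. rescale t (f i))"
  by (induction I rule: infinite_finite_induct) (simp_all add: rescale_add)

lemma rescale_inverse:
  assumes "\<And>v. t v \<noteq> 0" shows "rescale t (rescale (\<lambda>v. 1 / t v) f) = f"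
proof (rule poly_mapping_eqI)
  fix m
  have "eval_monomial (\<lambda>v. 1 / t v) m * eval_monomial t m = 1"
    unfolding eval_monomial_mult[symmetric] using assms by (simp add: eval_monomial_def)
  then show "Poly_Mapping.lookup (rescale t (rescale (\<lambda>v. 1 / t v) f)) m = Poly_Mapping.lookup f m"
    by (simp add: lookup_rescale mult.assoc)
qed

lemma rescale_zw: "rescale t (var v * var w) = const (t v * t w) * (var v * var w)"
  by (simp add: var_def mult_single rescale_single const_mult_single eval_monomial_add eval_monomial_single)

context
  fixes A :: "int mat" and \<theta> :: "int vec" and t :: "nat + nat \<Rightarrow> complex" and pp :: "zw_poly poly set"
  assumes \<theta>: "\<theta> \<in> carrier_vec (dim_row A)" and pp: "pp \<in> proj_points A \<theta>" and t: "\<And>v. t v \<noteq> 0"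
begin

interpretation proj_point A \<theta> pp
  by (rule proj_pointI[OF \<theta> pp])

lemma monom_torus_map: "f \<in> sections A \<theta> r \<Longrightarrow> monom f r \<in> torus_map A \<theta> t pp \<longleftrightarrow> monom (rescale t f) r \<in> pp"
  by (simp add: torus_map_def monom_in_section_ring map_poly_monom)

text \<open>The preimage of a prime ideal under the ring endomorphism that rescales the
  variables.\<close>

lemma primeideal_torus_map: "primeideal (torus_map A \<theta> t pp) (section_ring A \<theta>)"
proof -
  define E where "E F = map_poly (rescale t) F" for F :: "zw_poly poly"
  have cE: "coeff (E F) r = rescale t (coeff F r)" for F r by (simp add: E_def coeff_map_poly)
  have Ec: "E F \<in> carrier (section_ring A \<theta>)" if "F \<in> carrier (section_ring A \<theta>)" for F
    using that unfolding carrier_section_ring cE by (blast intro: sections_rescale)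
  have mem: "F \<in> torus_map A \<theta> t pp \<longleftrightarrow> F \<in> carrier (section_ring A \<theta>) \<and> E F \<in> pp" for F
    by (simp add: torus_map_def E_def)
  have Emult: "E (F * G) = E F * E G" for F G
    by (simp add: poly_eq_iff cE coeff_mult rescale_sum rescale_mult)
  have Eadd: "E (F + G) = E F + E G" for F G by (simp add: poly_eq_iff cE rescale_add)
  have Euminus: "E (- F) = - E F" for F by (simp add: poly_eq_iff cE rescale_uminus)
  have r1: "rescale t 1 = 1" using rescale_const[of t 1] by simp
  have E1: "E 1 = 1" by (simp add: poly_eq_iff cE coeff_1 r1)
  show ?thesis
  proof (rule primeidealI2)
    show "additive_subgroup (torus_map A \<theta> t pp) (section_ring A \<theta>)"
    proof (rule additive_subgroupI)
      interpret cring "section_ring A \<theta>" by (rule cring_section_ring[OF \<theta>])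
      show "subgroup (torus_map A \<theta> t pp) (add_monoid (section_ring A \<theta>))"
      proof (rule add.subgroupI)
        show "torus_map A \<theta> t pp \<subseteq> carrier (section_ring A \<theta>)" by (auto simp: torus_map_def)
        have "0 \<in> torus_map A \<theta> t pp" by (simp add: mem section_ring_0_closed E_def p_zero)
        then show "torus_map A \<theta> t pp \<noteq> {}" by blast
        show "\<ominus>\<^bsub>section_ring A \<theta>\<^esub> F \<in> torus_map A \<theta> t pp" if "F \<in> torus_map A \<theta> t pp" for F
        proof -
          have c: "F \<in> carrier (section_ring A \<theta>)" "E F \<in> pp" using that by (simp_all add: mem)
          have "\<ominus>\<^bsub>section_ring A \<theta>\<^esub> F = - F"
            by (rule minus_equality) (use c section_ring_uminus_closed in auto)
          moreover have "- E F \<in> pp"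
            using p_mult[OF c(2) section_ring_uminus_closed[OF section_ring_1_closed[OF \<theta>]]] by simp
          ultimately show ?thesis using c(1) section_ring_uminus_closed by (simp add: mem Euminus)
        qed
        show "F \<oplus>\<^bsub>section_ring A \<theta>\<^esub> G \<in> torus_map A \<theta> t pp"
          if "F \<in> torus_map A \<theta> t pp" "G \<in> torus_map A \<theta> t pp" for F G
          using that by (simp add: mem Eadd section_ring_add_closed p_add)
      qed
    qed
    show "cring (section_ring A \<theta>)" by (rule cring_section_ring[OF \<theta>])
    have "1 \<in> carrier (section_ring A \<theta>)" "1 \<notin> torus_map A \<theta> t pp"
      using section_ring_1_closed[OF \<theta>] p_one by (simp_all add: mem E1)
    then show "carrier (section_ring A \<theta>) \<noteq> torus_map A \<theta> t pp" by blast
    show "F \<otimes>\<^bsub>section_ring A \<theta>\<^esub> G \<in> torus_map A \<theta> t pp"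
      if "F \<in> carrier (section_ring A \<theta>)" "G \<in> torus_map A \<theta> t pp" for F G
      using that p_mult Ec by (simp add: mem Emult section_ring_mult_closed[OF \<theta>])
    show "G \<otimes>\<^bsub>section_ring A \<theta>\<^esub> F \<in> torus_map A \<theta> t pp"
      if "F \<in> carrier (section_ring A \<theta>)" "G \<in> torus_map A \<theta> t pp" for F G
      using that p_mult[of "E G" "E F"] Ec by (simp add: mem Emult section_ring_mult_closed[OF \<theta>] mult.commute)
    show "F \<in> torus_map A \<theta> t pp \<or> G \<in> torus_map A \<theta> t pp"
      if "F \<in> carrier (section_ring A \<theta>)" "G \<in> carrier (section_ring A \<theta>)"
        "F \<otimes>\<^bsub>section_ring A \<theta>\<^esub> G \<in> torus_map A \<theta> t pp" for F G
      using that p_prime[of "E F" "E G"] Ec by (simp add: mem Emult)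
  qed
qed

text \<open>Checked on the ideal itself, since the base point of an orbit is an arbitrary point of
  Proj and not given as a \<open>point_ideal\<close>.\<close>

lemma torus_map_proj: "torus_map A \<theta> t pp \<in> proj_points A \<theta>"
proof -
  have "\<forall>F\<in>torus_map A \<theta> t pp. \<forall>r. monom (coeff F r) r \<in> torus_map A \<theta> t pp"
  proof (intro ballI allI)
    fix F r assume F: "F \<in> torus_map A \<theta> t pp"
    have "monom (coeff (map_poly (rescale t) F) r) r \<in> pp" using F by (intro p_homogeneous) (simp add: torus_map_def)
    moreover have "coeff F r \<in> sections A \<theta> r" using F by (simp add: torus_map_def carrier_section_ring)
    ultimately show "monom (coeff F r) r \<in> torus_map A \<theta> t pp" by (simp add: monom_torus_map coeff_map_poly)
  qed
  moreover have "\<exists>r>0. \<exists>f\<in>sections A \<theta> r. monom f r \<notin> torus_map A \<theta> t pp"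
  proof -
    obtain r f where f: "r > 0" "f \<in> sections A \<theta> r" "f \<notin> hpart pp A \<theta> r" using semistable by blast
    then have "rescale (\<lambda>v. 1 / t v) f \<in> sections A \<theta> r" "monom (rescale (\<lambda>v. 1 / t v) f) r \<notin> torus_map A \<theta> t pp"
      by (auto simp: sections_rescale monom_torus_map rescale_inverse[OF t] hpart_def)
    then show ?thesis using f(1) by blast
  qed
  moreover have "\<exists>c. monom (f - const c * g) r \<in> torus_map A \<theta> t pp"
    if f: "f \<in> sections A \<theta> r" and g: "g \<in> sections A \<theta> r" "monom g r \<notin> torus_map A \<theta> t pp" for r f g
  proof -
    have "rescale t g \<notin> hpart pp A \<theta> r" using g by (simp add: monom_torus_map hpart_def)
    then obtain c where "rescale t f - const c * rescale t g \<in> hpart pp A \<theta> r"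
      using residue[OF sections_rescale[OF f] sections_rescale[OF g(1)]] by blast
    then have "monom (rescale t (f - const c * g)) r \<in> pp" by (simp add: hpart_def rescale_diff rescale_mult rescale_const)
    then have "monom (f - const c * g) r \<in> torus_map A \<theta> t pp"
      using f g(1) by (subst monom_torus_map) (auto intro: sections_diff sections_smult[OF \<theta>])
    then show ?thesis by blast
  qed
  ultimately show ?thesis
    unfolding proj_points_def sections_def[symmetric] using primeideal_torus_map by blast
qed

text \<open>\<open>z\<^sub>i w\<^sub>i\<close> is an eigenvector of the rescaling.\<close>

lemma zw_val_torus_map:
  assumes i: "i < dim_col A"
  shows "zw_val A \<theta> (torus_map A \<theta> t pp) i = t (Inl i) * t (Inr i) * zw_val A \<theta> pp i"
proof -
  let ?f = "var (Inl i) * var (Inr i) :: zw_poly" and ?c = "zw_val A \<theta> pp i" and ?t = "t (Inl i) * t (Inr i)"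
  have f: "?f \<in> sections A \<theta> 0" by (rule zw_section[OF \<theta> i])
  have "?f - const ?c * 1 \<in> hpart pp A \<theta> 0"
    using val_iff[OF sections_1[OF \<theta>] H_one f] unfolding zw_val_def[OF \<theta>] by blast
  from H_smult[OF this, of ?t] have "rescale t (?f - const (?t * ?c) * 1) \<in> hpart pp A \<theta> 0"
    by (simp add: rescale_diff rescale_const rescale_zw right_diff_distrib, simp add: const_mult mult.assoc)
  moreover have "?f - const (?t * ?c) * 1 \<in> sections A \<theta> 0"
    by (intro sections_diff f sections_smult \<theta> sections_1)
  ultimately have mem: "?f - const (?t * ?c) * 1 \<in> hpart (torus_map A \<theta> t pp) A \<theta> 0"
    by (simp add: hpart_def monom_torus_map)
  interpret q: proj_point A \<theta> "torus_map A \<theta> t pp" by (rule proj_pointI[OF \<theta> torus_map_proj])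
  show ?thesis unfolding zw_val_def[OF \<theta>, of "torus_map A \<theta> t pp"]
    using q.val_iff[OF sections_1[OF \<theta>] q.H_one f] mem by blast
qed

end

text \<open>Artin's argument for the independence of characters, with repeated characters grouped together.\<close>

lemma character_classes:
  fixes \<psi> :: "'i \<Rightarrow> 's \<Rightarrow> complex"
  assumes "finite I" "i0 \<in> I" and one: "e \<in> M" "\<And>i. i \<in> I \<Longrightarrow> \<psi> i e = 1"
    and mult: "\<And>s s'. s \<in> M \<Longrightarrow> s' \<in> M \<Longrightarrow> mul s s' \<in> M"
      "\<And>i s s'. i \<in> I \<Longrightarrow> s \<in> M \<Longrightarrow> s' \<in> M \<Longrightarrow> \<psi> i (mul s s') = \<psi> i s * \<psi> i s'"
    and zero: "\<And>s. s \<in> M \<Longrightarrow> (\<Sum>i\<in>I. c i * \<psi> i s) = 0"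
  shows "(\<Sum>i\<in>{i\<in>I. \<forall>s\<in>M. \<psi> i s = \<psi> i0 s}. c i) = 0"
proof -
  let ?C = "{i\<in>I. \<forall>s\<in>M. \<psi> i s = \<psi> i0 s}"
  have "\<forall>m. \<exists>s. m \<in> I - ?C \<longrightarrow> s \<in> M \<and> \<psi> m s \<noteq> \<psi> i0 s" by blast
  \<comment> \<open>For each index outside the class of \<open>i0\<close>, an element at which its
    character differs from that of \<open>i0\<close>.\<close>
  from choice[OF this] obtain \<sigma> where \<sigma>: "\<And>m. m \<in> I - ?C \<Longrightarrow> \<sigma> m \<in> M \<and> \<psi> m (\<sigma> m) \<noteq> \<psi> i0 (\<sigma> m)" by blast
  \<comment> \<open>Translating the relation by \<open>\<sigma> a\<close> and subtracting
    \<open>\<psi> a (\<sigma> a)\<close> times the relation itself puts into every coefficient a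
    factor that is zero at \<open>a\<close>.\<close>
  have step: "(\<Sum>i\<in>I. c i * (\<Prod>m\<in>J. \<psi> i (\<sigma> m) - \<psi> m (\<sigma> m)) * \<psi> i s) = 0"
    if "finite J" "J \<subseteq> I - ?C" "s \<in> M" for J s
    using that
  proof (induction J arbitrary: s rule: finite_induct)
    case empty then show ?case using zero by simp
  next
    case (insert a J)
    let ?P = "\<lambda>i. c i * (\<Prod>m\<in>J. \<psi> i (\<sigma> m) - \<psi> m (\<sigma> m))"
    have a: "\<sigma> a \<in> M" using \<sigma>[of a] insert.prems(1) by blast
    have J: "J \<subseteq> I - ?C" using insert.prems(1) by blast
    have "(\<Sum>i\<in>I. c i * (\<Prod>m\<in>insert a J. \<psi> i (\<sigma> m) - \<psi> m (\<sigma> m)) * \<psi> i s) =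
      (\<Sum>i\<in>I. ?P i * \<psi> i (mul (\<sigma> a) s) - \<psi> a (\<sigma> a) * (?P i * \<psi> i s))"
      using insert.hyps insert.prems(2) mult(2) a by (intro sum.cong refl) (simp add: algebra_simps)
    also have "\<dots> = (\<Sum>i\<in>I. ?P i * \<psi> i (mul (\<sigma> a) s)) - \<psi> a (\<sigma> a) * (\<Sum>i\<in>I. ?P i * \<psi> i s)"
      by (simp add: sum_subtractf sum_distrib_left)
    also have "\<dots> = 0" using insert.IH[OF J mult(1)[OF a insert.prems(2)]] insert.IH[OF J insert.prems(2)] by simp
    finally show ?case .
  qed
  \<comment> \<open>This product vanishes outside the class and is a nonzero constant on it.\<close>
  let ?D = "\<lambda>i. \<Prod>m\<in>I - ?C. \<psi> i (\<sigma> m) - \<psi> m (\<sigma> m)"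
  have fin: "finite (I - ?C)" using assms(1) by simp
  have "0 = (\<Sum>i\<in>I. c i * ?D i)"
    using step[OF fin subset_refl one(1)] one(2) by simp
  also have "\<dots> = (\<Sum>i\<in>?C. c i * ?D i)"
  proof (rule sum.mono_neutral_right[OF assms(1)])
    show "\<forall>i\<in>I - ?C. c i * ?D i = 0"
    proof
      fix i assume i: "i \<in> I - ?C"
      then have "?D i = 0" by (intro prod_zero[OF fin]) (rule bexI[of _ i], simp_all)
      then show "c i * ?D i = 0" by simp
    qed
  qed blast
  also have "\<dots> = (\<Sum>i\<in>?C. c i * ?D i0)"
  proof (rule sum.cong[OF refl])
    fix i assume i: "i \<in> ?C"
    have "?D i = ?D i0" by (rule prod.cong[OF refl]) (use i \<sigma> in auto)
    then show "c i * ?D i = c i * ?D i0" by simp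
  qed
  also have "\<dots> = (\<Sum>i\<in>?C. c i) * ?D i0" by (rule sum_distrib_right[symmetric])
  finally have z: "(\<Sum>i\<in>?C. c i) * ?D i0 = 0" ..
  have "\<psi> i0 (\<sigma> m) - \<psi> m (\<sigma> m) \<noteq> 0" if "m \<in> I - ?C" for m using \<sigma>[OF that] by auto
  then have "?D i0 \<noteq> 0" using fin by (simp add: prod_zero_iff)
  with z show ?thesis by simp
qed

text \<open>Each row of \<open>B\<close> is nonzero, hence is the coefficient list of a nonzero
  polynomial. An integer that avoids their finitely many roots gives, through its powers, a
  combination of the columns of \<open>B\<close> without zero entries.\<close>

lemma admissible_kernel_vector:
  assumes "admissible A"
  obtains b :: "nat \<Rightarrow> int" where "\<And>j. j < dim_row A \<Longrightarrow> lin A b j = 0" "\<And>i. i < dim_col A \<Longrightarrow> b i \<noteq> 0"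
proof -
  let ?n = "dim_col A"
  obtain B where B: "kernel_basis A B" "\<forall>i<?n. row B i \<noteq> 0\<^sub>v (dim_col B)" using assms unfolding admissible_def by blast
  let ?k = "dim_col B"
  have Bc: "dim_row B = ?n" using B(1) unfolding kernel_basis_def by auto
  define q where "q i = (\<Sum>c<?k. monom (B $$ (i, c)) c)" for i
  have cq: "coeff (q i) c = (if c < ?k then B $$ (i, c) else 0)" for i c
    unfolding q_def by (simp add: coeff_sum coeff_monom)
  have q0: "q i \<noteq> 0" if i: "i < ?n" for i
  proof
    assume "q i = 0"
    then have "coeff (q i) c = 0" for c by simp
    then have "B $$ (i, c) = 0" if "c < ?k" for c using that cq[of i c] by simp
    then have "row B i = 0\<^sub>v ?k" using i Bc by (intro eq_vecI) auto
    then show False using B(2) i by blast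
  qed
  have "finite (\<Union>i<?n. {x. poly (q i) x = 0})" using q0 by (intro finite_UN_I) (auto simp: poly_roots_finite)
  then obtain M :: int where M: "M \<notin> (\<Union>i<?n. {x. poly (q i) x = 0})"
    using ex_new_if_finite[OF infinite_UNIV_int] by blast
  define v where "v = vec ?k (\<lambda>c. M ^ c)"
  define b where "b i = (B *\<^sub>v v) $ i" for i
  have bq: "b i = poly (q i) M" if "i < ?n" for i
    using that Bc by (simp add: b_def q_def v_def scalar_prod_def poly_sum poly_monom lessThan_atLeast0)
  have "v \<in> carrier_vec ?k" by (simp add: v_def)
  then have "B *\<^sub>v v \<in> mat_kernel A" using B(1) unfolding kernel_basis_def by (auto dest: bij_betw_apply)
  then have ker: "A *\<^sub>v (B *\<^sub>v v) = 0\<^sub>v (dim_row A)" unfolding mat_kernel_def by blast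
  have "lin A b j = 0" if j: "j < dim_row A" for j
  proof -
    have "lin A b j = (A *\<^sub>v (B *\<^sub>v v)) $ j" using j Bc by (simp add: lin_def b_def scalar_prod_def lessThan_atLeast0)
    then show ?thesis using ker j by simp
  qed
  moreover have "b i \<noteq> 0" if "i < ?n" for i using M that unfolding bq[OF that] by blast
  ultimately show ?thesis by (rule that)
qed

text \<open>Take z = 1 and w = y. The monomial whose exponents are the positive parts of
  \<open>u\<close> on z and the negative parts on w has degree \<theta>; it does not vanish there
  because \<open>y\<close> has no zero entries, so the point is semistable.\<close>

lemma hk_point_exists:
  fixes y :: "nat \<Rightarrow> complex"
  assumes \<theta>: "\<theta> = vec (dim_row A) (lin A u)"
    and y: "\<And>j. j < dim_row A \<Longrightarrow> lin A y j = 0" "\<And>i. i < dim_col A \<Longrightarrow> y i \<noteq> 0"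
  shows "\<exists>q\<in>hk_points A \<theta>. \<forall>i<dim_col A. zw_val A \<theta> q i = y i"
proof -
  let ?n = "dim_col A"
  have \<theta>c: "\<theta> \<in> carrier_vec (dim_row A)" by (simp add: \<theta>)
  define x :: "nat + nat \<Rightarrow> complex" where "x = case_sum (\<lambda>i. 1) y"
  define m where "m = (\<Sum>i<?n. Poly_Mapping.single (Inl i) (nat (u i)) + Poly_Mapping.single (Inr i) (nat (- u i)))"
  have lk: "Poly_Mapping.lookup m (Inl i) = nat (u i)" "Poly_Mapping.lookup m (Inr i) = nat (- u i)" if "i < ?n" for i
    using that by (simp_all add: m_def lookup_sum lookup_add lookup_single when_def)
  have lk0: "Poly_Mapping.lookup m (Inl i) = 0" "Poly_Mapping.lookup m (Inr i) = 0" if "\<not> i < ?n" for i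
    using that by (auto simp: m_def lookup_sum lookup_add lookup_single when_def intro!: sum.neutral)
  have "v \<in> Inl ` {..<?n} \<union> Inr ` {..<?n}" if "Poly_Mapping.lookup m v \<noteq> 0" for v
    using that lk0(1) lk0(2) by (cases v) (metis UnI1 UnI2 imageI lessThan_iff)+
  then have keys: "Poly_Mapping.keys m \<subseteq> Inl ` {..<?n} \<union> Inr ` {..<?n}" by (auto simp: in_keys_iff)
  have "monomial_degree A m = int 1 \<cdot>\<^sub>v \<theta>"
    unfolding \<theta> monomial_degree_def lin_def by (intro eq_vecI) (auto simp: lk intro!: sum.cong)
  then have mk: "m \<in> section_keys A \<theta> 1" using keys by (simp add: section_keys_def graded_keys_def)
  have "eval_monomial x m \<noteq> 0"
    unfolding eval_monomial_def using keys y(2) by (auto simp: x_def prod_zero_iff)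
  then have proj: "point_ideal A \<theta> x \<in> proj_points A \<theta>"
    using point_ideal_in_proj[OF \<theta>c _ sections_single[OF mk, of 1], of x] by (simp add: eval_mpoly_single)
  have zw: "zw_val A \<theta> (point_ideal A \<theta> x) i = y i" if "i < ?n" for i
    unfolding zw_val_point_ideal[OF \<theta>c proj that] by (simp add: x_def)
  have "point_ideal A \<theta> x \<in> hk_points A \<theta>"
    unfolding hk_points_zw_val[OF \<theta>c] using proj y(1) zw by (simp add: lin_def)
  then show ?thesis using zw by blast
qed

text \<open>Extracts linear data from the orbit: \<open>x\<close> collects the values of the
  \<open>z\<^sub>i w\<^sub>i\<close> at the base point, and \<open>\<psi> i\<close> is the character
  by which the subtorus acts on \<open>z\<^sub>i w\<^sub>i\<close>. The last property is density: a
  linear relation between these functions holds on a closed set, so it passes from the orbit to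
  Y.\<close>

lemma toric_orbit:
  assumes \<theta>: "\<theta> \<in> carrier_vec (dim_row A)" and "is_toric A \<theta>"
  obtains k :: nat and \<psi> :: "nat \<Rightarrow> (nat \<Rightarrow> complex) \<Rightarrow> complex" and x :: "nat \<Rightarrow> complex" where
    "\<And>i. \<psi> i (\<lambda>_. 1) = 1" "\<And>i s s'. \<psi> i (\<lambda>l. s l * s' l) = \<psi> i s * \<psi> i s'"
    "\<And>s j. \<forall>l<k. s l \<noteq> 0 \<Longrightarrow> j < dim_row A \<Longrightarrow> lin A (\<lambda>i. \<psi> i s * x i) j = 0"
    "\<And>a q. \<forall>s. (\<forall>l<k. s l \<noteq> 0) \<longrightarrow> (\<Sum>i<dim_col A. a i * (\<psi> i s * x i)) = 0 \<Longrightarrow> q \<in> hk_points A \<theta> \<Longrightarrow>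
      (\<Sum>i<dim_col A. a i * zw_val A \<theta> q i) = 0"
proof -
  let ?n = "dim_col A" and ?X = "zariski (lawrence_variety A \<theta>)"
  obtain T p0 where T: "subtorus A \<theta> T" and "p0 \<in> points (lawrence_variety A \<theta>)"
    and hk: "hk_points A \<theta> = ?X closure_of {\<tau> p0 |\<tau>. \<tau> \<in> T}"
    using assms(2) unfolding is_toric_def by blast
  then have p0: "p0 \<in> proj_points A \<theta>" by (simp add: points_lawrence[OF \<theta>])
  obtain k and w :: "nat + nat \<Rightarrow> nat \<Rightarrow> int" where
    T': "T = {torus_map A \<theta> (\<lambda>v. \<Prod>l<k. s l powi w v l) |s. \<forall>l<k. s l \<noteq> 0}"
    using T unfolding subtorus_def by blast
  define t where "t s v = (\<Prod>l<k. s l powi w v l)" for s :: "nat \<Rightarrow> complex" and v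
  define \<psi> where "\<psi> i s = t s (Inl i) * t s (Inr i)" for i s
  define x where "x = zw_val A \<theta> p0"
  have orbit: "{\<tau> p0 |\<tau>. \<tau> \<in> T} = {torus_map A \<theta> (t s) p0 |s. \<forall>l<k. s l \<noteq> 0}"
    unfolding T' t_def by blast
  have t0: "t s v \<noteq> 0" if "\<forall>l<k. s l \<noteq> 0" for s v using that by (simp add: t_def)
  have proj: "torus_map A \<theta> (t s) p0 \<in> proj_points A \<theta>" if "\<forall>l<k. s l \<noteq> 0" for s
    by (rule torus_map_proj[OF \<theta> p0 t0[OF that]])
  have zw: "zw_val A \<theta> (torus_map A \<theta> (t s) p0) i = \<psi> i s * x i" if "\<forall>l<k. s l \<noteq> 0" "i < ?n" for s i
    unfolding \<psi>_def x_def by (rule zw_val_torus_map[OF \<theta> p0 t0[OF that(1)] that(2)])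
  have sub: "{\<tau> p0 |\<tau>. \<tau> \<in> T} \<subseteq> hk_points A \<theta>"
    unfolding hk by (rule closure_of_subset) (use proj in \<open>auto simp: orbit points_lawrence[OF \<theta>]\<close>)
  show ?thesis
  proof (rule that[of \<psi> k x])
    show "\<psi> i (\<lambda>_. 1) = 1" for i by (simp add: \<psi>_def t_def)
    show "\<psi> i (\<lambda>l. s l * s' l) = \<psi> i s * \<psi> i s'" for i s s'
      by (simp add: \<psi>_def t_def power_int_mult_distrib prod.distrib)
    show "lin A (\<lambda>i. \<psi> i s * x i) j = 0" if s: "\<forall>l<k. s l \<noteq> 0" and j: "j < dim_row A" for s j
    proof -
      have "torus_map A \<theta> (t s) p0 \<in> hk_points A \<theta>" using sub s unfolding orbit by blast
      then have "(\<Sum>i<?n. of_int (A $$ (j, i)) * zw_val A \<theta> (torus_map A \<theta> (t s) p0) i) = 0"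
        using j unfolding hk_points_zw_val[OF \<theta>] by blast
      then show ?thesis by (simp add: lin_def zw[OF s])
    qed
    show "(\<Sum>i<?n. a i * zw_val A \<theta> q i) = 0"
      if a: "\<forall>s. (\<forall>l<k. s l \<noteq> 0) \<longrightarrow> (\<Sum>i<?n. a i * (\<psi> i s * x i)) = 0" and q: "q \<in> hk_points A \<theta>" for a q
    proof -
      define f :: zw_poly where "f = (\<Sum>i<?n. const (a i) * var (Inl i) * var (Inr i))"
      have f: "f \<in> sections A \<theta> 0"
        unfolding f_def mult.assoc by (intro sections_sum sections_smult \<theta> zw_section) simp
      have iff: "monom f 0 \<in> r \<longleftrightarrow> (\<Sum>i<?n. a i * zw_val A \<theta> r i) = 0" if "r \<in> proj_points A \<theta>" for r
      proof -
        interpret r: proj_point A \<theta> r by (rule proj_pointI[OF \<theta> that])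
        show ?thesis using r.val_eq_0_iff[OF sections_1[OF \<theta>] r.H_one f] r.H_monom[OF f]
          unfolding f_def val_linear[OF \<theta> that] by blast
      qed
      have cl: "closedin ?X {r \<in> proj_points A \<theta>. monom f 0 \<in> r}"
      proof -
        have "proj_points A \<theta> - {r \<in> proj_points A \<theta>. monom f 0 \<in> r} = {r \<in> proj_points A \<theta>. monom f 0 \<notin> r}" by blast
        then show ?thesis unfolding closedin_def points_lawrence[OF \<theta>]
          using openin_lawrence_nonzero[OF \<theta> f] by auto
      qed
      have "{\<tau> p0 |\<tau>. \<tau> \<in> T} \<subseteq> {r \<in> proj_points A \<theta>. monom f 0 \<in> r}"
        unfolding orbit using iff[OF proj] a by (auto simp: proj zw)
      from closure_of_minimal[OF this cl] have "monom f 0 \<in> q" "q \<in> proj_points A \<theta>" using q unfolding hk[symmetric] by blast+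
      then show ?thesis using iff by blast
    qed
  qed
qed

text \<open>The orbit vectors span the kernel. Indices with equal characters have proportional
  entries in all orbit vectors, hence in all kernel vectors; conversely, separating different
  characters shows that the part of \<open>x\<close> on each class lies in the kernel by itself. So
  the kernel is a sum of lines, one for each class.\<close>

lemma toric_sign_classes:
  assumes adm: "admissible A" "unimodular A" and \<theta>: "\<theta> \<in> carrier_vec (dim_row A)" and tor: "is_toric A \<theta>"
  shows "\<exists>K cls \<epsilon>. sign_classes A K cls \<epsilon>"
proof -
  let ?n = "dim_col A" and ?d = "dim_row A"
  obtain u where u: "\<forall>j<?d. lin A u j = \<theta> $ j"
    using spec[OF unimodular_int_surjective[OF adm, unfolded int_surjective_def], of "\<lambda>j. \<theta> $ j"] by auto
  have \<theta>u: "\<theta> = vec ?d (lin A u)" using \<theta> u by (intro eq_vecI) auto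
  obtain b :: "nat \<Rightarrow> int" where b: "\<And>j. j < ?d \<Longrightarrow> lin A b j = 0" "\<And>i. i < ?n \<Longrightarrow> b i \<noteq> 0"
    by (rule admissible_kernel_vector[OF adm(1)], rule that)
  obtain k :: nat and \<psi> :: "nat \<Rightarrow> (nat \<Rightarrow> complex) \<Rightarrow> complex" and x :: "nat \<Rightarrow> complex" where
    one: "\<And>i. \<psi> i (\<lambda>_. 1) = 1" and mult: "\<And>i s s'. \<psi> i (\<lambda>l. s l * s' l) = \<psi> i s * \<psi> i s'"
    and stable: "\<And>s j. \<forall>l<k. s l \<noteq> 0 \<Longrightarrow> j < ?d \<Longrightarrow> lin A (\<lambda>i. \<psi> i s * x i) j = 0"
    and dense: "\<And>a q. \<forall>s. (\<forall>l<k. s l \<noteq> 0) \<longrightarrow> (\<Sum>i<?n. a i * (\<psi> i s * x i)) = 0 \<Longrightarrow> q \<in> hk_points A \<theta> \<Longrightarrow>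
      (\<Sum>i<?n. a i * zw_val A \<theta> q i) = 0"
    by (rule toric_orbit[OF \<theta> tor], rule that, assumption+)
  define M where "M = {s :: nat \<Rightarrow> complex. \<forall>l<k. s l \<noteq> 0}"
  have functional0: "(\<Sum>i<?n. a i * y i) = 0"
    if a: "\<And>s. \<forall>l<k. s l \<noteq> 0 \<Longrightarrow> (\<Sum>i<?n. a i * (\<psi> i s * x i)) = 0"
      and y: "\<And>j. j < ?d \<Longrightarrow> lin A y j = 0" "\<And>i. i < ?n \<Longrightarrow> y i \<noteq> 0" for a y
  proof -
    obtain q where q: "q \<in> hk_points A \<theta>" "\<forall>i<?n. zw_val A \<theta> q i = y i"
      using hk_point_exists[OF \<theta>u y] by blast
    have "(\<Sum>i<?n. a i * zw_val A \<theta> q i) = 0" by (rule dense[OF _ q(1)]) (use a in blast)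
    then show ?thesis using q(2) by simp
  qed
  have lb: "lin A (\<lambda>i. complex_of_int (b i)) j = 0" if "j < ?d" for j using b(1)[OF that] by (simp add: lin_of_int)
  \<comment> \<open>\<open>functional0\<close> reaches only kernel vectors without zero entries; a
    general one is the difference of such a vector and a multiple of \<open>b\<close>.\<close>
  have functional: "(\<Sum>i<?n. a i * y i) = 0"
    if a: "\<And>s. \<forall>l<k. s l \<noteq> 0 \<Longrightarrow> (\<Sum>i<?n. a i * (\<psi> i s * x i)) = 0"
      and y: "\<And>j. j < ?d \<Longrightarrow> lin A y j = 0" for a y
  proof -
    obtain \<mu> where \<mu>: "\<mu> \<notin> (\<lambda>i. - y i / of_int (b i)) ` {..<?n}"
      using ex_new_if_finite[OF infinite_UNIV_char_0, of "(\<lambda>i. - y i / of_int (b i)) ` {..<?n}"] by blast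
    have "y i + \<mu> * of_int (b i) \<noteq> 0" if i: "i < ?n" for i
    proof
      assume "y i + \<mu> * of_int (b i) = 0"
      then have "\<mu> = - y i / of_int (b i)" using b(2)[OF i] by (simp add: field_simps add_eq_0_iff)
      then show False using \<mu> i by blast
    qed
    moreover have "lin A (\<lambda>i. y i + \<mu> * of_int (b i)) j = 0" if "j < ?d" for j
      unfolding lin_add lin_smult using y lb that by simp
    ultimately have "(\<Sum>i<?n. a i * (y i + \<mu> * of_int (b i))) = 0"
      by (intro functional0[of a "\<lambda>i. y i + \<mu> * of_int (b i)"]) (use a in simp_all)
    moreover have "(\<Sum>i<?n. a i * of_int (b i)) = 0" by (intro functional0[of a "\<lambda>i. of_int (b i)"]) (use a lb b(2) in simp_all)
    moreover have "(\<Sum>i<?n. a i * (y i + \<mu> * of_int (b i))) = (\<Sum>i<?n. a i * y i) + \<mu> * (\<Sum>i<?n. a i * of_int (b i))"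
      by (simp add: algebra_simps sum.distrib sum_distrib_left)
    ultimately show ?thesis by simp
  qed
  \<comment> \<open>Otherwise the \<open>i\<close>-th coordinate would vanish on all orbit vectors,
    hence at \<open>b\<close>.\<close>
  have x0: "x i \<noteq> 0" if i: "i < ?n" for i
  proof
    assume xi: "x i = 0"
    have "(\<Sum>m<?n. (if m = i then 1 else 0) * of_int (b m)) = (0 :: complex)"
      by (rule functional[of "\<lambda>m. if m = i then 1 else 0", OF _ lb]) (use xi in \<open>auto intro!: sum.neutral\<close>)
    then show False using i b(2)[OF i] by (simp add: if_distrib[of "\<lambda>w. w * _"] cong: if_cong)
  qed
  define C where "C i = {m\<in>{..<?n}. \<forall>s\<in>M. \<psi> m s = \<psi> i s}" for i
  have par: "y i * x m = y m * x i"
    if y: "\<And>j. j < ?d \<Longrightarrow> lin A y j = 0" and i: "i < ?n" "m < ?n" "C i = C m" for y i m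
  proof -
    have "m \<in> C i" using i by (simp add: C_def)
    then have \<psi>: "\<psi> m s = \<psi> i s" if "\<forall>l<k. s l \<noteq> 0" for s using that by (simp add: C_def M_def)
    \<comment> \<open>The functional taking \<open>z\<close> to
      \<open>x m * z i - x i * z m\<close>; it vanishes on orbit vectors because the characters at
      \<open>i\<close> and \<open>m\<close> agree.\<close>
    let ?a = "\<lambda>l. (if l = i then x m else 0) - (if l = m then x i else 0)"
    have exp: "(\<Sum>l<?n. ?a l * z l) = x m * z i - x i * z m" for z :: "nat \<Rightarrow> complex"
      using i by (simp add: left_diff_distrib sum_subtractf if_distrib[of "\<lambda>w. w * _"] cong: if_cong)
    have "(\<Sum>l<?n. ?a l * y l) = 0"
      by (rule functional[of ?a, OF _ y]) (simp_all only: exp, simp add: \<psi>)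
    then show ?thesis unfolding exp by (simp add: mult.commute)
  qed
  obtain g where g: "bij_betw g (C ` {..<?n}) {0..<card (C ` {..<?n})}"
    using ex_bij_betw_finite_nat[of "C ` {..<?n}"] by auto
  define K where "K = card (C ` {..<?n})"
  define cls where "cls i = g (C i)" for i
  have cls_image: "cls ` {..<?n} = {..<K}"
    using bij_betw_imp_surj_on[OF g] unfolding cls_def K_def by (simp add: image_image lessThan_atLeast0)
  have cls_eq: "cls i = cls m \<longleftrightarrow> C i = C m" if "i < ?n" "m < ?n" for i m
    using bij_betw_imp_inj_on[OF g] that by (auto simp: cls_def inj_on_eq_iff)
  have Ceq: "C i = C m \<longleftrightarrow> m \<in> C i" if "i < ?n" "m < ?n" for i m
    using that unfolding C_def by auto
  \<comment> \<open>Separation of characters, applied to the \<open>j\<close>-th kernel equation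
    along the orbit.\<close>
  have class_sum: "(\<Sum>m\<in>{m\<in>{..<?n}. cls m = c}. of_int (A $$ (j, m)) * x m) = 0" if c: "c < K" and j: "j < ?d" for c j
  proof -
    obtain i where i: "i < ?n" "cls i = c" using c cls_image by (metis imageE lessThan_iff)
    have "{m\<in>{..<?n}. cls m = c} = C i"
    proof -
      have "cls m = c \<longleftrightarrow> m \<in> C i" if "m < ?n" for m
        using cls_eq[OF i(1) that] Ceq[OF i(1) that] i(2) by auto
      then show ?thesis by (auto simp: C_def)
    qed
    moreover have "(\<Sum>m\<in>{m\<in>{..<?n}. \<forall>s\<in>M. \<psi> m s = \<psi> i s}. of_int (A $$ (j, m)) * x m) = 0"
    proof (rule character_classes[of "{..<?n}" i "\<lambda>_. 1" M \<psi> "\<lambda>s s' l. s l * s' l"])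
      fix s assume "s \<in> M"
      then show "(\<Sum>i<?n. of_int (A $$ (j, i)) * x i * \<psi> i s) = 0"
        using stable[of s j] j by (simp add: M_def lin_def mult_ac)
    qed (use i in \<open>simp_all add: M_def one mult\<close>)
    ultimately show ?thesis by (simp add: C_def)
  qed
  have kernel: "(\<forall>j<?d. lin A y j = 0) \<longleftrightarrow> (\<exists>t. \<forall>i<?n. y i = x i * t (cls i))" for y :: "nat \<Rightarrow> complex"
  proof
    assume y: "\<forall>j<?d. lin A y j = 0"
    define r where "r c = (SOME i. i < ?n \<and> cls i = c)" for c
    have r: "r (cls i) < ?n \<and> cls (r (cls i)) = cls i" if "i < ?n" for i
      unfolding r_def using that by (intro someI[of "\<lambda>m. m < ?n \<and> cls m = cls i"]) simp
    have "y i = x i * (y (r (cls i)) / x (r (cls i)))" if i: "i < ?n" for i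
    proof -
      have "C i = C (r (cls i))" using cls_eq[of i "r (cls i)"] r[OF i] i by simp
      then have "y i * x (r (cls i)) = y (r (cls i)) * x i" by (intro par) (use y i r[OF i] in auto)
      then show ?thesis using x0[of "r (cls i)"] r[OF i] by (simp add: field_simps)
    qed
    then show "\<exists>t. \<forall>i<?n. y i = x i * t (cls i)" by (intro exI[of _ "\<lambda>c. y (r c) / x (r c)"]) blast
  next
    assume "\<exists>t. \<forall>i<?n. y i = x i * t (cls i)"
    then obtain t where t: "\<And>i. i < ?n \<Longrightarrow> y i = x i * t (cls i)" by blast
    show "\<forall>j<?d. lin A y j = 0"
    proof (intro allI impI)
      fix j assume j: "j < ?d"
      have "lin A y j = (\<Sum>m\<in>{..<?n}. of_int (A $$ (j, m)) * x m * t (cls m))"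
        by (simp add: lin_def t mult_ac)
      also have "\<dots> = (\<Sum>c\<in>{..<K}. \<Sum>m\<in>{m\<in>{..<?n}. cls m = c}. of_int (A $$ (j, m)) * x m * t (cls m))"
        by (rule sum.group[symmetric]) (use cls_image in auto)
      also have "\<dots> = (\<Sum>c\<in>{..<K}. (\<Sum>m\<in>{m\<in>{..<?n}. cls m = c}. of_int (A $$ (j, m)) * x m) * t c)"
        by (intro sum.cong refl) (simp add: sum_distrib_right)
      also have "\<dots> = 0" using class_sum j by (intro sum.neutral) simp
      finally show "lin A y j = 0" .
    qed
  qed
  show ?thesis using line_classes_sign_classes[OF adm cls_image kernel b] by blast
qed

section \<open>Cycle quivers\<close>

lemma sum_lessThan_add: fixes m n :: nat shows "(\<Sum>i<m + n. f i) = (\<Sum>i<m. f i) + (\<Sum>i<n. f (m + i) :: 'a :: comm_monoid_add)"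
  by (induction n) (simp_all add: add.assoc)

lemma lin_four_block:
  assumes "M = four_block_mat A (0\<^sub>m (dim_row A) (dim_col B)) (0\<^sub>m (dim_row B) (dim_col A)) B"
  shows "j < dim_row A \<Longrightarrow> lin M y j = lin A y j"
    and "j < dim_row B \<Longrightarrow> lin M y (dim_row A + j) = lin B (\<lambda>i. y (dim_col A + i)) j"
proof -
  have d: "dim_col M = dim_col A + dim_col B" using assms by simp
  show "lin M y j = lin A y j" if "j < dim_row A"
    unfolding lin_def d sum_lessThan_add using that by (simp add: assms)
  show "lin M y (dim_row A + j) = lin B (\<lambda>i. y (dim_col A + i)) j" if "j < dim_row B"
    unfolding lin_def d sum_lessThan_add using that by (simp add: assms)
qed

lemma cycle_matrix_dim:
  "dim_row (boundary_matrix (cycle_quiver n)) = n - 1" "dim_col (boundary_matrix (cycle_quiver n)) = n"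
  by (simp_all add: boundary_matrix_def cycle_quiver_def)

text \<open>Row \<open>j\<close> belongs to the vertex j + 1, which edge j + 1 leaves and edge j
  enters. The closing edge enters only vertex 0, which has no row.\<close>

lemma lin_cycle_matrix:
  assumes "j < n - 1" shows "lin (boundary_matrix (cycle_quiver n)) y j = y (Suc j) - y j"
proof -
  have succ: "Suc i mod n = Suc j \<longleftrightarrow> i = j" if "i < n" for i
    using that assms by (cases "Suc i = n") auto
  have "lin (boundary_matrix (cycle_quiver n)) y j = (\<Sum>i<n. (if i = Suc j then y i else 0) - (if i = j then y i else 0))"
    unfolding lin_def cycle_matrix_dim
  proof (rule sum.cong[OF refl])
    fix i assume "i \<in> {..<n}"
    then have i: "i < n" by simp
    then have "boundary_matrix (cycle_quiver n) $$ (j, i) = of_bool (i = Suc j) - of_bool (i = j)"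
      using assms succ[OF i] by (simp add: boundary_matrix_def cycle_quiver_def)
    then show "of_int (boundary_matrix (cycle_quiver n) $$ (j, i)) * y i = (if i = Suc j then y i else 0) - (if i = j then y i else 0)"
      by (auto simp: of_bool_def)
  qed
  also have "\<dots> = y (Suc j) - y j" using assms by (simp add: sum_subtractf)
  finally show ?thesis .
qed

text \<open>The kernel of the difference operator on a cycle consists of the constants, so every
  cycle is a class with all signs 1; the block form of the matrix gives an induction on the
  list.\<close>

lemma cycle_quivers_sign_classes:
  assumes "\<forall>n\<in>set ns. n \<ge> 1"
  defines "M \<equiv> quiver_matrix (map cycle_quiver ns)"
  shows "\<exists>cls. sign_classes M (length ns) cls (\<lambda>_. 1) \<and> int_surjective M \<and> dim_row M + length ns = dim_col M \<and>
    (\<forall>c<length ns. card {i. i < dim_col M \<and> cls i = c} = ns ! c)"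
  using assms(1) unfolding M_def
proof (induction ns)
  case Nil
  have "quiver_matrix (map cycle_quiver []) = 0\<^sub>m 0 0" by (simp add: quiver_matrix_def)
  then show ?case by (simp add: sign_classes_def int_surjective_def)
next
  case (Cons n ns)
  define A where "A = boundary_matrix (cycle_quiver n)"
  define B where "B = quiver_matrix (map cycle_quiver ns)"
  define M where "M = quiver_matrix (map cycle_quiver (n # ns))"
  have M: "M = four_block_mat A (0\<^sub>m (dim_row A) (dim_col B)) (0\<^sub>m (dim_row B) (dim_col A)) B"
    by (simp add: M_def A_def B_def quiver_matrix_def Let_def)
  have n: "n \<ge> 1" using Cons.prems by simp
  have dA: "dim_row A = n - 1" "dim_col A = n" unfolding A_def by (rule cycle_matrix_dim)+
  have dM: "dim_row M = (n - 1) + dim_row B" "dim_col M = n + dim_col B" unfolding M by (simp_all add: dA)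
  have linM: "j < n - 1 \<Longrightarrow> lin M y j = y (Suc j) - y j"
    "j < dim_row B \<Longrightarrow> lin M y (n - 1 + j) = lin B (\<lambda>i. y (n + i)) j" for j and y :: "nat \<Rightarrow> 'a :: comm_ring_1"
    using lin_four_block[OF M, of j y] lin_cycle_matrix[of j n y] unfolding dA A_def[symmetric] by simp_all
  have rowsM: "(\<forall>j<dim_row M. P j) \<longleftrightarrow> (\<forall>j<n - 1. P j) \<and> (\<forall>j<dim_row B. P (n - 1 + j))" for P
  proof -
    have "P j" if "\<forall>j<n - 1. P j" "\<forall>j<dim_row B. P (n - 1 + j)" "j < dim_row M" for j
      using that spec[OF that(2), of "j - (n - 1)"] unfolding dM by (cases "j < n - 1") simp_all
    then show ?thesis unfolding dM by auto
  qed
  have colsM: "(\<forall>i<dim_col M. P i) \<longleftrightarrow> (\<forall>i<n. P i) \<and> (\<forall>i<dim_col B. P (n + i))" for P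
  proof -
    have "P i" if "\<forall>i<n. P i" "\<forall>i<dim_col B. P (n + i)" "i < dim_col M" for i
      using that spec[OF that(2), of "i - n"] unfolding dM by (cases "i < n") simp_all
    then show ?thesis unfolding dM by auto
  qed
  obtain cls where sc: "sign_classes B (length ns) cls (\<lambda>_. 1)" and surj: "int_surjective B"
    and dim: "dim_row B + length ns = dim_col B"
    and card: "\<And>c. c < length ns \<Longrightarrow> card {i. i < dim_col B \<and> cls i = c} = ns ! c"
    using Cons.IH Cons.prems unfolding B_def[symmetric] by auto
  \<comment> \<open>The new cycle becomes class 0 and the others move up by one, as do positions in
    the list.\<close>
  define cls' where "cls' i = (if i < n then 0 else Suc (cls (i - n)))" for i
  have cls': "i < n \<Longrightarrow> cls' i = 0" "cls' (n + i) = Suc (cls i)" for i by (simp_all add: cls'_def)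
  have "sign_classes M (length (n # ns)) cls' (\<lambda>_. 1)"
    unfolding sign_classes_def
  proof (intro conjI allI)
    have "{..<dim_col M} = {..<n} \<union> (+) n ` {..<dim_col B}"
      unfolding dM using image_add_atLeastLessThan[of n 0 "dim_col B"] by (auto simp: lessThan_atLeast0)
    then have "cls' ` {..<dim_col M} = cls' ` {..<n} \<union> Suc ` cls ` {..<dim_col B}"
      by (simp add: image_Un image_image cls'(2))
    also have "cls' ` {..<n} = {0}" 
    proof -
      have "cls' ` {..<n} = (\<lambda>_. 0) ` {..<n}" by (rule image_cong[OF refl]) (simp add: cls'(1))
      then show ?thesis using n by (auto simp: image_constant_conv lessThan_empty_iff)
    qed
    also have "Suc ` cls ` {..<dim_col B} = Suc ` {..<length ns}" using sign_classesD(2)[OF sc] by simp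
    finally show "cls' ` {..<dim_col M} = {..<length (n # ns)}" by (simp add: lessThan_Suc_eq_insert_0)
    fix y :: "nat \<Rightarrow> complex"
    have const: "(\<forall>j<n - 1. y (Suc j) - y j = 0) \<longleftrightarrow> (\<forall>i<n. y i = y 0)"
    proof
      assume a: "\<forall>j<n - 1. y (Suc j) - y j = 0"
      have "i < n \<Longrightarrow> y i = y 0" for i by (induction i) (use a in auto)
      then show "\<forall>i<n. y i = y 0" by blast
    next
      assume a: "\<forall>i<n. y i = y 0"
      show "\<forall>j<n - 1. y (Suc j) - y j = 0"
      proof (intro allI impI)
        fix j assume j: "j < n - 1"
        have "y (Suc j) = y 0" by (rule a[rule_format]) (use j in simp)
        moreover have "y j = y 0" by (rule a[rule_format]) (use j in simp)
        ultimately show "y (Suc j) - y j = 0" by simp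
      qed
    qed
    have "(\<forall>j<dim_row M. lin M y j = 0) \<longleftrightarrow>
      (\<forall>j<n - 1. y (Suc j) - y j = 0) \<and> (\<forall>j<dim_row B. lin B (\<lambda>i. y (n + i)) j = 0)"
      unfolding rowsM using linM[of _ y] by simp
    also have "\<dots> \<longleftrightarrow> (\<forall>i<n. y i = y 0) \<and> (\<exists>t. \<forall>i<dim_col B. y (n + i) = t (cls i))"
      unfolding const sign_classesD(3)[OF sc] by simp
    also have "\<dots> \<longleftrightarrow> (\<exists>t. \<forall>i<dim_col M. y i = t (cls' i))"
    proof
      assume "(\<forall>i<n. y i = y 0) \<and> (\<exists>t. \<forall>i<dim_col B. y (n + i) = t (cls i))"
      then obtain t where t: "\<forall>i<n. y i = y 0" "\<forall>i<dim_col B. y (n + i) = t (cls i)" by blast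
      have "y i = case_nat (y 0) t (cls' i)" if "i < n" for i
        unfolding cls'(1)[OF that] nat.case by (rule t(1)[rule_format, OF that])
      moreover have "y (n + i) = case_nat (y 0) t (cls' (n + i))" if "i < dim_col B" for i
        unfolding cls'(2) nat.case by (rule t(2)[rule_format, OF that])
      ultimately show "\<exists>t. \<forall>i<dim_col M. y i = t (cls' i)"
        unfolding colsM by (intro exI[of _ "case_nat (y 0) t"] conjI allI impI)
    next
      assume "\<exists>t. \<forall>i<dim_col M. y i = t (cls' i)"
      then obtain t where t: "\<forall>i<n. y i = t (cls' i)" "\<forall>i<dim_col B. y (n + i) = t (cls' (n + i))" unfolding colsM by blast
      have t0: "y i = t 0" if "i < n" for i using t(1)[rule_format, OF that] unfolding cls'(1)[OF that] .
      have y0: "y i = y 0" if "i < n" for i using t0[OF that] t0[of 0] n by simp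
      have yB: "\<forall>i<dim_col B. y (n + i) = t (Suc (cls i))" using t(2) by (simp add: cls')
      show "(\<forall>i<n. y i = y 0) \<and> (\<exists>t. \<forall>i<dim_col B. y (n + i) = t (cls i))"
        by (intro conjI exI[of _ "\<lambda>c. t (Suc c)"] allI impI, erule y0, erule yB[rule_format])
    qed
    finally show "(\<forall>j<dim_row M. lin M y j = 0) \<longleftrightarrow> (\<exists>t. \<forall>i<dim_col M. y i = of_int 1 * t (cls' i))" by simp
  qed simp
  moreover have "int_surjective M"
    unfolding int_surjective_def
  proof
    fix v :: "nat \<Rightarrow> int"
    obtain y where y: "\<forall>j<dim_row B. lin B y j = v (n - 1 + j)"
      using spec[OF surj[unfolded int_surjective_def], of "\<lambda>j. v (n - 1 + j)"] by blast
    \<comment> \<open>Partial sums invert the difference operator of the first block.\<close>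
    define z where "z i = (if i < n then \<Sum>l<i. v l else y (i - n))" for i
    have "z (Suc j) - z j = v j" if "j < n - 1" for j
    proof -
      have "Suc j < n" using that by simp
      then show ?thesis by (simp add: z_def)
    qed
    moreover have "lin B (\<lambda>i. z (n + i)) j = v (n - 1 + j)" if "j < dim_row B" for j using y that by (simp add: z_def)
    ultimately have "\<forall>j<dim_row M. lin M z j = v j" unfolding rowsM using linM[of _ z] by simp
    then show "\<exists>y. \<forall>j<dim_row M. lin M y j = v j" by blast
  qed
  moreover have "dim_row M + length (n # ns) = dim_col M" using dim n unfolding dM by simp
  moreover have "card {i. i < dim_col M \<and> cls' i = c} = (n # ns) ! c" if c: "c < length (n # ns)" for c
  proof (cases c)
    case 0
    have "{i. i < dim_col M \<and> cls' i = 0} = {..<n}" unfolding dM cls'_def by auto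
    then show ?thesis using 0 by simp
  next
    case (Suc c')
    have "{i. i < dim_col M \<and> cls' i = c} = (+) n ` {i. i < dim_col B \<and> cls i = c'}"
    proof (intro equalityI subsetI)
      fix i assume "i \<in> {i. i < dim_col M \<and> cls' i = c}"
      then have "\<not> i < n" "i - n < dim_col B" "cls (i - n) = c'" unfolding dM cls'_def Suc by (auto split: if_splits)
      then show "i \<in> (+) n ` {i. i < dim_col B \<and> cls i = c'}" by (intro image_eqI[of _ _ "i - n"]) auto
    qed (auto simp: dM cls' Suc)
    then show ?thesis using card[of c'] c Suc by (simp add: card_image)
  qed
  ultimately show ?case unfolding M_def[symmetric] by blast
qed

lemma product_fspace_cong:
  assumes "\<And>i. i < k \<Longrightarrow> X i = Y i" shows "product_fspace k X = product_fspace k Y"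
  unfolding product_fspace_def using assms by (simp cong: imp_cong)

lemma sign_classes_isomorphic:
  assumes sc: "sign_classes A K cls \<epsilon>" and surj: "int_surjective A" and \<theta>: "\<theta> \<in> carrier_vec (dim_row A)"
    and gen: "generic A \<theta>"
  shows "isomorphic (toric_hyperkaehler A \<theta>) (product_fspace K (\<lambda>c. ale_space (card {i. i < dim_col A \<and> cls i = c})))"
    "is_toric A \<theta>" "\<And>c. c < K \<Longrightarrow> card {i. i < dim_col A \<and> cls i = c} \<ge> 1"
proof -
  obtain u where u: "\<forall>j<dim_row A. lin A u j = \<theta> $ j"
    using spec[OF surj[unfolded int_surjective_def], of "\<lambda>j. \<theta> $ j"] by auto
  have \<theta>u: "\<theta> = vec (dim_row A) (lin A u)" using \<theta> u by (intro eq_vecI) auto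
  obtain ix where "circuit_matrix A \<theta> K (\<lambda>c. card {i. i < dim_col A \<and> cls i = c}) ix \<epsilon> u"
    using sign_classes_circuit[OF sc \<theta>u generic_imp_distinct[OF sc surj gen \<theta>u]] by blast
  then interpret circuit_matrix A \<theta> K "\<lambda>c. card {i. i < dim_col A \<and> cls i = c}" ix \<epsilon> u .
  show "isomorphic (toric_hyperkaehler A \<theta>) (product_fspace K (\<lambda>c. ale_space (card {i. i < dim_col A \<and> cls i = c})))"
    by (rule circuit_isomorphic)
  show "is_toric A \<theta>" by (rule circuit_toric)
  show "card {i. i < dim_col A \<and> cls i = c} \<ge> 1" if "c < K" for c by (rule N[OF that])
qed

lemma sheaf_hyperkaehler: "sheaf_of_functions (toric_hyperkaehler A \<theta>)"
  unfolding toric_hyperkaehler_def lawrence_generated by (intro sheaf_induced sheaf_generated)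

lemma ale_product_cycle_quivers:
  fixes n :: "nat \<Rightarrow> nat"
  assumes n: "\<And>i. i < k \<Longrightarrow> n i \<ge> 1" and ns: "ns = map n [0..<k]"
  defines "M \<equiv> quiver_matrix (map cycle_quiver ns)"
  shows "\<exists>\<theta>. admissible M \<and> unimodular M \<and> \<theta> \<in> carrier_vec (dim_row M) \<and> generic M \<theta> \<and> is_toric M \<theta> \<and>
    isomorphic (product_fspace k (\<lambda>i. ale_space (n i))) (toric_hyperkaehler M \<theta>)"
proof -
  have "\<forall>n\<in>set ns. n \<ge> 1" using n by (auto simp: ns)
  from cycle_quivers_sign_classes[OF this, folded M_def] obtain cls where
    sc: "sign_classes M k cls (\<lambda>_. 1)" and surj: "int_surjective M" and dim: "dim_row M + k = dim_col M"
    and card: "\<And>c. c < k \<Longrightarrow> card {i. i < dim_col M \<and> cls i = c} = n c"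
    by (auto simp: ns)
  \<comment> \<open>All signs are 1 and the column indices themselves serve as the values of
    \<open>u\<close>; being distinct, they make \<open>\<theta>\<close> generic.\<close>
  define \<theta> where "\<theta> = vec (dim_row M) (lin M int)"
  have \<theta>c: "\<theta> \<in> carrier_vec (dim_row M)" by (simp add: \<theta>_def)
  have gen: "generic M \<theta>" by (rule distinct_imp_generic[OF sc surj \<theta>_def]) simp
  note iso = sign_classes_isomorphic[OF sc surj \<theta>c gen]
  have "product_fspace k (\<lambda>i. ale_space (n i)) = product_fspace k (\<lambda>c. ale_space (card {i. i < dim_col M \<and> cls i = c}))"
    by (rule product_fspace_cong) (simp add: card)
  then have "isomorphic (product_fspace k (\<lambda>i. ale_space (n i))) (toric_hyperkaehler M \<theta>)"
    using isomorphic_sym[OF iso(1) sheaf_hyperkaehler] by simp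
  then show ?thesis using sign_classes_unimodular[OF sc surj dim] \<theta>c gen iso(2) by blast
qed

theorem theorem10p1:
  fixes Z :: "'a fspace"
  assumes "smooth_variety Z"
  shows "((\<exists>(A :: int mat) \<theta>. admissible A \<and> unimodular A \<and>
             \<theta> \<in> carrier_vec (dim_row A) \<and> generic A \<theta> \<and>
             smooth_variety (toric_hyperkaehler A \<theta>) \<and> is_toric A \<theta> \<and>
             isomorphic Z (toric_hyperkaehler A \<theta>))
          \<longleftrightarrow>
          (\<exists>(k :: nat) (n :: nat \<Rightarrow> nat). (\<forall>i<k. n i \<ge> 1) \<and>
             isomorphic Z (product_fspace k (\<lambda>i. ale_space (n i)))))
       \<and> ((\<exists>(k :: nat) (n :: nat \<Rightarrow> nat). (\<forall>i<k. n i \<ge> 1) \<and>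
             isomorphic Z (product_fspace k (\<lambda>i. ale_space (n i))))
          \<longleftrightarrow>
          (\<exists>(ns :: nat list) \<theta>. (\<forall>n\<in>set ns. n \<ge> 1) \<and>
             \<theta> \<in> carrier_vec (dim_row (quiver_matrix (map cycle_quiver ns))) \<and>
             generic (quiver_matrix (map cycle_quiver ns)) \<theta> \<and>
             isomorphic Z (toric_quiver_variety (map cycle_quiver ns) \<theta>)))"
    (is "(?i \<longleftrightarrow> ?ii) \<and> (_ \<longleftrightarrow> ?iii)")
proof -
  \<comment> \<open>Both (i) and (iii) produce sign classes, so the passage from these to ALE spaces
    is made once.\<close>
  have ale: ?ii if "sign_classes A K cls \<epsilon>" "int_surjective A" "\<theta> \<in> carrier_vec (dim_row A)" "generic A \<theta>"
    "isomorphic Z (toric_hyperkaehler A \<theta>)" for A K cls \<epsilon> \<theta>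
  proof -
    note iso = sign_classes_isomorphic[OF that(1-4)]
    show ?thesis
      by (intro exI[of _ K] exI[of _ "\<lambda>c. card {i. i < dim_col A \<and> cls i = c}"] conjI allI impI iso(3)
          isomorphic_trans[OF that(5) iso(1)])
  qed
  have "?i \<Longrightarrow> ?ii"
  proof -
    assume ?i
    then obtain A \<theta> where A: "admissible A" "unimodular A" "\<theta> \<in> carrier_vec (dim_row A)" "generic A \<theta>"
      "is_toric A \<theta>" "isomorphic Z (toric_hyperkaehler A \<theta>)" by iprover
    obtain K cls \<epsilon> where "sign_classes A K cls \<epsilon>" using toric_sign_classes[OF A(1-3,5)] by iprover
    then show ?ii by (rule ale[OF _ unimodular_int_surjective[OF A(1,2)] A(3,4,6)])
  qed
  moreover have "?iii \<Longrightarrow> ?ii"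
  proof -
    assume ?iii
    then obtain ns \<theta> where ns: "\<forall>n\<in>set ns. n \<ge> 1" and \<theta>: "\<theta> \<in> carrier_vec (dim_row (quiver_matrix (map cycle_quiver ns)))"
      "generic (quiver_matrix (map cycle_quiver ns)) \<theta>" "isomorphic Z (toric_hyperkaehler (quiver_matrix (map cycle_quiver ns)) \<theta>)"
      unfolding toric_quiver_variety_def by iprover
    obtain cls where "sign_classes (quiver_matrix (map cycle_quiver ns)) (length ns) cls (\<lambda>_. 1)"
      "int_surjective (quiver_matrix (map cycle_quiver ns))"
      using cycle_quivers_sign_classes[OF ns] by iprover
    then show ?ii by (rule ale[OF _ _ \<theta>])
  qed
  moreover have "?ii \<Longrightarrow> ?i \<and> ?iii"
  proof -
    assume ?ii
    then obtain k n where n: "\<forall>i<k. n i \<ge> 1" and Z: "isomorphic Z (product_fspace k (\<lambda>i. ale_space (n i)))" by iprover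
    define ns where "ns = map n [0..<k]"
    have n': "\<And>i. i < k \<Longrightarrow> n i \<ge> 1" using n by blast
    obtain \<theta> where \<theta>: "admissible (quiver_matrix (map cycle_quiver ns))" "unimodular (quiver_matrix (map cycle_quiver ns))"
      "\<theta> \<in> carrier_vec (dim_row (quiver_matrix (map cycle_quiver ns)))" "generic (quiver_matrix (map cycle_quiver ns)) \<theta>"
      "is_toric (quiver_matrix (map cycle_quiver ns)) \<theta>"
      "isomorphic (product_fspace k (\<lambda>i. ale_space (n i))) (toric_hyperkaehler (quiver_matrix (map cycle_quiver ns)) \<theta>)"
      using ale_product_cycle_quivers[OF n' ns_def] by iprover
    have iso: "isomorphic Z (toric_hyperkaehler (quiver_matrix (map cycle_quiver ns)) \<theta>)"
      by (rule isomorphic_trans[OF Z \<theta>(6)])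
    \<comment> \<open>Smoothness of the quiver variety is inherited from \<open>Z\<close>.\<close>
    have smooth: "smooth_variety (toric_hyperkaehler (quiver_matrix (map cycle_quiver ns)) \<theta>)"
      by (rule smooth_variety_transport[OF iso sheaf_hyperkaehler assms])
    have "\<forall>n\<in>set ns. n \<ge> 1" using n by (auto simp: ns_def)
    then show "?i \<and> ?iii"
      unfolding toric_quiver_variety_def using \<theta>(1-5) iso smooth by iprover
  qed
  ultimately show ?thesis by iprover
qed

end
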